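(* Let $d\geq2$ and $1<\alpha<2$. Let $\vec{u}_0:\mathbb{R}^d\to\mathbb{R}^d$ be a divergence-free initial velocity field such that $\vec{u}_0\in\dot{\mathscr{B}}^{-(\alpha-1),\infty}_{L^1_\xi}(\mathbb{R}^d)$. Let $\theta_0:\mathbb{R}^d\to\mathbb{R}$ be an initial temperature such that $\theta_0\in\dot{\mathscr{B}}^{-\frac{\alpha}{\mathfrak{p}},\infty}_{L^{\mathfrak{q},\infty}_\xi}(\mathbb{R}^d)$, where $\frac{\alpha}{\mathfrak{p}}+\frac{d}{\mathfrak{q}'}=2\alpha-1$ and $1<\alpha<\mathfrak{p}<\frac{\alpha}{\alpha-1}$. Let $\vec{f}:[0,+\infty[\times\mathbb{R}^d\to\mathbb{R}^d$ be an external force such that $\vec{f}\in L^{\mathbf{p},\infty}_t([0,+\infty[,\mathcal{F}^{\mathfrak{s}}_{L^{\mathbf{q},\infty}_\xi}(\mathbb{R}^d))$, where $\frac{\alpha}{\mathbf{p}}+\frac{d}{\mathbf{q}'}-\mathfrak{s}=2\alpha-1$ with $1<\mathbf{p}<\frac{\alpha}{\alpha-1}$, $1<\mathbf{q}<+\infty$ and $0\leq\mathfrak{s}<\frac{d}{\mathbf{q}'}$. (Here $r'$ denotes the conjugate exponent of $r$.) If the quantity $$\|\vec{u}_0\|_{\dot{\mathscr{B}}^{-(\alpha-1),\infty}_{L^1_\xi}}+\|\theta_0\|_{\dot{\mathscr{B}}^{-\frac{\alpha}{\mathfrak{p}},\infty}_{L^{\mathfrak{q},\infty}_\xi}}+\|\vec{f}\|_{L^{\mathbf{p},\infty}_t(\mathcal{F}^{\mathfrak{s}}_{L^{\mathbf{q},\infty}_\xi})}$$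 is small enough (i.e. smaller than some constant $\varepsilon>0$ depending only on $\alpha$, $d$ and the indices), then there exists a global mild solution $(\vec{u},\theta)$ of the fractional Navier-Stokes-Boussinesq system with data $(\vec{u}_0,\theta_0,\vec{f})$, that is, for $t>0$, $$\begin{cases}\displaystyle \vec{u}(t)=\mathfrak{p}_t*\vec{u}_0-\int_0^t\mathfrak{p}_{t-s}*\mathbb{P}(\mathrm{div}(\vec{u}\otimes\vec{u}))\,ds+\int_0^t\mathfrak{p}_{t-s}*\mathbb{P}(\theta\vec{e}_d)\,ds+\int_0^t\mathfrak{p}_{t-s}*\mathbb{P}(\vec{f})\,ds,\\[3mm] \displaystyle \theta(t)=\mathfrak{p}_t*\theta_0-\int_0^t\mathfrak{p}_{t-s}*\mathrm{div}(\theta\vec{u})\,ds,\end{cases}$$ such that $(\vec{u},\theta)\in L^{\frac{\alpha}{\alpha-1},\infty}_t(L^1_\xi)\times L^{\mathfrak{p},\infty}_t(L^{\mathfrak{q},\infty}_\xi)$.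
   Context: Fourier transform: $\widehat{\phi}$ always denotes the Fourier transform taken only in the space variable $x\in\mathbb{R}^d$, with frequency variable $\xi\in\mathbb{R}^d$. The system: $\partial_t\vec{u}=-(-\Delta)^{\alpha/2}\vec{u}-\mathbb{P}\mathrm{div}(\vec{u}\otimes\vec{u})+\mathbb{P}(\theta\vec{e}_d)+\mathbb{P}(\vec{f})$, $\partial_t\theta=-(-\Delta)^{\alpha/2}\theta-\mathrm{div}(\theta\vec{u})$, $\vec{u}(0,\cdot)=\vec{u}_0$ with $\mathrm{div}(\vec{u}_0)=0$, $\theta(0,\cdot)=\theta_0$, where $\vec{u}:[0,+\infty[\times\mathbb{R}^d\to\mathbb{R}^d$, $\theta:[0,+\infty[\times\mathbb{R}^d\to\mathbb{R}$, and $\vec{e}_d$ is the $d$-th canonical basis vector. Here $\widehat{(-\Delta)^{\alpha/2}\phi}(\xi)=|\xi|^\alpha\widehat{\phi}(\xi)$; $\mathfrak{p}_t$ is the kernel of the semigroup $e^{-t(-\Delta)^{\alpha/2}}$, i.e. $\widehat{\mathfrak{p}_t*\phi}(\xi)=e^{-t|\xi|^\alpha}\widehat{\phi}(\xi)$; and $\mathbb{P}(\vec{\phi})=\vec{\phi}+\nabla(-\Delta)^{-1}\mathrm{div}(\vec{\phi})$ is the Leray projector, i.e. $\widehat{\mathbb{P}\vec\phi}(\xi)=\widehat{\vec\phi}(\xi)-\frac{\xi\,(\xi\cdot\widehat{\vec\phi}(\xi))}{|\xi|^2}$. A global mild solution is a solution of the integral (Duhamel) equations for all $t>0$. Lorentz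 spaces: for $1\le q<+\infty$, $\|g\|_{L^{q,\infty}}=\sup_{\lambda>0}\lambda\,|\{x:|g(x)|>\lambda\}|^{1/q}$ and $L^{q,\infty}$ is the space of measurable functions for which this is finite. Fourier-Besov-Lorentz spaces: for $\mathfrak{s}\in\mathbb{R}$ and $1<q<+\infty$, $\dot{\mathscr{B}}^{\mathfrak{s},\infty}_{L^{q,\infty}_\xi}(\mathbb{R}^d)$ is the space of (vector- or scalar-valued) tempered distributions $\psi$ modulo polynomials such that $$\|\psi\|_{\dot{\mathscr{B}}^{\mathfrak{s},\infty}_{L^{q,\infty}_\xi}}=\sup_{j\in\mathbb{Z}}2^{j\mathfrak{s}}\big\|\mathds{1}_{\{2^j\le|\xi|\le2^{j+1}\}}\widehat{\psi}\big\|_{L^{q,\infty}}<+\infty,$$ and $\dot{\mathscr{B}}^{\mathfrak{s},\infty}_{L^{1}_\xi}(\mathbb{R}^d)$ is defined in the same way with $L^{q,\infty}$ replaced by the Lebesgue space $L^1$. Time-space Fourier-Herz-Lorentz spaces: for $1\le p,q<+\infty$ and $\mathfrak{s}\in\mathbb{R}$, $L^{p,\infty}_t([0,+\infty[,\mathcal{F}^{\mathfrak{s}}_{L^{q,\infty}_\xi}(\mathbb{R}^d))$, also written $L^{p,\infty}_t(\mathcal{F}^{\mathfrak{s}}_{L^{q,\infty}_\xi})$, is the space of (vector- or scalar-valued) functions $\phi$ on $[0,+\infty[\times\mathbb{R}^d$ such that $$\|\phi\|_{L^{p,\infty}_t(\mathcal{F}^{\mathfrak{s}}_{L^{q,\infty}_\xi})}=\Big\|\,\big\||\xi|^{\mathfrak{s}}\widehat{\phi}(t,\xi)\big\|_{L^{q,\infty}(d\xi)}\Big\|_{L^{p,\infty}_t([0,+\infty[)}<+\infty.$$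 When $\mathfrak{s}=0$ it is denoted $L^{p,\infty}_t(L^{q,\infty}_\xi)$, with $\|\phi\|_{L^{p,\infty}_t(L^{q,\infty}_\xi)}=\|\,\|\widehat{\phi}(t,\cdot)\|_{L^{q,\infty}}\|_{L^{p,\infty}_t}$. Similarly $\|\phi\|_{L^{p,\infty}_t(L^{1}_\xi)}=\|\,\|\widehat{\phi}(t,\cdot)\|_{L^{1}}\|_{L^{p,\infty}_t}$. *)

theory Defs
  imports "HOL-Analysis.Analysis"
begin

section \<open>Schwartz functions and tempered distributions\<close>

definition partial :: "'n \<Rightarrow> (real^'n \<Rightarrow> complex) \<Rightarrow> real^'n \<Rightarrow> complex" where
  "partial i \<phi> x = frechet_derivative \<phi> (at x) (axis i 1)"

definition iter_partial :: "'n list \<Rightarrow> (real^'n \<Rightarrow> complex) \<Rightarrow> real^'n \<Rightarrow> complex" where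
  "iter_partial is \<phi> = foldr partial is \<phi>"

definition schwartz :: "(real^'n \<Rightarrow> complex) set" where
  "schwartz = {\<phi>. \<forall>is. (\<forall>x. iter_partial is \<phi> differentiable (at x)) \<and>
      (\<forall>N::nat. bounded (range (\<lambda>x. (1 + norm x) ^ N * norm (iter_partial is \<phi> x))))}"

definition schwartz_norm :: "nat \<Rightarrow> (real^'n \<Rightarrow> complex) \<Rightarrow> real" where
  "schwartz_norm N \<phi> =
     (SUP (is, x) \<in> {is. length is \<le> N} \<times> UNIV. (1 + norm x) ^ N * norm (iter_partial is \<phi> x))"

text \<open>A distribution is a functional on test functions; only its values on \<^const>\<open>schwartz\<close>
  are meaningful.\<close>

type_synonym 'n distr = "(real^'n \<Rightarrow> complex) \<Rightarrow> complex"

definition tempered :: "'n::finite distr \<Rightarrow> bool" where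
  "tempered T \<longleftrightarrow>
     (\<forall>\<phi>\<in>schwartz. \<forall>\<psi>\<in>schwartz. T (\<lambda>x. \<phi> x + \<psi> x) = T \<phi> + T \<psi>) \<and>
     (\<forall>c. \<forall>\<phi>\<in>schwartz. T (\<lambda>x. c * \<phi> x) = c * T \<phi>) \<and>
     (\<exists>C N. \<forall>\<phi>\<in>schwartz. norm (T \<phi>) \<le> C * schwartz_norm N \<phi>)"

definition real_valued :: "'n::finite distr \<Rightarrow> bool" where
  "real_valued T \<longleftrightarrow> (\<forall>\<phi>\<in>schwartz. T (\<lambda>x. cnj (\<phi> x)) = cnj (T \<phi>))"

definition ddiff :: "'n \<Rightarrow> 'n::finite distr \<Rightarrow> 'n distr" where
  "ddiff i T = (\<lambda>\<phi>. - T (partial i \<phi>))"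

definition ddiv :: "('n \<Rightarrow> 'n::finite distr) \<Rightarrow> 'n distr" where
  "ddiv \<psi> = (\<lambda>\<phi>. \<Sum>i\<in>UNIV. ddiff i (\<psi> i) \<phi>)"


section \<open>Fourier transform\<close>

definition fourier :: "(real^'n \<Rightarrow> complex) \<Rightarrow> real^'n \<Rightarrow> complex" where
  "fourier \<phi> \<xi> = (LINT x|lborel. cis (- (x \<bullet> \<xi>)) * \<phi> x)"

definition fourier_inv :: "(real^'n \<Rightarrow> complex) \<Rightarrow> real^'n \<Rightarrow> complex" where
  "fourier_inv \<phi> x = (LINT \<xi>|lborel. cis (x \<bullet> \<xi>) * \<phi> \<xi>) / (2 * pi) ^ CARD('n)"

text \<open>The Fourier transform of a distribution is given by duality, testing \<open>T\<close> against
  \<^term>\<open>fourier \<phi>\<close>. In the first definition it is the function \<open>g\<close> on the whole space; in the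
  second one it coincides with \<open>g\<close> away from the origin, which is insensitive to adding
  polynomials to \<open>T\<close>.\<close>

definition fourier_fun :: "'n::finite distr \<Rightarrow> (real^'n \<Rightarrow> complex) \<Rightarrow> bool" where
  "fourier_fun T g \<longleftrightarrow> g \<in> borel_measurable borel \<and>
     (\<forall>\<phi>\<in>schwartz. integrable lborel (\<lambda>\<xi>. g \<xi> * \<phi> \<xi>) \<and>
        T (fourier \<phi>) = (LINT \<xi>|lborel. g \<xi> * \<phi> \<xi>))"

definition fourier_fun_off0 :: "'n::finite distr \<Rightarrow> (real^'n \<Rightarrow> complex) \<Rightarrow> bool" where
  "fourier_fun_off0 T g \<longleftrightarrow> g \<in> borel_measurable borel \<and>
     (\<forall>\<phi>\<in>schwartz. (\<exists>K. compact K \<and> 0 \<notin> K \<and> (\<forall>\<xi>. \<xi> \<notin> K \<longrightarrow> \<phi> \<xi> = 0)) \<longrightarrow>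
        integrable lborel (\<lambda>\<xi>. g \<xi> * \<phi> \<xi>) \<and>
        T (fourier \<phi>) = (LINT \<xi>|lborel. g \<xi> * \<phi> \<xi>))"

text \<open>\<open>fhat T\<close> is unique up to null sets, depends only on the class of \<open>T\<close> modulo polynomials,
  and agrees almost everywhere with the whole-space transform whenever the latter is a function.\<close>

definition fhat :: "'n::finite distr \<Rightarrow> real^'n \<Rightarrow> complex" where
  "fhat T = (SOME g. fourier_fun_off0 T g)"

definition vhat :: "('n \<Rightarrow> 'n::finite distr) \<Rightarrow> real^'n \<Rightarrow> complex^'n" where
  "vhat \<psi> \<xi> = (\<chi> i. fhat (\<psi> i) \<xi>)"

text \<open>The distribution whose Fourier transform is the function \<open>g\<close>.\<close>

definition from_fourier :: "(real^'n \<Rightarrow> complex) \<Rightarrow> 'n::finite distr" where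
  "from_fourier g = (\<lambda>\<phi>. LINT \<xi>|lborel. g \<xi> * fourier_inv \<phi> \<xi>)"

text \<open>A distribution is a polynomial iff its Fourier transform is supported at the origin.\<close>

definition zero_mod_polynomials :: "'n::finite distr \<Rightarrow> bool" where
  "zero_mod_polynomials T \<longleftrightarrow> fourier_fun_off0 T (\<lambda>_. 0)"


section \<open>Operators\<close>

text \<open>\<open>heat \<alpha> t T\<close> is \<open>\<pp>\<^sub>t * T\<close>. On a class modulo polynomials this acts on the representative
  whose Fourier transform carries no mass at the origin.\<close>

definition heat :: "real \<Rightarrow> real \<Rightarrow> 'n::finite distr \<Rightarrow> 'n distr" where
  "heat \<alpha> t T = from_fourier (\<lambda>\<xi>. of_real (exp (- t * norm \<xi> powr \<alpha>)) * fhat T \<xi>)"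

definition leray :: "('n \<Rightarrow> 'n::finite distr) \<Rightarrow> 'n \<Rightarrow> 'n distr" where
  "leray \<psi> i = from_fourier (\<lambda>\<xi>. fhat (\<psi> i) \<xi> -
     of_real (\<xi> $ i) * (\<Sum>j\<in>UNIV. of_real (\<xi> $ j) * fhat (\<psi> j) \<xi>) / of_real ((norm \<xi>)\<^sup>2))"

text \<open>Pointwise product, through the convolution of the Fourier transforms; the factor is the one
  belonging to the normalisation of \<^const>\<open>fourier\<close>. It is meaningful when one transform lies in
  \<open>L\<^sup>1\<close> and the other one in \<open>L\<^sup>1\<close> or in weak \<open>L\<^sup>q\<close>.\<close>

definition dprod :: "'n::finite distr \<Rightarrow> 'n distr \<Rightarrow> 'n distr" where
  "dprod S T = from_fourier
     (\<lambda>\<xi>. (LINT \<eta>|lborel. fhat S (\<xi> - \<eta>) * fhat T \<eta>) / (2 * pi) ^ CARD('n))"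

definition div_tensor :: "('n \<Rightarrow> 'n::finite distr) \<Rightarrow> ('n \<Rightarrow> 'n distr) \<Rightarrow> 'n \<Rightarrow> 'n distr" where
  "div_tensor v w i = ddiv (\<lambda>j. dprod (v i) (w j))"

text \<open>\<open>times_ed \<theta>\<close> is \<open>\<theta> e\<^sub>d\<close>, with \<open>e\<^sub>d\<close> the last canonical basis vector.\<close>

definition times_ed :: "'n::{finite,linorder} distr \<Rightarrow> 'n \<Rightarrow> 'n distr" where
  "times_ed \<theta> i = (if i = Max UNIV then \<theta> else (\<lambda>_. 0))"

text \<open>Time integrals of distribution-valued functions are taken in the weak sense.\<close>

definition time_integrable :: "real \<Rightarrow> (real \<Rightarrow> 'n::finite distr) \<Rightarrow> bool" where
  "time_integrable t A \<longleftrightarrow> (\<forall>\<phi>\<in>schwartz. set_integrable lebesgue {0<..<t} (\<lambda>s. A s \<phi>))"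

definition time_integral :: "real \<Rightarrow> (real \<Rightarrow> 'n::finite distr) \<Rightarrow> 'n distr" where
  "time_integral t A = (\<lambda>\<phi>. LINT s:{0<..<t}|lebesgue. A s \<phi>)"


section \<open>Mild solutions\<close>

definition mild_solution ::
  "real \<Rightarrow> ('n \<Rightarrow> 'n::{finite,linorder} distr) \<Rightarrow> 'n distr \<Rightarrow> (real \<Rightarrow> 'n \<Rightarrow> 'n distr) \<Rightarrow>
   (real \<Rightarrow> 'n \<Rightarrow> 'n distr) \<Rightarrow> (real \<Rightarrow> 'n distr) \<Rightarrow> bool" where
  "mild_solution \<alpha> u0 \<theta>0 f u \<theta> \<longleftrightarrow> (\<forall>t>0.
     (\<forall>i. tempered (u t i) \<and> real_valued (u t i)) \<and> tempered (\<theta> t) \<and> real_valued (\<theta> t) \<and>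
     (\<forall>i.
       time_integrable t (\<lambda>s. heat \<alpha> (t - s) (leray (div_tensor (u s) (u s)) i)) \<and>
       time_integrable t (\<lambda>s. heat \<alpha> (t - s) (leray (times_ed (\<theta> s)) i)) \<and>
       time_integrable t (\<lambda>s. heat \<alpha> (t - s) (leray (f s) i)) \<and>
       (\<forall>\<phi>\<in>schwartz. u t i \<phi> = heat \<alpha> t (u0 i) \<phi>
          - time_integral t (\<lambda>s. heat \<alpha> (t - s) (leray (div_tensor (u s) (u s)) i)) \<phi>
          + time_integral t (\<lambda>s. heat \<alpha> (t - s) (leray (times_ed (\<theta> s)) i)) \<phi>
          + time_integral t (\<lambda>s. heat \<alpha> (t - s) (leray (f s) i)) \<phi>)) \<and>
     time_integrable t (\<lambda>s. heat \<alpha> (t - s) (ddiv (\<lambda>j. dprod (\<theta> s) (u s j)))) \<and>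
     (\<forall>\<phi>\<in>schwartz. \<theta> t \<phi> = heat \<alpha> t \<theta>0 \<phi>
        - time_integral t (\<lambda>s. heat \<alpha> (t - s) (ddiv (\<lambda>j. dprod (\<theta> s) (u s j)))) \<phi>))"


section \<open>Function spaces\<close>

definition conj_exponent :: "real \<Rightarrow> real" where
  "conj_exponent r = r / (r - 1)"

definition enn_powr :: "ennreal \<Rightarrow> real \<Rightarrow> ennreal" where
  "enn_powr x r = (if x = \<infinity> then \<infinity> else ennreal (enn2real x powr r))"

definition weak_norm :: "'a measure \<Rightarrow> real \<Rightarrow> ('a \<Rightarrow> ennreal) \<Rightarrow> ennreal" where
  "weak_norm M q h =
     (SUP l\<in>{0<..}. ennreal l * enn_powr (emeasure M {x \<in> space M. h x > ennreal l}) (1 / q))"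

definition annulus :: "int \<Rightarrow> (real^'n) set" where
  "annulus j = {\<xi>. 2 powr of_int j \<le> norm \<xi> \<and> norm \<xi> \<le> 2 powr (of_int j + 1)}"

text \<open>The norms below are functions of the Fourier transform \<open>g\<close> (scalar or vector valued).\<close>

definition besov_weak_norm ::
  "real \<Rightarrow> real \<Rightarrow> (real^'n \<Rightarrow> 'v::real_normed_vector) \<Rightarrow> ennreal" where
  "besov_weak_norm \<sigma> q g = (SUP j. ennreal (2 powr (of_int j * \<sigma>)) *
     weak_norm lborel q (\<lambda>\<xi>. indicator (annulus j) \<xi> * ennreal (norm (g \<xi>))))"

definition besov_L1_norm ::
  "real \<Rightarrow> (real^'n \<Rightarrow> 'v::real_normed_vector) \<Rightarrow> ennreal" where
  "besov_L1_norm \<sigma> g = (SUP j. ennreal (2 powr (of_int j * \<sigma>)) *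
     (\<integral>\<^sup>+\<xi>. indicator (annulus j) \<xi> * ennreal (norm (g \<xi>)) \<partial>lborel))"

definition time_weak_norm ::
  "real \<Rightarrow> real \<Rightarrow> real \<Rightarrow> (real \<Rightarrow> real^'n \<Rightarrow> 'v::real_normed_vector) \<Rightarrow> ennreal" where
  "time_weak_norm p \<sigma> q g = weak_norm (lebesgue_on {0..}) p
     (\<lambda>t. weak_norm lborel q (\<lambda>\<xi>. ennreal (norm \<xi> powr \<sigma> * norm (g t \<xi>))))"

definition time_L1_norm ::
  "real \<Rightarrow> (real \<Rightarrow> real^'n \<Rightarrow> 'v::real_normed_vector) \<Rightarrow> ennreal" where
  "time_L1_norm p g = weak_norm (lebesgue_on {0..}) p
     (\<lambda>t. \<integral>\<^sup>+\<xi>. ennreal (norm (g t \<xi>)) \<partial>lborel)"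

text \<open>Elements of the Fourier-Besov-Lorentz spaces are represented by tempered distributions
  (any representative modulo polynomials).\<close>

definition besov_weak :: "real \<Rightarrow> real \<Rightarrow> 'n::finite distr set" where
  "besov_weak \<sigma> q = {T. tempered T \<and> (\<exists>g. fourier_fun_off0 T g) \<and> besov_weak_norm \<sigma> q (fhat T) < \<infinity>}"

definition besov_L1_vec :: "real \<Rightarrow> ('n \<Rightarrow> 'n::finite distr) set" where
  "besov_L1_vec \<sigma> = {\<psi>. (\<forall>i. tempered (\<psi> i) \<and> (\<exists>g. fourier_fun_off0 (\<psi> i) g)) \<and>
     besov_L1_norm \<sigma> (vhat \<psi>) < \<infinity>}"

text \<open>For almost every time the spatial Fourier transform is a function, jointly measurable in
  time and frequency.\<close>

definition time_fourier_measurable :: "(real \<Rightarrow> 'n::finite distr) \<Rightarrow> bool" where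
  "time_fourier_measurable T \<longleftrightarrow> (\<exists>G :: real \<times> (real^'n) \<Rightarrow> complex.
     G \<in> borel_measurable borel \<and>
     (AE t in lebesgue_on {0..}. tempered (T t) \<and> fourier_fun (T t) (\<lambda>\<xi>. G (t, \<xi>))))"

definition time_weak :: "real \<Rightarrow> real \<Rightarrow> real \<Rightarrow> (real \<Rightarrow> 'n::finite distr) set" where
  "time_weak p \<sigma> q =
     {T. time_fourier_measurable T \<and> time_weak_norm p \<sigma> q (\<lambda>t. fhat (T t)) < \<infinity>}"

definition time_weak_vec :: "real \<Rightarrow> real \<Rightarrow> real \<Rightarrow> (real \<Rightarrow> 'n \<Rightarrow> 'n::finite distr) set" where
  "time_weak_vec p \<sigma> q =
     {\<psi>. (\<forall>i. time_fourier_measurable (\<lambda>t. \<psi> t i)) \<and>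
         time_weak_norm p \<sigma> q (\<lambda>t. vhat (\<psi> t)) < \<infinity>}"

definition time_L1_vec :: "real \<Rightarrow> (real \<Rightarrow> 'n \<Rightarrow> 'n::finite distr) set" where
  "time_L1_vec p =
     {\<psi>. (\<forall>i. time_fourier_measurable (\<lambda>t. \<psi> t i)) \<and> time_L1_norm p (\<lambda>t. vhat (\<psi> t)) < \<infinity>}"

end

theory Submission
  imports Defs "HOL-Probability.Probability"
begin

text \<open>
  On the Fourier side the Duhamel equations become a quadratic fixed point problem for functions of
  time and frequency. Replacing every term by its absolute value gives a monotone majorant system,
  whose iterates increase; the Picard iterates converge pointwise wherever the limiting majorant is
  finite, because their increments are dominated by those of the majorants. The majorants are
  controlled by taking, at each time, the norm in frequency (\<open>L\<^sup>1\<close> for the velocity, weak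
 \<open>L\<^sup>q\<close> for the temperature): the smoothing of the heat kernel turns the system into scalar
 inequalities with Riesz potentials in time, which the Hardy-Littlewood-Sobolev inequality closes
 in weak \<open>L\<^sup>p\<close> spaces. Weak norms are handled throughout by the equivalent condition
 \<open>\<integral>\<^sub>E h <= A |E|\<^sup>\<kappa>\<close> for all sets \<open>E\<close> of finite measure, which is stable under sums, integrals and
 increasing limits. The linear coupling of the temperature into the velocity needs no smallness,
 since the temperature equation has no forcing and so is small on its own.
\<close>

text \<open>No contraction in a Banach space is used: the weak norms of the statement are only
  quasi-norms, and the mixed time-frequency space would first have to be shown complete. The
  pointwise majorant yields instead one function defined at every time and frequency, so that the
  Duhamel formula can be checked at each t > 0 although the norms see only almost every time.

  The pair of norms is dictated by the nonlinearity. \<open>L^1\<close> in frequency is an algebra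
  under convolution and acts on weak \<open>L^q\<close>; the divergence costs (t-s)^(-1/\<alpha>)
  through the heat kernel; passing from weak \<open>L^q\<close> to \<open>L^1\<close> costs a
  further kind of power. The scaling relations make all these powers fit: every Riesz potential
  lands exactly in the time exponent with reciprocal 1 - 1/\<alpha> (velocity) or 1/p (temperature).
  The conditions \<alpha> < p < \<alpha>/(\<alpha>-1) keep the product and the coupling kernel in
  the admissible range.

  A second obstacle is that \<open>fhat\<close> is an arbitrary choice, determined only up to null
  sets; uniqueness of transforms, proved with explicit bump functions, removes this
  dependence.\<close>

lemma ball_borel [measurable, simp]: "ball x r \<in> sets borel"
 by simp

section \<open>Weak-norm calculus through integrals over sets of finite measure\<close>

text \<open>For \<kappa> = 1 - 1/q with 1 < q the least \<open>A\<close> is a norm equivalent to the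
  weak \<open>L^q\<close> quasi-norm, and \<kappa> = 0 is the \<open>L^1\<close> bound, so one
  calculus serves temperature and velocity. \<open>A\<close> is an extended real because bounds at
  exceptional times may be infinite.\<close>

definition lorentz_bound :: "real => ennreal => ('a::euclidean_space => ennreal) => bool" where
 "lorentz_bound \<kappa> A h \<longleftrightarrow> (\<forall>E\<in>sets borel. emeasure lborel E < \<infinity> -->
   (\<integral>\<^sup>+x. h x * indicator E x \<partial>lborel) <= A * ennreal (measure lborel E powr \<kappa>))"

lemma lorentz_boundI:
 assumes "\<And>E. E \<in> sets borel ==> emeasure lborel E < \<infinity> ==>
   (\<integral>\<^sup>+x. h x * indicator E x \<partial>lborel) <= A * ennreal (measure lborel E powr \<kappa>)"
 shows "lorentz_bound \<kappa> A h"
 using assms by (auto simp: lorentz_bound_def)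

lemma lorentz_boundD:
 assumes "lorentz_bound \<kappa> A h" "E \<in> sets borel" "emeasure lborel E < \<infinity>"
 shows "(\<integral>\<^sup>+x. h x * indicator E x \<partial>lborel) <= A * ennreal (measure lborel E powr \<kappa>)"
 using assms by (auto simp: lorentz_bound_def)

lemma lorentz_bound_mono:
 assumes "lorentz_bound \<kappa> A h" "A <= B" "AE x in lborel. g x <= h x"
 shows "lorentz_bound \<kappa> B g"
proof (rule lorentz_boundI)
 fix E :: "'a set" assume E: "E \<in> sets borel" "emeasure lborel E < \<infinity>"
 have "(\<integral>\<^sup>+x. g x * indicator E x \<partial>lborel) <= (\<integral>\<^sup>+x. h x * indicator E x \<partial>lborel)"
  using assms(3) by (intro nn_integral_mono_AE) (auto elim!: eventually_mono simp: mult_right_mono)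
 also have "\<dots> <= A * ennreal (measure lborel E powr \<kappa>)" using lorentz_boundD[OF assms(1) E] .
 also have "\<dots> <= B * ennreal (measure lborel E powr \<kappa>)" using assms(2) by (intro mult_right_mono) auto
 finally show "(\<integral>\<^sup>+x. g x * indicator E x \<partial>lborel) <= B * ennreal (measure lborel E powr \<kappa>)" .
qed

lemma lorentz_bound_add:
 assumes "lorentz_bound \<kappa> A h" "lorentz_bound \<kappa> B g"
  and [measurable]: "h \<in> borel_measurable borel" "g \<in> borel_measurable borel"
 shows "lorentz_bound \<kappa> (A + B) (%x. h x + g x)"
proof (rule lorentz_boundI)
 fix E :: "'a set" assume E [measurable]: "E \<in> sets borel" and fin: "emeasure lborel E < \<infinity>"
 have "(\<integral>\<^sup>+x. (h x + g x) * indicator E x \<partial>lborel) =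
   (\<integral>\<^sup>+x. h x * indicator E x \<partial>lborel) + (\<integral>\<^sup>+x. g x * indicator E x \<partial>lborel)"
  by (subst nn_integral_add[symmetric]) (auto simp: distrib_right)
 also have "\<dots> <= (A + B) * ennreal (measure lborel E powr \<kappa>)"
  unfolding distrib_right by (intro add_mono lorentz_boundD assms E fin)
 finally show "(\<integral>\<^sup>+x. (h x + g x) * indicator E x \<partial>lborel) <= (A + B) * ennreal (measure lborel E powr \<kappa>)" .
qed

lemma lorentz_bound_sum:
 assumes "finite I" "\<And>i. i \<in> I ==> lorentz_bound \<kappa> (A i) (h i)"
  and "\<And>i. i \<in> I ==> h i \<in> borel_measurable borel"
 shows "lorentz_bound \<kappa> (\<Sum>i\<in>I. A i) (%x. \<Sum>i\<in>I. h i x)"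
 using assms
proof (induction I rule: finite_induct)
 case empty
 then show ?case by (auto simp: lorentz_bound_def)
next
 case (insert i I)
 then show ?case by (simp add: lorentz_bound_add)
qed

lemma lorentz_bound_cmult:
 assumes "lorentz_bound \<kappa> A h" and [measurable]: "h \<in> borel_measurable borel"
 shows "lorentz_bound \<kappa> (c * A) (%x. c * h x)"
proof (rule lorentz_boundI)
 fix E :: "'a set" assume E [measurable]: "E \<in> sets borel" and fin: "emeasure lborel E < \<infinity>"
 have "(\<integral>\<^sup>+x. c * h x * indicator E x \<partial>lborel) = c * (\<integral>\<^sup>+x. h x * indicator E x \<partial>lborel)"
  by (subst nn_integral_cmult[symmetric]) (auto simp: mult.assoc)
 also have "\<dots> <= c * (A * ennreal (measure lborel E powr \<kappa>))"
  by (intro mult_left_mono lorentz_boundD assms E fin) auto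
 finally show "(\<integral>\<^sup>+x. c * h x * indicator E x \<partial>lborel) <= c * A * ennreal (measure lborel E powr \<kappa>)"
  by (simp add: mult.assoc)
qed

lemma lorentz_bound_SUP:
 fixes h :: "nat => 'a::euclidean_space => ennreal"
 assumes "\<And>n. lorentz_bound \<kappa> A (h n)" and [measurable]: "\<And>n. h n \<in> borel_measurable borel"
  and "incseq h"
 shows "lorentz_bound \<kappa> A (%x. SUP n. h n x)"
proof (rule lorentz_boundI)
 fix E :: "'a set" assume E [measurable]: "E \<in> sets borel" and fin: "emeasure lborel E < \<infinity>"
 have inc: "incseq (%n x. h n x * indicator E x)"
  using assms(3) by (auto simp: incseq_def le_fun_def intro!: mult_right_mono)
 have "(\<integral>\<^sup>+x. (SUP n. h n x) * indicator E x \<partial>lborel) = (\<integral>\<^sup>+x. (SUP n. h n x * indicator E x) \<partial>lborel)"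
  by (simp add: SUP_mult_right_ennreal)
 also have "\<dots> = (SUP n. (\<integral>\<^sup>+x. h n x * indicator E x \<partial>lborel))"
  by (rule nn_integral_monotone_convergence_SUP) (auto intro: inc)
 also have "\<dots> <= A * ennreal (measure lborel E powr \<kappa>)"
  by (intro SUP_least lorentz_boundD assms E fin)
 finally show "(\<integral>\<^sup>+x. (SUP n. h n x) * indicator E x \<partial>lborel) <= A * ennreal (measure lborel E powr \<kappa>)" .
qed

text \<open>Only sets of finite measure are tested, so the whole space is reached by exhausting it
  with balls and monotone convergence.\<close>

lemma lorentz_bound_0_iff:
 fixes h :: "'a::euclidean_space => ennreal"
 assumes [measurable]: "h \<in> borel_measurable borel"
 shows "lorentz_bound 0 A h \<longleftrightarrow> (\<integral>\<^sup>+x. h x \<partial>lborel) <= A"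
proof
 assume L: "lorentz_bound 0 A h"
 have "(\<integral>\<^sup>+x. h x \<partial>lborel) = (\<integral>\<^sup>+x. (SUP n. h x * indicator (ball 0 (real n)) x) \<partial>lborel)"
 proof (intro nn_integral_cong)
  fix x :: 'a
  obtain n where "norm x < real n" using reals_Archimedean2 by blast
  then show "h x = (SUP n. h x * indicator (ball 0 (real n)) x)"
   by (intro antisym SUP_least) (auto intro!: SUP_upper2[of n] split: split_indicator)
 qed
 also have "\<dots> = (SUP n. \<integral>\<^sup>+x. h x * indicator (ball 0 (real n)) x \<partial>lborel)"
  by (rule nn_integral_monotone_convergence_SUP)
    (auto simp: incseq_def le_fun_def intro!: mult_left_mono split: split_indicator)
 also have "\<dots> <= A"
 proof (rule SUP_least)
  fix n
  have "(\<integral>\<^sup>+x. h x * indicator (ball 0 (real n)) x \<partial>lborel)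
    <= A * ennreal (measure lborel (ball (0::'a) (real n)) powr 0)"
   by (intro lorentz_boundD L emeasure_lborel_ball_finite) auto
  also have "\<dots> <= A" by (intro mult_left_le) (auto simp: ennreal_le_1)
  finally show "(\<integral>\<^sup>+x. h x * indicator (ball 0 (real n)) x \<partial>lborel) <= A" .
 qed
 finally show "(\<integral>\<^sup>+x. h x \<partial>lborel) <= A" .
next
 assume A: "(\<integral>\<^sup>+x. h x \<partial>lborel) <= A"
 show "lorentz_bound 0 A h"
 proof (rule lorentz_boundI)
  fix E :: "'a set" assume E [measurable]: "E \<in> sets borel" and fin: "emeasure lborel E < \<infinity>"
  show "(\<integral>\<^sup>+x. h x * indicator E x \<partial>lborel) <= A * ennreal (measure lborel E powr 0)"
  \<comment> \<open>In HOL \<open>0 powr 0\<close> is 0, so a null set must be shown to contribute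
    nothing.\<close>
  proof (cases "measure lborel E = 0")
   case True
   then have "emeasure lborel E = 0" using fin by (simp add: emeasure_eq_ennreal_measure)
   then have "AE x in lborel. x \<notin> E" using E by (simp add: AE_iff_null null_sets_def)
   then have "AE x in lborel. h x * indicator E x = 0" by eventually_elim auto
   then have "(\<integral>\<^sup>+x. h x * indicator E x \<partial>lborel) = 0" by (subst nn_integral_0_iff_AE) auto
   then show ?thesis by simp
  next
   case False
   have "(\<integral>\<^sup>+x. h x * indicator E x \<partial>lborel) <= (\<integral>\<^sup>+x. h x \<partial>lborel)"
    by (intro nn_integral_mono) (auto split: split_indicator)
   with A False show ?thesis by simp
  qed
 qed
qed

text \<open>Tonelli's theorem, after writing \<open>h x\<close> as the length of the set of positive
  levels below it. The restriction to positive levels matters because \<open>ennreal\<close> sends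
  every negative real to 0.\<close>

lemma layer_cake:
 fixes h :: "'a => ennreal"
 assumes "sigma_finite_measure M" and [measurable]: "h \<in> borel_measurable M" "g \<in> borel_measurable M"
 shows "(\<integral>\<^sup>+x. h x * g x \<partial>M) = (\<integral>\<^sup>+l. indicator {0<..} l *
   (\<integral>\<^sup>+x. g x * indicator {x. h x > ennreal l} x \<partial>M) \<partial>lborel)"
proof -
 interpret sigma_finite_measure M by fact
 interpret L: pair_sigma_finite M "lborel :: real measure" ..
 have cake: "y = (\<integral>\<^sup>+l. indicator {0<..} l * indicator {l. y > ennreal l} l \<partial>lborel)" for y :: ennreal
 proof -
  have "(\<integral>\<^sup>+l. indicator {0<..} l * indicator {l. y > ennreal l} l \<partial>lborel) =
    (\<integral>\<^sup>+l. indicator ({0<..} \<inter> {l. y > ennreal l}) l \<partial>lborel)"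
   by (intro nn_integral_cong) (auto split: split_indicator)
  also have "\<dots> = emeasure lborel ({0<..} \<inter> {l. y > ennreal l})"
   by (subst nn_integral_indicator) auto
  also have "\<dots> = y"
  proof (cases y)
   case (real r)
   then have "{0<..} \<inter> {l. y > ennreal l} = {0<..<r}" by (auto simp: ennreal_less_iff)
   then show ?thesis using real by simp
  next
   case top
   then have "{0<..} \<inter> {l. y > ennreal l} = {0<..}" by auto
   moreover have "emeasure lborel {0::real<..} = \<infinity>"
   proof -
    have "ennreal (real n) <= emeasure lborel {0::real<..}" for n
    proof -
     have "ennreal (real n) = emeasure lborel {0<..<real n}" by simp
     also have "\<dots> <= emeasure lborel {0::real<..}" by (intro emeasure_mono) auto
     finally show ?thesis .
    qed
    then show ?thesis
     by (metis ennreal_of_nat_eq_real_of_nat infinity_ennreal_def not_less ennreal_Ex_less_of_nat less_top)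
   qed
   ultimately show ?thesis using top by simp
  qed
  finally show ?thesis by simp
 qed
 have "(\<integral>\<^sup>+x. h x * g x \<partial>M) =
   (\<integral>\<^sup>+x. (\<integral>\<^sup>+l. indicator {0<..} l * indicator {l. h x > ennreal l} l * g x \<partial>lborel) \<partial>M)"
  by (subst cake) (auto intro!: nn_integral_cong simp: nn_integral_multc)
 also have "\<dots> = (\<integral>\<^sup>+l. (\<integral>\<^sup>+x. indicator {0<..} l * indicator {l. h x > ennreal l} l * g x \<partial>M) \<partial>lborel)"
  by (rule L.Fubini'[symmetric]) measurable
 also have "\<dots> = (\<integral>\<^sup>+l. indicator {0<..} l *
   (\<integral>\<^sup>+x. g x * indicator {x. h x > ennreal l} x \<partial>M) \<partial>lborel)"
  by (intro nn_integral_cong, subst nn_integral_cmult[symmetric])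
    (auto intro!: nn_integral_cong split: split_indicator)
 finally show ?thesis .
qed

lemma nn_integral_powr_Icc_0:
 fixes a c :: real assumes "a > -1" "c \<ge> 0"
 shows "(\<integral>\<^sup>+x. ennreal (x powr a) * indicator {0..c} x \<partial>lborel) = ennreal (c powr (a+1) / (a+1))"
 by (intro nn_integral_has_integral_lebesgue' has_integral_powr_from_0 assms) auto

lemma nn_integral_powr_atLeast:
 fixes a e :: real assumes "e < -1" "a > 0"
 shows "(\<integral>\<^sup>+x. ennreal (x powr e) * indicator {a..} x \<partial>lborel) = ennreal (-(a powr (e+1)) / (e+1))"
 by (intro nn_integral_has_integral_lebesgue' has_integral_powr_to_inf assms) auto

text \<open>Chebyshev's inequality on the level set, cut by a ball first: a power of its measure may
  be divided out only once the measure is known to be finite, and the resulting bound does not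
  depend on the radius.\<close>

lemma lorentz_bound_level_set:
 fixes h :: "'a::euclidean_space => ennreal"
 assumes L: "lorentz_bound (1 - \<theta>) (ennreal A) h" and [measurable]: "h \<in> borel_measurable borel"
  and "0 < \<theta>" "0 <= A" "0 < l"
 shows "emeasure lborel {x. h x > ennreal l} <= ennreal ((A / l) powr (1 / \<theta>))"
proof -
 define E where "E n = {x. h x > ennreal l} \<inter> ball 0 (real n)" for n
 have [measurable]: "E n \<in> sets borel" for n unfolding E_def by measurable
 have fin: "emeasure lborel (E n) < \<infinity>" for n
 proof -
  have "emeasure lborel (E n) <= emeasure lborel (ball (0::'a) (real n))"
   unfolding E_def by (intro emeasure_mono) auto
  also have "\<dots> < \<infinity>" by (rule emeasure_lborel_ball_finite)
  finally show ?thesis .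
 qed
 have *: "emeasure lborel (E n) <= ennreal ((A / l) powr (1 / \<theta>))" for n
 proof -
  define m where "m = measure lborel (E n)"
  have em: "emeasure lborel (E n) = ennreal m"
   unfolding m_def using fin[of n] by (intro emeasure_eq_ennreal_measure) auto
  have m0: "m \<ge> 0" by (simp add: m_def)
  have "ennreal (l * m) = ennreal l * emeasure lborel (E n)"
   using assms by (simp add: em ennreal_mult m0)
  also have "\<dots> = (\<integral>\<^sup>+x. ennreal l * indicator (E n) x \<partial>lborel)"
   by (simp add: nn_integral_cmult)
  also have "\<dots> <= (\<integral>\<^sup>+x. h x * indicator (E n) x \<partial>lborel)"
   by (intro nn_integral_mono) (auto simp: E_def split: split_indicator)
  also have "\<dots> <= ennreal A * ennreal (m powr (1 - \<theta>))"
   unfolding m_def by (intro lorentz_boundD L fin) auto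
  finally have le: "l * m <= A * m powr (1 - \<theta>)"
   using assms by (simp add: ennreal_mult[symmetric] ennreal_le_iff)
  have "m <= (A / l) powr (1 / \<theta>)"
  proof (cases "m = 0")
   case False
   then have mp: "m > 0" using m0 by simp
   have "m powr \<theta> * m powr (1 - \<theta>) = m" using mp by (simp add: powr_add[symmetric])
   then have "l * m powr \<theta> * m powr (1 - \<theta>) <= A * m powr (1 - \<theta>)" using le by (simp add: mult.assoc)
   then have "l * m powr \<theta> <= A" using mp by simp
   then have "m powr \<theta> <= A / l" using assms by (simp add: field_simps)
   then have "(m powr \<theta>) powr (1 / \<theta>) <= (A / l) powr (1 / \<theta>)"
    using assms by (intro powr_mono2) auto
   then show ?thesis using mp assms by (simp add: powr_powr)
  qed simp
  then show ?thesis by (simp add: em ennreal_leI)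
 qed
 have "emeasure lborel {x. h x > ennreal l} = emeasure lborel (\<Union>n. E n)"
 proof (rule arg_cong[where f="emeasure lborel"])
  show "{x. h x > ennreal l} = (\<Union>n. E n)"
   unfolding E_def using reals_Archimedean2 by fastforce
 qed
 also have "\<dots> = (SUP n. emeasure lborel (E n))"
  by (rule SUP_emeasure_incseq[symmetric]) (auto simp: E_def incseq_def)
 also have "\<dots> <= ennreal ((A / l) powr (1 / \<theta>))"
  by (intro SUP_least *)
 finally show ?thesis .
qed

text \<open>In the layer-cake formula each level contributes at most the measure of \<open>E\<close>
  and at most the weak estimate. Using the first for low levels and the second for high ones gives 1
  + \<theta>/(1-\<theta>) = 1/(1-\<theta>).\<close>

lemma lorentz_bound_of_level_sets:
 fixes h :: "'a::euclidean_space => ennreal"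
 assumes [measurable]: "h \<in> borel_measurable borel" and \<theta>: "0 < \<theta>" "\<theta> < 1" and A: "0 < A"
  and lev: "\<And>l. 0 < l ==> emeasure lborel {x. h x > ennreal l} <= ennreal ((A / l) powr (1 / \<theta>))"
 shows "lorentz_bound (1 - \<theta>) (ennreal (A / (1 - \<theta>))) h"
proof (rule lorentz_boundI)
 fix E :: "'a set" assume E [measurable]: "E \<in> sets borel" and fin: "emeasure lborel E < \<infinity>"
 define m where "m = measure lborel E"
 have em: "emeasure lborel E = ennreal m"
  unfolding m_def using fin by (intro emeasure_eq_ennreal_measure) auto
 have m0: "m \<ge> 0" by (simp add: m_def)
 show "(\<integral>\<^sup>+x. h x * indicator E x \<partial>lborel) <= ennreal (A / (1 - \<theta>)) * ennreal (measure lborel E powr (1 - \<theta>))"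
 proof (cases "m = 0")
  case True
  then have "emeasure lborel E = 0" by (simp add: em)
  then have "AE x in lborel. x \<notin> E" using E by (simp add: AE_iff_null null_sets_def)
  then have "AE x in lborel. h x * indicator E x = 0" by eventually_elim auto
  then have "(\<integral>\<^sup>+x. h x * indicator E x \<partial>lborel) = 0" by (subst nn_integral_0_iff_AE) auto
  then show ?thesis by simp
 next
  case False
  then have mp: "m > 0" using m0 by simp
  \<comment> \<open>The level at which the two competing bounds agree:
    \<open>(A / l0) powr (1 / \<theta>)\<close> is \<open>m\<close>.\<close>
  define l0 where "l0 = A * m powr (- \<theta>)"
  have l0: "l0 > 0" using A mp by (simp add: l0_def)
  have bnd: "indicator {0<..} l * (\<integral>\<^sup>+x. indicator E x * indicator {x. h x > ennreal l} x \<partial>lborel)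
   <= ennreal m * indicator {0..l0} l + ennreal (A powr (1 / \<theta>)) * (ennreal (l powr (- 1 / \<theta>)) * indicator {l0..} l)"
   (is "?L <= ?R") for l
  proof (cases "l > 0")
   case True
   have le1: "(\<integral>\<^sup>+x. indicator E x * indicator {x. h x > ennreal l} x \<partial>lborel) <= ennreal m"
   proof -
    have "(\<integral>\<^sup>+x. indicator E x * indicator {x. h x > ennreal l} x \<partial>lborel) <= (\<integral>\<^sup>+x. indicator E x \<partial>lborel)"
     by (intro nn_integral_mono) (auto split: split_indicator)
    then show ?thesis by (simp add: em)
   qed
   have le2: "(\<integral>\<^sup>+x. indicator E x * indicator {x. h x > ennreal l} x \<partial>lborel) <=
     ennreal (A powr (1 / \<theta>)) * ennreal (l powr (- 1 / \<theta>))"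
   proof -
    have "(\<integral>\<^sup>+x. indicator E x * indicator {x. h x > ennreal l} x \<partial>lborel) <= (\<integral>\<^sup>+x. indicator {x. h x > ennreal l} x \<partial>lborel)"
     by (intro nn_integral_mono) (auto split: split_indicator)
    also have "\<dots> <= ennreal ((A / l) powr (1 / \<theta>))" using lev[OF True] by simp
    also have "(A / l) powr (1 / \<theta>) = A powr (1 / \<theta>) * l powr (- 1 / \<theta>)"
     using A True by (simp add: powr_divide powr_minus_divide)
    finally show ?thesis by (simp add: ennreal_mult)
   qed
   show ?thesis
   proof (cases "l <= l0")
    case t: True
    then have "?L <= ennreal m * indicator {0..l0} l" using le1 True by simp
    also have "\<dots> <= ?R" by simp
    finally show ?thesis .
   next
    case False
    then show ?thesis using le2 True by simp
   qed
  qed simp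
  have "(\<integral>\<^sup>+x. h x * indicator E x \<partial>lborel) = (\<integral>\<^sup>+l. indicator {0<..} l *
    (\<integral>\<^sup>+x. indicator E x * indicator {x. h x > ennreal l} x \<partial>lborel) \<partial>lborel)"
   by (rule layer_cake) (auto intro: sigma_finite_lborel)
  also have "\<dots> <= (\<integral>\<^sup>+l. ennreal m * indicator {0..l0} l
    + ennreal (A powr (1 / \<theta>)) * (ennreal (l powr (- 1 / \<theta>)) * indicator {l0..} l) \<partial>lborel)"
   by (intro nn_integral_mono bnd)
  also have "\<dots> = ennreal m * ennreal l0 + ennreal (A powr (1 / \<theta>)) * ennreal (-(l0 powr (- 1 / \<theta> + 1)) / (- 1 / \<theta> + 1))"
   using l0 \<theta> by (subst nn_integral_add) (auto simp: nn_integral_cmult nn_integral_powr_atLeast)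
  also have "\<dots> = ennreal (m * l0 + A powr (1 / \<theta>) * (-(l0 powr (- 1 / \<theta> + 1)) / (- 1 / \<theta> + 1)))"
  proof -
   have "-(l0 powr (- 1 / \<theta> + 1)) / (- 1 / \<theta> + 1) \<ge> 0"
    using \<theta> by (intro divide_nonpos_nonpos) (auto simp: field_simps)
   moreover have "ennreal x * ennreal y + ennreal z * ennreal w = ennreal (x * y + z * w)"
    if "x \<ge> 0" "y \<ge> 0" "z \<ge> 0" "w \<ge> 0" for x y z w
    using that by (simp add: ennreal_mult)
   ultimately show ?thesis using l0 m0 powr_ge_zero[of A "1 / \<theta>"] less_imp_le by blast
  qed
  also have "m * l0 = A * m powr (1 - \<theta>)"
   using mp by (simp add: l0_def powr_diff powr_minus_divide)
  also have "A powr (1 / \<theta>) * (-(l0 powr (- 1 / \<theta> + 1)) / (- 1 / \<theta> + 1)) = A * m powr (1 - \<theta>) * (\<theta> / (1 - \<theta>))"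
  proof -
   have "l0 powr (- 1 / \<theta> + 1) = A powr (- 1 / \<theta> + 1) * (m powr (- \<theta>)) powr (- 1 / \<theta> + 1)"
    unfolding l0_def using A mp by (simp add: powr_mult)
   also have "(m powr (- \<theta>)) powr (- 1 / \<theta> + 1) = m powr (1 - \<theta>)"
   proof -
    have "- \<theta> * (- 1 / \<theta> + 1) = 1 - \<theta>" using \<theta> by (simp add: right_diff_distrib)
    then show ?thesis by (simp only: powr_powr)
   qed
   finally have e1: "A powr (1 / \<theta>) * l0 powr (- 1 / \<theta> + 1) = A * m powr (1 - \<theta>)"
    using A by (simp add: mult.assoc[symmetric] powr_add[symmetric])
   have e2: "- 1 / (- 1 / \<theta> + 1) = \<theta> / (1 - \<theta>)" using \<theta> by (simp add: divide_simps) (simp add: algebra_simps)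
   have "A powr (1 / \<theta>) * (-(l0 powr (- 1 / \<theta> + 1)) / (- 1 / \<theta> + 1)) = (A powr (1 / \<theta>) * l0 powr (- 1 / \<theta> + 1)) * (- 1 / (- 1 / \<theta> + 1))"
    by simp
   then show ?thesis unfolding e1 e2 .
  qed
  also have "A * m powr (1 - \<theta>) + A * m powr (1 - \<theta>) * (\<theta> / (1 - \<theta>)) = A / (1 - \<theta>) * m powr (1 - \<theta>)"
   using \<theta> by (simp add: field_simps)
  finally show ?thesis using A \<theta> by (subst ennreal_mult[symmetric]) (auto simp: m_def)
 qed
qed

text \<open>Hoelder's inequality in weak spaces: a product above \<open>l\<close> forces one factor
  above some \<open>a\<close> or the other above \<open>l / a\<close>, and the threshold
  \<open>a\<close> is free to be optimised.\<close>

lemma lorentz_bound_mult: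
 fixes g h :: "'a::euclidean_space => ennreal"
 assumes [measurable]: "g \<in> borel_measurable borel" "h \<in> borel_measurable borel"
  and \<theta>: "0 < \<theta>" "0 < \<theta>'" "\<theta> + \<theta>' < 1" and AB: "0 < A" "0 < B"
  and g: "lorentz_bound (1 - \<theta>) (ennreal A) g" and h: "lorentz_bound (1 - \<theta>') (ennreal B) h"
 shows "lorentz_bound (1 - (\<theta> + \<theta>')) (ennreal (2 powr (\<theta> + \<theta>') / (1 - (\<theta> + \<theta>')) * (A * B))) (%x. g x * h x)"
proof -
 define m where "m = 1 / (\<theta> + \<theta>')"
 have "lorentz_bound (1 - (\<theta> + \<theta>')) (ennreal (2 powr (\<theta> + \<theta>') * (A * B) / (1 - (\<theta> + \<theta>')))) (%x. g x * h x)"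
 proof (rule lorentz_bound_of_level_sets)
  fix l :: real assume l: "0 < l"
  define x where "x = l / (A * B)"
  have xp: "x > 0" using l AB by (simp add: x_def)
  \<comment> \<open>This threshold equalises the two level-set estimates: both become
    \<open>x powr (- m)\<close>, and their sum puts the power of 2 into the constant.\<close>
  define a where "a = A * x powr (m * \<theta>)"
  have ap: "a > 0" using AB xp by (simp add: a_def)
  have "{x. g x * h x > ennreal l} \<subseteq> {x. g x > ennreal a} \<union> {x. h x > ennreal (l / a)}"
  proof (rule ccontr)
   assume "\<not> ?thesis"
   then obtain y where "g y * h y > ennreal l" "\<not> g y > ennreal a" "\<not> h y > ennreal (l / a)"
    by blast
   then have y: "g y * h y > ennreal l" "g y <= ennreal a" "h y <= ennreal (l / a)"
    by (auto simp: not_less)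
   have "g y * h y <= ennreal a * ennreal (l / a)" using y by (intro mult_mono) auto
   also have "\<dots> = ennreal l" using ap l by (simp add: ennreal_mult[symmetric])
   finally show False using y by simp
  qed
  then have "emeasure lborel {x. g x * h x > ennreal l} <= emeasure lborel ({x. g x > ennreal a} \<union> {x. h x > ennreal (l / a)})"
   by (intro emeasure_mono) auto
  also have "\<dots> <= emeasure lborel {x. g x > ennreal a} + emeasure lborel {x. h x > ennreal (l / a)}"
   by (intro emeasure_subadditive) auto
  also have "\<dots> <= ennreal ((A / a) powr (1 / \<theta>)) + ennreal ((B / (l / a)) powr (1 / \<theta>'))"
   using ap l \<theta> AB by (intro add_mono lorentz_bound_level_set g h) auto
  also have "(A / a) powr (1 / \<theta>) = x powr (- m)"
   using AB \<theta> xp by (simp add: a_def powr_minus_divide powr_divide powr_powr)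
  also have "(B / (l / a)) powr (1 / \<theta>') = x powr (- m)"
  proof -
   have "B / (l / a) = x powr (m * \<theta>) / x" using AB l xp by (simp add: a_def x_def field_simps)
   also have "\<dots> = x powr (m * \<theta> - 1)" using xp by (simp add: powr_diff)
   also have "m * \<theta> - 1 = - m * \<theta>'" using \<theta> by (simp add: m_def field_simps)
   finally show ?thesis using \<theta> by (simp add: powr_powr)
  qed
  also have "ennreal (x powr (- m)) + ennreal (x powr (- m)) = ennreal (2 * x powr (- m))"
   by (simp add: ennreal_plus[symmetric] del: ennreal_plus)
  also have "2 * x powr (- m) = (2 powr (\<theta> + \<theta>') * (A * B) / l) powr (1 / (\<theta> + \<theta>'))"
  proof -
   have "2 powr (\<theta> + \<theta>') * (A * B) / l = 2 powr (\<theta> + \<theta>') * (1 / x)" by (simp add: x_def)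
   also have "\<dots> powr (1 / (\<theta> + \<theta>')) = 2 * (1 / x) powr m"
    using xp \<theta> by (subst powr_mult) (auto simp: powr_powr m_def)
   finally show ?thesis using xp by (simp add: powr_divide powr_minus_divide)
  qed
  finally show "emeasure lborel {x. g x * h x > ennreal l} <= ennreal ((2 powr (\<theta> + \<theta>') * (A * B) / l) powr (1 / (\<theta> + \<theta>')))" .
 qed (use \<theta> AB in auto)
 then show ?thesis by simp
qed

text \<open>Lets automatic measurability handle indicators of intervals whose endpoints are
  themselves variables, as they occur in all the kernels in time.\<close>

lemma pred_in_interval [measurable (raw)]:
 fixes f g h :: "'a => real"
 assumes [measurable]: "f \<in> borel_measurable M" "g \<in> borel_measurable M" "h \<in> borel_measurable M"
 shows "Measurable.pred M (%x. f x \<in> {g x<..})" "Measurable.pred M (%x. f x \<in> {..<g x})"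
  "Measurable.pred M (%x. f x \<in> {g x<..<h x})"
 unfolding greaterThan_iff lessThan_iff greaterThanLessThan_iff by measurable

text \<open>Every level set is contained in an interval of length
  \<open>(1 / l) powr (1 / \<gamma>)\<close>. Both orientations are recorded because the duality
  argument integrates the kernel once in \<open>t\<close> and once in \<open>s\<close>.\<close>

lemma riesz_kernel_lorentz_bound:
 fixes \<gamma> s :: real
 assumes "0 < \<gamma>" "\<gamma> < 1"
 shows "lorentz_bound (1 - \<gamma>) (ennreal (1 / (1 - \<gamma>))) (%t. indicator {s<..} t * ennreal ((t - s) powr (- \<gamma>)))"
  and "lorentz_bound (1 - \<gamma>) (ennreal (1 / (1 - \<gamma>))) (%t. indicator {..<s} t * ennreal ((s - t) powr (- \<gamma>)))"
proof -
 have *: "x < (1 / l) powr (1 / \<gamma>)" if "l > 0" "x > 0" "l < x powr (- \<gamma>)" for l x :: real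
 proof -
  have "x powr \<gamma> < 1 / l" using that by (simp add: powr_minus field_simps)
  then have "(x powr \<gamma>) powr (1 / \<gamma>) < (1 / l) powr (1 / \<gamma>)" using assms that by (intro powr_less_mono2) auto
  then show ?thesis using assms that by (simp add: powr_powr)
 qed
 show "lorentz_bound (1 - \<gamma>) (ennreal (1 / (1 - \<gamma>))) (%t. indicator {s<..} t * ennreal ((t - s) powr (- \<gamma>)))"
 proof (rule lorentz_bound_of_level_sets)
  fix l :: real assume l: "0 < l"
  have "{t. ennreal l < indicator {s<..} t * ennreal ((t - s) powr - \<gamma>)} \<subseteq> {s<..<s + (1 / l) powr (1 / \<gamma>)}"
   using *[OF l] l by (auto simp: ennreal_less_iff split: split_indicator_asm) (smt (verit))
  then have "emeasure lborel {t. ennreal l < indicator {s<..} t * ennreal ((t - s) powr - \<gamma>)} <= emeasure lborel {s<..<s + (1 / l) powr (1 / \<gamma>)}"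
   by (intro emeasure_mono) auto
  then show "emeasure lborel {t. ennreal l < indicator {s<..} t * ennreal ((t - s) powr - \<gamma>)} <= ennreal ((1 / l) powr (1 / \<gamma>))" by simp
 qed (use assms in auto)
 show "lorentz_bound (1 - \<gamma>) (ennreal (1 / (1 - \<gamma>))) (%t. indicator {..<s} t * ennreal ((s - t) powr (- \<gamma>)))"
 proof (rule lorentz_bound_of_level_sets)
  fix l :: real assume l: "0 < l"
  have "{t. ennreal l < indicator {..<s} t * ennreal ((s - t) powr - \<gamma>)} \<subseteq> {s - (1 / l) powr (1 / \<gamma>)<..<s}"
   using *[OF l] l by (auto simp: ennreal_less_iff split: split_indicator_asm) (smt (verit))
  then have "emeasure lborel {t. ennreal l < indicator {..<s} t * ennreal ((s - t) powr - \<gamma>)} <= emeasure lborel {s - (1 / l) powr (1 / \<gamma>)<..<s}"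
   by (intro emeasure_mono) auto
  then show "emeasure lborel {t. ennreal l < indicator {..<s} t * ennreal ((s - t) powr - \<gamma>)} <= ennreal ((1 / l) powr (1 / \<gamma>))" by simp
 qed (use assms in auto)
qed

text \<open>Argue by duality: against the indicator of \<open>E\<close> the kernel becomes a bounded function \<open>k\<close> lying
 in the weak space of exponent \<open>1/\<gamma>\<close>, and the layer-cake formula for \<open>k\<close> reduces the claim to an
 integral of a power.\<close>

lemma hardy_littlewood_sobolev:
 fixes g :: "real => ennreal" and \<gamma> \<theta> A :: real
 assumes \<gamma>: "0 < \<gamma>" "\<gamma> < 1" and \<theta>: "0 < \<theta>" "\<theta> < 1" "1 < \<theta> + \<gamma>" and A: "0 <= A"
  and [measurable]: "g \<in> borel_measurable borel"
  and g: "lorentz_bound (1 - \<theta>) (ennreal A) g"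
 shows "lorentz_bound (2 - \<theta> - \<gamma>) (ennreal (1 / ((1 - \<gamma>) * (1 - (1 - \<theta>) / \<gamma>)) * A))
  (%t. \<integral>\<^sup>+s. indicator {0<..<t} s * ennreal ((t - s) powr (- \<gamma>)) * g s \<partial>lborel)"
proof (rule lorentz_boundI)
 fix E :: "real set" assume E [measurable]: "E \<in> sets borel" and fin: "emeasure lborel E < \<infinity>"
 define m where "m = measure lborel E"
 define c where "c = 1 / (1 - \<gamma>)"
 \<comment> \<open>The power of the level that appears when \<open>g\<close> is integrated over a
   level set of \<open>k\<close>; it is below 1 exactly because 1 < \<theta> + \<gamma>.\<close>
 define \<rho> where "\<rho> = (1 - \<theta>) / \<gamma>"
 have c: "c > 0" and \<rho>: "0 < \<rho>" "\<rho> < 1" using \<gamma> \<theta> by (auto simp: c_def \<rho>_def)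
 have em: "emeasure lborel E = ennreal m"
  unfolding m_def using fin by (intro emeasure_eq_ennreal_measure) auto
 have m0: "m \<ge> 0" by (simp add: m_def)
 define k where "k s = (\<integral>\<^sup>+t. indicator E t * (indicator {s<..} t * ennreal ((t - s) powr (- \<gamma>))) \<partial>lborel)" for s
 have [measurable]: "k \<in> borel_measurable borel" unfolding k_def
  by measurable
 \<comment> \<open>An upper bound for \<open>k\<close>: levels above it are empty, so the power
   -\<rho> of the level is integrated over a bounded interval only.\<close>
 define Mx where "Mx = c * m powr (1 - \<gamma>)"
 have Mx0: "Mx \<ge> 0" using c by (simp add: Mx_def)
 have kM: "k s <= ennreal Mx" for s
  using lorentz_boundD[OF riesz_kernel_lorentz_bound(1)[OF \<gamma>, of s] E fin] c
  by (subst (asm) ennreal_mult[symmetric]) (auto simp: k_def Mx_def c_def m_def mult_ac)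
 have Lk: "lorentz_bound (1 - \<gamma>) (ennreal (c * m)) k"
 proof (rule lorentz_boundI)
  fix F :: "real set" assume F [measurable]: "F \<in> sets borel" and finF: "emeasure lborel F < \<infinity>"
  have "(\<integral>\<^sup>+s. k s * indicator F s \<partial>lborel) =
    (\<integral>\<^sup>+s. (\<integral>\<^sup>+t. indicator E t * (indicator {s<..} t * ennreal ((t - s) powr (- \<gamma>))) * indicator F s \<partial>lborel) \<partial>lborel)"
   unfolding k_def by (subst nn_integral_multc) auto
  also have "\<dots> = (\<integral>\<^sup>+t. (\<integral>\<^sup>+s. indicator E t * (indicator {s<..} t * ennreal ((t - s) powr (- \<gamma>))) * indicator F s \<partial>lborel) \<partial>lborel)"
   by (rule lborel_pair.Fubini') measurable
  also have "\<dots> <= (\<integral>\<^sup>+t. indicator E t * ennreal (c * measure lborel F powr (1 - \<gamma>)) \<partial>lborel)"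
  proof (intro nn_integral_mono)
   fix t
   have "(\<integral>\<^sup>+s. indicator E t * (indicator {s<..} t * ennreal ((t - s) powr (- \<gamma>))) * indicator F s \<partial>lborel)
    = indicator E t * (\<integral>\<^sup>+s. (indicator {..<t} s * ennreal ((t - s) powr (- \<gamma>))) * indicator F s \<partial>lborel)"
    by (subst nn_integral_cmult[symmetric]) (auto intro!: nn_integral_cong split: split_indicator)
   also have "\<dots> <= indicator E t * (ennreal c * ennreal (measure lborel F powr (1 - \<gamma>)))"
    unfolding c_def by (intro mult_left_mono lorentz_boundD riesz_kernel_lorentz_bound \<gamma> F finF) auto
   finally show "(\<integral>\<^sup>+s. indicator E t * (indicator {s<..} t * ennreal ((t - s) powr (- \<gamma>))) * indicator F s \<partial>lborel)
     <= indicator E t * ennreal (c * measure lborel F powr (1 - \<gamma>))" using c by (simp add: ennreal_mult)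
  qed
  also have "\<dots> = ennreal m * ennreal (c * measure lborel F powr (1 - \<gamma>))"
   by (simp add: nn_integral_multc em)
  finally show "(\<integral>\<^sup>+s. k s * indicator F s \<partial>lborel) <= ennreal (c * m) * ennreal (measure lborel F powr (1 - \<gamma>))"
   using c m0 by (simp add: ennreal_mult mult_ac)
 qed
 have lev: "emeasure lborel {x. k x > ennreal l} <= ennreal ((c * m / l) powr (1 / \<gamma>))" if "l > 0" for l
  using that Lk \<gamma> c m0 by (intro lorentz_bound_level_set) auto
 have bnd: "indicator {0<..} l * (\<integral>\<^sup>+s. g s * indicator {s. k s > ennreal l} s \<partial>lborel)
   <= ennreal (A * (c * m) powr \<rho>) * (ennreal (l powr (- \<rho>)) * indicator {0..Mx} l)" for l
 proof (cases "0 < l \<and> l <= Mx")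
  case True
  let ?K = "{s. k s > ennreal l}"
  have finK: "emeasure lborel ?K < \<infinity>" using lev[of l] True by (auto intro: le_less_trans)
  have "measure lborel ?K <= (c * m / l) powr (1 / \<gamma>)"
  proof -
   have "emeasure lborel ?K = ennreal (measure lborel ?K)"
    using finK by (intro emeasure_eq_ennreal_measure) auto
   then show ?thesis using lev[of l] True by (simp add: ennreal_le_iff)
  qed
  then have "measure lborel ?K powr (1 - \<theta>) <= ((c * m / l) powr (1 / \<gamma>)) powr (1 - \<theta>)"
   using \<theta> by (intro powr_mono2) auto
  also have "\<dots> = (c * m) powr \<rho> * l powr (- \<rho>)"
   using c m0 True by (simp add: powr_powr \<rho>_def powr_divide powr_minus_divide)
  finally have le: "measure lborel ?K powr (1 - \<theta>) <= (c * m) powr \<rho> * l powr (- \<rho>)" .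
  have "(\<integral>\<^sup>+s. g s * indicator ?K s \<partial>lborel) <= ennreal A * ennreal (measure lborel ?K powr (1 - \<theta>))"
   by (intro lorentz_boundD g finK) auto
  also have "\<dots> <= ennreal A * ennreal ((c * m) powr \<rho> * l powr (- \<rho>))"
   by (intro mult_left_mono ennreal_leI le) auto
  finally show ?thesis using True A c m0 by (simp add: ennreal_mult mult.assoc)
 next
  case False
  have "indicator {0<..} l * (\<integral>\<^sup>+s. g s * indicator {s. k s > ennreal l} s \<partial>lborel) = 0"
  proof (cases "0 < l")
   case True
   then have "Mx < l" using False by auto
   then have "\<not> k s > ennreal l" for s
    using order_trans[OF kM, of "ennreal l" s] by (simp add: not_less ennreal_leI)
   then show ?thesis by simp
  qed simp
  then show ?thesis by (simp only: zero_le)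
 qed
 have "(\<integral>\<^sup>+t. (\<integral>\<^sup>+s. indicator {0<..<t} s * ennreal ((t - s) powr (- \<gamma>)) * g s \<partial>lborel) * indicator E t \<partial>lborel)
   = (\<integral>\<^sup>+t. (\<integral>\<^sup>+s. indicator {0<..<t} s * ennreal ((t - s) powr (- \<gamma>)) * g s * indicator E t \<partial>lborel) \<partial>lborel)"
  by (subst nn_integral_multc) auto
 also have "\<dots> <= (\<integral>\<^sup>+t. (\<integral>\<^sup>+s. g s * (indicator E t * (indicator {s<..} t * ennreal ((t - s) powr (- \<gamma>)))) \<partial>lborel) \<partial>lborel)"
  by (intro nn_integral_mono) (auto split: split_indicator simp: mult.commute)
 also have "\<dots> = (\<integral>\<^sup>+s. (\<integral>\<^sup>+t. g s * (indicator E t * (indicator {s<..} t * ennreal ((t - s) powr (- \<gamma>)))) \<partial>lborel) \<partial>lborel)"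
  by (rule lborel_pair.Fubini') measurable
 also have "\<dots> = (\<integral>\<^sup>+s. k s * g s \<partial>lborel)"
  unfolding k_def by (intro nn_integral_cong, subst nn_integral_cmult) (auto simp: mult.commute)
 also have "\<dots> = (\<integral>\<^sup>+l. indicator {0<..} l * (\<integral>\<^sup>+s. g s * indicator {s. k s > ennreal l} s \<partial>lborel) \<partial>lborel)"
  by (rule layer_cake) (auto intro: sigma_finite_lborel)
 also have "\<dots> <= (\<integral>\<^sup>+l. ennreal (A * (c * m) powr \<rho>) * (ennreal (l powr (- \<rho>)) * indicator {0..Mx} l) \<partial>lborel)"
  by (intro nn_integral_mono bnd)
 also have "\<dots> = ennreal (A * (c * m) powr \<rho>) * ennreal (Mx powr (- \<rho> + 1) / (- \<rho> + 1))"
  using \<rho> Mx0 by (subst nn_integral_cmult) (auto simp: nn_integral_powr_Icc_0)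
 also have "\<dots> = ennreal (A * (c * m) powr \<rho> * (Mx powr (- \<rho> + 1) / (- \<rho> + 1)))"
  using A \<rho> by (subst ennreal_mult) auto
 also have "A * (c * m) powr \<rho> * (Mx powr (- \<rho> + 1) / (- \<rho> + 1)) = 1 / ((1 - \<gamma>) * (1 - (1 - \<theta>) / \<gamma>)) * A * m powr (2 - \<theta> - \<gamma>)"
 proof (cases "m = 0")
  case True
  then show ?thesis using \<rho> by (simp add: Mx_def)
 next
  case False
  then have mp: "m > 0" using m0 by simp
  have "(c * m) powr \<rho> * Mx powr (1 - \<rho>) = c powr \<rho> * c powr (1 - \<rho>) * (m powr \<rho> * (m powr (1 - \<gamma>)) powr (1 - \<rho>))"
   using c mp by (simp add: Mx_def powr_mult)
  also have "c powr \<rho> * c powr (1 - \<rho>) = c" using c by (simp add: powr_add[symmetric])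
  also have "m powr \<rho> * (m powr (1 - \<gamma>)) powr (1 - \<rho>) = m powr (\<rho> + (1 - \<gamma>) * (1 - \<rho>))"
   by (simp add: powr_powr powr_add)
  also have "\<rho> + (1 - \<gamma>) * (1 - \<rho>) = 2 - \<theta> - \<gamma>" using \<gamma> by (simp add: \<rho>_def field_simps)
  finally have "(c * m) powr \<rho> * Mx powr (1 - \<rho>) = c * m powr (2 - \<theta> - \<gamma>)" .
  then have "A * ((c * m) powr \<rho> * Mx powr (1 - \<rho>)) / (1 - \<rho>) = A * (c * m powr (2 - \<theta> - \<gamma>)) / (1 - \<rho>)" by simp
  then show ?thesis using \<rho> by (simp add: c_def \<rho>_def mult_ac)
 qed
 finally show "(\<integral>\<^sup>+t. (\<integral>\<^sup>+s. indicator {0<..<t} s * ennreal ((t - s) powr (- \<gamma>)) * g s \<partial>lborel) * indicator E t \<partial>lborel)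
   <= ennreal (1 / ((1 - \<gamma>) * (1 - (1 - \<theta>) / \<gamma>)) * A) * ennreal (measure lborel E powr (2 - \<theta> - \<gamma>))"
  using A \<rho> \<gamma> by (subst ennreal_mult[symmetric]) (auto simp: m_def \<rho>_def)
qed

section \<open>Dyadic annuli and frequency smoothing\<close>

text \<open>The enumeration of the integers alternates in sign, so its \<open>n\<close>-th member
  has size about \<open>n / 2\<close>. This turns exponential decay in the dyadic index into a
  geometric series in \<open>n\<close>.\<close>

lemma int_decode_abs_ge: "real n - 1 <= 2 * \<bar>real_of_int (int_decode n)\<bar>"
 by (cases "even n") (auto simp: int_decode_def sum_decode_def elim!: evenE oddE)

lemma dyadic_cover: "x \<noteq> 0 ==> \<exists>j. x \<in> annulus j"
proof -
 assume "x \<noteq> 0"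
 then have n: "norm x > 0" by simp
 have "2 powr of_int \<lfloor>log 2 (norm x)\<rfloor> <= 2 powr (log 2 (norm x))" by (intro powr_mono) auto
 moreover have "2 powr (log 2 (norm x)) <= 2 powr (of_int \<lfloor>log 2 (norm x)\<rfloor> + 1)" by (intro powr_mono) linarith+
 moreover have "2 powr (log 2 (norm x)) = norm x" using n by simp
 ultimately have "x \<in> annulus \<lfloor>log 2 (norm x)\<rfloor>" unfolding annulus_def by simp
 then show ?thesis by blast
qed

lemma annulus_measurable [measurable]: "annulus j \<in> sets borel"
 unfolding annulus_def by measurable

text \<open>A translation of the integers is not visible in their enumeration, so the sum is read as
  an integral over counting measure, which every bijection preserves.\<close>

lemma suminf_int_decode_shift:
 fixes f :: "int => ennreal"
 shows "(\<Sum>n. f (int_decode n)) = (\<Sum>n. f (J + int_decode n))"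
proof -
 have *: "(\<Sum>n. g (int_decode n)) = (\<integral>\<^sup>+j. g j \<partial>count_space UNIV)" for g :: "int => ennreal"
  by (subst nn_integral_bij_count_space[OF bij_int_decode, symmetric]) (simp add: nn_integral_count_space_nat)
 have "bij ((+) J)" by (rule bij_betw_byWitness[where f'="%x. x - J"]) auto
 then have "(\<integral>\<^sup>+j. f (J + j) \<partial>count_space UNIV) = (\<integral>\<^sup>+j. f j \<partial>count_space UNIV)"
  by (rule nn_integral_bij_count_space)
 then show ?thesis using *[of f] *[of "%j. f (J + j)"] by simp
qed

text \<open>On the annulus of index j the weight is at most its value at \<mu> 2^j and
  \<open>h\<close> has mass at most A 2^(j \<beta>). Low annuli sum because \<beta> > 0, high ones
  because the decay order \<open>N\<close> exceeds \<beta>. Shifting the index by about -log2 \<mu>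
  scales out \<mu> and leaves a sum independent of it.\<close>

lemma dyadic_integral_bound:
 fixes w :: "real => real"
 assumes w: "\<And>r. 0 <= w r" "\<And>r. w r <= 1" "\<And>r s. 0 <= r ==> r <= s ==> w s <= w r"
  and dec: "\<And>r. 0 < r ==> w r <= D * r powr (- N)" and [measurable]: "w \<in> borel_measurable borel"
  and \<beta>: "0 < \<beta>" "\<beta> < N"
 shows "\<exists>C>0. \<forall>(h :: real^'n => ennreal) A \<mu>. h \<in> borel_measurable borel --> 0 < \<mu> -->
  (\<forall>j. (\<integral>\<^sup>+\<xi>. h \<xi> * indicator (annulus j) \<xi> \<partial>lborel) <= A * ennreal (2 powr (of_int j * \<beta>))) -->
  (\<integral>\<^sup>+\<xi>. ennreal (w (\<mu> * norm \<xi>)) * h \<xi> \<partial>lborel) <= ennreal C * A * ennreal (\<mu> powr (- \<beta>))"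
proof -
 \<comment> \<open>The summand after the shift of index; the - 1 pays for rounding -log2 \<mu> to an
   integer.\<close>
 define f where "f k = w (2 powr (of_int k - 1)) * 2 powr (of_int k * \<beta>)" for k :: int
 \<comment> \<open>The slower of the two decay rates, \<beta> towards low and
   \<open>N - \<beta>\<close> towards high frequencies.\<close>
 define \<delta> where "\<delta> = min \<beta> (N - \<beta>)"
 have \<delta>: "\<delta> > 0" using \<beta> by (simp add: \<delta>_def)
 have D: "D \<ge> 0" using dec[of 1] w(1)[of 1] by simp
 define D' where "D' = 1 + D * 2 powr N"
 have "1 <= D'" using D by (simp add: D'_def)
 then have D': "D' > 0" "1 <= D'" by linarith+
 have f0: "f k \<ge> 0" for k using w by (simp add: f_def)
 have fb: "f k <= D' * 2 powr (- \<delta> * \<bar>of_int k\<bar>)" for k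
 proof (cases "k < 0")
  case True
  have "f k <= 1 * 2 powr (of_int k * \<beta>)" unfolding f_def by (intro mult_right_mono w) auto
  also have "\<dots> <= D' * 2 powr (- \<delta> * \<bar>of_int k\<bar>)"
  proof -
   have "\<delta> * \<bar>of_int k\<bar> <= \<beta> * \<bar>of_int k\<bar>" by (intro mult_right_mono) (auto simp: \<delta>_def)
   then have "of_int k * \<beta> <= - \<delta> * \<bar>of_int k\<bar>" using True by (simp add: mult.commute)
   then show ?thesis using D' by (intro mult_mono[OF _ powr_mono]) auto
  qed
  finally show ?thesis .
 next
  case False
  have "f k <= (D * (2 powr (of_int k - 1)) powr (- N)) * 2 powr (of_int k * \<beta>)"
   unfolding f_def by (intro mult_right_mono dec) auto
  also have "\<dots> = D * 2 powr N * 2 powr (of_int k * (\<beta> - N))"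
   by (simp add: powr_powr mult.assoc powr_add[symmetric] algebra_simps)
  also have "\<dots> <= D' * 2 powr (- \<delta> * \<bar>of_int k\<bar>)"
  proof -
   have "\<delta> * of_int k <= (N - \<beta>) * of_int k" using False by (intro mult_right_mono) (auto simp: \<delta>_def)
   then have "of_int k * (\<beta> - N) <= - \<delta> * \<bar>of_int k\<bar>" using False by (simp add: algebra_simps)
   then show ?thesis using D' by (intro mult_mono[OF _ powr_mono]) (auto simp: D'_def)
  qed
  finally show ?thesis .
 qed
 \<comment> \<open>Half the rate per step, since the absolute value in the enumeration grows by one
   only every second step.\<close>
 define q where "q = 2 powr (- \<delta> / 2)"
 have q: "0 < q" "q < 1" using \<delta> by (auto simp: q_def powr_less_one)
 have fq: "f (int_decode n) <= D' * 2 powr (\<delta> / 2) * q ^ n" for n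
 proof -
  have "f (int_decode n) <= D' * 2 powr (- \<delta> * \<bar>of_int (int_decode n)\<bar>)" by (rule fb)
  also have "\<dots> <= D' * 2 powr (\<delta> / 2 + real n * (- \<delta> / 2))"
  proof (intro mult_left_mono powr_mono)
   have "\<delta> * (real n - 1) <= \<delta> * (2 * \<bar>real_of_int (int_decode n)\<bar>)"
    using \<delta> by (intro mult_left_mono int_decode_abs_ge) auto
   then show "- \<delta> * \<bar>of_int (int_decode n)\<bar> <= \<delta> / 2 + real n * (- \<delta> / 2)" by (simp add: field_simps)
  qed (use D' in auto)
  also have "\<dots> = D' * 2 powr (\<delta> / 2) * q ^ n"
   unfolding powr_add q_def by (simp add: powr_power mult_ac)
  finally show ?thesis .
 qed
 have sm: "summable (%n. f (int_decode n))"
  by (rule summable_comparison_test[where g="%n. D' * 2 powr (\<delta> / 2) * q ^ n"])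
    (use fq f0 q in \<open>auto intro!: summable_mult summable_geometric\<close>)
 define C where "C = (\<Sum>n. f (int_decode n)) + 1"
 have C: "C > 0" unfolding C_def using suminf_nonneg[OF sm] f0 by (simp add: add_nonneg_pos)
 have Csum: "(\<Sum>n. ennreal (f (int_decode n))) <= ennreal C"
  unfolding C_def by (subst suminf_ennreal2[OF f0 sm]) (simp add: ennreal_leI)
 have "(\<integral>\<^sup>+\<xi>. ennreal (w (\<mu> * norm \<xi>)) * h \<xi> \<partial>lborel) <= ennreal C * A * ennreal (\<mu> powr (- \<beta>))"
  if [measurable]: "h \<in> borel_measurable borel" and \<mu>: "0 < \<mu>" and
   h: "\<And>j. (\<integral>\<^sup>+\<xi>. h \<xi> * indicator (annulus j) \<xi> \<partial>lborel) <= A * ennreal (2 powr (of_int j * \<beta>))"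
  for h :: "real^'n => ennreal" and A \<mu>
 proof -
  \<comment> \<open>The dyadic scale of 1/\<mu>: with it \<mu> 2^J lies between 1/2 and 1.\<close>
  define J where "J = \<lfloor>- log 2 \<mu>\<rfloor>"
  have lam: "\<mu> = 2 powr (log 2 \<mu>)" using \<mu> by simp
  have J: "of_int J <= - log 2 \<mu>" "- log 2 \<mu> < of_int J + 1" unfolding J_def by linarith+
  have "AE \<xi> in lborel. ennreal (w (\<mu> * norm \<xi>)) * h \<xi> <=
    (\<Sum>n. ennreal (w (\<mu> * 2 powr of_int (int_decode n))) * (h \<xi> * indicator (annulus (int_decode n)) \<xi>))"
   using AE_lborel_singleton[of "0 :: real^'n"]
  proof eventually_elim
   fix \<xi> :: "real^'n" assume "\<xi> \<noteq> 0"
   then obtain j where j: "\<xi> \<in> annulus j" using dyadic_cover by blast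
   have "ennreal (w (\<mu> * norm \<xi>)) * h \<xi> <= ennreal (w (\<mu> * 2 powr of_int j)) * (h \<xi> * indicator (annulus j) \<xi>)"
    using j \<mu> by (auto simp: annulus_def intro!: mult_right_mono ennreal_leI w)
   also have "\<dots> = (%n. ennreal (w (\<mu> * 2 powr of_int (int_decode n))) * (h \<xi> * indicator (annulus (int_decode n)) \<xi>)) (int_encode j)"
    by simp
   also have "\<dots> = (\<Sum>n\<in>{int_encode j}. ennreal (w (\<mu> * 2 powr of_int (int_decode n))) * (h \<xi> * indicator (annulus (int_decode n)) \<xi>))"
    by simp
   also have "\<dots> <= (\<Sum>n. ennreal (w (\<mu> * 2 powr of_int (int_decode n))) * (h \<xi> * indicator (annulus (int_decode n)) \<xi>))"
    by (rule sum_le_suminf) auto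
   finally show "ennreal (w (\<mu> * norm \<xi>)) * h \<xi> <=
    (\<Sum>n. ennreal (w (\<mu> * 2 powr of_int (int_decode n))) * (h \<xi> * indicator (annulus (int_decode n)) \<xi>))" .
  qed
  then have "(\<integral>\<^sup>+\<xi>. ennreal (w (\<mu> * norm \<xi>)) * h \<xi> \<partial>lborel) <=
    (\<integral>\<^sup>+\<xi>. (\<Sum>n. ennreal (w (\<mu> * 2 powr of_int (int_decode n))) * (h \<xi> * indicator (annulus (int_decode n)) \<xi>)) \<partial>lborel)"
   by (rule nn_integral_mono_AE)
  also have "\<dots> = (\<Sum>n. \<integral>\<^sup>+\<xi>. ennreal (w (\<mu> * 2 powr of_int (int_decode n))) * (h \<xi> * indicator (annulus (int_decode n)) \<xi>) \<partial>lborel)"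
   by (rule nn_integral_suminf) measurable
  also have "\<dots> = (\<Sum>n. ennreal (w (\<mu> * 2 powr of_int (int_decode n))) * (\<integral>\<^sup>+\<xi>. h \<xi> * indicator (annulus (int_decode n)) \<xi> \<partial>lborel))"
   by (intro suminf_cong nn_integral_cmult) measurable
  also have "\<dots> <= (\<Sum>n. (%j. ennreal (w (\<mu> * 2 powr of_int j)) * (A * ennreal (2 powr (of_int j * \<beta>)))) (int_decode n))"
   by (intro suminf_le) (auto intro!: mult_left_mono h)
  also have "\<dots> = (\<Sum>n. (%j. ennreal (w (\<mu> * 2 powr of_int j)) * (A * ennreal (2 powr (of_int j * \<beta>)))) (J + int_decode n))"
   by (rule suminf_int_decode_shift)
  also have "\<dots> <= (\<Sum>n. (A * ennreal (\<mu> powr (- \<beta>))) * ennreal (f (int_decode n)))"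
  proof (intro suminf_le allI)
   fix n define k where "k = int_decode n"
   have 1: "w (\<mu> * 2 powr of_int (J + k)) <= w (2 powr (of_int k - 1))"
   proof (rule w)
    have "2 powr (of_int k - 1) <= 2 powr (log 2 \<mu> + of_int (J + k))" using J by (intro powr_mono) auto
    also have "\<dots> = \<mu> * 2 powr of_int (J + k)" using \<mu> by (simp add: powr_add)
    finally show "2 powr (of_int k - 1) <= \<mu> * 2 powr of_int (J + k)" .
   qed simp
   have 2: "2 powr (of_int (J + k) * \<beta>) <= \<mu> powr (- \<beta>) * 2 powr (of_int k * \<beta>)"
   proof -
    have "of_int J * \<beta> <= - log 2 \<mu> * \<beta>" using J \<beta> by (intro mult_right_mono) auto
    then have "2 powr (of_int (J + k) * \<beta>) <= 2 powr (log 2 \<mu> * (- \<beta>) + of_int k * \<beta>)"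
     by (intro powr_mono) (auto simp: algebra_simps)
    also have "\<dots> = \<mu> powr (- \<beta>) * 2 powr (of_int k * \<beta>)"
     by (subst (2) lam) (simp only: powr_add powr_powr)
    finally show ?thesis .
   qed
   have "w (\<mu> * 2 powr of_int (J + k)) * 2 powr (of_int (J + k) * \<beta>) <= \<mu> powr (- \<beta>) * f k"
    using mult_mono[OF 1 2] w by (simp add: f_def mult_ac)
   then have "A * ennreal (w (\<mu> * 2 powr of_int (J + k)) * 2 powr (of_int (J + k) * \<beta>)) <= A * ennreal (\<mu> powr (- \<beta>) * f k)"
    by (intro mult_left_mono ennreal_leI) auto
   then show "ennreal (w (\<mu> * 2 powr of_int (J + int_decode n))) * (A * ennreal (2 powr (of_int (J + int_decode n) * \<beta>)))
    <= (A * ennreal (\<mu> powr (- \<beta>))) * ennreal (f (int_decode n))"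
    using w f0 by (simp add: k_def[symmetric] ennreal_mult mult_ac)
  qed auto
  also have "\<dots> = (A * ennreal (\<mu> powr (- \<beta>))) * (\<Sum>n. ennreal (f (int_decode n)))" by simp
  also have "\<dots> <= (A * ennreal (\<mu> powr (- \<beta>))) * ennreal C" by (intro mult_left_mono Csum) auto
  finally show ?thesis by (simp add: mult_ac)
 qed
 with C show ?thesis by blast
qed

text \<open>The dyadic sum for the profile exp(-r^\<alpha>) at scale \<mu> = \<tau>^(1/\<alpha>),
  because \<tau> |\<xi>|^\<alpha> = (\<mu> |\<xi>|)^\<alpha>; this is where the exponent
  -\<beta>/\<alpha> of time comes from.\<close>

lemma heat_integral_bound:
 assumes \<beta>: "0 < \<beta>" and \<alpha>: "0 < \<alpha>"
 shows "\<exists>C>0. \<forall>(h :: real^'n => ennreal) A \<tau>. h \<in> borel_measurable borel --> 0 < \<tau> -->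
  (\<forall>j. (\<integral>\<^sup>+\<xi>. h \<xi> * indicator (annulus j) \<xi> \<partial>lborel) <= A * ennreal (2 powr (of_int j * \<beta>))) -->
  (\<integral>\<^sup>+\<xi>. ennreal (exp (- \<tau> * norm \<xi> powr \<alpha>)) * h \<xi> \<partial>lborel) <= ennreal C * A * ennreal (\<tau> powr (- (\<beta> / \<alpha>)))"
proof -
 \<comment> \<open>Only polynomial decay, of order \<alpha> m > \<beta>, is extracted from the
   exponential, by means of (1 + u/m)^m <= exp u.\<close>
 obtain m :: nat where m: "\<beta> / \<alpha> < real m" using reals_Archimedean2 by blast
 then have mp: "real m > 0" using \<beta> \<alpha> by (meson divide_pos_pos less_trans)
 define w where "w r = exp (- (\<bar>r\<bar> powr \<alpha>))" for r :: real
 have "\<exists>C>0. \<forall>(h :: real^'n => ennreal) A \<mu>. h \<in> borel_measurable borel --> 0 < \<mu> -->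
  (\<forall>j. (\<integral>\<^sup>+\<xi>. h \<xi> * indicator (annulus j) \<xi> \<partial>lborel) <= A * ennreal (2 powr (of_int j * \<beta>))) -->
  (\<integral>\<^sup>+\<xi>. ennreal (w (\<mu> * norm \<xi>)) * h \<xi> \<partial>lborel) <= ennreal C * A * ennreal (\<mu> powr (- \<beta>))"
 proof (rule dyadic_integral_bound)
  show "\<beta> < \<alpha> * real m" using m \<alpha> by (simp add: field_simps)
  show "w s <= w r" if "0 <= r" "r <= s" for r s
   using that \<alpha> by (auto simp: w_def intro!: powr_mono2)
  show "w r <= real m ^ m * r powr (- (\<alpha> * real m))" if r: "0 < r" for r
  proof -
   have y: "r powr \<alpha> > 0" using r by simp
   have "(r powr \<alpha> / real m) ^ m <= (1 + r powr \<alpha> / real m) ^ m" using y mp by (intro power_mono) auto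
   also have "\<dots> <= exp (r powr \<alpha>)" proof (rule exp_ge_one_plus_x_over_n_power_n)
    show "- real m <= r powr \<alpha>" using y mp by linarith
   qed (use mp in auto)
   finally have "(r powr \<alpha>) ^ m / real m ^ m <= exp (r powr \<alpha>)" by (simp add: power_divide)
   moreover have "(r powr \<alpha>) ^ m = r powr (\<alpha> * real m)" using r by (simp add: powr_power mult.commute)
   ultimately have le: "r powr (\<alpha> * real m) <= real m ^ m * exp (r powr \<alpha>)" using mp by (simp add: field_simps)
   have "w r = 1 / exp (r powr \<alpha>)" using r by (simp add: w_def exp_minus field_simps)
   also have "\<dots> <= real m ^ m / r powr (\<alpha> * real m)" using le r by (simp add: field_simps)
   finally show ?thesis by (simp add: powr_minus_divide)
  qed
 qed (use \<beta> in \<open>auto simp: w_def\<close>)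
 then obtain C where C: "C > 0" and *: "\<And>(h :: real^'n => ennreal) A \<mu>. h \<in> borel_measurable borel ==> 0 < \<mu> ==>
  (\<And>j. (\<integral>\<^sup>+\<xi>. h \<xi> * indicator (annulus j) \<xi> \<partial>lborel) <= A * ennreal (2 powr (of_int j * \<beta>))) ==>
  (\<integral>\<^sup>+\<xi>. ennreal (w (\<mu> * norm \<xi>)) * h \<xi> \<partial>lborel) <= ennreal C * A * ennreal (\<mu> powr (- \<beta>))" by blast
 have "(\<integral>\<^sup>+\<xi>. ennreal (exp (- \<tau> * norm \<xi> powr \<alpha>)) * h \<xi> \<partial>lborel) <= ennreal C * A * ennreal (\<tau> powr (- (\<beta> / \<alpha>)))"
  if "h \<in> borel_measurable borel" and \<tau>: "0 < \<tau>" and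
   "\<And>j. (\<integral>\<^sup>+\<xi>. h \<xi> * indicator (annulus j) \<xi> \<partial>lborel) <= A * ennreal (2 powr (of_int j * \<beta>))"
  for h :: "real^'n => ennreal" and A \<tau>
 proof -
  have "w (\<tau> powr (1 / \<alpha>) * norm \<xi>) = exp (- \<tau> * norm \<xi> powr \<alpha>)" for \<xi> :: "real^'n"
   using \<tau> \<alpha> by (simp add: w_def abs_mult powr_mult powr_powr)
  then show ?thesis using *[OF that(1) _ that(3), of "\<tau> powr (1 / \<alpha>)"] \<tau> by (simp add: powr_powr)
 qed
 with C show ?thesis by blast
qed

text \<open>The same dyadic sum with a polynomial profile at scale 1. It serves for integrability of
  polynomial weights and for the moderate growth of functions in weak spaces.\<close>

lemma schwartz_weight_integral_bound:
 assumes \<beta>: "0 < \<beta>" "\<beta> < real N"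
 shows "\<exists>C>0. \<forall>(h :: real^'n => ennreal) A. h \<in> borel_measurable borel -->
  (\<forall>j. (\<integral>\<^sup>+\<xi>. h \<xi> * indicator (annulus j) \<xi> \<partial>lborel) <= A * ennreal (2 powr (of_int j * \<beta>))) -->
  (\<integral>\<^sup>+\<xi>. ennreal (1 / (1 + norm \<xi>) ^ N) * h \<xi> \<partial>lborel) <= ennreal C * A"
proof -
 define w where "w r = 1 / (1 + \<bar>r\<bar>) ^ N" for r :: real
 have "\<exists>C>0. \<forall>(h :: real^'n => ennreal) A \<mu>. h \<in> borel_measurable borel --> 0 < \<mu> -->
  (\<forall>j. (\<integral>\<^sup>+\<xi>. h \<xi> * indicator (annulus j) \<xi> \<partial>lborel) <= A * ennreal (2 powr (of_int j * \<beta>))) -->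
  (\<integral>\<^sup>+\<xi>. ennreal (w (\<mu> * norm \<xi>)) * h \<xi> \<partial>lborel) <= ennreal C * A * ennreal (\<mu> powr (- \<beta>))"
 proof (rule dyadic_integral_bound)
  show "w s <= w r" if "0 <= r" "r <= s" for r s
   using that by (auto simp: w_def intro!: divide_left_mono power_mono)
  show "w r <= 1 * r powr (- real N)" if "0 < r" for r
   using that by (auto simp: w_def powr_minus_divide powr_realpow intro!: divide_left_mono power_mono)
 qed (use \<beta> in \<open>auto simp: w_def divide_simps\<close>)
 then obtain C where "C > 0" and *: "\<And>(h :: real^'n => ennreal) A \<mu>. h \<in> borel_measurable borel ==> 0 < \<mu> ==>
  (\<And>j. (\<integral>\<^sup>+\<xi>. h \<xi> * indicator (annulus j) \<xi> \<partial>lborel) <= A * ennreal (2 powr (of_int j * \<beta>))) ==>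
  (\<integral>\<^sup>+\<xi>. ennreal (w (\<mu> * norm \<xi>)) * h \<xi> \<partial>lborel) <= ennreal C * A * ennreal (\<mu> powr (- \<beta>))" by blast
 then show ?thesis by (intro exI[of _ C]) (use *[where \<mu>=1] in \<open>auto simp: w_def\<close>)
qed

text \<open>The annulus itself is the test set; its volume is at most that of the ball of radius
  2^(j+1), a multiple of 2^(j d).\<close>

lemma lorentz_bound_annulus:
 fixes h :: "real^'n => ennreal"
 assumes "lorentz_bound \<kappa> A h" "0 <= \<kappa>"
 shows "(\<integral>\<^sup>+\<xi>. h \<xi> * indicator (annulus j) \<xi> \<partial>lborel) <=
  (A * ennreal ((unit_ball_vol (real CARD('n)) * 2 ^ CARD('n)) powr \<kappa>)) * ennreal (2 powr (of_int j * (real CARD('n) * \<kappa>)))"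
proof -
 let ?B = "cball (0 :: real^'n) (2 powr (of_int j + 1))"
 have le: "emeasure lborel (annulus j :: (real^'n) set) <= emeasure lborel ?B"
  by (intro emeasure_mono) (auto simp: annulus_def)
 have fin: "emeasure lborel (annulus j :: (real^'n) set) < \<infinity>"
  by (rule le_less_trans[OF le]) (rule emeasure_lborel_cball_finite)
 have "measure lborel (annulus j :: (real^'n) set) <= measure lborel ?B"
  using emeasure_lborel_cball_finite[of "0 :: real^'n" "2 powr (of_int j + 1)"]
  by (intro measure_mono_fmeasurable fmeasurableI) (auto simp: annulus_def)
 also have "\<dots> = unit_ball_vol (real CARD('n)) * (2 powr (of_int j + 1)) ^ CARD('n)"
  by (subst content_cball) auto
 also have "(2 powr (of_int j + 1)) ^ CARD('n) = 2 ^ CARD('n) * 2 powr (of_int j * real CARD('n))"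
  by (simp add: powr_power algebra_simps powr_add powr_realpow)
 finally have "measure lborel (annulus j :: (real^'n) set) powr \<kappa> <=
   (unit_ball_vol (real CARD('n)) * (2 ^ CARD('n) * 2 powr (of_int j * real CARD('n)))) powr \<kappa>"
  using assms by (intro powr_mono2) auto
 also have "\<dots> = (unit_ball_vol (real CARD('n)) * 2 ^ CARD('n)) powr \<kappa> * 2 powr (of_int j * (real CARD('n) * \<kappa>))"
  by (simp add: powr_mult powr_powr mult_ac)
 finally have m: "measure lborel (annulus j :: (real^'n) set) powr \<kappa> <= \<dots>" .
 have "(\<integral>\<^sup>+\<xi>. h \<xi> * indicator (annulus j) \<xi> \<partial>lborel) <= A * ennreal (measure lborel (annulus j :: (real^'n) set) powr \<kappa>)"
  by (intro lorentz_boundD assms fin) auto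
 also have "\<dots> <= A * ennreal ((unit_ball_vol (real CARD('n)) * 2 ^ CARD('n)) powr \<kappa> * 2 powr (of_int j * (real CARD('n) * \<kappa>)))"
  by (intro mult_left_mono ennreal_leI m) auto
 finally show ?thesis by (simp add: ennreal_mult mult.assoc)
qed

section \<open>Schwartz functions and Fourier inversion\<close>

lemma iter_partial_Nil [simp]: "iter_partial [] \<phi> = \<phi>"
 and iter_partial_Cons [simp]: "iter_partial (i # is) \<phi> = partial i (iter_partial is \<phi>)"
 and iter_partial_append: "iter_partial (is @ js) \<phi> = iter_partial is (iter_partial js \<phi>)"
 by (simp_all add: iter_partial_def)

lemma partial_eqI: "(\<phi> has_derivative D) (at x) ==> partial i \<phi> x = D (axis i 1)"
 unfolding partial_def by (simp add: frechet_derivative_at[symmetric])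

lemma has_derivative_partial:
 fixes \<phi> :: "real^'n => complex"
 assumes "\<phi> differentiable (at x)"
 shows "(\<phi> has_derivative (%h. \<Sum>i\<in>UNIV. (h $ i) *\<^sub>R partial i \<phi> x)) (at x)"
proof -
 let ?D = "frechet_derivative \<phi> (at x)"
 have D: "(\<phi> has_derivative ?D) (at x)" using assms by (simp add: frechet_derivative_works)
 then have lin: "linear ?D" by (rule has_derivative_linear)
 have "?D h = (\<Sum>i\<in>UNIV. (h $ i) *\<^sub>R partial i \<phi> x)" for h
 proof -
  have "h = (\<Sum>i\<in>UNIV. (h $ i) *\<^sub>R axis i 1)"
   by (simp add: vec_eq_iff axis_def if_distrib[of "%x. _ * x"] sum.delta cong: if_cong)
  then have "?D h = ?D (\<Sum>i\<in>UNIV. (h $ i) *\<^sub>R axis i 1)" by simp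
  also have "\<dots> = (\<Sum>i\<in>UNIV. (h $ i) *\<^sub>R ?D (axis i 1))"
   by (simp add: linear_sum[OF lin] linear_cmul[OF lin])
  finally show ?thesis by (simp add: partial_def)
 qed
 then have "?D = (%h. \<Sum>i\<in>UNIV. (h $ i) *\<^sub>R partial i \<phi> x)" by (rule ext)
 with D show ?thesis by simp
qed

lemma has_derivative_partialI:
 fixes \<phi> :: "real^'n => complex"
 assumes "(\<phi> has_derivative (%h. \<Sum>i\<in>UNIV. (h $ i) *\<^sub>R \<psi> i)) (at x)"
 shows "\<phi> differentiable (at x)" "partial i \<phi> x = \<psi> i"
 using partial_eqI[OF assms, of i] assms
 by (auto simp: differentiable_def axis_def if_distrib[of "%x. x *\<^sub>R _"] sum.delta cong: if_cong)

text \<open>Membership in \<open>schwartz\<close> speaks of all iterated derivatives. A class closed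
  under \<open>partial\<close> reduces it to one differentiation and one decay bound, without higher
  Leibniz or chain rules.\<close>

lemma schwartz_coinduct:
 assumes S: "\<phi> \<in> S"
  and diff: "\<And>\<phi> x. \<phi> \<in> S ==> \<phi> differentiable (at x)"
  and part: "\<And>\<phi> i. \<phi> \<in> S ==> partial i \<phi> \<in> S"
  and dec: "\<And>\<phi> N. \<phi> \<in> S ==> bounded (range (%x. (1 + norm x) ^ N * norm (\<phi> x)))"
 shows "\<phi> \<in> schwartz"
proof -
 have "iter_partial is \<phi> \<in> S" for "is" using S by (induction "is") (auto intro: part)
 then show ?thesis unfolding schwartz_def using diff dec by blast
qed

lemma schwartz_iter_partial: "\<phi> \<in> schwartz ==> iter_partial is \<phi> \<in> schwartz"
 unfolding schwartz_def by (simp add: iter_partial_append[symmetric])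

lemma schwartz_partial: "\<phi> \<in> schwartz ==> partial i \<phi> \<in> schwartz"
 using schwartz_iter_partial[of \<phi> "[i]"] by simp

lemma schwartz_differentiable: "\<phi> \<in> schwartz ==> \<phi> differentiable (at x)"
 unfolding schwartz_def by (metis (mono_tags, lifting) iter_partial_Nil mem_Collect_eq)

lemma schwartz_bounded: "\<phi> \<in> schwartz ==> bounded (range (%x. (1 + norm x) ^ N * norm (\<phi> x)))"
 unfolding schwartz_def by (auto dest: spec[of _ "[]"])

lemma bounded_weightI:
 fixes \<phi> :: "real^'n => complex"
 assumes "\<And>x. (1 + norm x) ^ N * norm (\<phi> x) <= B"
 shows "bounded (range (%x. (1 + norm x) ^ N * norm (\<phi> x)))"
 by (rule boundedI[of _ B]) (use assms in auto)

lemma schwartz_decay: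
 fixes \<phi> :: "real^'n => complex"
 assumes "\<phi> \<in> schwartz"
 obtains C where "C > 0" "\<And>x. (1 + norm x) ^ N * norm (\<phi> x) <= C"
proof -
 obtain B where B: "B > 0" "\<And>x. norm ((1 + norm x) ^ N * norm (\<phi> x)) <= B"
  using schwartz_bounded[OF assms, of N] unfolding bounded_pos by auto
 show ?thesis by (rule that[of B]) (use B in \<open>auto intro: order_trans[OF abs_ge_self]\<close>)
qed

lemma schwartz_has_derivative:
 "\<phi> \<in> schwartz ==> (\<phi> has_derivative (%h. \<Sum>i\<in>UNIV. (h $ i) *\<^sub>R partial i \<phi> x)) (at x)"
 by (intro has_derivative_partial schwartz_differentiable)

lemma schwartz_continuous: "\<phi> \<in> schwartz ==> continuous_on UNIV \<phi>"
 by (meson continuous_at_imp_continuous_on differentiable_imp_continuous_within schwartz_differentiable)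

lemma schwartz_measurable: "\<phi> \<in> schwartz ==> \<phi> \<in> borel_measurable borel"
 by (intro borel_measurable_continuous_onI schwartz_continuous)

lemma schwartz_zero: "(%_::real^'n. 0) \<in> schwartz"
proof (rule schwartz_coinduct[of _ "{%_. 0}"])
 fix \<phi> :: "real^'n => complex" and i assume "\<phi> \<in> {%_. 0}"
 then have \<phi>: "\<phi> = (%_. 0)" by simp
 have "partial i \<phi> x = 0" for x
  by (rule partial_eqI[of _ "%_. 0"]) (simp add: \<phi>)
 then show "partial i \<phi> \<in> {%_. 0}" by auto
qed auto

lemma schwartz_add:
 assumes "\<phi> \<in> schwartz" "\<psi> \<in> schwartz" shows "(%x. \<phi> x + \<psi> x) \<in> schwartz"
proof (rule schwartz_coinduct[of _ "{%x. \<phi> x + \<psi> x |\<phi> \<psi>. \<phi> \<in> schwartz \<and> \<psi> \<in> schwartz}"])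
 fix \<omega> :: "real^'a => complex" and i x and N :: nat
 assume "\<omega> \<in> {%x. \<phi> x + \<psi> x |\<phi> \<psi>. \<phi> \<in> schwartz \<and> \<psi> \<in> schwartz}"
 then obtain \<phi> \<psi> where \<omega>: "\<omega> = (%x. \<phi> x + \<psi> x)" and S: "\<phi> \<in> schwartz" "\<psi> \<in> schwartz" by auto
 have D: "(\<omega> has_derivative (%h. \<Sum>i\<in>UNIV. (h $ i) *\<^sub>R (partial i \<phi> x + partial i \<psi> x))) (at x)" for x
  using has_derivative_add[OF schwartz_has_derivative[OF S(1)] schwartz_has_derivative[OF S(2)], of x]
  by (simp add: \<omega> sum.distrib scaleR_add_right)
 show "\<omega> differentiable (at x)" by (rule has_derivative_partialI[OF D])
 have "partial i \<omega> = (%x. partial i \<phi> x + partial i \<psi> x)" by (rule ext) (rule has_derivative_partialI[OF D])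
 then show "partial i \<omega> \<in> {%x. \<phi> x + \<psi> x |\<phi> \<psi>. \<phi> \<in> schwartz \<and> \<psi> \<in> schwartz}"
  using S schwartz_partial by blast
 obtain B C where B: "\<And>x. (1 + norm x) ^ N * norm (\<phi> x) <= B" and C: "\<And>x. (1 + norm x) ^ N * norm (\<psi> x) <= C"
  using schwartz_decay[OF S(1)] schwartz_decay[OF S(2)] by metis
 show "bounded (range (%x. (1 + norm x) ^ N * norm (\<omega> x)))"
 proof (rule bounded_weightI)
  fix x
  have "(1 + norm x) ^ N * norm (\<omega> x) <= (1 + norm x) ^ N * (norm (\<phi> x) + norm (\<psi> x))"
   unfolding \<omega> by (intro mult_left_mono norm_triangle_ineq) auto
  then show "(1 + norm x) ^ N * norm (\<omega> x) <= B + C" using B[of x] C[of x] by (simp add: distrib_left)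
 qed
qed (use assms in blast)

lemma schwartz_cmult:
 assumes "\<phi> \<in> schwartz" shows "(%x. c * \<phi> x) \<in> schwartz"
proof (rule schwartz_coinduct[of _ "{%x. c * \<phi> x |\<phi>. \<phi> \<in> schwartz}"])
 fix \<omega> :: "real^'a => complex" and i x and N :: nat
 assume "\<omega> \<in> {%x. c * \<phi> x |\<phi>. \<phi> \<in> schwartz}"
 then obtain \<phi> where \<omega>: "\<omega> = (%x. c * \<phi> x)" and S: "\<phi> \<in> schwartz" by auto
 have D: "(\<omega> has_derivative (%h. \<Sum>i\<in>UNIV. (h $ i) *\<^sub>R (c * partial i \<phi> x))) (at x)" for x
  using has_derivative_mult_right[OF schwartz_has_derivative[OF S], of c x]
  by (simp add: \<omega> sum_distrib_left)
 show "\<omega> differentiable (at x)" by (rule has_derivative_partialI[OF D])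
 have "partial i \<omega> = (%x. c * partial i \<phi> x)" by (rule ext) (rule has_derivative_partialI[OF D])
 then show "partial i \<omega> \<in> {%x. c * \<phi> x |\<phi>. \<phi> \<in> schwartz}"
  using S schwartz_partial by blast
 obtain B where B: "\<And>x. (1 + norm x) ^ N * norm (\<phi> x) <= B" using schwartz_decay[OF S] by metis
 show "bounded (range (%x. (1 + norm x) ^ N * norm (\<omega> x)))"
 proof (rule bounded_weightI)
  fix x
  have "(1 + norm x) ^ N * norm (\<omega> x) = norm c * ((1 + norm x) ^ N * norm (\<phi> x))" by (simp add: \<omega> norm_mult)
  also have "\<dots> <= norm c * B" by (intro mult_left_mono B) auto
  finally show "(1 + norm x) ^ N * norm (\<omega> x) <= norm c * B" .
 qed
qed (use assms in blast)

text \<open>Products with a coordinate are not closed under \<open>partial\<close>, since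
  differentiating the coordinate leaves \<phi> itself. An arbitrary Schwartz summand \<psi> in the
  coinductive class absorbs this term.\<close>

lemma schwartz_coord_mult:
 fixes \<phi> :: "real^'n => complex"
 assumes "\<phi> \<in> schwartz" shows "(%x. of_real (x $ k) * \<phi> x) \<in> schwartz"
proof (rule schwartz_coinduct[of _ "{%x. of_real (x $ k) * \<phi> x + \<psi> x |\<phi> \<psi>. \<phi> \<in> schwartz \<and> \<psi> \<in> schwartz}"])
 fix \<omega> :: "real^'n => complex" and i x and N :: nat
 assume "\<omega> \<in> {%x. of_real (x $ k) * \<phi> x + \<psi> x |\<phi> \<psi>. \<phi> \<in> schwartz \<and> \<psi> \<in> schwartz}"
 then obtain \<phi> \<psi> where \<omega>: "\<omega> = (%x. of_real (x $ k) * \<phi> x + \<psi> x)" and S: "\<phi> \<in> schwartz" "\<psi> \<in> schwartz" by auto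
 have D: "(\<omega> has_derivative (%h. \<Sum>i\<in>UNIV. (h $ i) *\<^sub>R
   (of_real (x $ k) * partial i \<phi> x + ((if i = k then \<phi> x else 0) + partial i \<psi> x)))) (at x)" for x
 proof -
  have "bounded_linear (%x::real^'n. complex_of_real (x $ k))"
   by (intro bounded_linear_compose[OF bounded_linear_of_real] bounded_linear_vec_nth)
  then have c: "((%x::real^'n. complex_of_real (x $ k)) has_derivative (%h. of_real (h $ k))) (at x)"
   by (rule bounded_linear_imp_has_derivative)
  show ?thesis unfolding \<omega>
   by (rule has_derivative_eq_rhs[OF has_derivative_add[OF has_derivative_mult[OF c schwartz_has_derivative[OF S(1)]]
       schwartz_has_derivative[OF S(2)]]])
     (auto simp: fun_eq_iff sum.distrib distrib_left scaleR_add_right sum_distrib_left scaleR_conv_of_real mult_ac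
      if_distrib[of "%x. _ * x"] sum.delta cong: if_cong)
 qed
 show "\<omega> differentiable (at x)" by (rule has_derivative_partialI[OF D])
 have "partial i \<omega> = (%x. of_real (x $ k) * partial i \<phi> x + ((if i = k then \<phi> x else 0) + partial i \<psi> x))"
  by (rule ext) (rule has_derivative_partialI[OF D])
 moreover have "(%x. (if i = k then \<phi> x else 0) + partial i \<psi> x) \<in> schwartz"
  using S by (cases "i = k") (auto intro!: schwartz_add schwartz_partial schwartz_zero)
 ultimately show "partial i \<omega> \<in> {%x. of_real (x $ k) * \<phi> x + \<psi> x |\<phi> \<psi>. \<phi> \<in> schwartz \<and> \<psi> \<in> schwartz}"
  using schwartz_partial[OF S(1), of i]
  by (intro CollectI exI[of _ "partial i \<phi>"] exI[of _ "%x. (if i = k then \<phi> x else 0) + partial i \<psi> x"]) simp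
 obtain B C where B: "\<And>x. (1 + norm x) ^ Suc N * norm (\<phi> x) <= B" and C: "\<And>x. (1 + norm x) ^ N * norm (\<psi> x) <= C"
  using schwartz_decay[OF S(1)] schwartz_decay[OF S(2)] by metis
 show "bounded (range (%x. (1 + norm x) ^ N * norm (\<omega> x)))"
 proof (rule bounded_weightI)
  fix x
  have "norm (\<omega> x) <= \<bar>x $ k\<bar> * norm (\<phi> x) + norm (\<psi> x)"
   unfolding \<omega> by (rule norm_triangle_le) (simp add: norm_mult)
  also have "\<dots> <= (1 + norm x) * norm (\<phi> x) + norm (\<psi> x)"
   using component_le_norm_cart[of x k] by (intro add_right_mono mult_right_mono) auto
  finally have "(1 + norm x) ^ N * norm (\<omega> x) <= (1 + norm x) ^ N * ((1 + norm x) * norm (\<phi> x) + norm (\<psi> x))"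
   by (intro mult_left_mono) auto
  also have "\<dots> = (1 + norm x) ^ Suc N * norm (\<phi> x) + (1 + norm x) ^ N * norm (\<psi> x)"
   by (simp add: algebra_simps)
  also have "\<dots> <= B + C" by (intro add_mono B C)
  finally show "(1 + norm x) ^ N * norm (\<omega> x) <= B + C" .
 qed
qed (use assms schwartz_zero in force)

text \<open>Reflection with conjugation on one side of the transform is conjugation on the other;
  this is how real-valuedness of a distribution is read off its transform.\<close>

lemma schwartz_reflect_cnj:
 fixes \<phi> :: "real^'n => complex"
 assumes "\<phi> \<in> schwartz" shows "(%x. cnj (\<phi> (- x))) \<in> schwartz"
proof (rule schwartz_coinduct[of _ "{%x. cnj (\<phi> (- x)) |\<phi>. \<phi> \<in> schwartz}"])
 fix \<omega> :: "real^'n => complex" and i x and N :: nat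
 assume "\<omega> \<in> {%x. cnj (\<phi> (- x)) |\<phi>. \<phi> \<in> schwartz}"
 then obtain \<phi> where \<omega>: "\<omega> = (%x. cnj (\<phi> (- x)))" and S: "\<phi> \<in> schwartz" by auto
 have D: "(\<omega> has_derivative (%h. \<Sum>i\<in>UNIV. (h $ i) *\<^sub>R cnj (- 1 * partial i \<phi> (- x)))) (at x)" for x
 proof -
  have m: "((%x::real^'n. - x) has_derivative (%h. - h)) (at x)"
   by (auto intro!: derivative_eq_intros)
  show ?thesis unfolding \<omega>
   by (rule has_derivative_eq_rhs[OF has_derivative_cnj[OF has_derivative_compose[OF m schwartz_has_derivative[OF S]]]])
     (auto simp: fun_eq_iff sum_negf)
 qed
 show "\<omega> differentiable (at x)" by (rule has_derivative_partialI[OF D])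
 have "partial i \<omega> = (%x. cnj (- 1 * partial i \<phi> (- x)))" by (rule ext) (rule has_derivative_partialI[OF D])
 then show "partial i \<omega> \<in> {%x. cnj (\<phi> (- x)) |\<phi>. \<phi> \<in> schwartz}"
  using schwartz_cmult[OF schwartz_partial[OF S, of i], of "- 1"]
  by (intro CollectI exI[of _ "%x. - 1 * partial i \<phi> x"]) simp
 obtain B where B: "\<And>x. (1 + norm x) ^ N * norm (\<phi> x) <= B" using schwartz_decay[OF S] by metis
 show "bounded (range (%x. (1 + norm x) ^ N * norm (\<omega> x)))"
  by (rule bounded_weightI[of _ _ B]) (use B[of "- x" for x] in \<open>simp add: \<omega>\<close>)
qed (use assms in blast)

text \<open>The constant function has mass of order 2^(j d) on the annulus of index j, so the dyadic
  estimate applies with \<beta> = d and decay order d + 1.\<close>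

lemma weight_integrable:
 "integrable lborel (%x::real^'n. 1 / (1 + norm x) ^ (CARD('n) + 1))"
proof -
 obtain C where "C > 0" and C: "\<And>(h :: real^'n => ennreal) A. h \<in> borel_measurable borel ==>
  (\<And>j. (\<integral>\<^sup>+\<xi>. h \<xi> * indicator (annulus j) \<xi> \<partial>lborel) <= A * ennreal (2 powr (of_int j * real CARD('n)))) ==>
  (\<integral>\<^sup>+\<xi>. ennreal (1 / (1 + norm \<xi>) ^ (CARD('n) + 1)) * h \<xi> \<partial>lborel) <= ennreal C * A"
  using schwartz_weight_integral_bound[of "real CARD('n)" "CARD('n) + 1", where 'n='n] by auto
 have L: "lorentz_bound 1 1 (%x::real^'n. 1)"
  by (rule lorentz_boundI) (simp add: emeasure_eq_ennreal_measure)
 have "(\<integral>\<^sup>+x. ennreal (1 / (1 + norm (x::real^'n)) ^ (CARD('n) + 1)) * 1 \<partial>lborel)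
   <= ennreal C * (1 * ennreal ((unit_ball_vol (real CARD('n)) * 2 ^ CARD('n)) powr 1))"
  using lorentz_bound_annulus[OF L] by (intro C) auto
 also have "\<dots> < \<infinity>" by (simp add: ennreal_mult_less_top)
 finally show ?thesis by (intro integrableI_nonneg) auto
qed

lemma schwartz_weight_integrable:
 fixes \<phi> :: "real^'n => complex"
 assumes "\<phi> \<in> schwartz" shows "integrable lborel (%x. (1 + norm x) ^ k * norm (\<phi> x))"
proof -
 obtain C where C: "C > 0" "\<And>x. (1 + norm x) ^ (k + (CARD('n) + 1)) * norm (\<phi> x) <= C"
  using schwartz_decay[OF assms] by metis
 note [measurable] = schwartz_measurable[OF assms]
 show ?thesis
 proof (rule Bochner_Integration.integrable_bound[OF integrable_mult_right[OF weight_integrable, of C]])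
  have "(1 + norm x) ^ k * norm (\<phi> x) <= C * (1 / (1 + norm x) ^ (CARD('n) + 1))" for x
  proof -
   have p: "(1 + norm x) ^ (CARD('n) + 1) > 0" by (intro zero_less_power add_pos_nonneg) auto
   show ?thesis using C(2)[of x] p unfolding power_add[of _ k] by (simp add: pos_le_divide_eq mult_ac)
  qed
  then show "AE x in lborel. norm ((1 + norm x) ^ k * norm (\<phi> x)) <= norm (C * (1 / (1 + norm x) ^ (CARD('n) + 1)))"
   using C(1) by (intro always_eventually allI) (simp add: abs_mult)
 qed measurable
qed

lemma schwartz_integrable:
 fixes \<phi> :: "real^'n => complex"
 assumes "\<phi> \<in> schwartz" shows "integrable lborel \<phi>"
 using schwartz_weight_integrable[OF assms, of 0] schwartz_measurable[OF assms]
 by (simp add: integrable_norm_iff)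

lemma cis_minus_linear_bound: "norm (cis y - 1 - \<i> * of_real y) <= y\<^sup>2 / 2"
 using iexp_approx1[of y 1] by (simp add: cis_conv_exp mult.commute numeral_2_eq_2 power2_eq_square abs_mult_self_eq diff_diff_eq)

lemma integrable_cis_mult:
 fixes f :: "real^'n => complex"
 assumes "integrable lborel f" "g \<in> borel_measurable borel"
 shows "integrable lborel (%x. cis (g x) * f x)"
 using assms by (intro Bochner_Integration.integrable_bound[OF assms(1)]) (auto simp: norm_mult cis_conv_exp)

text \<open>The second-order Taylor remainder of the exponential is integrated against \<phi>. This
  bounds the remainder of the transform by a multiple of |h|^2 directly, and no limit has to be
  exchanged with an integral.\<close>

lemma fourier_has_derivative:
 fixes \<phi> :: "real^'n => complex"
 assumes S: "\<phi> \<in> schwartz"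
 shows "(fourier \<phi> has_derivative (%h. \<Sum>i\<in>UNIV. (h $ i) *\<^sub>R fourier (%x. - \<i> * (of_real (x $ i) * \<phi> x)) \<xi>)) (at \<xi>)"
proof -
 note [measurable] = schwartz_measurable[OF S]
 have Si: "(%x. - \<i> * (of_real (x $ i) * \<phi> x)) \<in> schwartz" for i
  by (intro schwartz_cmult schwartz_coord_mult S)
 define K where "K = (LINT x|lborel. (1 + norm x) ^ 2 * norm (\<phi> x))"
 have bnd: "norm (fourier \<phi> (\<xi> + h) - fourier \<phi> \<xi> - (\<Sum>i\<in>UNIV. (h $ i) *\<^sub>R fourier (%x. - \<i> * (of_real (x $ i) * \<phi> x)) \<xi>))
   <= (norm h)\<^sup>2 * K" for h
 proof -
  have I0: "integrable lborel (%x. cis (- (x \<bullet> \<xi>)) * \<phi> x)" for \<xi>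
   by (intro integrable_cis_mult schwartz_integrable S) auto
  have I1: "integrable lborel (%x. (h $ i) *\<^sub>R (cis (- (x \<bullet> \<xi>)) * (- \<i> * (of_real (x $ i) * \<phi> x))))" for i
   by (intro integrable_scaleR_right integrable_cis_mult schwartz_integrable Si) auto
  have pt: "cis (- (x \<bullet> (\<xi> + h))) * \<phi> x - cis (- (x \<bullet> \<xi>)) * \<phi> x - (\<Sum>i\<in>UNIV. (h $ i) *\<^sub>R (cis (- (x \<bullet> \<xi>)) * (- \<i> * (of_real (x $ i) * \<phi> x))))
    = cis (- (x \<bullet> \<xi>)) * \<phi> x * (cis (- (x \<bullet> h)) - 1 - \<i> * of_real (- (x \<bullet> h)))" for x
  proof -
   have "(\<Sum>i\<in>UNIV. (h $ i) *\<^sub>R (cis (- (x \<bullet> \<xi>)) * (- \<i> * (of_real (x $ i) * \<phi> x)))) =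
     cis (- (x \<bullet> \<xi>)) * \<phi> x * (- \<i> * of_real (\<Sum>i\<in>UNIV. x $ i * h $ i))"
    by (simp add: sum_distrib_left scaleR_conv_of_real sum_negf mult_ac)
   also have "(\<Sum>i\<in>UNIV. x $ i * h $ i) = x \<bullet> h" by (simp add: inner_vec_def)
   finally have e: "(\<Sum>i\<in>UNIV. (h $ i) *\<^sub>R (cis (- (x \<bullet> \<xi>)) * (- \<i> * (of_real (x $ i) * \<phi> x)))) =
     cis (- (x \<bullet> \<xi>)) * \<phi> x * (- \<i> * of_real (x \<bullet> h))" .
   have "cis (- (x \<bullet> (\<xi> + h))) = cis (- (x \<bullet> \<xi>)) * cis (- (x \<bullet> h))" by (simp add: cis_mult inner_add_right)
   then show ?thesis unfolding e by (simp add: algebra_simps)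
  qed
  have "fourier \<phi> (\<xi> + h) - fourier \<phi> \<xi> - (\<Sum>i\<in>UNIV. (h $ i) *\<^sub>R fourier (%x. - \<i> * (of_real (x $ i) * \<phi> x)) \<xi>)
    = (LINT x|lborel. cis (- (x \<bullet> (\<xi> + h))) * \<phi> x - cis (- (x \<bullet> \<xi>)) * \<phi> x
      - (\<Sum>i\<in>UNIV. (h $ i) *\<^sub>R (cis (- (x \<bullet> \<xi>)) * (- \<i> * (of_real (x $ i) * \<phi> x)))))"
   unfolding fourier_def
   by (simp only: Bochner_Integration.integral_diff Bochner_Integration.integrable_diff
     Bochner_Integration.integral_sum Bochner_Integration.integrable_sum I0 I1 integral_scaleR_right)
  also have "\<dots> = (LINT x|lborel. cis (- (x \<bullet> \<xi>)) * \<phi> x * (cis (- (x \<bullet> h)) - 1 - \<i> * of_real (- (x \<bullet> h))))"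
   by (simp only: pt)
  also have "norm \<dots> <= (LINT x|lborel. (norm h)\<^sup>2 * ((1 + norm x) ^ 2 * norm (\<phi> x)))"
  proof (rule Bochner_Integration.integral_norm_bound_integral)
   show "integrable lborel (%x. cis (- (x \<bullet> \<xi>)) * \<phi> x * (cis (- (x \<bullet> h)) - 1 - \<i> * of_real (- (x \<bullet> h))))"
    unfolding pt[symmetric] by (intro Bochner_Integration.integrable_diff Bochner_Integration.integrable_sum I0 I1)
   show "integrable lborel (%x. (norm h)\<^sup>2 * ((1 + norm x) ^ 2 * norm (\<phi> x)))"
    by (intro integrable_mult_right schwartz_weight_integrable S)
   fix x
   have "norm (cis (- (x \<bullet> h)) - 1 - \<i> * of_real (- (x \<bullet> h))) <= (x \<bullet> h)\<^sup>2 / 2"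
    using cis_minus_linear_bound[of "- (x \<bullet> h)"] by simp
   also have "\<dots> <= (x \<bullet> h)\<^sup>2" by simp
   also have "\<dots> <= (norm x * norm h)\<^sup>2"
    using Cauchy_Schwarz_ineq2[of x h] by (metis abs_ge_zero power2_abs power_mono)
   also have "\<dots> <= (norm h)\<^sup>2 * (1 + norm x) ^ 2"
    unfolding power_mult_distrib by (subst mult.commute) (intro mult_left_mono power_mono, auto)
   finally have "norm (cis (- (x \<bullet> h)) - 1 - \<i> * of_real (- (x \<bullet> h))) * norm (\<phi> x) <= (norm h)\<^sup>2 * (1 + norm x) ^ 2 * norm (\<phi> x)"
    by (intro mult_right_mono) auto
   then show "norm (cis (- (x \<bullet> \<xi>)) * \<phi> x * (cis (- (x \<bullet> h)) - 1 - \<i> * of_real (- (x \<bullet> h)))) <= (norm h)\<^sup>2 * ((1 + norm x) ^ 2 * norm (\<phi> x))"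
    by (simp add: norm_mult mult_ac)
  qed
  finally show ?thesis by (simp add: K_def)
 qed
 have lin: "bounded_linear (%h. \<Sum>i\<in>UNIV. (h $ i) *\<^sub>R fourier (%x. - \<i> * (of_real (x $ i) * \<phi> x)) \<xi>)"
  by (intro bounded_linear_sum bounded_linear_scaleR_const bounded_linear_vec_nth)
 have K0: "K \<ge> 0" unfolding K_def by (intro integral_nonneg_AE) auto
 show ?thesis
  unfolding has_derivative_at
 proof (intro conjI lin)
  show "(%h. norm (fourier \<phi> (\<xi> + h) - fourier \<phi> \<xi> - (\<Sum>i\<in>UNIV. (h $ i) *\<^sub>R fourier (%x. - \<i> * (of_real (x $ i) * \<phi> x)) \<xi>)) / norm h) \<midarrow>0\<rightarrow> 0"
  proof (rule tendsto_sandwich[of "%_. 0" _ _ "%h. norm h * K"])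
   show "\<forall>\<^sub>F h in at 0. norm (fourier \<phi> (\<xi> + h) - fourier \<phi> \<xi> - (\<Sum>i\<in>UNIV. (h $ i) *\<^sub>R fourier (%x. - \<i> * (of_real (x $ i) * \<phi> x)) \<xi>)) / norm h <= norm h * K"
    using eventually_neq_at_within[of 0 0 UNIV]
   proof eventually_elim
    case (elim h)
    then show ?case using bnd[of h] by (simp add: pos_divide_le_eq power2_eq_square mult_ac)
   qed
   show "(%h::real^'n. norm h * K) \<midarrow>0\<rightarrow> 0" by (auto intro!: tendsto_eq_intros)
  qed auto
 qed
qed

lemma cis_measurable [measurable (raw)]:
 fixes f :: "'a => real"
 assumes [measurable]: "f \<in> borel_measurable M"
 shows "(%x. cis (f x)) \<in> borel_measurable M"
 unfolding cis_conv_exp by measurable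

lemma lborel_integral_translate:
 fixes f :: "'a::euclidean_space => 'b::{banach, second_countable_topology}"
 assumes "f \<in> borel_measurable borel"
 shows "(LINT x|lborel. f (a + x)) = (LINT x|lborel. f x)"
proof -
 have "(LINT x|lborel. f x) = (LINT x|distr lborel borel ((+) a). f x)" by (simp add: lborel_distr_plus)
 also have "\<dots> = (LINT x|lborel. f (a + x))" using assms by (subst integral_distr) auto
 finally show ?thesis ..
qed

lemma lborel_integral_affine:
 fixes f :: "'a::euclidean_space => 'b::{banach, second_countable_topology}"
 assumes [measurable]: "f \<in> borel_measurable borel" and c: "c \<noteq> 0"
 shows "(LINT x|lborel. f x) = \<bar>c\<bar> ^ DIM('a) *\<^sub>R (LINT x|lborel. f (a + c *\<^sub>R x))"
proof -
 have "(LINT x|lborel. f x) = (LINT x|density (distr lborel borel (%x. a + c *\<^sub>R x)) (%_. ennreal (\<bar>c\<bar> ^ DIM('a))). f x)"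
  by (subst lborel_affine[OF c, of a]) simp
 also have "\<dots> = (LINT x|distr lborel borel (%x. a + c *\<^sub>R x). \<bar>c\<bar> ^ DIM('a) *\<^sub>R f x)"
  by (subst integral_density) auto
 also have "\<dots> = (LINT x|lborel. \<bar>c\<bar> ^ DIM('a) *\<^sub>R f (a + c *\<^sub>R x))"
  by (subst integral_distr) auto
 finally show ?thesis by simp
qed

lemma lborel_integral_uminus:
 fixes f :: "'a::euclidean_space => 'b::{banach, second_countable_topology}"
 assumes "f \<in> borel_measurable borel"
 shows "(LINT x|lborel. f (- x)) = (LINT x|lborel. f x)"
 using lborel_integral_affine[OF assms, of "- 1" 0] by simp

lemma has_vector_derivative_quotient:
 fixes f :: "real => 'a::real_normed_vector"
 assumes "(f has_vector_derivative d) (at 0)"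
 shows "((%s. (f s - f 0) /\<^sub>R s) \<longlongrightarrow> d) (at 0)"
proof -
 have "((%s. norm (f (0 + s) - f 0 - s *\<^sub>R d) / norm s) \<longlongrightarrow> 0) (at 0)"
  using assms unfolding has_vector_derivative_def has_derivative_at by auto
 then have "((%s. norm ((f s - f 0 - s *\<^sub>R d) /\<^sub>R s)) \<longlongrightarrow> 0) (at 0)"
  by (simp add: divide_inverse mult.commute)
 then have "((%s. (f s - f 0 - s *\<^sub>R d) /\<^sub>R s) \<longlongrightarrow> 0) (at 0)"
  by (rule tendsto_norm_zero_cancel)
 then have "((%s. (f s - f 0 - s *\<^sub>R d) /\<^sub>R s + d) \<longlongrightarrow> 0 + d) (at 0)"
  by (intro tendsto_add tendsto_const)
 then show ?thesis unfolding add_0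
 proof (rule Lim_transform_eventually)
  show "\<forall>\<^sub>F s in at 0. (f s - f 0 - s *\<^sub>R d) /\<^sub>R s + d = (f s - f 0) /\<^sub>R s"
   using eventually_neq_at_within[of 0 0 UNIV]
   by eventually_elim (simp add: scaleR_diff_right)
 qed
qed

text \<open>Translation replaces integration by parts: the transform of a difference quotient of
  \<phi> is the difference quotient of a character times \<open>fourier \<phi> \<xi>\<close>, and
  both sides converge as the step tends to 0.\<close>

lemma fourier_partial:
 fixes \<phi> :: "real^'n => complex"
 assumes S: "\<phi> \<in> schwartz"
 shows "fourier (partial i \<phi>) \<xi> = \<i> * of_real (\<xi> $ i) * fourier \<phi> \<xi>"
proof -
 note [measurable] = schwartz_measurable[OF S] schwartz_measurable[OF schwartz_partial[OF S]]
 define e :: "real^'n" where "e = axis i 1"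
 have ne: "norm e = 1" by (simp add: e_def)
 obtain C where C: "C > 0" "\<And>x. (1 + norm x) ^ (CARD('n) + 1) * norm (partial i \<phi> x) <= C"
  using schwartz_decay[OF schwartz_partial[OF S]] by metis
 \<comment> \<open>Dominates the difference quotients for all steps up to 1: a point y at distance
   at most 1 from x satisfies 1 + |x| <= 2 (1 + |y|), whence the power of 2.\<close>
 define W where "W x = 2 ^ (CARD('n) + 1) * C * (1 / (1 + norm x) ^ (CARD('n) + 1))" for x :: "real^'n"
 have Wint: "integrable lborel W" unfolding W_def by (intro integrable_mult_right weight_integrable)
 have D: "((%s. \<phi> (s *\<^sub>R e + x)) has_vector_derivative partial i \<phi> (s *\<^sub>R e + x)) (at s)" for s x
 proof -
  have "((%s. s *\<^sub>R e + x) has_derivative (%h. h *\<^sub>R e)) (at s)" by (auto intro!: derivative_eq_intros)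
  from has_derivative_compose[OF this schwartz_has_derivative[OF S]]
  show ?thesis unfolding has_vector_derivative_def
   by (rule has_derivative_eq_rhs) (auto simp: fun_eq_iff e_def axis_def if_distrib[of "%x. _ * x"] if_distrib[of "%x. x *\<^sub>R _"] sum.delta cong: if_cong)
 qed
 have quot: "norm ((\<phi> (s *\<^sub>R e + x) - \<phi> x) /\<^sub>R s) <= W x" if s: "0 < s" "s <= 1" for s x
 proof -
  have "norm (\<phi> (s *\<^sub>R e + x) - \<phi> (0 *\<^sub>R e + x)) <= W x * norm (s - 0)"
  proof (rule differentiable_bound[of "{0..s}" "%s. \<phi> (s *\<^sub>R e + x)" "%s h. h *\<^sub>R partial i \<phi> (s *\<^sub>R e + x)"])
   show "((%s. \<phi> (s *\<^sub>R e + x)) has_derivative (%h. h *\<^sub>R partial i \<phi> (y *\<^sub>R e + x))) (at y within {0..s})" for y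
    using D[of x y] unfolding has_vector_derivative_def by (rule has_derivative_at_withinI)
   show "onorm (%h. h *\<^sub>R partial i \<phi> (t *\<^sub>R e + x)) <= W x" if t: "t \<in> {0..s}" for t
   proof -
    define y where "y = t *\<^sub>R e + x"
    have "norm x <= norm y + norm (t *\<^sub>R e)"
     using norm_triangle_ineq4[of y "t *\<^sub>R e"] by (simp add: y_def)
    moreover have "norm (t *\<^sub>R e) <= 1" using t s by (simp add: ne)
    ultimately have "1 + norm x <= 2 + 2 * norm y" using norm_ge_zero[of y] by linarith
    then have "1 + norm x <= 2 * (1 + norm y)" by simp
    then have "(1 + norm x) ^ (CARD('n) + 1) <= (2 * (1 + norm y)) ^ (CARD('n) + 1)" by (intro power_mono) auto
    then have "(1 + norm x) ^ (CARD('n) + 1) * norm (partial i \<phi> y) <= (2 * (1 + norm y)) ^ (CARD('n) + 1) * norm (partial i \<phi> y)"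
     by (intro mult_right_mono) auto
    also have "\<dots> = 2 ^ (CARD('n) + 1) * ((1 + norm y) ^ (CARD('n) + 1) * norm (partial i \<phi> y))"
     by (simp only: power_mult_distrib mult.assoc)
    also have "\<dots> <= 2 ^ (CARD('n) + 1) * C" by (intro mult_left_mono C) auto
    finally have *: "(1 + norm x) ^ (CARD('n) + 1) * norm (partial i \<phi> y) <= 2 ^ (CARD('n) + 1) * C" .
    have p: "(1 + norm x) ^ (CARD('n) + 1) > 0" by (intro zero_less_power add_pos_nonneg) auto
    from * have le: "norm (partial i \<phi> y) <= W x"
     using p by (simp add: W_def pos_le_divide_eq mult.commute)
    have "onorm (%h. h *\<^sub>R partial i \<phi> y) <= norm (partial i \<phi> y)"
     by (rule onorm_bound) auto
    with le show ?thesis by (simp add: y_def)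
   qed
  qed (use s in auto)
  then have "norm (\<phi> (s *\<^sub>R e + x) - \<phi> x) / s <= W x" using s by (simp add: pos_divide_le_eq)
  then show ?thesis using s by (simp add: divide_inverse mult.commute)
 qed
 define h where "h n = 1 / (real n + 1)" for n
 have h: "0 < h n" "h n <= 1" for n by (auto simp: h_def)
 have h0: "h \<longlonglongrightarrow> 0" unfolding h_def by (rule LIMSEQ_inverse_real_of_nat[unfolded inverse_eq_divide of_nat_Suc add.commute[of 1]])
 have hat: "filterlim h (at 0) sequentially"
  using h0 h(1) by (auto simp: filterlim_at intro!: always_eventually less_imp_neq[symmetric])
 have L1: "(%n. (LINT x|lborel. cis (- (x \<bullet> \<xi>)) * ((\<phi> (h n *\<^sub>R e + x) - \<phi> x) /\<^sub>R h n))) \<longlonglongrightarrow> fourier (partial i \<phi>) \<xi>"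
  unfolding fourier_def
 proof (rule integral_dominated_convergence[OF _ _ Wint])
  show "AE x in lborel. (%n. cis (- (x \<bullet> \<xi>)) * ((\<phi> (h n *\<^sub>R e + x) - \<phi> x) /\<^sub>R h n)) \<longlonglongrightarrow> cis (- (x \<bullet> \<xi>)) * partial i \<phi> x"
  proof (intro always_eventually allI tendsto_mult tendsto_const)
   fix x
   have "((%s. (\<phi> (s *\<^sub>R e + x) - \<phi> (0 *\<^sub>R e + x)) /\<^sub>R (s - 0)) \<longlongrightarrow> partial i \<phi> (0 *\<^sub>R e + x)) (at 0)"
    using has_vector_derivative_quotient[OF D[of x 0]] by simp
   from filterlim_compose[OF this hat]
   show "(%n. (\<phi> (h n *\<^sub>R e + x) - \<phi> x) /\<^sub>R h n) \<longlonglongrightarrow> partial i \<phi> x" by simp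
  qed
  show "AE x in lborel. norm (cis (- (x \<bullet> \<xi>)) * ((\<phi> (h n *\<^sub>R e + x) - \<phi> x) /\<^sub>R h n)) <= W x" for n
   using quot[OF h] by (intro always_eventually allI) (simp add: norm_mult)
 qed measurable
 have shift: "(LINT x|lborel. cis (- (x \<bullet> \<xi>)) * ((\<phi> (s *\<^sub>R e + x) - \<phi> x) /\<^sub>R s)) = ((cis (s * \<xi> $ i) - 1) /\<^sub>R s) * fourier \<phi> \<xi>" for s
 proof -
  have eq: "cis (- (x \<bullet> \<xi>)) = cis (s * \<xi> $ i) * cis (- ((s *\<^sub>R e + x) \<bullet> \<xi>))" for x
   by (simp add: cis_mult inner_add_left e_def inner_axis' )
  have I: "integrable lborel (%x. cis (- (x \<bullet> \<xi>)) * \<phi> x)"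
   by (intro integrable_cis_mult schwartz_integrable S) auto
  have T: "(LINT x|lborel. cis (- ((s *\<^sub>R e + x) \<bullet> \<xi>)) * \<phi> (s *\<^sub>R e + x)) = fourier \<phi> \<xi>"
   unfolding fourier_def by (rule lborel_integral_translate) measurable
  have IT: "integrable lborel (%x. cis (- ((s *\<^sub>R e + x) \<bullet> \<xi>)) * \<phi> (s *\<^sub>R e + x))"
  proof -
   have "integrable (distr lborel borel ((+) (s *\<^sub>R e))) (%x. cis (- (x \<bullet> \<xi>)) * \<phi> x)"
    unfolding lborel_distr_plus by (rule I)
   then show ?thesis by (subst (asm) integrable_distr_eq) auto
  qed
  have "(LINT x|lborel. cis (- (x \<bullet> \<xi>)) * ((\<phi> (s *\<^sub>R e + x) - \<phi> x) /\<^sub>R s)) =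
   (LINT x|lborel. (cis (s * \<xi> $ i) * (cis (- ((s *\<^sub>R e + x) \<bullet> \<xi>)) * \<phi> (s *\<^sub>R e + x)) - cis (- (x \<bullet> \<xi>)) * \<phi> x) /\<^sub>R s)"
   by (rule Bochner_Integration.integral_cong) (auto simp: right_diff_distrib mult.assoc[symmetric] eq[symmetric])
  also have "\<dots> = (cis (s * \<xi> $ i) * fourier \<phi> \<xi> - fourier \<phi> \<xi>) /\<^sub>R s"
   by (simp only: integral_scaleR_right Bochner_Integration.integral_diff integral_mult_right_zero integrable_mult_right I IT T)
    (simp add: fourier_def)
  finally show ?thesis by (simp add: left_diff_distrib scaleR_diff_right)
 qed
 have "((%s. cis (s * \<xi> $ i)) has_vector_derivative \<i> * of_real (\<xi> $ i)) (at 0)"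
  unfolding has_vector_derivative_def
  by (rule has_derivative_eq_rhs[OF has_derivative_cis[OF has_derivative_mult_left[OF has_derivative_ident]]])
    (auto simp: fun_eq_iff scaleR_conv_of_real)
 from filterlim_compose[OF has_vector_derivative_quotient[OF this] hat]
 have L2: "(%n. ((cis (h n * \<xi> $ i) - 1) /\<^sub>R h n) * fourier \<phi> \<xi>) \<longlonglongrightarrow> (\<i> * of_real (\<xi> $ i)) * fourier \<phi> \<xi>"
  by (intro tendsto_mult tendsto_const) simp
 show ?thesis
  using LIMSEQ_unique[OF L1[unfolded shift] L2] by simp
qed

lemma fourier_norm_le:
 fixes \<phi> :: "real^'n => complex"
 shows "norm (fourier \<phi> \<xi>) <= (LINT x|lborel. norm (\<phi> x))"
 unfolding fourier_def by (rule order_trans[OF integral_norm_bound]) (simp add: norm_mult)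

lemma fourier_step:
 fixes \<phi> :: "real^'n => complex"
 assumes S: "\<phi> \<in> schwartz"
 shows "(1 + norm \<xi>) * norm (fourier \<phi> \<xi>) <= norm (fourier \<phi> \<xi>) + (\<Sum>i\<in>UNIV. norm (fourier (partial i \<phi>) \<xi>))"
proof -
 have "norm \<xi> * norm (fourier \<phi> \<xi>) <= (\<Sum>i\<in>UNIV. \<bar>\<xi> $ i\<bar>) * norm (fourier \<phi> \<xi>)"
  by (intro mult_right_mono norm_le_l1_cart) auto
 also have "\<dots> = (\<Sum>i\<in>UNIV. norm (fourier (partial i \<phi>) \<xi>))"
  by (simp add: sum_distrib_right fourier_partial[OF S] norm_mult)
 finally show ?thesis by (simp add: distrib_right)
qed

text \<open>A supremum of reals is meaningful only for a bounded set. There are finitely many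
  derivative lists of length at most \<open>N\<close>, and each of them gives a bounded
  family.\<close>

lemma schwartz_norm_bdd:
 fixes \<phi> :: "real^'n => complex"
 assumes S: "\<phi> \<in> schwartz"
 shows "bdd_above ((%(is, x). (1 + norm x) ^ N * norm (iter_partial is \<phi> x)) ` ({is. length is <= N} \<times> UNIV))"
proof -
 have "finite {is :: 'n list. length is <= N}"
  using finite_lists_length_le[of "UNIV :: 'n set" N] by simp
 moreover have "bdd_above ((%x. (1 + norm x) ^ N * norm (iter_partial is \<phi> x)) ` UNIV)" for "is"
  by (intro bounded_imp_bdd_above schwartz_bounded schwartz_iter_partial S)
 ultimately have "bdd_above (\<Union>is\<in>{is. length is <= N}. (%x. (1 + norm x) ^ N * norm (iter_partial is \<phi> x)) ` UNIV)"
  by (subst bdd_above_UN) auto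
 then show ?thesis by (rule bdd_above_mono) auto
qed

lemma schwartz_norm_ge:
 fixes \<phi> :: "real^'n => complex"
 assumes S: "\<phi> \<in> schwartz" and len: "length is <= N" and M: "M <= N"
 shows "(1 + norm x) ^ M * norm (iter_partial is \<phi> x) <= schwartz_norm N \<phi>"
proof -
 have "(1 + norm x) ^ M * norm (iter_partial is \<phi> x) <= (1 + norm x) ^ N * norm (iter_partial is \<phi> x)"
  by (intro mult_right_mono power_increasing M) auto
 also have "\<dots> = (case (is, x) of (is, x) => (1 + norm x) ^ N * norm (iter_partial is \<phi> x))" by simp
 also have "\<dots> <= schwartz_norm N \<phi>"
  unfolding schwartz_norm_def by (intro cSUP_upper schwartz_norm_bdd S) (use len in auto)
 finally show ?thesis .
qed

text \<open>Each factor 1 + |\<xi>| is exchanged for at most one more derivative; in the end a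
  derivative is estimated by its \<open>L^1\<close> norm, for which d + 1 powers of decay suffice.
  The constant is uniform in \<phi>, as the continuity clause of \<open>tempered\<close>
  demands.\<close>

lemma fourier_decay:
 "\<exists>C>0. \<forall>(\<phi> :: real^'n => complex) \<xi>. \<phi> \<in> schwartz -->
   (1 + norm \<xi>) ^ N * norm (fourier \<phi> \<xi>) <= C * schwartz_norm (N + CARD('n) + 1) \<phi>"
proof -
 define K where "K = (LINT x::real^'n|lborel. 1 / (1 + norm x) ^ (CARD('n) + 1))"
 have K0: "K \<ge> 0" unfolding K_def by (intro integral_nonneg_AE) auto
 have "(1 + norm \<xi>) ^ k * norm (fourier (iter_partial is \<phi>) \<xi>) <= (1 + real CARD('n)) ^ k * K * schwartz_norm (N + CARD('n) + 1) \<phi>"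
  if S: "\<phi> \<in> schwartz" and "length is + k <= N" for \<phi> :: "real^'n => complex" and \<xi> k "is"
  using that(2)
 proof (induction k arbitrary: "is")
  case 0
  note Si = schwartz_iter_partial[OF S, of "is"]
  have "norm (fourier (iter_partial is \<phi>) \<xi>) <= (LINT x|lborel. norm (iter_partial is \<phi> x))"
   by (rule fourier_norm_le)
  also have "\<dots> <= (LINT x|lborel. schwartz_norm (N + CARD('n) + 1) \<phi> * (1 / (1 + norm (x::real^'n)) ^ (CARD('n) + 1)))"
  proof (rule Bochner_Integration.integral_mono)
   show "integrable lborel (%x. norm (iter_partial is \<phi> x))" by (intro integrable_norm schwartz_integrable Si)
   show "integrable lborel (%x::real^'n. schwartz_norm (N + CARD('n) + 1) \<phi> * (1 / (1 + norm x) ^ (CARD('n) + 1)))"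
    by (intro integrable_mult_right weight_integrable)
   fix x :: "real^'n"
   have p: "(1 + norm x) ^ (CARD('n) + 1) > 0" by (intro zero_less_power add_pos_nonneg) auto
   have "(1 + norm x) ^ (CARD('n) + 1) * norm (iter_partial is \<phi> x) <= schwartz_norm (N + CARD('n) + 1) \<phi>"
    using 0 by (intro schwartz_norm_ge S) auto
   with p show "norm (iter_partial is \<phi> x) <= schwartz_norm (N + CARD('n) + 1) \<phi> * (1 / (1 + norm x) ^ (CARD('n) + 1))"
    by (simp add: pos_le_divide_eq mult.commute)
  qed
  also have "\<dots> = K * schwartz_norm (N + CARD('n) + 1) \<phi>"
   unfolding integral_mult_right_zero K_def by (rule mult.commute)
  finally show ?case by simp
 next
  case (Suc k)
  let ?B = "(1 + real CARD('n)) ^ k * K * schwartz_norm (N + CARD('n) + 1) \<phi>"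
  have IH: "(1 + norm \<xi>) ^ k * norm (fourier (iter_partial js \<phi>) \<xi>) <= ?B" if "length js <= Suc (length is)" for js
   using that Suc by auto
  have "(1 + norm \<xi>) ^ Suc k * norm (fourier (iter_partial is \<phi>) \<xi>) =
    (1 + norm \<xi>) ^ k * ((1 + norm \<xi>) * norm (fourier (iter_partial is \<phi>) \<xi>))" by simp
  also have "\<dots> <= (1 + norm \<xi>) ^ k * (norm (fourier (iter_partial is \<phi>) \<xi>) + (\<Sum>i\<in>UNIV. norm (fourier (iter_partial (i # is) \<phi>) \<xi>)))"
   using fourier_step[OF schwartz_iter_partial[OF S, of "is"], of \<xi>] by (intro mult_left_mono) auto
  also have "\<dots> = (1 + norm \<xi>) ^ k * norm (fourier (iter_partial is \<phi>) \<xi>) + (\<Sum>i\<in>UNIV. (1 + norm \<xi>) ^ k * norm (fourier (iter_partial (i # is) \<phi>) \<xi>))"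
   by (simp only: distrib_left sum_distrib_left)
  also have "\<dots> <= ?B + (\<Sum>i\<in>(UNIV :: 'n set). ?B)"
   by (intro add_mono sum_mono IH) auto
  also have "\<dots> = (1 + real CARD('n)) ^ Suc k * K * schwartz_norm (N + CARD('n) + 1) \<phi>"
   by (simp add: algebra_simps)
  finally show ?case .
 qed
 from this[of _ "[]" N] have *: "(1 + norm \<xi>) ^ N * norm (fourier \<phi> \<xi>) <= ((1 + real CARD('n)) ^ N * K) * schwartz_norm (N + CARD('n) + 1) \<phi>"
  if "\<phi> \<in> schwartz" for \<phi> :: "real^'n => complex" and \<xi> using that by simp
 have "(1 + norm \<xi>) ^ N * norm (fourier \<phi> \<xi>) <= ((1 + real CARD('n)) ^ N * K + 1) * schwartz_norm (N + CARD('n) + 1) \<phi>"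
  if S: "\<phi> \<in> schwartz" for \<phi> :: "real^'n => complex" and \<xi>
 proof -
  have "0 <= (1 + norm (0::real^'n)) ^ 0 * norm (iter_partial [] \<phi> 0)" by simp
  also have "\<dots> <= schwartz_norm (N + CARD('n) + 1) \<phi>" by (intro schwartz_norm_ge S) auto
  finally show ?thesis using *[OF S, of \<xi>] by (simp add: distrib_right)
 qed
 moreover have "(1 + real CARD('n)) ^ N * K + 1 > 0" using K0 by (simp add: add_nonneg_pos)
 ultimately show ?thesis by blast
qed

lemma fourier_schwartz:
 fixes \<phi> :: "real^'n => complex"
 assumes "\<phi> \<in> schwartz" shows "fourier \<phi> \<in> schwartz"
proof (rule schwartz_coinduct[of _ "{fourier \<phi> |\<phi>. \<phi> \<in> schwartz}"])
 fix \<omega> :: "real^'n => complex" and i x and N :: nat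
 assume "\<omega> \<in> {fourier \<phi> |\<phi>. \<phi> \<in> schwartz}"
 then obtain \<phi> where \<omega>: "\<omega> = fourier \<phi>" and S: "\<phi> \<in> schwartz" by auto
 note D = fourier_has_derivative[OF S]
 show "\<omega> differentiable (at x)" unfolding \<omega> by (rule has_derivative_partialI[OF D])
 have "partial i \<omega> = fourier (%x. - \<i> * (of_real (x $ i) * \<phi> x))"
  unfolding \<omega> by (rule ext) (rule has_derivative_partialI[OF D])
 moreover have "(%x. - \<i> * (of_real (x $ i) * \<phi> x)) \<in> schwartz"
  by (intro schwartz_cmult schwartz_coord_mult S)
 ultimately show "partial i \<omega> \<in> {fourier \<phi> |\<phi>. \<phi> \<in> schwartz}" by blast
 obtain C where "\<And>\<xi>. (1 + norm \<xi>) ^ N * norm (fourier \<phi> \<xi>) <= C * schwartz_norm (N + CARD('n) + 1) \<phi>"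
  using fourier_decay[of N, where 'n='n] S by blast
 then show "bounded (range (%x. (1 + norm x) ^ N * norm (\<omega> x)))"
  unfolding \<omega> by (rule bounded_weightI)
qed (use assms in blast)

lemma fourier_inv_eq: "fourier_inv \<phi> x = fourier \<phi> (- x) / (2 * pi) ^ CARD('n)" for \<phi> :: "real^'n => complex"
 by (simp add: fourier_inv_def fourier_def inner_commute)

lemma fourier_inv_decay:
 "\<exists>C>0. \<forall>(\<phi> :: real^'n => complex) \<xi>. \<phi> \<in> schwartz -->
   norm (fourier_inv \<phi> \<xi>) <= C * schwartz_norm (N + CARD('n) + 1) \<phi> * (1 / (1 + norm \<xi>) ^ N)"
proof -
 obtain C where C: "C > 0" "\<And>(\<phi> :: real^'n => complex) \<xi>. \<phi> \<in> schwartz ==>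
   (1 + norm \<xi>) ^ N * norm (fourier \<phi> \<xi>) <= C * schwartz_norm (N + CARD('n) + 1) \<phi>"
  using fourier_decay[of N, where 'n='n] by blast
 have "norm (fourier_inv \<phi> \<xi>) <= C * schwartz_norm (N + CARD('n) + 1) \<phi> * (1 / (1 + norm \<xi>) ^ N)"
  if S: "\<phi> \<in> schwartz" for \<phi> :: "real^'n => complex" and \<xi>
 proof -
  have p: "(1 + norm \<xi>) ^ N > 0" by (intro zero_less_power add_pos_nonneg) auto
  have "1 <= (2 * pi) ^ CARD('n)" using pi_gt3 by (intro one_le_power) linarith
  then have "norm (fourier \<phi> (- \<xi>)) / (2 * pi) ^ CARD('n) <= norm (fourier \<phi> (- \<xi>)) / 1"
   by (intro divide_left_mono) auto
  then have "norm (fourier_inv \<phi> \<xi>) <= norm (fourier \<phi> (- \<xi>))"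
   by (simp add: fourier_inv_eq norm_divide norm_power norm_mult)
  also have "\<dots> <= C * schwartz_norm (N + CARD('n) + 1) \<phi> * (1 / (1 + norm \<xi>) ^ N)"
   using C(2)[OF S, of "- \<xi>"] p by (simp add: pos_le_divide_eq mult.commute)
  finally show ?thesis .
 qed
 with C(1) show ?thesis by blast
qed

lemma fourier_inv_measurable:
 fixes \<phi> :: "real^'n => complex"
 assumes "\<phi> \<in> schwartz" shows "fourier_inv \<phi> \<in> borel_measurable borel"
proof -
 have [measurable]: "fourier \<phi> \<in> borel_measurable borel" by (intro schwartz_measurable fourier_schwartz assms)
 have "(%x. fourier \<phi> (- x) / (2 * pi) ^ CARD('n)) \<in> borel_measurable borel" by measurable
 then show ?thesis by (simp add: fourier_inv_eq[abs_def])
qed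

lemma bij_betw_axis_Basis: "bij_betw (%i::'n. axis i (1::real)) UNIV (Basis :: (real^'n) set)"
 by (auto simp: bij_betw_def inj_on_def axis_eq_axis Basis_vec_def)

text \<open>\<open>lborel\<close> on vectors is a product measure indexed by \<open>Basis\<close>;
  the bijection \<open>axis\<close> from the index type turns this into a product over
  coordinates.\<close>

lemma lborel_integral_prod:
 fixes f :: "'n::finite => real => complex"
 assumes f: "\<And>i. integrable lborel (f i)"
 shows "(LINT x|lborel. (\<Prod>i\<in>UNIV. f i (x $ i))) = (\<Prod>i\<in>UNIV. LINT y|lborel. f i y)"
proof -
 interpret product_sigma_finite "%_::real^'n. lborel :: real measure" ..
 have [measurable]: "f i \<in> borel_measurable borel" for i using f[of i] by auto
 define F where "F b = f (inv (%i. axis i 1) b)" for b :: "real^'n"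
 have inj: "inj (%i::'n. axis i (1::real))" by (simp add: inj_def axis_eq_axis)
 have F: "F (axis i 1) = f i" for i by (simp add: F_def inv_f_f[OF inj])
 have comp: "(\<Sum>b\<in>Basis. g b *\<^sub>R b) $ i = g (axis i 1)" for g :: "real^'n => real" and i
 proof -
  have "(\<Sum>b\<in>Basis. g b *\<^sub>R b) = (\<Sum>i\<in>UNIV. g (axis i 1) *\<^sub>R axis i 1)"
   by (rule sum.reindex_bij_betw[OF bij_betw_axis_Basis, symmetric])
  then show ?thesis by (simp add: axis_def if_distrib[of "%x. _ * x"] sum.delta cong: if_cong)
 qed
 have "(LINT x|lborel. (\<Prod>i\<in>UNIV. f i (x $ i))) =
   (LINT x|distr (Pi\<^sub>M Basis (%b. lborel)) borel (%g. \<Sum>b\<in>Basis. g b *\<^sub>R b). (\<Prod>i\<in>UNIV. f i ((x :: real^'n) $ i)))"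
  by (subst lborel_eq) rule
 also have "\<dots> = (LINT g|Pi\<^sub>M Basis (%b. lborel). (\<Prod>i\<in>UNIV. f i ((\<Sum>b\<in>Basis. g b *\<^sub>R (b::real^'n)) $ i)))"
  by (rule integral_distr) auto
 also have "\<dots> = (LINT g|Pi\<^sub>M Basis (%b. lborel). (\<Prod>b\<in>Basis. F b (g b)))"
  unfolding comp prod.reindex_bij_betw[OF bij_betw_axis_Basis, symmetric] F by rule
 also have "\<dots> = (\<Prod>b\<in>Basis. integral\<^sup>L lborel (F b))"
  by (rule product_integral_prod) (auto simp: F_def f)
 also have "\<dots> = (\<Prod>i\<in>UNIV. LINT y|lborel. f i y)"
  by (simp add: prod.reindex_bij_betw[OF bij_betw_axis_Basis, symmetric] F)
 finally show ?thesis .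
qed

text \<open>Up to the factor sqrt (2 pi) this is the characteristic function of the standard normal
  distribution.\<close>

lemma gauss_integral_1:
 fixes t :: real
 shows "integrable lborel (%x. cis (t * x) * complex_of_real (exp (- x\<^sup>2 / 2)))" (is "integrable _ ?f")
  and "(LINT x|lborel. cis (t * x) * complex_of_real (exp (- x\<^sup>2 / 2))) = complex_of_real (sqrt (2 * pi) * exp (- t\<^sup>2 / 2))"
proof -
 have eq: "?f = (%x. complex_of_real (sqrt (2 * pi)) * (std_normal_density x *\<^sub>R iexp (t * x)))"
  by (auto simp: fun_eq_iff std_normal_density_def scaleR_conv_of_real cis_conv_exp)
 have I: "integrable lborel (%x. std_normal_density x *\<^sub>R iexp (t * x))"
  by (rule Bochner_Integration.integrable_bound[OF integrable_normal_density[of 1 0]]) auto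
 then show "integrable lborel ?f" unfolding eq by (rule integrable_mult_right)
 have "(LINT x|lborel. std_normal_density x *\<^sub>R iexp (t * x)) = char std_normal_distribution t"
  unfolding char_def by (subst integral_density) auto
 also have "\<dots> = complex_of_real (exp (- t\<^sup>2 / 2))" by (simp add: char_std_normal_distribution)
 finally show "(LINT x|lborel. ?f x) = complex_of_real (sqrt (2 * pi) * exp (- t\<^sup>2 / 2))"
  unfolding eq integral_mult_right_zero by simp
qed

definition gauss :: "real^'n => real" where "gauss x = exp (- (norm x)\<^sup>2 / 2)"

lemma gauss_measurable [measurable]: "gauss \<in> borel_measurable borel"
 unfolding gauss_def by measurable

lemma gauss_prod: "gauss x = (\<Prod>i\<in>UNIV. exp (- (x $ i)\<^sup>2 / 2))"
 by (simp add: gauss_def power2_norm_eq_inner inner_vec_def power2_eq_square[symmetric]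
   exp_sum[symmetric] sum_divide_distrib sum_negf)

lemma gauss_integral:
 "(LINT x|lborel. cis (x \<bullet> \<xi>) * of_real (gauss x)) = complex_of_real (sqrt (2 * pi) ^ CARD('n) * gauss \<xi>)"
 for \<xi> :: "real^'n"
proof -
 have "cis (x \<bullet> \<xi>) * of_real (gauss x) = (\<Prod>i\<in>UNIV. cis (\<xi> $ i * x $ i) * complex_of_real (exp (- (x $ i)\<^sup>2 / 2)))" for x :: "real^'n"
  by (simp add: gauss_prod prod.distrib inner_vec_def cis_conv_exp sum_distrib_left exp_sum mult.commute)
 then have "(LINT x|lborel. cis (x \<bullet> \<xi>) * of_real (gauss x)) =
   (LINT x|lborel. (\<Prod>i\<in>UNIV. cis (\<xi> $ i * x $ i) * complex_of_real (exp (- (x $ i)\<^sup>2 / 2))))"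
  by (simp only:)
 also have "\<dots> = (\<Prod>i\<in>UNIV. complex_of_real (sqrt (2 * pi) * exp (- (\<xi> $ i)\<^sup>2 / 2)))"
  by (subst lborel_integral_prod[where f="%i y. cis (\<xi> $ i * y) * complex_of_real (exp (- y\<^sup>2 / 2))"])
    (simp_all only: gauss_integral_1)
 also have "\<dots> = complex_of_real (sqrt (2 * pi) ^ CARD('n) * gauss \<xi>)"
  by (simp add: gauss_prod prod.distrib)
 finally show ?thesis .
qed

text \<open>A non-integrable function has Bochner integral 0 by convention, whereas the Gaussian
  integral is positive.\<close>

lemma gauss_integrable: "integrable lborel (%x::real^'n. complex_of_real (gauss x))"
proof (rule ccontr)
 assume "\<not> ?thesis"
 then have "(LINT x|lborel. complex_of_real (gauss (x::real^'n))) = 0" by (rule not_integrable_integral_eq)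
 then show False using gauss_integral[of "0 :: real^'n"] by (simp add: gauss_def)
qed

lemma gauss_scaled_integrable:
 assumes "c \<noteq> 0" shows "integrable lborel (%x::real^'n. complex_of_real (gauss (c *\<^sub>R x)))"
proof (rule ccontr)
 assume "\<not> ?thesis"
 then have "(LINT x|lborel. complex_of_real (gauss (c *\<^sub>R (x::real^'n)))) = 0" by (rule not_integrable_integral_eq)
 moreover have "(LINT x|lborel. complex_of_real (gauss (x::real^'n))) = \<bar>c\<bar> ^ DIM(real^'n) *\<^sub>R (LINT x|lborel. complex_of_real (gauss (0 + c *\<^sub>R (x::real^'n))))"
  by (rule lborel_integral_affine) (use assms in auto)
 ultimately show False using gauss_integral[of "0 :: real^'n"] by (simp add: gauss_def)
qed

text \<open>Gaussian regularisation: with a factor \<open>gauss (\<epsilon> *\<^sub>R \<xi>)\<close>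
  in the frequency integral Fubini applies and leaves an average of \<phi> around \<open>x\<close>
  at scale \<epsilon>. Letting \<epsilon> tend to 0 on both sides gives the formula.\<close>

lemma fourier_inversion:
 fixes \<phi> :: "real^'n => complex"
 assumes S: "\<phi> \<in> schwartz" shows "fourier_inv (fourier \<phi>) x = \<phi> x"
proof -
 note [measurable] = schwartz_measurable[OF S] schwartz_measurable[OF fourier_schwartz[OF S]]
 \<comment> \<open>It occurs twice, as the factor in the transform of the Gaussian and as the mass
   of the Gaussian; its square is the normalisation of \<open>fourier_inv\<close>.\<close>
 define s where "s = complex_of_real (sqrt (2 * pi) ^ CARD('n))"
 have approx: "(LINT \<xi>|lborel. cis (x \<bullet> \<xi>) * of_real (gauss (\<epsilon> *\<^sub>R \<xi>)) * fourier \<phi> \<xi>) =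
   s * (LINT z|lborel. \<phi> (x + \<epsilon> *\<^sub>R z) * of_real (gauss z))" if \<epsilon>: "\<epsilon> > 0" for \<epsilon>
 proof -
  have inner: "(LINT \<xi>|lborel. cis ((x - y) \<bullet> \<xi>) * of_real (gauss (\<epsilon> *\<^sub>R \<xi>))) = s * of_real (gauss ((x - y) /\<^sub>R \<epsilon>)) / of_real (\<epsilon> ^ CARD('n))" for y
  proof -
   have "s * of_real (gauss ((x - y) /\<^sub>R \<epsilon>)) = (LINT \<zeta>|lborel. cis (\<zeta> \<bullet> ((x - y) /\<^sub>R \<epsilon>)) * of_real (gauss \<zeta>))"
    unfolding gauss_integral s_def by simp
   also have "\<dots> = \<bar>\<epsilon>\<bar> ^ DIM(real^'n) *\<^sub>R (LINT \<xi>|lborel. cis ((0 + \<epsilon> *\<^sub>R \<xi>) \<bullet> ((x - y) /\<^sub>R \<epsilon>)) * of_real (gauss (0 + \<epsilon> *\<^sub>R \<xi>)))"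
    by (rule lborel_integral_affine) (use \<epsilon> in auto)
   also have "(%\<xi>. cis ((0 + \<epsilon> *\<^sub>R \<xi>) \<bullet> ((x - y) /\<^sub>R \<epsilon>)) * of_real (gauss (0 + \<epsilon> *\<^sub>R \<xi>))) =
     (%\<xi>. cis ((x - y) \<bullet> \<xi>) * complex_of_real (gauss (\<epsilon> *\<^sub>R \<xi>)))"
    using \<epsilon> by (simp add: inner_commute mult.assoc[symmetric])
   finally show ?thesis using \<epsilon> by (simp add: scaleR_conv_of_real[where 'a=complex])
  qed
  have "(LINT \<xi>|lborel. cis (x \<bullet> \<xi>) * of_real (gauss (\<epsilon> *\<^sub>R \<xi>)) * fourier \<phi> \<xi>) =
    (LINT \<xi>|lborel. (LINT y|lborel. cis ((x - y) \<bullet> \<xi>) * of_real (gauss (\<epsilon> *\<^sub>R \<xi>)) * \<phi> y))"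
  proof (rule Bochner_Integration.integral_cong[OF refl])
   fix \<xi> :: "real^'n"
   have "cis (x \<bullet> \<xi>) * of_real (gauss (\<epsilon> *\<^sub>R \<xi>)) * fourier \<phi> \<xi> =
    (LINT y|lborel. (cis (x \<bullet> \<xi>) * of_real (gauss (\<epsilon> *\<^sub>R \<xi>))) * (cis (- (y \<bullet> \<xi>)) * \<phi> y))"
    unfolding fourier_def by simp
   also have "\<dots> = (LINT y|lborel. cis ((x - y) \<bullet> \<xi>) * of_real (gauss (\<epsilon> *\<^sub>R \<xi>)) * \<phi> y)"
   proof (rule Bochner_Integration.integral_cong[OF refl])
    fix y
    have "cis ((x - y) \<bullet> \<xi>) = cis (x \<bullet> \<xi>) * cis (- (y \<bullet> \<xi>))" by (simp add: cis_mult inner_diff_left)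
    then show "cis (x \<bullet> \<xi>) * of_real (gauss (\<epsilon> *\<^sub>R \<xi>)) * (cis (- (y \<bullet> \<xi>)) * \<phi> y) = cis ((x - y) \<bullet> \<xi>) * of_real (gauss (\<epsilon> *\<^sub>R \<xi>)) * \<phi> y"
     by (simp add: mult_ac)
   qed
   finally show "cis (x \<bullet> \<xi>) * of_real (gauss (\<epsilon> *\<^sub>R \<xi>)) * fourier \<phi> \<xi> = (LINT y|lborel. cis ((x - y) \<bullet> \<xi>) * of_real (gauss (\<epsilon> *\<^sub>R \<xi>)) * \<phi> y)" .
  qed
  also have "\<dots> = (LINT y|lborel. (LINT \<xi>|lborel. cis ((x - y) \<bullet> \<xi>) * of_real (gauss (\<epsilon> *\<^sub>R \<xi>)) * \<phi> y))"
  proof (rule lborel_pair.Fubini_integral)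
   have "integrable (lborel \<Otimes>\<^sub>M lborel) (%(y, \<xi>). \<phi> y * complex_of_real (gauss (\<epsilon> *\<^sub>R (\<xi>::real^'n))))"
   proof (rule lborel_pair.Fubini_integrable)
    show "integrable lborel (%y. LINT \<xi>|lborel. norm (case (y, \<xi>) of (y, \<xi>) => \<phi> y * complex_of_real (gauss (\<epsilon> *\<^sub>R (\<xi>::real^'n)))))"
     by (simp add: norm_mult integrable_norm schwartz_integrable S)
    show "AE y in lborel. integrable lborel (%\<xi>. case (y, \<xi>) of (y, \<xi>) => \<phi> y * complex_of_real (gauss (\<epsilon> *\<^sub>R (\<xi>::real^'n))))"
     using \<epsilon> by (intro AE_I2) (simp add: gauss_scaled_integrable)
   qed measurable
   then show "integrable (lborel \<Otimes>\<^sub>M lborel) (%(y, \<xi>). cis ((x - y) \<bullet> \<xi>) * of_real (gauss (\<epsilon> *\<^sub>R \<xi>)) * \<phi> y)"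
    by (rule Bochner_Integration.integrable_bound) (auto simp: norm_mult cis_conv_exp split_beta)
  qed
  also have "\<dots> = (LINT y|lborel. s / of_real (\<epsilon> ^ CARD('n)) * (\<phi> y * of_real (gauss ((x - y) /\<^sub>R \<epsilon>))))"
   unfolding integral_mult_left_zero inner by (rule Bochner_Integration.integral_cong) (simp_all add: mult_ac)
  also have "\<dots> = s / of_real (\<epsilon> ^ CARD('n)) * (LINT y|lborel. \<phi> y * of_real (gauss ((x - y) /\<^sub>R \<epsilon>)))"
   by simp
  also have "(LINT y|lborel. \<phi> y * of_real (gauss ((x - y) /\<^sub>R \<epsilon>))) =
   \<bar>\<epsilon>\<bar> ^ DIM(real^'n) *\<^sub>R (LINT z|lborel. \<phi> (x + \<epsilon> *\<^sub>R z) * of_real (gauss ((x - (x + \<epsilon> *\<^sub>R z)) /\<^sub>R \<epsilon>)))"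
   by (rule lborel_integral_affine) (use \<epsilon> in auto)
  finally show ?thesis using \<epsilon> by (simp add: gauss_def scaleR_conv_of_real[where 'a=complex])
 qed
 define h where "h n = 1 / (real n + 1)" for n
 have h: "h n > 0" for n by (auto simp: h_def)
 have h0: "h \<longlonglongrightarrow> 0" unfolding h_def by (rule LIMSEQ_inverse_real_of_nat[unfolded inverse_eq_divide of_nat_Suc add.commute[of 1]])
 have L1: "(%n. LINT \<xi>|lborel. cis (x \<bullet> \<xi>) * of_real (gauss (h n *\<^sub>R \<xi>)) * fourier \<phi> \<xi>) \<longlonglongrightarrow> (LINT \<xi>|lborel. cis (x \<bullet> \<xi>) * of_real 1 * fourier \<phi> \<xi>)"
 proof (rule integral_dominated_convergence)
  show "integrable lborel (%\<xi>. norm (fourier \<phi> \<xi>))" by (intro integrable_norm schwartz_integrable fourier_schwartz S)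
  show "AE \<xi> in lborel. (%n. cis (x \<bullet> \<xi>) * of_real (gauss (h n *\<^sub>R \<xi>)) * fourier \<phi> \<xi>) \<longlonglongrightarrow> cis (x \<bullet> \<xi>) * of_real 1 * fourier \<phi> \<xi>"
  proof (intro always_eventually allI tendsto_mult tendsto_const tendsto_of_real)
   fix \<xi> :: "real^'n"
   have "(%n. exp (- (norm (h n *\<^sub>R \<xi>))\<^sup>2 / 2)) \<longlonglongrightarrow> exp (- (norm (0 *\<^sub>R \<xi>))\<^sup>2 / 2)"
    by (intro tendsto_intros h0) auto
   then show "(%n. gauss (h n *\<^sub>R \<xi>)) \<longlonglongrightarrow> 1" by (simp add: gauss_def)
  qed
  show "AE \<xi> in lborel. norm (cis (x \<bullet> \<xi>) * of_real (gauss (h n *\<^sub>R \<xi>)) * fourier \<phi> \<xi>) <= norm (fourier \<phi> \<xi>)" for n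
   by (intro always_eventually allI) (simp add: norm_mult gauss_def mult_left_le_one_le)
 qed measurable
 obtain C where C: "\<And>x. norm (\<phi> x) <= C" using schwartz_decay[OF S, of 0] by auto
 have L2: "(%n. LINT z|lborel. \<phi> (x + h n *\<^sub>R z) * of_real (gauss z)) \<longlonglongrightarrow> (LINT z|lborel. \<phi> x * of_real (gauss (z::real^'n)))"
 proof (rule integral_dominated_convergence)
  show "integrable lborel (%z::real^'n. C * norm (complex_of_real (gauss z)))" by (intro integrable_mult_right integrable_norm gauss_integrable)
  show "AE z in lborel. (%n. \<phi> (x + h n *\<^sub>R z) * of_real (gauss z)) \<longlonglongrightarrow> \<phi> x * of_real (gauss z)"
  proof (intro always_eventually allI tendsto_mult tendsto_const)
   fix z :: "real^'n"
   have "isCont \<phi> x" using schwartz_continuous[OF S] by (simp add: continuous_on_eq_continuous_at)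
   moreover have "(%n. x + h n *\<^sub>R z) \<longlonglongrightarrow> x + 0 *\<^sub>R z" by (intro tendsto_intros h0)
   ultimately show "(%n. \<phi> (x + h n *\<^sub>R z)) \<longlonglongrightarrow> \<phi> x" by (intro isCont_tendsto_compose[of x \<phi>]) auto
  qed
  show "AE z in lborel. norm (\<phi> (x + h n *\<^sub>R z) * of_real (gauss z)) <= C * norm (complex_of_real (gauss z))" for n
   by (intro always_eventually allI) (simp add: norm_mult mult_right_mono C gauss_def)
 qed measurable
 have "(LINT \<xi>|lborel. cis (x \<bullet> \<xi>) * fourier \<phi> \<xi>) = s * (LINT z|lborel. \<phi> x * of_real (gauss (z::real^'n)))"
  using LIMSEQ_unique[OF L1[unfolded approx[OF h]] tendsto_mult[OF tendsto_const L2, of s]] by simp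
 also have "(LINT z|lborel. \<phi> x * of_real (gauss (z::real^'n))) = \<phi> x * s"
  using gauss_integral[of "0 :: real^'n"] by (simp add: s_def gauss_def)
 also have "s * (\<phi> x * s) = \<phi> x * of_real ((2 * pi) ^ CARD('n))"
 proof -
  have "s * s = of_real ((sqrt (2 * pi) * sqrt (2 * pi)) ^ CARD('n))"
   by (simp only: s_def of_real_mult[symmetric] power_mult_distrib)
  then have ss: "s * s = of_real ((2 * pi) ^ CARD('n))" by simp
  have "s * (\<phi> x * s) = \<phi> x * (s * s)" by (simp only: mult_ac)
  then show ?thesis unfolding ss .
 qed
 finally show ?thesis by (simp add: fourier_inv_def)
qed

section \<open>Smooth bump functions and uniqueness of transforms\<close>

text \<open>For m = 0 this is the classical smooth cutoff. Differentiation only produces further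
  powers of 1/y with the same exponential, so the family over \<open>m\<close> is closed under
  derivatives up to linear combinations.\<close>

definition bump_fun :: "nat => real => real" where
 "bump_fun m y = (if y > 0 then (1 / y) ^ m * exp (- 1 / y) else 0)"

lemma power_le_exp:
 fixes u :: real assumes "0 <= u" "k > 0" shows "u ^ k <= real k ^ k * exp u"
proof -
 have "(u / real k) ^ k <= (1 + u / real k) ^ k" using assms by (intro power_mono) auto
 also have "\<dots> <= exp u" using assms by (intro exp_ge_one_plus_x_over_n_power_n) auto
 finally show ?thesis using assms by (simp add: power_divide field_simps)
qed

text \<open>Vanishing to second order at 0 forces the difference quotients there to tend to 0, which
  settles differentiability at the only critical point.\<close>

lemma bump_fun_bound: "\<bar>bump_fun m h\<bar> <= real (m + 2) ^ (m + 2) * h\<^sup>2"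
proof (cases "h > 0")
 case True
 have "(1 / h) ^ (m + 2) <= real (m + 2) ^ (m + 2) * exp (1 / h)"
  using True by (intro power_le_exp) auto
 then have "(1 / h) ^ m <= real (m + 2) ^ (m + 2) * exp (1 / h) * h\<^sup>2"
  using True by (simp add: power_add field_simps power2_eq_square)
 then have "(1 / h) ^ m * exp (- (1 / h)) <= real (m + 2) ^ (m + 2) * exp (1 / h) * h\<^sup>2 * exp (- (1 / h))"
  by (intro mult_right_mono) auto
 also have "\<dots> = real (m + 2) ^ (m + 2) * h\<^sup>2 * (exp (1 / h) * exp (- (1 / h)))" by (simp only: mult_ac)
 also have "exp (1 / h) * exp (- (1 / h)) = 1" by (simp only: exp_add[symmetric]) simp
 finally show ?thesis using True by (simp add: bump_fun_def)
qed (simp add: bump_fun_def)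

lemma bump_fun_DERIV: "(bump_fun m has_field_derivative (- real m * bump_fun (Suc m) y + bump_fun (m + 2) y)) (at y)"
proof -
 consider "y > 0" | "y < 0" | "y = 0" by linarith
 then show ?thesis
 proof cases
  case 1
  have "((%y. inverse y ^ m * exp (- inverse y)) has_field_derivative
    - real m * inverse y * inverse y * inverse y ^ (m - Suc 0) * exp (- inverse y) + inverse y * inverse y * inverse y ^ m * exp (- inverse y)) (at y)"
   using 1 by (auto intro!: derivative_eq_intros simp: algebra_simps)
  also have "- real m * inverse y * inverse y * inverse y ^ (m - Suc 0) * exp (- inverse y) + inverse y * inverse y * inverse y ^ m * exp (- inverse y)
    = - real m * (inverse y ^ Suc m * exp (- inverse y)) + inverse y ^ (m + 2) * exp (- inverse y)"
   by (cases m) (simp_all add: algebra_simps)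
  finally have "((%y. inverse y ^ m * exp (- inverse y)) has_field_derivative
    - real m * (inverse y ^ Suc m * exp (- inverse y)) + inverse y ^ (m + 2) * exp (- inverse y)) (at y)" .
  then have "((%y. (1 / y) ^ m * exp (- 1 / y)) has_field_derivative (- real m * bump_fun (Suc m) y + bump_fun (m + 2) y)) (at y)"
   using 1 by (simp add: bump_fun_def inverse_eq_divide)
  then show ?thesis
   by (rule has_field_derivative_transform_within_open[of _ _ _ "{0<..}"]) (use 1 in \<open>auto simp: bump_fun_def\<close>)
 next
  case 2
  have "((%y. 0) has_field_derivative (- real m * bump_fun (Suc m) y + bump_fun (m + 2) y)) (at y)"
   using 2 by (simp add: bump_fun_def)
  then show ?thesis
   by (rule has_field_derivative_transform_within_open[of _ _ _ "{..<0}"]) (use 2 in \<open>auto simp: bump_fun_def\<close>)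
 next
  case 3
  have "(%h. (bump_fun m (0 + h) - bump_fun m 0) / h) \<midarrow>0\<rightarrow> 0"
  proof (rule tendsto_rabs_zero_cancel, rule tendsto_sandwich[of "%_. 0" _ _ "%h. real (m + 2) ^ (m + 2) * \<bar>h\<bar>"])
   show "\<forall>\<^sub>F h in at 0. \<bar>(bump_fun m (0 + h) - bump_fun m 0) / h\<bar> <= real (m + 2) ^ (m + 2) * \<bar>h\<bar>"
    using eventually_neq_at_within[of 0 0 UNIV]
   proof eventually_elim
    case (elim h)
    have "\<bar>bump_fun m h\<bar> <= real (m + 2) ^ (m + 2) * (\<bar>h\<bar> * \<bar>h\<bar>)"
     using bump_fun_bound[of m h] by (simp add: power2_eq_square)
    then have "\<bar>bump_fun m h\<bar> / \<bar>h\<bar> <= real (m + 2) ^ (m + 2) * \<bar>h\<bar>"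
     using elim by (simp add: pos_divide_le_eq mult.assoc)
    then show ?case by (simp add: bump_fun_def[of m 0])
   qed
   show "(%h. real (m + 2) ^ (m + 2) * \<bar>h\<bar>) \<midarrow>0\<rightarrow> 0" by (auto intro!: tendsto_eq_intros)
  qed auto
  then show ?thesis using 3 by (simp add: DERIV_def bump_fun_def)
 qed
qed

text \<open>An algebra containing the partial derivatives of its members. Restricted to a fixed
  compact support it is a coinductive class of Schwartz functions, so derivatives of products never
  have to be written out.\<close>

inductive_set bump_algebra :: "(real^'n => complex) set" where
 base: "(%x. of_real (bump_fun m (c * x $ i + d))) \<in> bump_algebra"
| const: "(%x. c) \<in> bump_algebra"
| add: "f \<in> bump_algebra ==> g \<in> bump_algebra ==> (%x. f x + g x) \<in> bump_algebra"
| mult: "f \<in> bump_algebra ==> g \<in> bump_algebra ==> (%x. f x * g x) \<in> bump_algebra"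

lemma bump_algebra_deriv:
 "f \<in> bump_algebra ==> \<exists>D. (\<forall>i. D i \<in> bump_algebra) \<and>
   (\<forall>x. (f has_derivative (%h. \<Sum>i\<in>UNIV. (h $ i) *\<^sub>R D i x)) (at x))"
proof (induction rule: bump_algebra.induct)
 case (base m c k d)
 define D where "D i = (%x::real^'a. if i = k then complex_of_real c * (of_real (- real m) * of_real (bump_fun (Suc m) (c * x $ k + d)) + of_real (bump_fun (m + 2) (c * x $ k + d))) else 0)" for i
 have "D i \<in> bump_algebra" for i
 proof (cases "i = k")
  case True
  show ?thesis unfolding D_def if_P[OF True]
   by (intro bump_algebra.mult bump_algebra.add bump_algebra.base bump_algebra.const)
 next
  case False
  show ?thesis unfolding D_def if_not_P[OF False] by (rule bump_algebra.const)
 qed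
 moreover have "((%x. complex_of_real (bump_fun m (c * x $ k + d))) has_derivative (%h. \<Sum>i\<in>UNIV. (h $ i) *\<^sub>R D i x)) (at x)" for x
 proof -
  have "((%x::real^'a. c * x $ k + d) has_derivative (%h. c * h $ k)) (at x)"
   by (auto intro!: derivative_eq_intros bounded_linear_imp_has_derivative bounded_linear_vec_nth)
  from has_derivative_of_real[OF has_derivative_compose[OF this bump_fun_DERIV[unfolded has_field_derivative_def]]]
  show ?thesis
   by (rule has_derivative_eq_rhs)
     (auto simp: fun_eq_iff D_def if_distrib[of "%x. _ * x"] sum.delta scaleR_conv_of_real algebra_simps cong: if_cong)
 qed
 ultimately show ?case by blast
next
 case (const c)
 show ?case by (rule exI[of _ "%i x. 0"]) (auto intro: bump_algebra.const)
next
 case (add f g)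
 then obtain D E where D: "\<And>i. D i \<in> bump_algebra" "\<And>x. (f has_derivative (%h. \<Sum>i\<in>UNIV. (h $ i) *\<^sub>R D i x)) (at x)"
  and E: "\<And>i. E i \<in> bump_algebra" "\<And>x. (g has_derivative (%h. \<Sum>i\<in>UNIV. (h $ i) *\<^sub>R E i x)) (at x)" by blast
 show ?case
 proof (rule exI[of _ "%i x. D i x + E i x"], intro conjI allI)
  show "((%x. f x + g x) has_derivative (%h. \<Sum>i\<in>UNIV. (h $ i) *\<^sub>R (D i x + E i x))) (at x)" for x
   by (rule has_derivative_eq_rhs[OF has_derivative_add[OF D(2) E(2)]]) (auto simp: scaleR_add_right sum.distrib)
 qed (auto intro: bump_algebra.add D E)
next
 case (mult f g)
 then obtain D E where D: "\<And>i. D i \<in> bump_algebra" "\<And>x. (f has_derivative (%h. \<Sum>i\<in>UNIV. (h $ i) *\<^sub>R D i x)) (at x)"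
  and E: "\<And>i. E i \<in> bump_algebra" "\<And>x. (g has_derivative (%h. \<Sum>i\<in>UNIV. (h $ i) *\<^sub>R E i x)) (at x)" by blast
 show ?case
 proof (rule exI[of _ "%i x. f x * E i x + D i x * g x"], intro conjI allI)
  show "((%x. f x * g x) has_derivative (%h. \<Sum>i\<in>UNIV. (h $ i) *\<^sub>R (f x * E i x + D i x * g x))) (at x)" for x
   by (rule has_derivative_eq_rhs[OF has_derivative_mult[OF D(2) E(2)]])
     (auto simp: scaleR_add_right sum.distrib sum_distrib_left sum_distrib_right)
 qed (auto intro!: bump_algebra.intros D E mult)
qed

text \<open>The support belongs to the coinductive class because the algebra alone gives no decay;
  derivatives keep the support since they vanish on the open complement of \<open>K\<close>.\<close>

lemma bump_algebra_schwartz: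
 fixes f :: "real^'n => complex"
 assumes f: "f \<in> bump_algebra" and K: "compact K" "\<And>x. x \<notin> K ==> f x = 0"
 shows "f \<in> schwartz"
proof (rule schwartz_coinduct[of _ "{f \<in> bump_algebra. \<forall>x. x \<notin> K --> f x = 0}"])
 fix \<omega> :: "real^'n => complex" and i x and N :: nat
 assume "\<omega> \<in> {f \<in> bump_algebra. \<forall>x. x \<notin> K --> f x = 0}"
 then have \<omega>: "\<omega> \<in> bump_algebra" "\<And>x. x \<notin> K ==> \<omega> x = 0" by auto
 obtain D where D: "\<And>i. D i \<in> bump_algebra" "\<And>x. (\<omega> has_derivative (%h. \<Sum>i\<in>UNIV. (h $ i) *\<^sub>R D i x)) (at x)"
  using bump_algebra_deriv[OF \<omega>(1)] by blast
 show "\<omega> differentiable (at x)" by (rule has_derivative_partialI[OF D(2)])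
 have "partial i \<omega> = D i" by (rule ext) (rule has_derivative_partialI[OF D(2)])
 moreover have "partial i \<omega> x = 0" if x: "x \<notin> K" for x
 proof -
  have "((%x. 0) has_derivative (%_. 0)) (at x)" by simp
  then have "(\<omega> has_derivative (%_. 0)) (at x)"
   by (rule has_derivative_transform_within_open[of _ _ _ _ "- K"])
     (use x \<omega>(2) compact_imp_closed[OF K(1)] in \<open>auto simp: open_Compl\<close>)
  then show ?thesis by (rule partial_eqI)
 qed
 ultimately show "partial i \<omega> \<in> {f \<in> bump_algebra. \<forall>x. x \<notin> K --> f x = 0}" using D(1)[of i] by auto
 have "continuous_on K \<omega>"
  by (meson D(2) continuous_at_imp_continuous_on has_derivative_continuous)
 then have "continuous_on K (%x. (1 + norm x) ^ N * norm (\<omega> x))" by (intro continuous_intros)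
 then have "bounded ((%x. (1 + norm x) ^ N * norm (\<omega> x)) ` K)"
  by (intro compact_imp_bounded compact_continuous_image K)
 then have "bounded (insert 0 ((%x. (1 + norm x) ^ N * norm (\<omega> x)) ` K))" by simp
 then show "bounded (range (%x. (1 + norm x) ^ N * norm (\<omega> x)))"
  by (rule bounded_subset) (use \<omega>(2) in force)
qed (use assms in blast)

text \<open>One cutoff for each face of the box, nonzero exactly in its interior. The index
  \<open>n\<close> only steepens the cutoffs, so that the limit is the indicator of the box.\<close>

definition box_bump :: "real^'n => real^'n => nat => real^'n => complex" where
 "box_bump a b n x = (\<Prod>i\<in>UNIV. of_real (bump_fun 0 (real (Suc n) * x $ i + (- real (Suc n) * a $ i))) *
   of_real (bump_fun 0 (- real (Suc n) * x $ i + real (Suc n) * b $ i)))"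

lemma box_bump_algebra: "box_bump a b n \<in> bump_algebra"
proof -
 have "finite I ==> (%x. \<Prod>i\<in>I. complex_of_real (bump_fun 0 (real (Suc n) * x $ i + (- real (Suc n) * a $ i))) *
   of_real (bump_fun 0 (- real (Suc n) * x $ i + real (Suc n) * b $ i))) \<in> bump_algebra" for I
 proof (induction I rule: finite_induct)
  case empty
  show ?case unfolding prod.empty by (rule bump_algebra.const)
 next
  case (insert i I)
  show ?case unfolding prod.insert[OF insert(1,2)]
   by (intro bump_algebra.mult bump_algebra.base insert)
 qed
 then show ?thesis unfolding box_bump_def[abs_def] by simp
qed

lemma bump_fun_0_scaled: "bump_fun 0 (real (Suc n) * y) = (if y > 0 then exp (- 1 / (real (Suc n) * y)) else 0)"
 by (auto simp: bump_fun_def zero_less_mult_iff)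

lemma box_bump_eq: "box_bump a b n x = (\<Prod>i\<in>UNIV. of_real (bump_fun 0 (real (Suc n) * (x $ i - a $ i))) *
   of_real (bump_fun 0 (real (Suc n) * (b $ i - x $ i))))"
 unfolding box_bump_def by (intro prod.cong refl arg_cong2[where f="(*)"] arg_cong[where f="%y. complex_of_real (bump_fun 0 y)"])
   (simp_all add: algebra_simps)

lemma box_bump_outside: "x \<notin> box a b ==> box_bump a b n x = 0"
 unfolding box_bump_eq by (auto simp: mem_box_cart bump_fun_0_scaled not_less simp del: of_nat_Suc intro!: prod_zero) (metis leD)

lemma box_bump_nonzero: "x \<in> box a b ==> box_bump a b n x \<noteq> 0"
 unfolding box_bump_eq by (auto simp: mem_box_cart bump_fun_0_scaled simp del: of_nat_Suc)

lemma box_bump_le_1: "norm (box_bump a b n x) <= 1"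
proof -
 have "bump_fun 0 y <= 1" "bump_fun 0 y \<ge> 0" for y by (auto simp: bump_fun_def)
 then show ?thesis unfolding box_bump_def prod_norm[symmetric] norm_mult
  by (intro prod_le_1) (auto intro!: mult_le_one)
qed

lemma box_bump_tendsto: "(%n. box_bump a b n x) \<longlonglongrightarrow> indicator (box a b) x"
proof (cases "x \<in> box a b")
 case True
 have *: "(%n. bump_fun 0 (real (Suc n) * y)) \<longlonglongrightarrow> 1" if y: "y > 0" for y
 proof -
  have "(%n. - (1 / y) * inverse (real (Suc n))) \<longlonglongrightarrow> - (1 / y) * 0"
   by (intro tendsto_mult tendsto_const LIMSEQ_inverse_real_of_nat)
  then have "(%n. exp (- (1 / y) * inverse (real (Suc n)))) \<longlonglongrightarrow> exp 0" by (intro tendsto_exp) simp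
  then show ?thesis using y unfolding bump_fun_0_scaled by (simp add: divide_inverse mult_ac)
 qed
 have "(%n. box_bump a b n x) \<longlonglongrightarrow> (\<Prod>i\<in>(UNIV :: 'a set). of_real 1 * of_real 1)"
  unfolding box_bump_eq using True by (intro tendsto_prod tendsto_mult tendsto_of_real *) (auto simp: mem_box_cart)
 then show ?thesis using True by simp
qed (simp add: box_bump_outside)

lemma box_bump_measurable [measurable]: "box_bump a b n \<in> borel_measurable borel"
proof -
 have "bump_fun 0 \<in> borel_measurable borel" unfolding bump_fun_def[abs_def] by measurable
 then show ?thesis unfolding box_bump_def[abs_def] by measurable
qed

text \<open>Open boxes form an intersection-stable generator of the Borel sets, so Dynkin's
  induction applies. Complements need the integral over the whole space, which is obtained from
  exhausting cubes.\<close>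

lemma set_integral_zero_of_boxes:
 fixes g :: "real^'n => complex"
 assumes g: "integrable lborel g" and box: "\<And>a b. (LINT x|lborel. indicator (box a b) x *\<^sub>R g x) = 0"
 shows "AE x in lborel. g x = 0"
proof (rule sigma_finite_measure.density_unique_banach[OF sigma_finite_lborel g, of "%_. 0"])
 fix A :: "(real^'n) set" assume A: "A \<in> sets lborel"
 let ?B = "range (%(a, b). box a b :: (real^'n) set)"
 have int: "set_integrable lborel A g" if "A \<in> sets borel" for A
  unfolding set_integrable_def using g that by (intro integrable_mult_indicator) auto
 have UN: "(LINT x|lborel. g x) = 0"
 proof -
  have "(%n. LINT x|lborel. indicator (box (\<chi> i. - real n) (\<chi> i. real n)) x *\<^sub>R g x) \<longlonglongrightarrow> (LINT x|lborel. g x)"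
  proof (rule integral_dominated_convergence[where w="%x. norm (g x)"])
   show "AE x in lborel. (%n. indicator (box (\<chi> i. - real n) (\<chi> i. real n)) x *\<^sub>R g x) \<longlonglongrightarrow> g x"
   proof (intro AE_I2 tendsto_eventually)
    fix x :: "real^'n"
    obtain N :: nat where N: "norm x < real N" using reals_Archimedean2 by blast
    show "\<forall>\<^sub>F n in sequentially. indicator (box (\<chi> i. - real n) (\<chi> i. real n)) x *\<^sub>R g x = g x"
     using eventually_ge_at_top[of N]
    proof eventually_elim
     case (elim n)
     have "\<bar>x $ i\<bar> < real n" for i using component_le_norm_cart[of x i] N elim by linarith
     then have "x \<in> box (\<chi> i. - real n) (\<chi> i. real n)" by (auto simp: mem_box_cart abs_less_iff minus_less_iff)
     then show ?case by simp
    qed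
   qed
  qed (use g in \<open>auto simp: split: split_indicator\<close>)
  then show ?thesis by (simp add: box LIMSEQ_const_iff)
 qed
 have gen: "sets borel = sigma_sets UNIV ?B" by (subst borel_eq_box) simp
 have "Int_stable ?B"
 proof (rule Int_stableI)
  fix a b assume "a \<in> ?B" "b \<in> ?B"
  then obtain p q r s where "a = box p q" "b = box r s" by auto
  then show "a \<inter> b \<in> ?B" by (auto simp: Int_interval box_Int_box)
 qed
 moreover have "?B \<subseteq> Pow UNIV" by auto
 moreover have "A \<in> sigma_sets UNIV ?B" using A gen by simp
 ultimately have "(LINT x:A|lborel. g x) = 0"
 proof (induction rule: sigma_sets_induct_disjoint)
  case (basic A)
  then show ?case using box by (auto simp: set_lebesgue_integral_def)
 next
  case empty
  then show ?case by (simp add: set_lebesgue_integral_def)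
 next
  case (compl A)
  then have Ab: "A \<in> sets borel" using gen by simp
  have "(LINT x:UNIV - A|lborel. g x) = (LINT x|lborel. g x - indicator A x *\<^sub>R g x)"
   unfolding set_lebesgue_integral_def by (intro Bochner_Integration.integral_cong) (auto split: split_indicator)
  also have "\<dots> = (LINT x|lborel. g x) - (LINT x:A|lborel. g x)"
   using g int[OF Ab] unfolding set_lebesgue_integral_def set_integrable_def by simp
  finally show ?case using UN compl by simp
 next
  case (union A)
  then have Ab: "A i \<in> sets borel" for i using gen by auto
  have "(LINT x:(\<Union>i. A i)|lborel. g x) = (\<Sum>i. LINT x:A i|lborel. g x)"
   using union(1) by (intro lebesgue_integral_countable_add int) (auto simp: disjoint_family_on_def Ab)
  then show ?case using union by simp
 qed
 then show "set_lebesgue_integral lborel A g = set_lebesgue_integral lborel A (%_. 0)" by (simp add: set_lebesgue_integral_def)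
qed simp

text \<open>Multiplying \<open>h\<close> by the bump of a box away from the origin makes it
  integrable; further bumps then approximate indicators of arbitrary boxes. Since the first bump has
  no zero in its box, \<open>h\<close> vanishes there almost everywhere.\<close>

lemma AE_zero_of_test_functions:
 fixes h :: "real^'n => complex"
 assumes [measurable]: "h \<in> borel_measurable borel"
  and h: "\<And>\<phi>. \<phi> \<in> schwartz ==> \<exists>K. compact K \<and> 0 \<notin> K \<and> (\<forall>\<xi>. \<xi> \<notin> K --> \<phi> \<xi> = 0) ==>
   integrable lborel (%\<xi>. h \<xi> * \<phi> \<xi>) \<and> (LINT \<xi>|lborel. h \<xi> * \<phi> \<xi>) = 0"
 shows "AE \<xi> in lborel. h \<xi> = 0"
proof -
 have loc: "AE \<xi> in lborel. \<xi> \<in> box a b --> h \<xi> = 0" if ab: "0 \<notin> cbox a b" for a b :: "real^'n"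
 proof -
  define g where "g \<xi> = h \<xi> * box_bump a b 0 \<xi>" for \<xi>
  have sup: "\<exists>K. compact K \<and> 0 \<notin> K \<and> (\<forall>\<xi>. \<xi> \<notin> K --> box_bump a b 0 \<xi> * f \<xi> = 0)" for f
   by (rule exI[of _ "cbox a b"]) (use ab box_bump_outside[of _ a b] box_subset_cbox[of a b] in \<open>auto simp: compact_cbox\<close>)
  have sch: "(%\<xi>. box_bump a b 0 \<xi> * f \<xi>) \<in> schwartz" if "f \<in> bump_algebra" for f
   by (rule bump_algebra_schwartz[of _ "cbox a b"])
    (use box_bump_outside[of _ a b] box_subset_cbox[of a b] that in \<open>auto simp: compact_cbox intro!: bump_algebra.mult box_bump_algebra\<close>)
  have gf: "integrable lborel (%\<xi>. g \<xi> * f \<xi>) \<and> (LINT \<xi>|lborel. g \<xi> * f \<xi>) = 0" if "f \<in> bump_algebra" for f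
   using h[OF sch[OF that] sup] by (simp add: g_def mult.assoc)
  have gi: "integrable lborel g" using gf[OF bump_algebra.const[of 1]] by simp
  have [measurable]: "g \<in> borel_measurable borel" using gi by auto
  have "AE x in lborel. g x = 0"
  proof (rule set_integral_zero_of_boxes[OF gi])
   fix c d :: "real^'n"
   have "(%n. LINT x|lborel. g x * box_bump c d n x) \<longlonglongrightarrow> (LINT x|lborel. g x * indicator (box c d) x)"
   proof (rule integral_dominated_convergence[where w="%x. norm (g x)"])
    show "AE x in lborel. (%n. g x * box_bump c d n x) \<longlonglongrightarrow> g x * indicator (box c d) x"
     by (intro AE_I2 tendsto_mult tendsto_const box_bump_tendsto)
    show "AE x in lborel. norm (g x * box_bump c d n x) <= norm (g x)" for n
     by (intro AE_I2) (simp add: norm_mult mult_left_le box_bump_le_1)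
   qed (use gi in auto)
   then have "(LINT x|lborel. g x * indicator (box c d) x) = 0"
    using gf[OF box_bump_algebra] by (simp add: LIMSEQ_const_iff)
   moreover have "(LINT x|lborel. g x * indicator (box c d) x) = (LINT x|lborel. indicator (box c d) x *\<^sub>R g x)"
    by (intro Bochner_Integration.integral_cong) (auto split: split_indicator)
   ultimately show "(LINT x|lborel. indicator (box c d) x *\<^sub>R g x) = 0" by simp
  qed
  then show ?thesis by eventually_elim (use box_bump_nonzero in \<open>auto simp: g_def\<close>)
 qed
 \<comment> \<open>Countably many boxes on each of which the coordinate \<open>i\<close> keeps away
   from 0; over all \<open>i\<close>, \<open>N\<close> and both signs they cover everything but the
   origin.\<close>
 let ?P = "%i N. box (\<chi> j. if j = i then 1 / real (Suc N) else - real (Suc N)) (\<chi> j. real (Suc N)) :: (real^'n) set"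
 let ?M = "%i N. box (\<chi> j. - real (Suc N)) (\<chi> j. if j = i then - 1 / real (Suc N) else real (Suc N)) :: (real^'n) set"
 have "AE \<xi> in lborel. \<forall>i. \<forall>N. \<xi> \<in> ?P i N --> h \<xi> = 0"
  unfolding AE_all_countable by (intro allI loc) (auto simp: mem_box_cart not_le intro!: exI)
 moreover have "AE \<xi> in lborel. \<forall>i. \<forall>N. \<xi> \<in> ?M i N --> h \<xi> = 0"
  unfolding AE_all_countable by (intro allI loc) (auto simp: mem_box_cart not_le intro!: exI)
 moreover have "AE \<xi> in lborel. \<xi> \<noteq> (0 :: real^'n)" by (rule AE_lborel_singleton)
 ultimately show ?thesis
 proof eventually_elim
  case (elim \<xi>)
  obtain i where i: "\<xi> $ i \<noteq> 0" using elim by (auto simp: vec_eq_iff)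
  obtain N1 where N1: "norm \<xi> < real N1" using reals_Archimedean2 by blast
  obtain N2 where N2: "1 / \<bar>\<xi> $ i\<bar> < real N2" using reals_Archimedean2 by blast
  define N where "N = max N1 N2"
  have bd: "\<bar>\<xi> $ j\<bar> < real (Suc N)" for j using component_le_norm_cart[of \<xi> j] N1 by (simp add: N_def)
  have "1 / \<bar>\<xi> $ i\<bar> < real (Suc N)" using N2 by (simp add: N_def)
  then have lo: "1 / real (Suc N) < \<bar>\<xi> $ i\<bar>" using i by (simp add: field_simps)
  show ?case
  proof (cases "\<xi> $ i > 0")
   case True
   then have "\<xi> \<in> ?P i N" using lo bd by (auto simp: mem_box_cart abs_less_iff minus_less_iff simp del: of_nat_Suc)
   then show ?thesis using elim by blast
  next
   case False
   then have "\<xi> \<in> ?M i N" using lo bd by (auto simp: mem_box_cart abs_less_iff minus_less_iff simp del: of_nat_Suc)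
   then show ?thesis using elim by blast
  qed
 qed
qed

lemma cnj_measurable [measurable (raw)]:
 "f \<in> borel_measurable M ==> (%x. cnj (f x)) \<in> borel_measurable M"
 by (rule measurable_compose[OF _ borel_measurable_continuous_onI]) (auto intro: continuous_intros)

lemma lebesgue_integral_cnj: "(LINT x|M. cnj (f x)) = cnj (LINT x|M. f x)"
 by (rule integral_bounded_linear'[OF bounded_linear_cnj bounded_linear_cnj]) auto

lemma fourier_fun_off0_unique:
 assumes g: "fourier_fun_off0 T g" and h: "fourier_fun_off0 T h"
 shows "AE \<xi> in lborel. g \<xi> = h \<xi>"
proof -
 have [measurable]: "g \<in> borel_measurable borel" "h \<in> borel_measurable borel"
  using g h by (auto simp: fourier_fun_off0_def)
 have "AE \<xi> in lborel. g \<xi> - h \<xi> = 0"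
 proof (rule AE_zero_of_test_functions)
  fix \<phi> :: "real^'a => complex"
  assume \<phi>: "\<phi> \<in> schwartz" "\<exists>K. compact K \<and> 0 \<notin> K \<and> (\<forall>\<xi>. \<xi> \<notin> K --> \<phi> \<xi> = 0)"
  have "integrable lborel (%\<xi>. g \<xi> * \<phi> \<xi>)" "T (fourier \<phi>) = (LINT \<xi>|lborel. g \<xi> * \<phi> \<xi>)"
   "integrable lborel (%\<xi>. h \<xi> * \<phi> \<xi>)" "T (fourier \<phi>) = (LINT \<xi>|lborel. h \<xi> * \<phi> \<xi>)"
   using g h \<phi> unfolding fourier_fun_off0_def by blast+
  then show "integrable lborel (%\<xi>. (g \<xi> - h \<xi>) * \<phi> \<xi>) \<and> (LINT \<xi>|lborel. (g \<xi> - h \<xi>) * \<phi> \<xi>) = 0"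
   by (simp add: left_diff_distrib)
 qed measurable
 then show ?thesis by simp
qed

lemma fourier_fun_imp_off0: "fourier_fun T g ==> fourier_fun_off0 T g"
 by (auto simp: fourier_fun_def fourier_fun_off0_def)

lemma fhat_off0: "fourier_fun_off0 T g ==> fourier_fun_off0 T (fhat T)"
 unfolding fhat_def by (rule someI[of "fourier_fun_off0 T" g])

lemma fhat_measurable: "fourier_fun_off0 T g ==> fhat T \<in> borel_measurable borel"
 using fhat_off0 by (auto simp: fourier_fun_off0_def)

lemma fhat_AE_off0: "fourier_fun_off0 T g ==> AE \<xi> in lborel. fhat T \<xi> = g \<xi>"
 by (rule fourier_fun_off0_unique[OF fhat_off0])

lemma fhat_AE: "fourier_fun T g ==> AE \<xi> in lborel. fhat T \<xi> = g \<xi>"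
 by (intro fhat_AE_off0 fourier_fun_imp_off0)

lemma fourier_reflect_cnj: "fourier (%\<xi>. cnj (\<phi> (- \<xi>))) x = cnj (fourier \<phi> x)"
 if [measurable]: "\<phi> \<in> borel_measurable borel" for \<phi> :: "real^'n => complex"
proof -
 have "fourier (%\<xi>. cnj (\<phi> (- \<xi>))) x = (LINT \<xi>|lborel. (%\<xi>. cnj (cis (- (\<xi> \<bullet> x)) * \<phi> \<xi>)) (- \<xi>))"
  unfolding fourier_def by (simp add: cis_cnj)
 also have "\<dots> = (LINT \<xi>|lborel. cnj (cis (- (\<xi> \<bullet> x)) * \<phi> \<xi>))"
  by (rule lborel_integral_uminus) measurable
 finally show ?thesis by (simp only: fourier_def lebesgue_integral_cnj)
qed

text \<open>For a real distribution the reflected conjugate of \<open>g\<close> represents the same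
  transform, as testing against reflected conjugates of test functions shows; uniqueness then
  identifies the two.\<close>

lemma hermitian_of_real_valued:
 fixes T :: "'n::finite distr"
 assumes T: "real_valued T" and g: "fourier_fun_off0 T g"
 shows "AE \<xi> in lborel. g \<xi> = cnj (g (- \<xi>))"
proof (rule fourier_fun_off0_unique[OF g])
 have gm [measurable]: "g \<in> borel_measurable borel" using g by (auto simp: fourier_fun_off0_def)
 show "fourier_fun_off0 T (%\<xi>. cnj (g (- \<xi>)))"
  unfolding fourier_fun_off0_def
 proof (intro conjI ballI impI)
  fix \<phi> :: "real^'n => complex"
  assume S: "\<phi> \<in> schwartz" and "\<exists>K. compact K \<and> 0 \<notin> K \<and> (\<forall>\<xi>. \<xi> \<notin> K --> \<phi> \<xi> = 0)"
  then obtain K where K: "compact K" "0 \<notin> K" "\<And>\<xi>. \<xi> \<notin> K ==> \<phi> \<xi> = 0" by blast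
  note [measurable] = schwartz_measurable[OF S]
  define \<psi> where "\<psi> = (%\<xi>. cnj (\<phi> (- \<xi>)))"
  have \<psi>S: "\<psi> \<in> schwartz" unfolding \<psi>_def by (rule schwartz_reflect_cnj[OF S])
  have "compact (uminus ` K)" "0 \<notin> uminus ` K" "\<And>\<xi>. \<xi> \<notin> uminus ` K ==> \<psi> \<xi> = 0"
  proof -
   show "compact (uminus ` K)" using K by (intro compact_continuous_image continuous_intros)
   show "0 \<notin> uminus ` K" using K by auto
   fix \<xi> assume "\<xi> \<notin> uminus ` K"
   then have "- \<xi> \<notin> K" by (metis add.inverse_inverse imageI)
   then show "\<psi> \<xi> = 0" using K by (simp add: \<psi>_def)
  qed
  then have I: "integrable lborel (%\<xi>. g \<xi> * \<psi> \<xi>)" and E: "T (fourier \<psi>) = (LINT \<xi>|lborel. g \<xi> * \<psi> \<xi>)"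
   using g \<psi>S unfolding fourier_fun_off0_def by blast+
  have F\<psi>: "fourier \<psi> = (%x. cnj (fourier \<phi> x))" unfolding \<psi>_def by (intro ext fourier_reflect_cnj) measurable
  have eq: "cnj (g (- \<xi>)) * \<phi> \<xi> = cnj (g (- \<xi>) * \<psi> (- \<xi>))" for \<xi> by (simp add: \<psi>_def)
  have "integrable (distr lborel borel uminus) (%\<xi>. g \<xi> * \<psi> \<xi>)"
  proof -
   have "distr lborel borel uminus = (lborel :: (real^'n) measure)"
    using lborel_affine[of "- 1" "0 :: real^'n"] by (simp add: density_1 one_ennreal_def[symmetric])
   then show ?thesis using I by simp
  qed
  then have "integrable lborel (%\<xi>. g (- \<xi>) * \<psi> (- \<xi>))"
   using I by (subst (asm) integrable_distr_eq) auto
  then show "integrable lborel (%\<xi>. cnj (g (- \<xi>)) * \<phi> \<xi>)" unfolding eq by (rule integrable_bounded_linear[OF bounded_linear_cnj])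
  have "T (fourier \<phi>) = cnj (T (%x. cnj (fourier \<phi> x)))"
   using T fourier_schwartz[OF S] unfolding real_valued_def by simp
  also have "\<dots> = cnj (LINT \<xi>|lborel. g \<xi> * \<psi> \<xi>)" using E F\<psi> by simp
  also have "(LINT \<xi>|lborel. g \<xi> * \<psi> \<xi>) = (LINT \<xi>|lborel. g (- \<xi>) * \<psi> (- \<xi>))"
   using I by (intro lborel_integral_uminus[symmetric]) auto
  finally show "T (fourier \<phi>) = (LINT \<xi>|lborel. cnj (g (- \<xi>)) * \<phi> \<xi>)" unfolding eq lebesgue_integral_cnj .
 qed measurable
qed

section \<open>Functions of moderate growth as transforms\<close>

text \<open>Integrability against one polynomial weight, of any order, is all that is needed to pair
  absolutely with Schwartz functions and to define a tempered distribution.\<close>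

definition tempered_fun :: "(real^'n => complex) => bool" where
 "tempered_fun g \<longleftrightarrow> g \<in> borel_measurable borel \<and>
   (\<exists>N. (\<integral>\<^sup>+\<xi>. ennreal (1 / (1 + norm \<xi>) ^ N) * ennreal (norm (g \<xi>)) \<partial>lborel) < \<infinity>)"

lemma tempered_fun_measurable: "tempered_fun g ==> g \<in> borel_measurable borel"
 by (simp add: tempered_fun_def)

lemma tempered_fun_weight:
 assumes "tempered_fun g"
 obtains N where "integrable lborel (%\<xi>. norm (g \<xi>) * (1 / (1 + norm \<xi>) ^ N))"
proof -
 have [measurable]: "g \<in> borel_measurable borel" using assms by (simp add: tempered_fun_def)
 obtain N where "(\<integral>\<^sup>+\<xi>. ennreal (1 / (1 + norm \<xi>) ^ N) * ennreal (norm (g \<xi>)) \<partial>lborel) < \<infinity>"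
  using assms by (auto simp: tempered_fun_def)
 then have "(\<integral>\<^sup>+\<xi>. ennreal (norm (g \<xi>) * (1 / (1 + norm \<xi>) ^ N)) \<partial>lborel) < \<infinity>"
  by (simp add: ennreal_mult[symmetric] mult.commute)
 then show ?thesis by (intro that[of N] integrableI_nonneg) auto
qed

lemma tempered_fun_integrable:
 fixes g :: "real^'n => complex"
 assumes g: "tempered_fun g" and [measurable]: "w \<in> borel_measurable borel"
  and w: "\<And>N. \<exists>C. \<forall>\<xi>. norm (w \<xi>) <= C * (1 / (1 + norm \<xi>) ^ N)"
 shows "integrable lborel (%\<xi>. g \<xi> * w \<xi>)"
proof -
 note [measurable] = tempered_fun_measurable[OF g]
 obtain N where N: "integrable lborel (%\<xi>. norm (g \<xi>) * (1 / (1 + norm \<xi>) ^ N))"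
  by (rule tempered_fun_weight[OF g])
 obtain C where C: "\<And>\<xi>. norm (w \<xi>) <= C * (1 / (1 + norm \<xi>) ^ N)" using w by blast
 show ?thesis
 proof (rule Bochner_Integration.integrable_bound[OF integrable_mult_right[OF N, of C]])
  show "AE \<xi> in lborel. norm (g \<xi> * w \<xi>) <= norm (C * (norm (g \<xi>) * (1 / (1 + norm \<xi>) ^ N)))"
  proof (rule AE_I2)
   fix \<xi>
   have "norm (g \<xi> * w \<xi>) <= norm (g \<xi>) * (C * (1 / (1 + norm \<xi>) ^ N))"
    unfolding norm_mult by (intro mult_left_mono C) auto
   also have "\<dots> = C * (norm (g \<xi>) * (1 / (1 + norm \<xi>) ^ N))" by simp
   also have "\<dots> <= norm (C * (norm (g \<xi>) * (1 / (1 + norm \<xi>) ^ N)))" unfolding real_norm_def by (rule abs_ge_self)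
   finally show "norm (g \<xi> * w \<xi>) <= norm (C * (norm (g \<xi>) * (1 / (1 + norm \<xi>) ^ N)))" .
  qed
 qed measurable
qed

lemma schwartz_weight_bound:
 assumes "\<phi> \<in> schwartz" shows "\<exists>C. \<forall>\<xi>. norm (\<phi> \<xi>) <= C * (1 / (1 + norm \<xi>) ^ N)"
proof -
 obtain C where C: "C > 0" "\<And>x. (1 + norm x) ^ N * norm (\<phi> x) <= C" using schwartz_decay[OF assms] by metis
 have "norm (\<phi> \<xi>) <= C * (1 / (1 + norm \<xi>) ^ N)" for \<xi>
 proof -
  have "(1 + norm \<xi>) ^ N > 0" by (intro zero_less_power add_pos_nonneg) auto
  then show ?thesis using C(2)[of \<xi>] by (simp add: pos_le_divide_eq mult.commute)
 qed
 then show ?thesis by blast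
qed

lemma fourier_inv_weight_bound:
 fixes \<phi> :: "real^'n => complex"
 assumes "\<phi> \<in> schwartz" shows "\<exists>C. \<forall>\<xi>. norm (fourier_inv \<phi> \<xi>) <= C * (1 / (1 + norm \<xi>) ^ N)"
 using fourier_inv_decay[of N, where 'n='n] assms by blast

lemma tempered_fun_integrable_schwartz:
 assumes "tempered_fun g" "\<phi> \<in> schwartz"
 shows "integrable lborel (%\<xi>. g \<xi> * \<phi> \<xi>)" "integrable lborel (%\<xi>. g \<xi> * fourier_inv \<phi> \<xi>)"
 by (rule tempered_fun_integrable[OF assms(1) schwartz_measurable[OF assms(2)] schwartz_weight_bound[OF assms(2)]])
  (rule tempered_fun_integrable[OF assms(1) fourier_inv_measurable[OF assms(2)] fourier_inv_weight_bound[OF assms(2)]])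

lemma tempered_fun_bound:
 assumes "tempered_fun g" "h \<in> borel_measurable borel" "AE \<xi> in lborel. norm (h \<xi>) <= c * (1 + norm \<xi>) ^ k * norm (g \<xi>)" "c \<ge> 0"
 shows "tempered_fun h"
proof -
 note [measurable] = tempered_fun_measurable[OF assms(1)] assms(2)
 obtain N where N: "(\<integral>\<^sup>+\<xi>. ennreal (1 / (1 + norm \<xi>) ^ N) * ennreal (norm (g \<xi>)) \<partial>lborel) < \<infinity>"
  using assms by (auto simp: tempered_fun_def)
 have "(\<integral>\<^sup>+\<xi>. ennreal (1 / (1 + norm \<xi>) ^ (N + k)) * ennreal (norm (h \<xi>)) \<partial>lborel) <=
   (\<integral>\<^sup>+\<xi>. ennreal c * (ennreal (1 / (1 + norm \<xi>) ^ N) * ennreal (norm (g \<xi>))) \<partial>lborel)"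
 proof (intro nn_integral_mono_AE)
  show "AE \<xi> in lborel. ennreal (1 / (1 + norm \<xi>) ^ (N + k)) * ennreal (norm (h \<xi>)) <=
    ennreal c * (ennreal (1 / (1 + norm \<xi>) ^ N) * ennreal (norm (g \<xi>)))"
   using assms(3)
  proof eventually_elim
   case (elim \<xi>)
   have p: "1 + norm \<xi> > 0" by (simp add: add_pos_nonneg)
   have "1 / (1 + norm \<xi>) ^ (N + k) * norm (h \<xi>) <= 1 / (1 + norm \<xi>) ^ (N + k) * (c * (1 + norm \<xi>) ^ k * norm (g \<xi>))"
    by (intro mult_left_mono elim) auto
   also have "\<dots> = c * (1 / (1 + norm \<xi>) ^ N * norm (g \<xi>))" using p by (auto simp: power_add)
   finally show ?case using assms(4) by (simp add: ennreal_mult[symmetric] ennreal_leI)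
  qed
 qed
 also have "\<dots> = ennreal c * (\<integral>\<^sup>+\<xi>. ennreal (1 / (1 + norm \<xi>) ^ N) * ennreal (norm (g \<xi>)) \<partial>lborel)"
  by (rule nn_integral_cmult) measurable
 also have "\<dots> < \<infinity>" using N by (simp add: ennreal_mult_less_top)
 finally show ?thesis using assms(2) by (auto simp: tempered_fun_def)
qed

text \<open>\<open>fhat\<close> is a choice known only up to null sets; this allows any other
  representative inside an inverse transform.\<close>

lemma from_fourier_eq_AE:
 assumes "\<phi> \<in> schwartz" and [measurable]: "g \<in> borel_measurable borel" "h \<in> borel_measurable borel"
  and "AE \<xi> in lborel. g \<xi> = h \<xi>"
 shows "from_fourier g \<phi> = from_fourier h \<phi>"
proof -
 note [measurable] = fourier_inv_measurable[OF assms(1)]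
 show ?thesis unfolding from_fourier_def
  by (rule integral_cong_AE) (use assms(4) in \<open>auto elim: eventually_mono\<close>)
qed

text \<open>Two functions occur because the operators apply \<open>from_fourier\<close> to an
  expression in chosen transforms, which equals the intended \<open>g\<close> only almost
  everywhere.\<close>

lemma fourier_fun_from_fourier:
 fixes g h :: "real^'n => complex"
 assumes g: "tempered_fun g" and h: "h \<in> borel_measurable borel" "AE \<xi> in lborel. h \<xi> = g \<xi>"
 shows "fourier_fun (from_fourier h) g"
 unfolding fourier_fun_def
proof (intro conjI ballI)
 show "g \<in> borel_measurable borel" by (rule tempered_fun_measurable[OF g])
 fix \<phi> :: "real^'n => complex" assume S: "\<phi> \<in> schwartz"
 show "integrable lborel (%\<xi>. g \<xi> * \<phi> \<xi>)" by (rule tempered_fun_integrable_schwartz[OF g S])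
 have "from_fourier h (fourier \<phi>) = from_fourier g (fourier \<phi>)"
  by (rule from_fourier_eq_AE) (use fourier_schwartz[OF S] h tempered_fun_measurable[OF g] in auto)
 then show "from_fourier h (fourier \<phi>) = (LINT \<xi>|lborel. g \<xi> * \<phi> \<xi>)"
  by (simp add: from_fourier_def fourier_inversion[OF S])
qed

lemma fourier_inv_add:
 assumes "\<phi> \<in> schwartz" "\<psi> \<in> schwartz"
 shows "fourier_inv (%x. \<phi> x + \<psi> x) \<xi> = fourier_inv \<phi> \<xi> + fourier_inv \<psi> (\<xi> :: real^'n)"
proof -
 have "integrable lborel (%x. cis (\<xi> \<bullet> x) * \<phi> x)" "integrable lborel (%x. cis (\<xi> \<bullet> x) * \<psi> x)"
  by (intro integrable_cis_mult schwartz_integrable assms; simp)+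
 then show ?thesis by (simp add: fourier_inv_def distrib_left add_divide_distrib)
qed

lemma fourier_inv_cmult: "fourier_inv (%x. c * \<phi> x) \<xi> = c * fourier_inv \<phi> (\<xi> :: real^'n)"
proof -
 have "(LINT x|lborel. cis (\<xi> \<bullet> x) * (c * \<phi> x)) = (LINT x|lborel. c * (cis (\<xi> \<bullet> x) * \<phi> x))"
  by (intro Bochner_Integration.integral_cong) auto
 then show ?thesis by (simp add: fourier_inv_def)
qed

lemma tempered_from_fourier:
 fixes g :: "real^'n => complex"
 assumes g: "tempered_fun g" shows "tempered (from_fourier g)"
proof -
 note [measurable] = tempered_fun_measurable[OF g]
 note I = tempered_fun_integrable_schwartz(2)[OF g]
 obtain N where N: "integrable lborel (%\<xi>. norm (g \<xi>) * (1 / (1 + norm \<xi>) ^ N))"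
  by (rule tempered_fun_weight[OF g])
 obtain C where C: "C > 0" "\<And>(\<phi> :: real^'n => complex) \<xi>. \<phi> \<in> schwartz ==>
   norm (fourier_inv \<phi> \<xi>) <= C * schwartz_norm (N + CARD('n) + 1) \<phi> * (1 / (1 + norm \<xi>) ^ N)"
  using fourier_inv_decay[of N, where 'n='n] by blast
 have "norm (from_fourier g \<phi>) <= (C * (LINT \<xi>|lborel. norm (g \<xi>) * (1 / (1 + norm \<xi>) ^ N))) * schwartz_norm (N + CARD('n) + 1) \<phi>"
  if S: "\<phi> \<in> schwartz" for \<phi> :: "real^'n => complex"
 proof -
  have "norm (from_fourier g \<phi>) <= (LINT \<xi>|lborel. (C * schwartz_norm (N + CARD('n) + 1) \<phi>) * (norm (g \<xi>) * (1 / (1 + norm \<xi>) ^ N)))"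
   unfolding from_fourier_def
  proof (rule Bochner_Integration.integral_norm_bound_integral[OF I[OF S] integrable_mult_right[OF N]])
   fix \<xi>
   have "norm (g \<xi> * fourier_inv \<phi> \<xi>) <= norm (g \<xi>) * (C * schwartz_norm (N + CARD('n) + 1) \<phi> * (1 / (1 + norm \<xi>) ^ N))"
    unfolding norm_mult by (intro mult_left_mono C S) auto
   then show "norm (g \<xi> * fourier_inv \<phi> \<xi>) <= (C * schwartz_norm (N + CARD('n) + 1) \<phi>) * (norm (g \<xi>) * (1 / (1 + norm \<xi>) ^ N))"
    by (simp only: mult_ac)
  qed
  also have "\<dots> = (C * schwartz_norm (N + CARD('n) + 1) \<phi>) * (LINT \<xi>|lborel. norm (g \<xi>) * (1 / (1 + norm \<xi>) ^ N))"
   by (rule integral_mult_right_zero)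
  finally show ?thesis by (simp only: mult_ac)
 qed
 moreover have "from_fourier g (%x. \<phi> x + \<psi> x) = from_fourier g \<phi> + from_fourier g \<psi>"
  if "\<phi> \<in> schwartz" "\<psi> \<in> schwartz" for \<phi> \<psi> :: "real^'n => complex"
  using that by (simp add: from_fourier_def fourier_inv_add distrib_left I)
 moreover have "from_fourier g (%x. c * \<phi> x) = c * from_fourier g \<phi>" for c and \<phi> :: "real^'n => complex"
 proof -
  have "from_fourier g (%x. c * \<phi> x) = (LINT \<xi>|lborel. c * (g \<xi> * fourier_inv \<phi> \<xi>))"
   unfolding from_fourier_def fourier_inv_cmult by (intro Bochner_Integration.integral_cong) auto
  then show ?thesis by (simp add: from_fourier_def)
 qed
 ultimately show ?thesis unfolding tempered_def by blast
qed

lemma real_valued_from_fourier: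
 fixes g :: "real^'n => complex"
 assumes [measurable]: "g \<in> borel_measurable borel" and g: "AE \<xi> in lborel. g (- \<xi>) = cnj (g \<xi>)"
 shows "real_valued (from_fourier g)"
 unfolding real_valued_def
proof
 fix \<phi> :: "real^'n => complex" assume S: "\<phi> \<in> schwartz"
 note [measurable] = fourier_inv_measurable[OF S] schwartz_measurable[OF S]
 have inv: "fourier_inv (%x. cnj (\<phi> x)) \<xi> = cnj (fourier_inv \<phi> (- \<xi>))" for \<xi>
 proof -
  have "(LINT x|lborel. cis (\<xi> \<bullet> x) * cnj (\<phi> x)) = (LINT x|lborel. cnj (cis (- \<xi> \<bullet> x) * \<phi> x))"
   by (intro Bochner_Integration.integral_cong) (auto simp: cis_cnj)
  then show ?thesis unfolding fourier_inv_def lebesgue_integral_cnj by simp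
 qed
 have "from_fourier g (%x. cnj (\<phi> x)) = (LINT \<xi>|lborel. g \<xi> * cnj (fourier_inv \<phi> (- \<xi>)))"
  by (simp add: from_fourier_def inv)
 also have "\<dots> = (LINT \<xi>|lborel. (%\<xi>. g (- \<xi>) * cnj (fourier_inv \<phi> \<xi>)) (- \<xi>))" by simp
 also have "\<dots> = (LINT \<xi>|lborel. g (- \<xi>) * cnj (fourier_inv \<phi> \<xi>))"
  by (rule lborel_integral_uminus) measurable
 also have "\<dots> = (LINT \<xi>|lborel. cnj (g \<xi> * fourier_inv \<phi> \<xi>))"
  by (rule integral_cong_AE) (use g in \<open>auto elim: eventually_mono\<close>)
 finally show "from_fourier g (%x. cnj (\<phi> x)) = cnj (from_fourier g \<phi>)"
  by (simp only: from_fourier_def lebesgue_integral_cnj)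
qed

text \<open>A derivative of \<open>fourier \<phi>\<close> is the transform of \<phi> multiplied by a
  coordinate and a constant. That is again a Schwartz function, so the duality for each component
  applies to it directly.\<close>

lemma fourier_fun_ddiv:
 fixes \<psi> :: "'n::finite => 'n distr"
 assumes "\<And>j. fourier_fun (\<psi> j) (g j)"
 shows "fourier_fun (ddiv \<psi>) (%\<xi>. \<Sum>j\<in>UNIV. \<i> * of_real (\<xi> $ j) * g j \<xi>)"
 unfolding fourier_fun_def
proof (intro conjI ballI)
 have [measurable]: "g j \<in> borel_measurable borel" for j using assms by (simp add: fourier_fun_def)
 show "(%\<xi>. \<Sum>j\<in>UNIV. \<i> * of_real (\<xi> $ j) * g j \<xi>) \<in> borel_measurable borel" by measurable
 fix \<phi> :: "real^'n => complex" assume S: "\<phi> \<in> schwartz"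
 have S': "(%x. - \<i> * (of_real (x $ j) * \<phi> x)) \<in> schwartz" for j by (intro schwartz_cmult schwartz_coord_mult S)
 have I: "integrable lborel (%\<xi>. g j \<xi> * (- \<i> * (of_real (\<xi> $ j) * \<phi> \<xi>)))"
  and E: "\<psi> j (fourier (%x. - \<i> * (of_real (x $ j) * \<phi> x))) = (LINT \<xi>|lborel. g j \<xi> * (- \<i> * (of_real (\<xi> $ j) * \<phi> \<xi>)))" for j
 proof -
  have "\<forall>\<phi>\<in>schwartz. integrable lborel (%\<xi>. g j \<xi> * \<phi> \<xi>) \<and> \<psi> j (fourier \<phi>) = (LINT \<xi>|lborel. g j \<xi> * \<phi> \<xi>)"
   using assms[of j] by (simp add: fourier_fun_def)
  from bspec[OF this S'[of j]] show "integrable lborel (%\<xi>. g j \<xi> * (- \<i> * (of_real (\<xi> $ j) * \<phi> \<xi>)))"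
   "\<psi> j (fourier (%x. - \<i> * (of_real (x $ j) * \<phi> x))) = (LINT \<xi>|lborel. g j \<xi> * (- \<i> * (of_real (\<xi> $ j) * \<phi> \<xi>)))"
   by blast+
 qed
 have P: "partial j (fourier \<phi>) = fourier (%x. - \<i> * (of_real (x $ j) * \<phi> x))" for j
  by (rule ext) (rule has_derivative_partialI[OF fourier_has_derivative[OF S]])
 have eq: "(\<Sum>j\<in>UNIV. \<i> * of_real (\<xi> $ j) * g j \<xi>) * \<phi> \<xi> = (\<Sum>j\<in>UNIV. - (g j \<xi> * (- \<i> * (of_real (\<xi> $ j) * \<phi> \<xi>))))" for \<xi>
  unfolding sum_distrib_right by (intro sum.cong refl) (simp add: mult_ac)
 show "integrable lborel (%\<xi>. (\<Sum>j\<in>UNIV. \<i> * of_real (\<xi> $ j) * g j \<xi>) * \<phi> \<xi>)"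
  unfolding eq by (intro Bochner_Integration.integrable_sum Bochner_Integration.integrable_minus I)
 show "ddiv \<psi> (fourier \<phi>) = (LINT \<xi>|lborel. (\<Sum>j\<in>UNIV. \<i> * of_real (\<xi> $ j) * g j \<xi>) * \<phi> \<xi>)"
  unfolding eq ddiv_def ddiff_def P E
  by (simp only: Bochner_Integration.integral_sum Bochner_Integration.integrable_minus I integral_minus)
qed

lemma heat_eq:
 fixes T :: "'n::finite distr"
 assumes "fourier_fun_off0 T g" "\<phi> \<in> schwartz"
 shows "heat \<alpha> t T \<phi> = (LINT \<xi>|lborel. of_real (exp (- t * norm \<xi> powr \<alpha>)) * g \<xi> * fourier_inv \<phi> \<xi>)"
proof -
 have [measurable]: "g \<in> borel_measurable borel" using assms by (simp add: fourier_fun_off0_def)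
 note [measurable] = fhat_measurable[OF assms(1)]
 have "heat \<alpha> t T \<phi> = from_fourier (%\<xi>. of_real (exp (- t * norm \<xi> powr \<alpha>)) * g \<xi>) \<phi>"
  unfolding heat_def
  by (rule from_fourier_eq_AE[OF assms(2)]) (use fhat_AE_off0[OF assms(1)] in \<open>auto elim: eventually_mono\<close>)
 then show ?thesis by (simp add: from_fourier_def)
qed

section \<open>The abstract majorant scheme\<close>

text \<open>Multiplication is discontinuous at the pair 0, \<infinity>, but for increasing sequences
  the diagonal dominates every mixed product in the double supremum.\<close>

lemma SUP_mult_incseq_ennreal:
 fixes f g :: "nat => ennreal"
 assumes f: "incseq f" and g: "incseq g"
 shows "(SUP n. f n * g n) = (SUP n. f n) * (SUP n. g n)"
proof (rule antisym)
 show "(SUP n. f n * g n) <= (SUP n. f n) * (SUP n. g n)"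
  by (intro SUP_least mult_mono SUP_upper) auto
 have "(SUP n. f n) * (SUP n. g n) = (SUP n. SUP m. f n * g m)"
  unfolding SUP_mult_right_ennreal[symmetric] SUP_mult_left_ennreal[symmetric] ..
 also have "\<dots> <= (SUP n. f n * g n)"
 proof (intro SUP_least)
  fix n m
  have "f n * g m <= f (max n m) * g (max n m)"
   by (intro mult_mono incseqD[OF f] incseqD[OF g]) auto
  also have "\<dots> <= (SUP n. f n * g n)" by (rule SUP_upper) simp
  finally show "f n * g m <= (SUP n. f n * g n)" .
 qed
 finally show "(SUP n. f n) * (SUP n. g n) <= (SUP n. f n * g n)" .
qed

text \<open>\<open>'c\<close> indexes the scalar unknowns and \<open>'x\<close> is the space of
  their arguments. \<open>lp\<close> and \<open>rp\<close> are the points where the two factors of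
  the bilinear term are evaluated, \<open>ep\<close> the point for the linear term.
  \<open>Ap\<close> is kept apart from \<open>A\<close> so that it may take absolute values inside
  an integral defining \<open>A\<close>.\<close>

locale majorant =
 fixes X :: "'x measure" and M :: "'z measure" and N :: "'s measure"
  and k :: "'c::finite => 'c => 'c => 'x => 'z => complex" and lp rp :: "'x => 'z => 'x"
  and L :: "'c => 'c => 'x => 's => complex" and ep :: "'x => 's => 'x"
  and A :: "'c => 'x => complex" and Ap :: "'c => 'x => ennreal"
 assumes sf: "sigma_finite_measure M" "sigma_finite_measure N"
  and meas [measurable]: "\<And>c b b'. (%(x, z). k c b b' x z) \<in> borel_measurable (X \<Otimes>\<^sub>M M)"
   "(%(x, z). lp x z) \<in> X \<Otimes>\<^sub>M M \<rightarrow>\<^sub>M X" "(%(x, z). rp x z) \<in> X \<Otimes>\<^sub>M M \<rightarrow>\<^sub>M X"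
   "\<And>c b. (%(x, s). L c b x s) \<in> borel_measurable (X \<Otimes>\<^sub>M N)" "(%(x, s). ep x s) \<in> X \<Otimes>\<^sub>M N \<rightarrow>\<^sub>M X"
   "\<And>c. A c \<in> borel_measurable X" "\<And>c. Ap c \<in> borel_measurable X"
  and A_le: "\<And>c x. ennreal (norm (A c x)) <= Ap c x"
  and space_X: "space X = UNIV"
begin

definition pic :: "('c => 'x => complex) => 'c => 'x => complex" where
 "pic Y c x = A c x + (\<Sum>b\<in>UNIV. \<Sum>b'\<in>UNIV. LINT z|M. k c b b' x z * (Y b (lp x z) * Y b' (rp x z)))
   + (\<Sum>b\<in>UNIV. LINT s|N. L c b x s * Y b (ep x s))"

definition maj :: "('c => 'x => ennreal) => 'c => 'x => ennreal" where
 "maj W c x = Ap c x + (\<Sum>b\<in>UNIV. \<Sum>b'\<in>UNIV. \<integral>\<^sup>+z. ennreal (norm (k c b b' x z)) * (W b (lp x z) * W b' (rp x z)) \<partial>M)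
   + (\<Sum>b\<in>UNIV. \<integral>\<^sup>+s. ennreal (norm (L c b x s)) * W b (ep x s) \<partial>N)"

definition pics :: "nat => 'c => 'x => complex" where "pics n = (pic ^^ n) (%_ _. 0)"
definition majs :: "nat => 'c => 'x => ennreal" where "majs n = (maj ^^ n) (%_ _. 0)"
definition maj_sol :: "'c => 'x => ennreal" where "maj_sol c x = (SUP n. majs n c x)"
text \<open>Convergence of the iterates is known only where the majorant is finite. The default 0
  elsewhere is harmless in the application, where those points form a null set of frequencies at
  each positive time.\<close>

definition sol :: "'c => 'x => complex" where
 "sol c x = (if maj_sol c x < \<infinity> then lim (%n. pics n c x) else 0)"

lemma pics_0: "pics 0 c x = 0" and pics_Suc: "pics (Suc n) c x = pic (pics n) c x"
 and majs_0: "majs 0 c x = 0" and majs_Suc: "majs (Suc n) c x = maj (majs n) c x"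
 by (simp_all add: pics_def majs_def)

lemma section_measurable [measurable (raw)]:
 "k c b b' x \<in> borel_measurable M" "lp x \<in> M \<rightarrow>\<^sub>M X" "rp x \<in> M \<rightarrow>\<^sub>M X"
 "L c b x \<in> borel_measurable N" "ep x \<in> N \<rightarrow>\<^sub>M X"
proof -
 have x: "x \<in> space X" by (simp add: space_X)
 show "k c b b' x \<in> borel_measurable M" "lp x \<in> M \<rightarrow>\<^sub>M X" "rp x \<in> M \<rightarrow>\<^sub>M X"
  "L c b x \<in> borel_measurable N" "ep x \<in> N \<rightarrow>\<^sub>M X"
  using measurable_Pair2[OF meas(1) x] measurable_Pair2[OF meas(2) x] measurable_Pair2[OF meas(3) x]
   measurable_Pair2[OF meas(4) x] measurable_Pair2[OF meas(5) x] by simp_all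
qed

lemma maj_mono: "(\<And>c x. W c x <= W' c x) ==> maj W c x <= maj W' c x"
 unfolding maj_def by (intro add_mono order_refl sum_mono nn_integral_mono mult_mono) auto

lemma maj_measurable [measurable]:
 assumes [measurable]: "\<And>c. W c \<in> borel_measurable X"
 shows "maj W c \<in> borel_measurable X"
proof -
 interpret M: sigma_finite_measure M by (rule sf)
 interpret N: sigma_finite_measure N by (rule sf)
 have 1: "(%x. \<integral>\<^sup>+z. ennreal (norm (k c b b' x z)) * (W b (lp x z) * W b' (rp x z)) \<partial>M) \<in> borel_measurable X" for b b'
  by (rule M.borel_measurable_nn_integral) (simp add: split_beta', measurable)
 have 2: "(%x. \<integral>\<^sup>+s. ennreal (norm (L c b x s)) * W b (ep x s) \<partial>N) \<in> borel_measurable X" for b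
  by (rule N.borel_measurable_nn_integral) (simp add: split_beta', measurable)
 show ?thesis unfolding maj_def[abs_def] using 1 2 by measurable
qed

lemma pic_measurable [measurable]:
 assumes [measurable]: "\<And>c. Y c \<in> borel_measurable X"
 shows "pic Y c \<in> borel_measurable X"
proof -
 interpret M: sigma_finite_measure M by (rule sf)
 interpret N: sigma_finite_measure N by (rule sf)
 have 1: "(%x. LINT z|M. k c b b' x z * (Y b (lp x z) * Y b' (rp x z))) \<in> borel_measurable X" for b b'
  by (rule M.borel_measurable_lebesgue_integral) (simp add: split_beta', measurable)
 have 2: "(%x. LINT s|N. L c b x s * Y b (ep x s)) \<in> borel_measurable X" for b
  by (rule N.borel_measurable_lebesgue_integral) (simp add: split_beta', measurable)
 show ?thesis unfolding pic_def[abs_def] using 1 2 by measurable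
qed

lemma majs_measurable [measurable]: "majs n c \<in> borel_measurable X"
proof (induction n arbitrary: c)
 case 0
 then show ?case by (simp add: majs_0[abs_def])
next
 case (Suc n)
 then show ?case by (simp add: majs_Suc[abs_def])
qed

lemma pics_measurable [measurable]: "pics n c \<in> borel_measurable X"
proof (induction n arbitrary: c)
 case 0
 then show ?case by (simp add: pics_0[abs_def])
next
 case (Suc n)
 then show ?case by (simp add: pics_Suc[abs_def])
qed

lemma maj_sol_measurable [measurable]: "maj_sol c \<in> borel_measurable X"
 unfolding maj_sol_def[abs_def] by measurable

lemma sol_measurable [measurable]: "sol c \<in> borel_measurable X"
 unfolding sol_def[abs_def] by measurable

lemma majs_mono: "majs n c x <= majs (Suc n) c x"
 by (induction n arbitrary: c x) (auto simp: majs_0 majs_Suc intro: maj_mono)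

lemma majs_incseq: "incseq (%n. majs n c x)"
 by (rule incseq_SucI) (rule majs_mono)

lemma majs_le_sol: "majs n c x <= maj_sol c x"
 unfolding maj_sol_def by (rule SUP_upper) simp

text \<open>Monotone convergence in each integral of the recursion; in the bilinear term both
  factors increase together, so the supremum of the products is the product of the suprema. The
  identity includes infinite values.\<close>

lemma maj_sol_eq: "maj_sol c x = maj maj_sol c x"
proof -
 have lim: "(%n. majs n c x) \<longlonglongrightarrow> maj_sol c x" for c x
  unfolding maj_sol_def by (rule LIMSEQ_SUP) (rule majs_incseq)
 have 1: "(%n. \<integral>\<^sup>+z. ennreal (norm (k c b b' x z)) * (majs n b (lp x z) * majs n b' (rp x z)) \<partial>M) \<longlonglongrightarrow>
   (\<integral>\<^sup>+z. ennreal (norm (k c b b' x z)) * (maj_sol b (lp x z) * maj_sol b' (rp x z)) \<partial>M)" (is "?seq \<longlonglongrightarrow> ?lim") for b b'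
 proof -
  have inc: "incseq (%n z. ennreal (norm (k c b b' x z)) * (majs n b (lp x z) * majs n b' (rp x z)))"
   by (intro incseq_SucI le_funI mult_mono majs_mono) auto
  have "(SUP n. ennreal (norm (k c b b' x z)) * (majs n b (lp x z) * majs n b' (rp x z))) =
   ennreal (norm (k c b b' x z)) * (maj_sol b (lp x z) * maj_sol b' (rp x z))" for z
  proof -
   have "(SUP n. majs n b (lp x z) * majs n b' (rp x z)) = maj_sol b (lp x z) * maj_sol b' (rp x z)"
    unfolding maj_sol_def by (rule SUP_mult_incseq_ennreal) (rule majs_incseq)+
   from this[symmetric] show ?thesis by (simp only: SUP_mult_left_ennreal)
  qed
  then have "(\<integral>\<^sup>+z. ennreal (norm (k c b b' x z)) * (maj_sol b (lp x z) * maj_sol b' (rp x z)) \<partial>M)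
   = (\<integral>\<^sup>+z. (SUP n. ennreal (norm (k c b b' x z)) * (majs n b (lp x z) * majs n b' (rp x z))) \<partial>M)"
   by (simp only:)
  also have "\<dots> = (SUP n. \<integral>\<^sup>+z. ennreal (norm (k c b b' x z)) * (majs n b (lp x z) * majs n b' (rp x z)) \<partial>M)"
   by (rule nn_integral_monotone_convergence_SUP[OF inc]) measurable
  finally have eq: "?lim = (SUP n. ?seq n)" .
  show ?thesis unfolding eq
   by (intro LIMSEQ_SUP incseq_SucI nn_integral_mono mult_mono majs_mono) auto
 qed
 have 2: "(%n. \<integral>\<^sup>+s. ennreal (norm (L c b x s)) * majs n b (ep x s) \<partial>N) \<longlonglongrightarrow>
   (\<integral>\<^sup>+s. ennreal (norm (L c b x s)) * maj_sol b (ep x s) \<partial>N)" (is "?seq \<longlonglongrightarrow> ?lim") for b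
 proof -
  have inc: "incseq (%n s. ennreal (norm (L c b x s)) * majs n b (ep x s))"
   by (intro incseq_SucI le_funI mult_mono majs_mono) auto
  have "(SUP n. ennreal (norm (L c b x s)) * majs n b (ep x s)) = ennreal (norm (L c b x s)) * maj_sol b (ep x s)" for s
   unfolding maj_sol_def by (rule SUP_mult_left_ennreal[symmetric])
  then have "(\<integral>\<^sup>+s. ennreal (norm (L c b x s)) * maj_sol b (ep x s) \<partial>N)
   = (\<integral>\<^sup>+s. (SUP n. ennreal (norm (L c b x s)) * majs n b (ep x s)) \<partial>N)"
   by (simp only:)
  also have "\<dots> = (SUP n. \<integral>\<^sup>+s. ennreal (norm (L c b x s)) * majs n b (ep x s) \<partial>N)"
   by (rule nn_integral_monotone_convergence_SUP[OF inc]) measurable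
  finally have eq: "?lim = (SUP n. ?seq n)" .
  show ?thesis unfolding eq
   by (intro LIMSEQ_SUP incseq_SucI nn_integral_mono mult_mono majs_mono) auto
 qed
 have "(%n. maj (majs n) c x) \<longlonglongrightarrow> maj maj_sol c x"
  unfolding maj_def by (intro tendsto_add tendsto_const tendsto_sum 1 2)
 moreover have "(%n. maj (majs n) c x) \<longlonglongrightarrow> maj_sol c x"
  using LIMSEQ_Suc[OF lim] by (simp add: majs_Suc)
 ultimately show ?thesis using LIMSEQ_unique by blast
qed

lemma maj_finite:
 assumes "maj W c x < \<infinity>"
 shows "(\<integral>\<^sup>+z. ennreal (norm (k c b b' x z)) * (W b (lp x z) * W b' (rp x z)) \<partial>M) < \<infinity>"
  "(\<integral>\<^sup>+s. ennreal (norm (L c b x s)) * W b (ep x s) \<partial>N) < \<infinity>"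
 using assms unfolding maj_def by (auto simp: ennreal_sum_less_top)

lemma integrable_terms:
 assumes [measurable]: "\<And>c. Y c \<in> borel_measurable X"
  and Y: "\<And>c x. ennreal (norm (Y c x)) <= W c x" and fin: "maj W c x < \<infinity>"
 shows "integrable M (%z. k c b b' x z * (Y b (lp x z) * Y b' (rp x z)))"
  "integrable N (%s. L c b x s * Y b (ep x s))"
proof -
 have "(\<integral>\<^sup>+z. ennreal (norm (k c b b' x z * (Y b (lp x z) * Y b' (rp x z)))) \<partial>M) <=
   (\<integral>\<^sup>+z. ennreal (norm (k c b b' x z)) * (W b (lp x z) * W b' (rp x z)) \<partial>M)"
  by (intro nn_integral_mono) (auto simp: norm_mult ennreal_mult intro!: mult_mono Y)
 also have "\<dots> < \<infinity>" by (rule maj_finite[OF fin])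
 finally show "integrable M (%z. k c b b' x z * (Y b (lp x z) * Y b' (rp x z)))"
  by (intro integrableI_bounded) auto
 have "(\<integral>\<^sup>+s. ennreal (norm (L c b x s * Y b (ep x s))) \<partial>N) <= (\<integral>\<^sup>+s. ennreal (norm (L c b x s)) * W b (ep x s) \<partial>N)"
  by (intro nn_integral_mono) (auto simp: norm_mult ennreal_mult intro!: mult_mono Y)
 also have "\<dots> < \<infinity>" by (rule maj_finite[OF fin])
 finally show "integrable N (%s. L c b x s * Y b (ep x s))"
  by (intro integrableI_bounded) auto
qed

text \<open>The invariant of the method is that the increment |u - y| is at most v - w, and products
  inherit it. It is written as a sum because subtraction of infinite extended reals would lose
  information.\<close>

lemma product_difference_bound:
 fixes u u' y y' :: complex and v v' w w' :: ennreal
 assumes "ennreal (norm (u - y)) + w <= v" "ennreal (norm (u' - y')) + w' <= v'"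
  "ennreal (norm u') <= v'" "ennreal (norm y) <= w"
 shows "ennreal (norm (u * u' - y * y')) + w * w' <= v * v'"
proof -
 have "norm (u * u' - y * y') <= norm (u - y) * norm u' + norm y * norm (u' - y')"
 proof -
  have "u * u' - y * y' = (u - y) * u' + y * (u' - y')" by (simp add: algebra_simps)
  then have "norm (u * u' - y * y') <= norm ((u - y) * u') + norm (y * (u' - y'))"
   by (simp only: norm_triangle_ineq)
  then show ?thesis by (simp only: norm_mult)
 qed
 then have "ennreal (norm (u * u' - y * y')) <= ennreal (norm (u - y)) * ennreal (norm u') + ennreal (norm y) * ennreal (norm (u' - y'))"
  by (simp add: ennreal_mult[symmetric] ennreal_plus[symmetric] ennreal_leI del: ennreal_plus)
 also have "\<dots> <= ennreal (norm (u - y)) * v' + w * ennreal (norm (u' - y'))"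
  using assms by (intro add_mono mult_mono) auto
 finally have "ennreal (norm (u * u' - y * y')) + w * w' <= ennreal (norm (u - y)) * v' + w * ennreal (norm (u' - y')) + w * w'"
  by (intro add_right_mono)
 also have "\<dots> = ennreal (norm (u - y)) * v' + w * (ennreal (norm (u' - y')) + w')" by (simp add: distrib_left add.assoc)
 also have "\<dots> <= ennreal (norm (u - y)) * v' + w * v'" using assms by (intro add_left_mono mult_left_mono) auto
 also have "\<dots> = (ennreal (norm (u - y)) + w) * v'" by (simp add: distrib_right)
 also have "\<dots> <= v * v'" using assms by (intro mult_right_mono) auto
 finally show ?thesis .
qed

text \<open>The product estimate is integrated term by term. If the right side is infinite nothing
  is claimed; otherwise all integrals converge, and a difference of integrals is the integral of the
  difference.\<close>

lemma pic_difference: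
 assumes [measurable]: "\<And>c. Y c \<in> borel_measurable X" "\<And>c. Z c \<in> borel_measurable X"
   "\<And>c. W c \<in> borel_measurable X" "\<And>c. W' c \<in> borel_measurable X"
  and Z: "\<And>c x. ennreal (norm (Z c x)) <= W c x" and Y: "\<And>c x. ennreal (norm (Y c x)) <= W' c x"
  and YZ: "\<And>c x. ennreal (norm (Y c x - Z c x)) + W c x <= W' c x"
 shows "ennreal (norm (pic Y c x - pic Z c x)) + maj W c x <= maj W' c x"
proof (cases "maj W' c x < \<infinity>")
 case fin: True
 have WW: "W c x <= W' c x" for c x using YZ[of c x] by (rule order_trans[rotated]) simp
 have "maj W c x <= maj W' c x" by (rule maj_mono) (rule WW)
 then have finW: "maj W c x < \<infinity>" using fin by (rule le_less_trans)
 note IY = integrable_terms[of Y W', OF assms(1) Y fin] and IZ = integrable_terms[of Z W, OF assms(2) Z finW]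
 have Q: "ennreal (norm ((LINT z|M. k c b b' x z * (Y b (lp x z) * Y b' (rp x z))) - (LINT z|M. k c b b' x z * (Z b (lp x z) * Z b' (rp x z)))))
   + (\<integral>\<^sup>+z. ennreal (norm (k c b b' x z)) * (W b (lp x z) * W b' (rp x z)) \<partial>M)
   <= (\<integral>\<^sup>+z. ennreal (norm (k c b b' x z)) * (W' b (lp x z) * W' b' (rp x z)) \<partial>M)" for b b'
 proof -
  have "(LINT z|M. k c b b' x z * (Y b (lp x z) * Y b' (rp x z))) - (LINT z|M. k c b b' x z * (Z b (lp x z) * Z b' (rp x z)))
    = (LINT z|M. k c b b' x z * (Y b (lp x z) * Y b' (rp x z) - Z b (lp x z) * Z b' (rp x z)))"
   by (simp only: right_diff_distrib Bochner_Integration.integral_diff IY IZ)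
  also have "ennreal (norm \<dots>) <= (\<integral>\<^sup>+z. ennreal (norm (k c b b' x z * (Y b (lp x z) * Y b' (rp x z) - Z b (lp x z) * Z b' (rp x z)))) \<partial>M)"
   by (rule integral_norm_bound_ennreal) (simp only: right_diff_distrib Bochner_Integration.integrable_diff IY IZ)
  finally have "ennreal (norm ((LINT z|M. k c b b' x z * (Y b (lp x z) * Y b' (rp x z))) - (LINT z|M. k c b b' x z * (Z b (lp x z) * Z b' (rp x z)))))
    + (\<integral>\<^sup>+z. ennreal (norm (k c b b' x z)) * (W b (lp x z) * W b' (rp x z)) \<partial>M)
   <= (\<integral>\<^sup>+z. ennreal (norm (k c b b' x z * (Y b (lp x z) * Y b' (rp x z) - Z b (lp x z) * Z b' (rp x z)))) \<partial>M)
    + (\<integral>\<^sup>+z. ennreal (norm (k c b b' x z)) * (W b (lp x z) * W b' (rp x z)) \<partial>M)"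
   by (intro add_right_mono)
  also have "\<dots> = (\<integral>\<^sup>+z. ennreal (norm (k c b b' x z)) * (ennreal (norm (Y b (lp x z) * Y b' (rp x z) - Z b (lp x z) * Z b' (rp x z))) + W b (lp x z) * W b' (rp x z)) \<partial>M)"
   by (subst nn_integral_add[symmetric]) (auto simp: norm_mult ennreal_mult distrib_left)
  also have "\<dots> <= (\<integral>\<^sup>+z. ennreal (norm (k c b b' x z)) * (W' b (lp x z) * W' b' (rp x z)) \<partial>M)"
   by (intro nn_integral_mono mult_left_mono product_difference_bound Y Z YZ) auto
  finally show ?thesis .
 qed
 have R: "ennreal (norm ((LINT s|N. L c b x s * Y b (ep x s)) - (LINT s|N. L c b x s * Z b (ep x s))))
   + (\<integral>\<^sup>+s. ennreal (norm (L c b x s)) * W b (ep x s) \<partial>N) <= (\<integral>\<^sup>+s. ennreal (norm (L c b x s)) * W' b (ep x s) \<partial>N)" for b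
 proof -
  have "(LINT s|N. L c b x s * Y b (ep x s)) - (LINT s|N. L c b x s * Z b (ep x s)) = (LINT s|N. L c b x s * (Y b (ep x s) - Z b (ep x s)))"
   by (simp only: right_diff_distrib Bochner_Integration.integral_diff IY IZ)
  also have "ennreal (norm \<dots>) <= (\<integral>\<^sup>+s. ennreal (norm (L c b x s * (Y b (ep x s) - Z b (ep x s)))) \<partial>N)"
   by (rule integral_norm_bound_ennreal) (simp only: right_diff_distrib Bochner_Integration.integrable_diff IY IZ)
  finally have "ennreal (norm ((LINT s|N. L c b x s * Y b (ep x s)) - (LINT s|N. L c b x s * Z b (ep x s))))
   + (\<integral>\<^sup>+s. ennreal (norm (L c b x s)) * W b (ep x s) \<partial>N)
   <= (\<integral>\<^sup>+s. ennreal (norm (L c b x s * (Y b (ep x s) - Z b (ep x s)))) \<partial>N) + (\<integral>\<^sup>+s. ennreal (norm (L c b x s)) * W b (ep x s) \<partial>N)"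
   by (intro add_right_mono)
  also have "\<dots> = (\<integral>\<^sup>+s. ennreal (norm (L c b x s)) * (ennreal (norm (Y b (ep x s) - Z b (ep x s))) + W b (ep x s)) \<partial>N)"
   by (subst nn_integral_add[symmetric]) (auto simp: norm_mult ennreal_mult distrib_left)
  also have "\<dots> <= (\<integral>\<^sup>+s. ennreal (norm (L c b x s)) * W' b (ep x s) \<partial>N)"
   by (intro nn_integral_mono mult_left_mono YZ) auto
  finally show ?thesis .
 qed
 let ?q = "%Y b b'. LINT z|M. k c b b' x z * (Y b (lp x z) * Y b' (rp x z))"
 let ?r = "%Y b. LINT s|N. L c b x s * Y b (ep x s)"
 let ?Q = "%W b b'. \<integral>\<^sup>+z. ennreal (norm (k c b b' x z)) * (W b (lp x z) * W b' (rp x z)) \<partial>M"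
 let ?R = "%W b. \<integral>\<^sup>+s. ennreal (norm (L c b x s)) * W b (ep x s) \<partial>N"
 have eq: "pic Y c x - pic Z c x = (\<Sum>b\<in>UNIV. \<Sum>b'\<in>UNIV. ?q Y b b' - ?q Z b b') + (\<Sum>b\<in>UNIV. ?r Y b - ?r Z b)"
 proof -
  have "(a + q + r) - (a + q' + r') = (q - q') + (r - r')" for a q r q' r' :: complex by simp
  then show ?thesis by (simp only: pic_def sum_subtractf)
 qed
 have "norm (pic Y c x - pic Z c x) <= norm (\<Sum>b\<in>UNIV. \<Sum>b'\<in>UNIV. ?q Y b b' - ?q Z b b') + norm (\<Sum>b\<in>UNIV. ?r Y b - ?r Z b)"
  unfolding eq by (rule norm_triangle_ineq)
 also have "\<dots> <= (\<Sum>b\<in>UNIV. \<Sum>b'\<in>UNIV. norm (?q Y b b' - ?q Z b b')) + (\<Sum>b\<in>UNIV. norm (?r Y b - ?r Z b))"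
  by (rule add_mono[OF order_trans[OF norm_sum sum_mono[OF norm_sum]] norm_sum])
 finally have "ennreal (norm (pic Y c x - pic Z c x)) <=
   (\<Sum>b\<in>UNIV. \<Sum>b'\<in>UNIV. ennreal (norm (?q Y b b' - ?q Z b b'))) + (\<Sum>b\<in>UNIV. ennreal (norm (?r Y b - ?r Z b)))"
  by (simp only: sum_ennreal norm_ge_zero sum_nonneg ennreal_plus[symmetric] ennreal_leI)
 then have "ennreal (norm (pic Y c x - pic Z c x)) + maj W c x <=
   ((\<Sum>b\<in>UNIV. \<Sum>b'\<in>UNIV. ennreal (norm (?q Y b b' - ?q Z b b'))) + (\<Sum>b\<in>UNIV. ennreal (norm (?r Y b - ?r Z b)))) + maj W c x"
  by (rule add_right_mono)
 also have "\<dots> = Ap c x + (\<Sum>b\<in>UNIV. \<Sum>b'\<in>UNIV. ennreal (norm (?q Y b b' - ?q Z b b')) + ?Q W b b') + (\<Sum>b\<in>UNIV. ennreal (norm (?r Y b - ?r Z b)) + ?R W b)"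
 proof -
  have "(x + y) + (a + q + r) = a + (x + q) + (y + r)" for x y a q r :: ennreal by (simp only: add_ac)
  then show ?thesis by (simp only: maj_def sum.distrib)
 qed
 also have "\<dots> <= maj W' c x"
  unfolding maj_def by (intro add_mono order_refl sum_mono Q R)
 finally show ?thesis .
qed (simp add: not_less top_unique)

text \<open>The two claims need each other: the size bound at the next index is the triangle
  inequality together with the increment bound, and comparing increments uses the size
  bounds.\<close>

lemma pics_bounds: "ennreal (norm (pics n c x)) <= majs n c x \<and>
  ennreal (norm (pics (Suc n) c x - pics n c x)) + majs n c x <= majs (Suc n) c x"
proof (induction n arbitrary: c x)
 case 0
 have "pic (%_ _. 0) c x = A c x" "maj (%_ _. 0) c x = Ap c x" by (simp_all add: pic_def maj_def)
 moreover have "pics 0 = (%_ _. 0)" "majs 0 = (%_ _. 0)" by (simp_all add: pics_def majs_def)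
 ultimately show ?case using A_le by (simp add: pics_Suc majs_Suc)
next
 case (Suc n)
 have le: "ennreal (norm (pics (Suc n) c x)) <= majs (Suc n) c x" for c x
 proof -
  have "norm (pics (Suc n) c x) <= norm (pics (Suc n) c x - pics n c x) + norm (pics n c x)"
   using norm_triangle_ineq[of "pics (Suc n) c x - pics n c x" "pics n c x"] by simp
  then have "ennreal (norm (pics (Suc n) c x)) <= ennreal (norm (pics (Suc n) c x - pics n c x)) + ennreal (norm (pics n c x))"
   by (simp add: ennreal_plus[symmetric] ennreal_leI del: ennreal_plus)
  also have "\<dots> <= ennreal (norm (pics (Suc n) c x - pics n c x)) + majs n c x" using Suc by (intro add_left_mono) auto
  also have "\<dots> <= majs (Suc n) c x" using Suc by auto
  finally show ?thesis .
 qed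
 have "ennreal (norm (pic (pics (Suc n)) c x - pic (pics n) c x)) + maj (majs n) c x <= maj (majs (Suc n)) c x"
  by (rule pic_difference) (use Suc le in auto)
 then show ?case using le by (simp add: pics_Suc majs_Suc)
qed

text \<open>The increment bounds telescope, so the series of increments converges absolutely
  wherever \<open>maj_sol\<close> is finite.\<close>

lemma pics_tendsto:
 assumes "maj_sol c x < \<infinity>" shows "(%n. pics n c x) \<longlonglongrightarrow> sol c x"
proof -
 have "ennreal (\<Sum>i<n. norm (pics (Suc i) c x - pics i c x)) <= majs n c x" for n
 proof (induction n)
  case (Suc n)
  have "ennreal (\<Sum>i<Suc n. norm (pics (Suc i) c x - pics i c x)) =
    ennreal (norm (pics (Suc n) c x - pics n c x)) + ennreal (\<Sum>i<n. norm (pics (Suc i) c x - pics i c x))"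
   by (simp add: sum_nonneg add.commute)
  also have "\<dots> <= ennreal (norm (pics (Suc n) c x - pics n c x)) + majs n c x" by (intro add_left_mono Suc)
  also have "\<dots> <= majs (Suc n) c x" using pics_bounds by blast
  finally show ?case .
 qed simp
 then have b: "ennreal (\<Sum>i<n. norm (pics (Suc i) c x - pics i c x)) <= maj_sol c x" for n
  using majs_le_sol order_trans by blast
 obtain B where B: "maj_sol c x = ennreal B" "B \<ge> 0" using assms by (cases "maj_sol c x") auto
 have "summable (%i. norm (pics (Suc i) c x - pics i c x))"
  by (rule summableI_nonneg_bounded[of _ B]) (use b B in \<open>auto simp: ennreal_le_iff\<close>)
 then have "summable (%i. pics (Suc i) c x - pics i c x)" by (rule summable_norm_cancel)
 then have "convergent (%n. \<Sum>i<n. pics (Suc i) c x - pics i c x)" by (simp add: summable_iff_convergent)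
 then have "convergent (%n. pics n c x)"
  using sum_lessThan_telescope[of "%i. pics i c x"] by (simp add: pics_0)
 then show ?thesis using assms by (simp add: sol_def convergent_LIMSEQ_iff)
qed

lemma sol_le: "ennreal (norm (sol c x)) <= maj_sol c x"
proof (cases "maj_sol c x < \<infinity>")
 case True
 have "(%n. ennreal (norm (pics n c x))) \<longlonglongrightarrow> ennreal (norm (sol c x))"
  by (intro tendsto_ennrealI tendsto_norm pics_tendsto True)
 then show ?thesis
  by (rule LIMSEQ_le_const2) (use pics_bounds majs_le_sol order_trans in blast)
qed (simp add: not_less top_unique)

lemma sol_zero: "maj_sol c x = 0 ==> pics n c x = 0"
 using pics_bounds[of n c x] majs_le_sol[of n c x] by simp

text \<open>Dominated convergence in the Picard recursion. The integrands of the majorant equation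
  dominate, and their integrals are finite because \<open>maj_sol\<close> satisfies that
  equation.\<close>

theorem sol_eq:
 assumes fin: "maj_sol c x < \<infinity>"
 shows "sol c x = pic sol c x"
proof -
 have fin': "maj maj_sol c x < \<infinity>" using fin maj_sol_eq by simp
 have pb: "ennreal (norm (pics n c x)) <= maj_sol c x" for n c x
  using pics_bounds majs_le_sol order_trans by blast
 have 1: "(%n. LINT z|M. k c b b' x z * (pics n b (lp x z) * pics n b' (rp x z))) \<longlonglongrightarrow>
   (LINT z|M. k c b b' x z * (sol b (lp x z) * sol b' (rp x z)))" for b b'
 proof -
  let ?V = "%z. ennreal (norm (k c b b' x z)) * (maj_sol b (lp x z) * maj_sol b' (rp x z))"
  have f: "(\<integral>\<^sup>+z. ?V z \<partial>M) < \<infinity>" by (rule maj_finite[OF fin'])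
  then have ae: "AE z in M. ?V z \<noteq> \<infinity>" by (intro nn_integral_PInf_AE) auto
  have w: "integrable M (%z. enn2real (?V z))"
  proof (rule integrableI_nonneg)
   have "(\<integral>\<^sup>+z. ennreal (enn2real (?V z)) \<partial>M) <= (\<integral>\<^sup>+z. ?V z \<partial>M)"
    by (intro nn_integral_mono) (simp add: ennreal_enn2real_if)
   then show "(\<integral>\<^sup>+z. ennreal (enn2real (?V z)) \<partial>M) < \<infinity>" using f by (rule le_less_trans)
  qed auto
  show ?thesis
  proof (rule integral_dominated_convergence[OF _ _ w])
   show "AE z in M. (%n. k c b b' x z * (pics n b (lp x z) * pics n b' (rp x z))) \<longlonglongrightarrow> k c b b' x z * (sol b (lp x z) * sol b' (rp x z))"
    using ae
   proof eventually_elim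
    case (elim z)
    show ?case
    \<comment> \<open>As 0 times \<infinity> is 0, a finite product does not make each factor
      finite. If some factor vanishes, so do the products of iterates and their limit; otherwise
      both majorants are finite and the iterates converge.\<close>
    proof (cases "k c b b' x z = 0 \<or> maj_sol b (lp x z) = 0 \<or> maj_sol b' (rp x z) = 0")
     case True
     moreover have "maj_sol b y = 0 ==> sol b y = 0" for b y using sol_le[of b y] by simp
     ultimately show ?thesis by (auto simp: sol_zero)
    next
     case False
     then have "maj_sol b (lp x z) < \<infinity>" "maj_sol b' (rp x z) < \<infinity>"
      using elim by (auto simp: ennreal_mult_eq_top_iff less_top[symmetric])
     then show ?thesis by (intro tendsto_mult tendsto_const pics_tendsto)
    qed
   qed
   show "AE z in M. norm (k c b b' x z * (pics n b (lp x z) * pics n b' (rp x z))) <= enn2real (?V z)" for n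
    using ae
   proof eventually_elim
    case (elim z)
    have "ennreal (norm (k c b b' x z * (pics n b (lp x z) * pics n b' (rp x z)))) <= ?V z"
     by (simp add: norm_mult ennreal_mult) (intro mult_mono pb; simp)
    also have "\<dots> = ennreal (enn2real (?V z))" using elim by (simp add: less_top)
    finally show ?case by (simp add: ennreal_le_iff)
   qed
  qed measurable
 qed
 have 2: "(%n. LINT s|N. L c b x s * pics n b (ep x s)) \<longlonglongrightarrow> (LINT s|N. L c b x s * sol b (ep x s))" for b
 proof -
  let ?V = "%s. ennreal (norm (L c b x s)) * maj_sol b (ep x s)"
  have f: "(\<integral>\<^sup>+s. ?V s \<partial>N) < \<infinity>" by (rule maj_finite[OF fin'])
  then have ae: "AE s in N. ?V s \<noteq> \<infinity>" by (intro nn_integral_PInf_AE) auto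
  have w: "integrable N (%s. enn2real (?V s))"
  proof (rule integrableI_nonneg)
   have "(\<integral>\<^sup>+s. ennreal (enn2real (?V s)) \<partial>N) <= (\<integral>\<^sup>+s. ?V s \<partial>N)"
    by (intro nn_integral_mono) (simp add: ennreal_enn2real_if)
   then show "(\<integral>\<^sup>+s. ennreal (enn2real (?V s)) \<partial>N) < \<infinity>" using f by (rule le_less_trans)
  qed auto
  show ?thesis
  proof (rule integral_dominated_convergence[OF _ _ w])
   show "AE s in N. (%n. L c b x s * pics n b (ep x s)) \<longlonglongrightarrow> L c b x s * sol b (ep x s)"
    using ae
   proof eventually_elim
    case (elim s)
    show ?case
    proof (cases "L c b x s = 0")
     case False
     then have "maj_sol b (ep x s) < \<infinity>" using elim by (auto simp: ennreal_mult_eq_top_iff less_top[symmetric])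
     then show ?thesis by (intro tendsto_mult tendsto_const pics_tendsto)
    qed simp
   qed
   show "AE s in N. norm (L c b x s * pics n b (ep x s)) <= enn2real (?V s)" for n
    using ae
   proof eventually_elim
    case (elim s)
    have "ennreal (norm (L c b x s * pics n b (ep x s))) <= ?V s"
     by (simp add: norm_mult ennreal_mult) (intro mult_mono pb; simp)
    also have "\<dots> = ennreal (enn2real (?V s))" using elim by (simp add: less_top)
    finally show ?case by (simp add: ennreal_le_iff)
   qed
  qed measurable
 qed
 have "(%n. pic (pics n) c x) \<longlonglongrightarrow> pic sol c x"
  unfolding pic_def by (intro tendsto_add tendsto_const tendsto_sum 1 2)
 moreover have "(%n. pic (pics n) c x) \<longlonglongrightarrow> sol c x"
  using LIMSEQ_Suc[OF pics_tendsto[OF fin]] by (simp add: pics_Suc)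
 ultimately show ?thesis using LIMSEQ_unique by blast
qed

declare section_measurable [measurable del] meas [measurable del]

end

section \<open>Weak norms: comparison, measurability, convolution and smoothing\<close>

lemma weak_norm_leI:
 assumes q: "0 < q" and A: "0 <= A"
  and lev: "\<And>l. 0 < l ==> emeasure M {x \<in> space M. h x > ennreal l} <= ennreal ((A / l) powr q)"
 shows "weak_norm M q h <= ennreal A"
 unfolding weak_norm_def
proof (rule SUP_least)
 fix l :: real assume "l \<in> {0<..}"
 then have l: "0 < l" by simp
 let ?e = "emeasure M {x \<in> space M. h x > ennreal l}"
 have fin: "?e < \<infinity>" using lev[OF l] by (rule le_less_trans) simp
 have "enn2real ?e <= (A / l) powr q"
  using enn2real_mono[OF lev[OF l]] by simp
 then have "enn2real ?e powr (1 / q) <= ((A / l) powr q) powr (1 / q)" using q by (intro powr_mono2) auto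
 also have "\<dots> = A / l" using q A l by (simp add: powr_powr)
 finally have "l * enn2real ?e powr (1 / q) <= A" using l by (simp add: field_simps)
 then have "ennreal l * ennreal (enn2real ?e powr (1 / q)) <= ennreal A"
  using l by (simp add: ennreal_mult[symmetric] ennreal_leI)
 then show "ennreal l * enn_powr ?e (1 / q) <= ennreal A" using fin by (auto simp: enn_powr_def)
qed

lemma weak_norm_level_set:
 assumes q: "0 < q" and A: "0 <= A" and w: "weak_norm M q h <= ennreal A" and l: "0 < l"
 shows "emeasure M {x \<in> space M. h x > ennreal l} <= ennreal ((A / l) powr q)"
proof -
 let ?e = "emeasure M {x \<in> space M. h x > ennreal l}"
 have "ennreal l * enn_powr ?e (1 / q) <= weak_norm M q h"
  unfolding weak_norm_def using l by (intro SUP_upper) auto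
 then have le: "ennreal l * enn_powr ?e (1 / q) <= ennreal A" using w by (rule order_trans)
 have fin: "?e \<noteq> \<infinity>"
 proof
  assume "?e = \<infinity>"
  then have "ennreal l * \<infinity> <= ennreal A" using le by (simp add: enn_powr_def)
  then show False using l by (simp add: ennreal_mult_top top_unique)
 qed
 then have "ennreal (l * enn2real ?e powr (1 / q)) <= ennreal A" using le l by (simp add: enn_powr_def ennreal_mult)
 then have "l * enn2real ?e powr (1 / q) <= A" using A by (simp add: ennreal_le_iff)
 then have "enn2real ?e powr (1 / q) <= A / l" using l by (simp add: field_simps)
 then have "(enn2real ?e powr (1 / q)) powr q <= (A / l) powr q" using q by (intro powr_mono2) auto
 then have "enn2real ?e <= (A / l) powr q" using q by (simp add: powr_powr)
 then have "ennreal (enn2real ?e) <= ennreal ((A / l) powr q)" by (rule ennreal_leI)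
 then show ?thesis using fin by (simp add: ennreal_enn2real_if)
qed

lemma lorentz_bound_weak_norm:
 fixes h :: "'a::euclidean_space => ennreal"
 assumes [measurable]: "h \<in> borel_measurable borel" and q: "1 < q"
 shows "lorentz_bound (1 - 1 / q) (ennreal (1 / (1 - 1 / q)) * weak_norm lborel q h) h"
proof (rule lorentz_boundI)
 fix E :: "'a set" assume E: "E \<in> sets borel" and fin: "emeasure lborel E < \<infinity>"
 let ?m = "measure lborel E powr (1 - 1 / q)" and ?I = "\<integral>\<^sup>+x. h x * indicator E x \<partial>lborel"
 have q': "0 < 1 - 1 / q" "0 < 1 / q" "1 / q < 1" using q by auto
 have bnd: "?I <= ennreal (A / (1 - 1 / q) * ?m)" if "0 < A" "weak_norm lborel q h <= ennreal A" for A
 proof -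
  have "lorentz_bound (1 - 1 / q) (ennreal (A / (1 - 1 / q))) h"
   by (rule lorentz_bound_of_level_sets) (use that q' q weak_norm_level_set[of q A lborel h] in auto)
  from lorentz_boundD[OF this E fin] show ?thesis using that q' by (subst ennreal_mult) auto
 qed
 show "?I <= ennreal (1 / (1 - 1 / q)) * weak_norm lborel q h * ennreal ?m"
 proof (cases "weak_norm lborel q h")
  case (real w)
  show ?thesis
  proof (rule ennreal_le_epsilon)
   fix e :: real assume e: "0 < e"
   \<comment> \<open>The criterion wants a positive constant while the weak norm may be 0, so an
     excess \<open>d\<close> is added whose contribution is at most \<open>e\<close>.\<close>
   define d where "d = e * (1 - 1 / q) / (?m + 1)"
   have m1: "?m + 1 > 0" by (simp add: add_nonneg_pos)
   have d: "d > 0" using e q' m1 by (simp add: d_def)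
   have dm: "d / (1 - 1 / q) * ?m <= e"
   proof -
    have "d / (1 - 1 / q) * ?m = e * (?m / (?m + 1))" using q' by (simp add: d_def)
    also have "\<dots> <= e * 1" using e m1 by (intro mult_left_mono) (auto simp: divide_le_eq)
    finally show ?thesis by simp
   qed
   have "?I <= ennreal ((w + d) / (1 - 1 / q) * ?m)"
    using real d by (intro bnd) (auto intro: ennreal_leI)
   also have "(w + d) / (1 - 1 / q) * ?m = w / (1 - 1 / q) * ?m + d / (1 - 1 / q) * ?m"
    by (simp add: add_divide_distrib distrib_right)
   also have "ennreal \<dots> <= ennreal (w / (1 - 1 / q) * ?m + e)" using dm by (intro ennreal_leI) simp
   also have "\<dots> = ennreal (1 / (1 - 1 / q)) * weak_norm lborel q h * ennreal ?m + ennreal e"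
    using real e q' by (subst ennreal_plus) (auto simp: ennreal_mult[symmetric])
   finally show "?I <= ennreal (1 / (1 - 1 / q)) * weak_norm lborel q h * ennreal ?m + ennreal e" .
  qed
 next
  case top
  show ?thesis
  proof (cases "?m = 0")
   case True
   then have "measure lborel E = 0" by simp
   then have "emeasure lborel E = 0" using fin by (simp add: emeasure_eq_ennreal_measure)
   then have "AE x in lborel. x \<notin> E" using E by (simp add: AE_iff_null null_sets_def)
   then have "AE x in lborel. h x * indicator E x = 0" by eventually_elim auto
   then have "?I = 0" using E by (subst nn_integral_0_iff_AE) auto
   then show ?thesis by simp
  next
   case False
   then have "ennreal ?m \<noteq> 0" by (simp add: ennreal_eq_0_iff)
   moreover have "ennreal (1 / (1 - 1 / q)) \<noteq> 0" using q' by (simp add: ennreal_eq_0_iff)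
   ultimately show ?thesis using top by (simp add: ennreal_mult_eq_top_iff ennreal_mult_top ennreal_top_mult)
  qed
 qed
qed

text \<open>Chebyshev's inequality loses no constant; the factor 1/(1 - 1/q) arises only in the
  opposite direction.\<close>

lemma weak_norm_le_lorentz_bound:
 fixes h :: "'a::euclidean_space => ennreal"
 assumes [measurable]: "h \<in> borel_measurable borel" and q: "0 < q" and L: "lorentz_bound (1 - 1 / q) A h"
 shows "weak_norm lborel q h <= A"
proof (cases A)
 case (real a)
 then show ?thesis
  using lorentz_bound_level_set[of "1 / q" a h] q L by (auto intro!: weak_norm_leI)
qed (simp add: top_unique)

text \<open>The supremum in the weak norm runs over uncountably many levels. The measure of a level
  set is right continuous in the level, so rational levels give the same supremum.\<close>

lemma weak_norm_measurable:
 fixes h :: "'t => 'a::euclidean_space => ennreal"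
 assumes [measurable]: "(%(t, x). h t x) \<in> borel_measurable (M \<Otimes>\<^sub>M lborel)" and q: "0 < q"
 shows "(%t. weak_norm lborel q (h t)) \<in> borel_measurable M"
proof -
 define e where "e l t = emeasure lborel {x. h t x > ennreal l}" for l t
 have em: "e l \<in> borel_measurable M" for l
 proof -
  have "(%t. \<integral>\<^sup>+x. indicator {p \<in> space (M \<Otimes>\<^sub>M lborel). (case p of (t, x) => h t x) > ennreal l} (t, x) \<partial>lborel) \<in> borel_measurable M"
   by (rule sigma_finite_measure.borel_measurable_nn_integral[OF sigma_finite_lborel]) (simp add: split_beta', measurable)
  moreover have "(\<integral>\<^sup>+x. indicator {p \<in> space (M \<Otimes>\<^sub>M lborel). (case p of (t, x) => h t x) > ennreal l} (t, x) \<partial>lborel) = e l t" if t: "t \<in> space M" for t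
  proof -
   have [measurable]: "h t \<in> borel_measurable lborel" using measurable_Pair2[OF assms(1) t] by simp
   have "(\<integral>\<^sup>+x. indicator {p \<in> space (M \<Otimes>\<^sub>M lborel). (case p of (t, x) => h t x) > ennreal l} (t, x) \<partial>lborel) = (\<integral>\<^sup>+x. indicator {x. h t x > ennreal l} x \<partial>lborel)"
    using t by (intro nn_integral_cong) (auto simp: space_pair_measure split: split_indicator)
   also have "\<dots> = e l t" unfolding e_def by (subst nn_integral_indicator) auto
   finally show ?thesis .
  qed
  ultimately show ?thesis by (subst (asm) measurable_cong) auto
 qed
 have pm: "(%t. enn_powr (e l t) (1 / q)) \<in> borel_measurable M" for l
  unfolding enn_powr_def using em[of l] by measurable
 have mono_p: "enn_powr x r <= enn_powr y r" if "x <= y" "0 <= r" for x y r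
  using that by (auto simp: enn_powr_def top_unique less_top[symmetric] intro!: ennreal_leI powr_mono2 enn2real_mono)
 have cont_p: "(%n. enn_powr (f n) (1 / q)) \<longlonglongrightarrow> enn_powr y (1 / q)" if f: "f \<longlonglongrightarrow> y" and inc: "incseq f" for f :: "nat => ennreal" and y
 proof (cases y)
  case (real r)
  have le: "f n <= y" for n using incseq_le[OF inc f] .
  have "(%n. enn2real (f n)) \<longlonglongrightarrow> enn2real y" using f real by (intro tendsto_enn2real) auto
  then have "(%n. enn2real (f n) powr (1 / q)) \<longlonglongrightarrow> enn2real y powr (1 / q)"
  proof (cases "enn2real y = 0")
   case False
   then show ?thesis using \<open>(%n. enn2real (f n)) \<longlonglongrightarrow> enn2real y\<close> by (intro tendsto_powr) auto
  next
   case True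
   then have "y = 0" using real by simp
   then have "f n = 0" for n using le[of n] by simp
   then show ?thesis using True by simp
  qed
  moreover have "f n \<noteq> \<infinity>" for n using le[of n] real by (auto simp: top_unique)
  ultimately show ?thesis using real by (simp add: enn_powr_def tendsto_ennrealI)
 next
  case top
  have "(%n. enn_powr (f n) (1 / q)) \<longlonglongrightarrow> (top :: ennreal)"
   unfolding tendsto_top_iff_ennreal
  proof (intro allI impI)
   fix L :: real assume L: "0 <= L"
   show "\<forall>\<^sub>F n in sequentially. ennreal L < enn_powr (f n) (1 / q)"
   proof -
    have "\<forall>\<^sub>F n in sequentially. f n > ennreal (L powr q)"
     using f top by (intro order_tendstoD) auto
    then show ?thesis
    proof eventually_elim
     case (elim n)
     show ?case
     proof (cases "f n")
      case (real r)
      then have "L powr q < r" using elim by (simp add: ennreal_less_iff)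
      then have "(L powr q) powr (1 / q) < r powr (1 / q)" using q by (intro powr_less_mono2) auto
      then have "L < r powr (1 / q)" using L q by (simp add: powr_powr)
      then show ?thesis using real L by (simp add: enn_powr_def ennreal_less_iff)
     qed (use L in \<open>auto simp: enn_powr_def\<close>)
    qed
   qed
  qed
  then show ?thesis using top by (simp add: enn_powr_def)
 qed
 have eq: "weak_norm lborel q (h t) = (SUP l\<in>{l\<in>\<rat>. 0 < l}. ennreal l * enn_powr (e l t) (1 / q))" if t: "t \<in> space M" for t
  unfolding weak_norm_def
 proof (rule antisym)
  have [measurable]: "h t \<in> borel_measurable lborel" using measurable_Pair2[OF assms(1) t] by simp
  show "(SUP l\<in>{l\<in>\<rat>. 0 < l}. ennreal l * enn_powr (e l t) (1 / q)) <= (SUP l\<in>{0<..}. ennreal l * enn_powr (emeasure lborel {x \<in> space lborel. h t x > ennreal l}) (1 / q))"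
   by (intro SUP_mono) (auto simp: e_def)
  show "(SUP l\<in>{0<..}. ennreal l * enn_powr (emeasure lborel {x \<in> space lborel. h t x > ennreal l}) (1 / q)) <= (SUP l\<in>{l\<in>\<rat>. 0 < l}. ennreal l * enn_powr (e l t) (1 / q))"
  proof (rule SUP_least)
   fix l :: real assume "l \<in> {0<..}"
   then have l: "0 < l" by simp
   \<comment> \<open>With decreasing levels the level sets increase to the one at \<open>l\<close>,
     as continuity of measure from below requires.\<close>
   obtain r where r: "\<And>n. r n \<in> \<rat>" "\<And>n. l < r n" "decseq r" "r \<longlonglongrightarrow> l"
   proof -
    have ex: "\<exists>x\<in>\<rat>. l < x \<and> x < y" if "l < y" for y using Rats_dense_in_real[OF that] by auto
    define r where "r = rec_nat (SOME x. x \<in> \<rat> \<and> l < x \<and> x < l + 1) (%n y. SOME x. x \<in> \<rat> \<and> l < x \<and> x < min y (l + 1 / real (Suc (Suc n))))"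
    have "r n \<in> \<rat> \<and> l < r n \<and> r n < l + 1 / real (Suc n)" for n
    proof (induction n)
     case 0
     show ?case unfolding r_def using someI_ex[of "%x. x \<in> \<rat> \<and> l < x \<and> x < l + 1"] ex[of "l + 1"] by auto
    next
     case (Suc n)
     have "\<exists>x. x \<in> \<rat> \<and> l < x \<and> x < min (r n) (l + 1 / real (Suc (Suc n)))"
      using ex[of "min (r n) (l + 1 / real (Suc (Suc n)))"] Suc by auto
     from someI_ex[OF this] show ?case unfolding r_def by simp
    qed
    note R = this
    have "r (Suc n) <= r n" for n
    proof -
     have "\<exists>x. x \<in> \<rat> \<and> l < x \<and> x < min (r n) (l + 1 / real (Suc (Suc n)))"
      using ex[of "min (r n) (l + 1 / real (Suc (Suc n)))"] R[of n] by auto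
     from someI_ex[OF this] show ?thesis unfolding r_def by simp
    qed
    then have "decseq r" by (rule decseq_SucI)
    moreover have "r \<longlonglongrightarrow> l"
    proof (rule tendsto_sandwich[of "%_. l" _ _ "%n. l + 1 / real (Suc n)"])
     have "(%n. l + inverse (real (Suc n))) \<longlonglongrightarrow> l + 0" by (intro tendsto_add tendsto_const LIMSEQ_inverse_real_of_nat)
     then show "(%n. l + 1 / real (Suc n)) \<longlonglongrightarrow> l" by (simp add: inverse_eq_divide)
    qed (use R in \<open>auto intro!: always_eventually less_imp_le simp del: of_nat_Suc\<close>)
    ultimately show ?thesis using R that by blast
   qed
   have inc: "incseq (%n. e (r n) t)"
    unfolding e_def using r(2,3) l
    by (intro incseq_SucI emeasure_mono) (auto simp: decseq_Suc_iff intro: le_less_trans[OF ennreal_leI])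
   have lim: "(%n. e (r n) t) \<longlonglongrightarrow> emeasure lborel {x \<in> space lborel. h t x > ennreal l}"
   proof -
    have "{x \<in> space lborel. h t x > ennreal l} = (\<Union>n. {x. h t x > ennreal (r n)})"
    proof (intro set_eqI iffI)
     fix x assume "x \<in> {x \<in> space lborel. h t x > ennreal l}"
     then have "ennreal l < h t x" by simp
     moreover have "(%n. ennreal (r n)) \<longlonglongrightarrow> ennreal l" by (intro tendsto_ennrealI r)
     ultimately have "\<forall>\<^sub>F n in sequentially. ennreal (r n) < h t x" by (intro order_tendstoD)
     then show "x \<in> (\<Union>n. {x. h t x > ennreal (r n)})" using eventually_happens by fastforce
    next
     fix x assume "x \<in> (\<Union>n. {x. h t x > ennreal (r n)})"
     then show "x \<in> {x \<in> space lborel. h t x > ennreal l}"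
      using r(2) l by (auto intro: le_less_trans[OF ennreal_leI[OF less_imp_le]])
    qed
    moreover have "(%n. emeasure lborel {x. h t x > ennreal (r n)}) \<longlonglongrightarrow> emeasure lborel (\<Union>n. {x. h t x > ennreal (r n)})"
     using r(2,3) l by (intro Lim_emeasure_incseq incseq_SucI)
      (auto simp: decseq_Suc_iff intro: le_less_trans[OF ennreal_leI])
    ultimately show ?thesis by (simp add: e_def)
   qed
   have "(%n. ennreal l * enn_powr (e (r n) t) (1 / q)) \<longlonglongrightarrow> ennreal l * enn_powr (emeasure lborel {x \<in> space lborel. h t x > ennreal l}) (1 / q)"
    by (intro tendsto_mult_ennreal tendsto_const cont_p lim inc) (use l in auto)
   then show "ennreal l * enn_powr (emeasure lborel {x \<in> space lborel. h t x > ennreal l}) (1 / q) <= (SUP l\<in>{l\<in>\<rat>. 0 < l}. ennreal l * enn_powr (e l t) (1 / q))"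
   proof (rule LIMSEQ_le_const2, intro exI allI impI)
    fix n
    have "ennreal l * enn_powr (e (r n) t) (1 / q) <= ennreal (r n) * enn_powr (e (r n) t) (1 / q)"
     using r(2)[of n] by (intro mult_right_mono ennreal_leI) auto
    also have "\<dots> <= (SUP l\<in>{l\<in>\<rat>. 0 < l}. ennreal l * enn_powr (e l t) (1 / q))"
     using r(1,2)[of n] l by (intro SUP_upper) auto
    finally show "ennreal l * enn_powr (e (r n) t) (1 / q) <= (SUP l\<in>{l\<in>\<rat>. 0 < l}. ennreal l * enn_powr (e l t) (1 / q))" .
   qed
  qed
 qed
 have "(%t. SUP l\<in>{l\<in>\<rat>. 0 < l}. ennreal l * enn_powr (e l t) (1 / q)) \<in> borel_measurable M"
  using pm by (intro borel_measurable_SUP countable_subset[OF _ countable_rat]) auto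
 then show ?thesis using eq by (subst measurable_cong) auto
qed

text \<open>Minkowski's integral inequality with constant one: for bounds tested on sets it is just
  Tonelli's theorem.\<close>

lemma lorentz_bound_nn_integral:
 fixes H :: "real => 'a::euclidean_space => ennreal"
 assumes [measurable]: "(%(s, x). H s x) \<in> borel_measurable (borel \<Otimes>\<^sub>M borel)" "B \<in> borel_measurable borel"
  and L: "\<And>s. lorentz_bound \<kappa> (B s) (H s)"
 shows "lorentz_bound \<kappa> (\<integral>\<^sup>+s. B s \<partial>lborel) (%x. \<integral>\<^sup>+s. H s x \<partial>lborel)"
proof (rule lorentz_boundI)
 fix E :: "'a set" assume E [measurable]: "E \<in> sets borel" and fin: "emeasure lborel E < \<infinity>"
 have [measurable]: "(%p. H (fst p) (snd p)) \<in> borel_measurable (borel \<Otimes>\<^sub>M borel)"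
  using assms(1) by (simp add: split_beta')
 have "(\<integral>\<^sup>+x. (\<integral>\<^sup>+s. H s x \<partial>lborel) * indicator E x \<partial>lborel) = (\<integral>\<^sup>+x. (\<integral>\<^sup>+s. H s x * indicator E x \<partial>lborel) \<partial>lborel)"
  by (intro nn_integral_cong, subst nn_integral_multc) auto
 also have "\<dots> = (\<integral>\<^sup>+s. (\<integral>\<^sup>+x. H s x * indicator E x \<partial>lborel) \<partial>lborel)"
  by (rule lborel_pair.Fubini') (simp add: split_beta', measurable)
 also have "\<dots> <= (\<integral>\<^sup>+s. B s * ennreal (measure lborel E powr \<kappa>) \<partial>lborel)"
  by (intro nn_integral_mono lorentz_boundD L E fin)
 also have "\<dots> = (\<integral>\<^sup>+s. B s \<partial>lborel) * ennreal (measure lborel E powr \<kappa>)"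
  by (rule nn_integral_multc) measurable
 finally show "(\<integral>\<^sup>+x. (\<integral>\<^sup>+s. H s x \<partial>lborel) * indicator E x \<partial>lborel) <= (\<integral>\<^sup>+s. B s \<partial>lborel) * ennreal (measure lborel E powr \<kappa>)" .
qed

lemma nn_integral_lborel_translate:
 fixes f :: "'a::euclidean_space => ennreal"
 assumes "f \<in> borel_measurable borel"
 shows "(\<integral>\<^sup>+x. f (a + x) \<partial>lborel) = (\<integral>\<^sup>+x. f x \<partial>lborel)"
proof -
 have "(\<integral>\<^sup>+x. f x \<partial>lborel) = (\<integral>\<^sup>+x. f x \<partial>distr lborel borel ((+) a))" by (simp add: lborel_distr_plus)
 also have "\<dots> = (\<integral>\<^sup>+x. f (a + x) \<partial>lborel)" using assms by (subst nn_integral_distr) auto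
 finally show ?thesis ..
qed

text \<open>Young's inequality for \<open>L^1\<close> acting on weak spaces: translates of
  \<open>h\<close> obey the same bound because translating a test set preserves its measure.\<close>

lemma lorentz_bound_convolution:
 fixes h g :: "'a::euclidean_space => ennreal"
 assumes [measurable]: "h \<in> borel_measurable borel" "g \<in> borel_measurable borel"
  and h: "lorentz_bound \<kappa> A h" and g: "lorentz_bound 0 B g"
 shows "lorentz_bound \<kappa> (A * B) (%x. \<integral>\<^sup>+y. h (x - y) * g y \<partial>lborel)"
proof (rule lorentz_boundI)
 fix E :: "'a set" assume E [measurable]: "E \<in> sets borel" and fin: "emeasure lborel E < \<infinity>"
 have tr: "(\<integral>\<^sup>+x. h (x - y) * indicator E x \<partial>lborel) <= A * ennreal (measure lborel E powr \<kappa>)" for y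
 proof -
  define F where "F = {x. y + x \<in> E}"
  have F [measurable]: "F \<in> sets borel" unfolding F_def by measurable
  have "emeasure lborel F = (\<integral>\<^sup>+x. indicator E (y + x) \<partial>lborel)"
  proof -
   have "(\<integral>\<^sup>+x. indicator E (y + x) \<partial>lborel) = (\<integral>\<^sup>+x. indicator F x \<partial>lborel)"
    by (intro nn_integral_cong) (auto simp: F_def split: split_indicator)
   then show ?thesis by simp
  qed
  also have "\<dots> = emeasure lborel E" by (subst nn_integral_lborel_translate) auto
  finally have FE: "emeasure lborel F = emeasure lborel E" .
  have "(\<integral>\<^sup>+x. h (x - y) * indicator E x \<partial>lborel) = (\<integral>\<^sup>+x. h (y + x - y) * indicator E (y + x) \<partial>lborel)"
   by (rule nn_integral_lborel_translate[symmetric]) measurable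
  also have "\<dots> = (\<integral>\<^sup>+x. h x * indicator F x \<partial>lborel)"
   by (intro nn_integral_cong) (auto simp: F_def split: split_indicator)
  also have "\<dots> <= A * ennreal (measure lborel F powr \<kappa>)"
   by (rule lorentz_boundD[OF h F]) (use FE fin in simp)
  finally show ?thesis using FE by (simp add: measure_def)
 qed
 have "(\<integral>\<^sup>+x. (\<integral>\<^sup>+y. h (x - y) * g y \<partial>lborel) * indicator E x \<partial>lborel) =
  (\<integral>\<^sup>+x. (\<integral>\<^sup>+y. g y * (h (x - y) * indicator E x) \<partial>lborel) \<partial>lborel)"
  by (intro nn_integral_cong, subst nn_integral_multc[symmetric]) (auto simp: mult_ac)
 also have "\<dots> = (\<integral>\<^sup>+y. (\<integral>\<^sup>+x. g y * (h (x - y) * indicator E x) \<partial>lborel) \<partial>lborel)"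
  by (rule lborel_pair.Fubini') measurable
 also have "\<dots> = (\<integral>\<^sup>+y. g y * (\<integral>\<^sup>+x. h (x - y) * indicator E x \<partial>lborel) \<partial>lborel)"
  by (intro nn_integral_cong nn_integral_cmult) measurable
 also have "\<dots> <= (\<integral>\<^sup>+y. g y * (A * ennreal (measure lborel E powr \<kappa>)) \<partial>lborel)"
  by (intro nn_integral_mono mult_left_mono tr) auto
 also have "\<dots> = (\<integral>\<^sup>+y. g y \<partial>lborel) * (A * ennreal (measure lborel E powr \<kappa>))"
  by (rule nn_integral_multc) measurable
 also have "\<dots> <= B * (A * ennreal (measure lborel E powr \<kappa>))"
  using g by (intro mult_right_mono) (simp_all add: lorentz_bound_0_iff)
 finally show "(\<integral>\<^sup>+x. (\<integral>\<^sup>+y. h (x - y) * g y \<partial>lborel) * indicator E x \<partial>lborel) <= A * B * ennreal (measure lborel E powr \<kappa>)"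
  by (simp add: mult_ac)
qed

text \<open>On the annulus of index j the weight |\<xi>|^\<sigma> is at least 2^(j \<sigma>), as
  \<sigma> is nonnegative; dividing it out lowers the growth exponent by \<sigma>.\<close>

lemma weighted_annulus_bound:
 fixes h :: "real^'n => ennreal"
 assumes [measurable]: "h \<in> borel_measurable borel"
  and L: "lorentz_bound \<kappa> A (%\<xi>. ennreal (norm \<xi> powr \<sigma>) * h \<xi>)" and "0 <= \<kappa>" "0 <= \<sigma>"
 shows "(\<integral>\<^sup>+\<xi>. h \<xi> * indicator (annulus j) \<xi> \<partial>lborel) <=
  (ennreal ((unit_ball_vol (real CARD('n)) * 2 ^ CARD('n)) powr \<kappa>) * A) * ennreal (2 powr (of_int j * (real CARD('n) * \<kappa> - \<sigma>)))"
proof -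
 let ?c = "ennreal ((unit_ball_vol (real CARD('n)) * 2 ^ CARD('n)) powr \<kappa>)"
 have "(\<integral>\<^sup>+\<xi>. h \<xi> * indicator (annulus j) \<xi> \<partial>lborel) <=
   (\<integral>\<^sup>+\<xi>. ennreal (2 powr (- (of_int j * \<sigma>))) * ((ennreal (norm \<xi> powr \<sigma>) * h \<xi>) * indicator (annulus j) \<xi>) \<partial>lborel)"
 proof (intro nn_integral_mono)
  fix \<xi> :: "real^'n"
  show "h \<xi> * indicator (annulus j) \<xi> <= ennreal (2 powr (- (of_int j * \<sigma>))) * ((ennreal (norm \<xi> powr \<sigma>) * h \<xi>) * indicator (annulus j) \<xi>)"
  proof (cases "\<xi> \<in> annulus j")
   case True
   then have "(2 powr of_int j) powr \<sigma> <= norm \<xi> powr \<sigma>" using assms by (intro powr_mono2) (auto simp: annulus_def)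
   then have "2 powr (- (of_int j * \<sigma>)) * (2 powr (of_int j * \<sigma>)) <= 2 powr (- (of_int j * \<sigma>)) * norm \<xi> powr \<sigma>"
    by (intro mult_left_mono) (auto simp: powr_powr)
   then have "1 <= 2 powr (- (of_int j * \<sigma>)) * norm \<xi> powr \<sigma>" by (simp add: powr_add[symmetric])
   then have "1 * h \<xi> <= ennreal (2 powr (- (of_int j * \<sigma>)) * norm \<xi> powr \<sigma>) * h \<xi>"
    by (intro mult_right_mono) (auto simp: ennreal_1[symmetric] ennreal_leI simp del: ennreal_1)
   then show ?thesis using True by (simp add: ennreal_mult mult.assoc)
  qed simp
 qed
 also have "\<dots> = ennreal (2 powr (- (of_int j * \<sigma>))) * (\<integral>\<^sup>+\<xi>. (ennreal (norm \<xi> powr \<sigma>) * h \<xi>) * indicator (annulus j) \<xi> \<partial>lborel)"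
  by (rule nn_integral_cmult) measurable
 also have "\<dots> <= ennreal (2 powr (- (of_int j * \<sigma>))) * (A * ?c * ennreal (2 powr (of_int j * (real CARD('n) * \<kappa>))))"
  by (intro mult_left_mono lorentz_bound_annulus assms) auto
 also have "\<dots> = (?c * A) * (ennreal (2 powr (- (of_int j * \<sigma>))) * ennreal (2 powr (of_int j * (real CARD('n) * \<kappa>))))"
  by (simp only: mult_ac)
 also have "ennreal (2 powr (- (of_int j * \<sigma>))) * ennreal (2 powr (of_int j * (real CARD('n) * \<kappa>))) = ennreal (2 powr (of_int j * (real CARD('n) * \<kappa> - \<sigma>)))"
  by (simp add: ennreal_mult[symmetric] powr_add[symmetric] right_diff_distrib)
 finally show ?thesis .
qed

text \<open>Origin of two of the singular kernels in time: under the heat flow, passing from a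
  weighted weak space to \<open>L^1\<close> costs the power (d \<kappa> - \<sigma>)/\<alpha>.
  Positivity of the difference makes the low frequencies summable.\<close>

lemma heat_smoothing:
 assumes "0 <= \<sigma>" "0 <= \<kappa>" "\<sigma> < real CARD('n) * \<kappa>" "0 < \<alpha>"
 shows "\<exists>C>0. \<forall>(h :: real^'n => ennreal) A \<tau>. h \<in> borel_measurable borel --> 0 < \<tau> -->
  lorentz_bound \<kappa> A (%\<xi>. ennreal (norm \<xi> powr \<sigma>) * h \<xi>) -->
  (\<integral>\<^sup>+\<xi>. ennreal (exp (- \<tau> * norm \<xi> powr \<alpha>)) * h \<xi> \<partial>lborel) <= ennreal C * A * ennreal (\<tau> powr (- ((real CARD('n) * \<kappa> - \<sigma>) / \<alpha>)))"
proof -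
 define c where "c = (unit_ball_vol (real CARD('n)) * 2 ^ CARD('n)) powr \<kappa>"
 have "unit_ball_vol (real CARD('n)) * 2 ^ CARD('n) > 0"
  by (intro mult_pos_pos unit_ball_vol_pos) auto
 then have c: "c > 0" unfolding c_def by (metis less_irrefl powr_gt_zero)
 obtain C where C: "C > 0" "\<And>(h :: real^'n => ennreal) A \<tau>. h \<in> borel_measurable borel ==> 0 < \<tau> ==>
  (\<And>j. (\<integral>\<^sup>+\<xi>. h \<xi> * indicator (annulus j) \<xi> \<partial>lborel) <= A * ennreal (2 powr (of_int j * (real CARD('n) * \<kappa> - \<sigma>)))) ==>
  (\<integral>\<^sup>+\<xi>. ennreal (exp (- \<tau> * norm \<xi> powr \<alpha>)) * h \<xi> \<partial>lborel) <= ennreal C * A * ennreal (\<tau> powr (- ((real CARD('n) * \<kappa> - \<sigma>) / \<alpha>)))"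
  using heat_integral_bound[of "real CARD('n) * \<kappa> - \<sigma>" \<alpha>, where 'n='n] assms by auto
 have "(\<integral>\<^sup>+\<xi>. ennreal (exp (- \<tau> * norm \<xi> powr \<alpha>)) * h \<xi> \<partial>lborel) <= ennreal (C * c) * A * ennreal (\<tau> powr (- ((real CARD('n) * \<kappa> - \<sigma>) / \<alpha>)))"
  if "h \<in> borel_measurable borel" "0 < \<tau>" "lorentz_bound \<kappa> A (%\<xi>. ennreal (norm \<xi> powr \<sigma>) * h \<xi>)" for h :: "real^'n => ennreal" and A \<tau>
 proof -
  have "ennreal (C * c) = ennreal C * ennreal c" using C c by (simp add: ennreal_mult)
  then show ?thesis
   using C(2)[OF that(1,2) weighted_annulus_bound[OF that(1,3) assms(2,1)]] unfolding c_def[symmetric]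
   by (simp only: mult.assoc)
 qed
 with C c show ?thesis by (intro exI[of _ "C * c"]) auto
qed

text \<open>The counterpart with a polynomial weight in place of the heat flow. No singular power of
  time appears, so it can be used inside a Duhamel integral up to its endpoint.\<close>

lemma weight_smoothing:
 assumes "0 <= \<sigma>" "0 <= \<kappa>" "\<sigma> < real CARD('n) * \<kappa>" "real CARD('n) * \<kappa> - \<sigma> < real N"
 shows "\<exists>C>0. \<forall>(h :: real^'n => ennreal) A. h \<in> borel_measurable borel -->
  lorentz_bound \<kappa> A (%\<xi>. ennreal (norm \<xi> powr \<sigma>) * h \<xi>) -->
  (\<integral>\<^sup>+\<xi>. ennreal (1 / (1 + norm \<xi>) ^ N) * h \<xi> \<partial>lborel) <= ennreal C * A"
proof -
 define c where "c = (unit_ball_vol (real CARD('n)) * 2 ^ CARD('n)) powr \<kappa>"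
 have "unit_ball_vol (real CARD('n)) * 2 ^ CARD('n) > 0"
  by (intro mult_pos_pos unit_ball_vol_pos) auto
 then have c: "c > 0" unfolding c_def by (metis less_irrefl powr_gt_zero)
 obtain C where C: "C > 0" "\<And>(h :: real^'n => ennreal) A. h \<in> borel_measurable borel ==>
  (\<And>j. (\<integral>\<^sup>+\<xi>. h \<xi> * indicator (annulus j) \<xi> \<partial>lborel) <= A * ennreal (2 powr (of_int j * (real CARD('n) * \<kappa> - \<sigma>)))) ==>
  (\<integral>\<^sup>+\<xi>. ennreal (1 / (1 + norm \<xi>) ^ N) * h \<xi> \<partial>lborel) <= ennreal C * A"
  using schwartz_weight_integral_bound[of "real CARD('n) * \<kappa> - \<sigma>" N, where 'n='n] assms by auto
 have "(\<integral>\<^sup>+\<xi>. ennreal (1 / (1 + norm \<xi>) ^ N) * h \<xi> \<partial>lborel) <= ennreal (C * c) * A"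
  if "h \<in> borel_measurable borel" "lorentz_bound \<kappa> A (%\<xi>. ennreal (norm \<xi> powr \<sigma>) * h \<xi>)" for h :: "real^'n => ennreal" and A
 proof -
  have "ennreal (C * c) = ennreal C * ennreal c" using C c by (simp add: ennreal_mult)
  then show ?thesis
   using C(2)[OF that(1) weighted_annulus_bound[OF that(1,2) assms(2,1)]] unfolding c_def[symmetric]
   by (simp only: mult.assoc)
 qed
 with C c show ?thesis by (intro exI[of _ "C * c"]) auto
qed

section \<open>The scalar system in time\<close>

text \<open>For \<gamma> < 1 this is, up to a Gamma factor, the Riemann-Liouville fractional
  integral of order 1 - \<gamma> started at time 0.\<close>

definition riesz :: "real => (real => ennreal) => real => ennreal" where
 "riesz \<gamma> g t = (\<integral>\<^sup>+s. indicator {0<..<t} s * ennreal ((t - s) powr (- \<gamma>)) * g s \<partial>lborel)"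

lemma riesz_measurable [measurable]:
 assumes [measurable]: "g \<in> borel_measurable borel"
 shows "riesz \<gamma> g \<in> borel_measurable borel"
 unfolding riesz_def[abs_def] by measurable

lemma riesz_mono: "(\<And>s. g s <= h s) ==> riesz \<gamma> g t <= riesz \<gamma> h t"
 unfolding riesz_def by (intro nn_integral_mono mult_left_mono) auto

text \<open>\<open>v\<close> and \<open>w\<close> stand for the frequency norms of velocity and
  temperature, \<open>m\<close> for that of the force. The kernel of order 1/\<alpha> is the cost of
  the divergence; those of orders \<gamma>1 and \<gamma>2 bring temperature and force into
  \<open>L^1\<close>. The sources are powers of time because Besov data of negative regularity are
  measured by their heat flow.\<close>

definition time_step :: "real => real => real => real => real => real => real => (real => ennreal) =>
  (real => ennreal) \<times> (real => ennreal) => (real => ennreal) \<times> (real => ennreal)" where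
 "time_step K \<epsilon> \<alpha> \<theta>r \<theta>p \<gamma>1 \<gamma>2 m = (%(v, w).
   (%t. ennreal K * (indicator {0<..} t * ennreal (\<epsilon> * t powr (- \<theta>r)) + riesz (1 / \<alpha>) (%s. v s * v s) t + riesz \<gamma>1 w t + riesz \<gamma>2 m t),
   %t. ennreal K * (indicator {0<..} t * ennreal (\<epsilon> * t powr (- \<theta>p)) + riesz (1 / \<alpha>) (%s. w s * v s) t)))"

lemma power_lorentz_bound:
 assumes "0 < \<theta>" "\<theta> < 1" "0 <= \<epsilon>"
 shows "lorentz_bound (1 - \<theta>) (ennreal (\<epsilon> / (1 - \<theta>))) (%t. indicator {0<..} t * ennreal (\<epsilon> * t powr (- \<theta>)))"
proof -
 have "lorentz_bound (1 - \<theta>) (ennreal \<epsilon> * ennreal (1 / (1 - \<theta>))) (%t. ennreal \<epsilon> * (indicator {0<..} t * ennreal ((t - 0) powr (- \<theta>))))"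
  by (intro lorentz_bound_cmult riesz_kernel_lorentz_bound assms) auto
 moreover have "ennreal \<epsilon> * ennreal (1 / (1 - \<theta>)) = ennreal (\<epsilon> / (1 - \<theta>))"
  using assms by (simp add: ennreal_mult[symmetric])
 moreover have "(%t. ennreal \<epsilon> * (indicator {0<..} t * ennreal ((t - 0) powr (- \<theta>)))) = (%t. indicator {0<..} t * ennreal (\<epsilon> * t powr (- \<theta>)))"
  using assms by (auto simp: fun_eq_iff ennreal_mult split: split_indicator)
 ultimately show ?thesis by simp
qed

text \<open>The quadratic term is absorbed by smallness; the linear coupling of \<open>w\<close> into \<open>v\<close> is harmless
 because the equation for \<open>w\<close> has no source besides its initial datum, which forces \<open>w\<close> to be of
 the order of \<open>\<epsilon>\<close>.\<close>

lemma time_system: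
 assumes \<alpha>: "1 < \<alpha>" "\<alpha> < 2" and \<theta>r: "\<theta>r = 1 - 1 / \<alpha>" and \<theta>p: "1 - 1 / \<alpha> < \<theta>p" "\<theta>p < 1 / \<alpha>"
  and \<theta>f: "1 - 1 / \<alpha> < \<theta>f" "\<theta>f < 1" and \<gamma>: "\<gamma>1 = 2 - 1 / \<alpha> - \<theta>p" "\<gamma>2 = 2 - 1 / \<alpha> - \<theta>f" and K: "0 < K"
 shows "\<exists>\<epsilon>>0. \<exists>R>0. \<forall>m n. m \<in> borel_measurable borel --> lorentz_bound (1 - \<theta>f) (ennreal (K * \<epsilon>)) m -->
   lorentz_bound (1 - \<theta>r) (ennreal R) (fst ((time_step K \<epsilon> \<alpha> \<theta>r \<theta>p \<gamma>1 \<gamma>2 m ^^ n) (%_. 0, %_. 0))) \<and>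
   lorentz_bound (1 - \<theta>p) (ennreal R) (snd ((time_step K \<epsilon> \<alpha> \<theta>r \<theta>p \<gamma>1 \<gamma>2 m ^^ n) (%_. 0, %_. 0)))"
proof -
 have a: "1 / 2 < 1 / \<alpha>" "1 / \<alpha> < 1" using \<alpha> by (auto simp: field_simps)
 have r: "0 < \<theta>r" "\<theta>r < 1" "\<theta>r + \<theta>r < 1" "\<theta>p + \<theta>r < 1" "0 < \<theta>p" "\<theta>p < 1" "0 < \<theta>f"
  using a \<theta>r \<theta>p \<theta>f by linarith+
 have g: "0 < \<gamma>1" "\<gamma>1 < 1" "0 < \<gamma>2" "\<gamma>2 < 1" using a \<gamma> \<theta>p \<theta>f by linarith+
 define H where "H \<gamma> \<theta> = 1 / ((1 - \<gamma>) * (1 - (1 - \<theta>) / \<gamma>))" for \<gamma> \<theta> :: real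
 have H0: "0 <= H \<gamma> \<theta>" if "0 < \<gamma>" "\<gamma> < 1" "1 < \<theta> + \<gamma>" for \<gamma> \<theta>
 proof -
  have "(1 - \<theta>) / \<gamma> <= 1" using that by (simp add: divide_le_eq)
  then show ?thesis using that unfolding H_def by (intro divide_nonneg_nonneg mult_nonneg_nonneg) auto
 qed
 have hls: "lorentz_bound \<kappa> (ennreal (H \<gamma> \<theta> * A)) (riesz \<gamma> g)"
  if "0 < \<gamma>" "\<gamma> < 1" "0 < \<theta>" "\<theta> < 1" "1 < \<theta> + \<gamma>" "0 <= A" "g \<in> borel_measurable borel" "lorentz_bound (1 - \<theta>) (ennreal A) g" "\<kappa> = 2 - \<theta> - \<gamma>" for \<gamma> \<theta> A g \<kappa>
  unfolding riesz_def[abs_def] H_def that(9) by (rule hardy_littlewood_sobolev) (use that in auto)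
 define P where "P \<theta> \<theta>' = 2 powr (\<theta> + \<theta>') / (1 - (\<theta> + \<theta>'))" for \<theta> \<theta>' :: real
 \<comment> \<open>The largest coefficient arising from the potentials, the weak products and the
   sources. Force and initial velocity share one entry since both are proportional to
   \<epsilon>.\<close>
 define D where "D = max (max (1 / (1 - \<theta>r) + H \<gamma>2 \<theta>f * K) (H (1 / \<alpha>) (\<theta>r + \<theta>r) * P \<theta>r \<theta>r))
   (max (H \<gamma>1 \<theta>p) (max (1 / (1 - \<theta>p)) (H (1 / \<alpha>) (\<theta>p + \<theta>r) * P \<theta>p \<theta>r)))"
 define C where "C = max 1 (K * D)"
 have D: "1 / (1 - \<theta>r) + H \<gamma>2 \<theta>f * K <= D" "H (1 / \<alpha>) (\<theta>r + \<theta>r) * P \<theta>r \<theta>r <= D" "H \<gamma>1 \<theta>p <= D"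
  "1 / (1 - \<theta>p) <= D" "H (1 / \<alpha>) (\<theta>p + \<theta>r) * P \<theta>p \<theta>r <= D"
  by (auto simp: D_def)
 have C: "C \<ge> 1" "K * D <= C" by (auto simp: C_def)
 have D0: "D \<ge> 0" using D(4) r by (meson divide_nonneg_nonneg dual_order.trans diff_ge_0_iff_ge less_imp_le zero_le_one)
 \<comment> \<open>Chosen so that \<open>C * x\<close> equals 1/2 for the radius \<open>x\<close>
   below; the quadratic terms then take up half of \<open>x\<close> and half of
   \<open>y\<close>.\<close>
 define \<epsilon> where "\<epsilon> = 1 / (8 * C\<^sup>2 * (1 + C))"
 have \<epsilon>: "\<epsilon> > 0" using C by (simp add: \<epsilon>_def zero_less_power)
 \<comment> \<open>Radii of an invariant set. \<open>y\<close> is twice the temperature source;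
   \<open>x\<close> must also absorb the linear feed \<open>C * y\<close>, which is of order
   \<epsilon> as well, and this accounts for the factor 1 + C.\<close>
 define x y where "x = 4 * C * \<epsilon> * (1 + C)" and "y = 2 * C * \<epsilon>"
 have xy: "x > 0" "y > 0" using C \<epsilon> by (auto simp: x_def y_def)
 have Cx: "C * x = 1 / 2"
 proof -
  define Z where "Z = C\<^sup>2 * (1 + C)"
  have Z: "Z > 0" using C by (auto simp: Z_def intro!: mult_pos_pos zero_less_power)
  have "C * x = 4 * Z * \<epsilon>" by (simp add: x_def Z_def power2_eq_square algebra_simps)
  also have "\<epsilon> = 1 / (8 * Z)" by (simp add: \<epsilon>_def Z_def mult.assoc)
  finally show ?thesis using Z by simp
 qed
 have X: "K * (D * \<epsilon> + D * (x * x) + D * y) <= x"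
 proof -
  have "K * (D * \<epsilon> + D * (x * x) + D * y) = (K * D) * (\<epsilon> + x * x + y)" by (simp add: algebra_simps)
  also have "\<dots> <= C * (\<epsilon> + x * x + y)" using C xy \<epsilon> by (intro mult_right_mono) auto
  also have "\<dots> = C * \<epsilon> + (C * x) * x + C * y" by (simp add: algebra_simps)
  also have "\<dots> = C * \<epsilon> + x / 2 + 2 * C * (C * \<epsilon>)" by (simp add: Cx y_def)
  also have "\<dots> <= x" using C \<epsilon> by (simp add: x_def algebra_simps)
  finally show ?thesis .
 qed
 have Y: "K * (D * \<epsilon> + D * (y * x)) <= y"
 proof -
  have "K * (D * \<epsilon> + D * (y * x)) = (K * D) * (\<epsilon> + y * x)" by (simp add: algebra_simps)
  also have "\<dots> <= C * (\<epsilon> + y * x)" using C xy \<epsilon> by (intro mult_right_mono) auto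
  also have "\<dots> = C * \<epsilon> + y * (C * x)" by (simp add: algebra_simps)
  also have "\<dots> = y" by (simp add: Cx y_def)
  finally show ?thesis .
 qed
 define T where "T m = time_step K \<epsilon> \<alpha> \<theta>r \<theta>p \<gamma>1 \<gamma>2 m" for m
 have main: "lorentz_bound (1 - \<theta>r) (ennreal x) (fst ((T m ^^ n) (%_. 0, %_. 0))) \<and>
   lorentz_bound (1 - \<theta>p) (ennreal y) (snd ((T m ^^ n) (%_. 0, %_. 0))) \<and>
   fst ((T m ^^ n) (%_. 0, %_. 0)) \<in> borel_measurable borel \<and> snd ((T m ^^ n) (%_. 0, %_. 0)) \<in> borel_measurable borel"
  if mm [measurable]: "m \<in> borel_measurable borel" and mL: "lorentz_bound (1 - \<theta>f) (ennreal (K * \<epsilon>)) m" for m n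
 proof (induction n)
  case 0
  have "lorentz_bound \<kappa> A (%_::real. 0)" for \<kappa> A by (simp add: lorentz_bound_def)
  then show ?case by simp
 next
  case (Suc n)
  define v w where "v = fst ((T m ^^ n) (%_. 0, %_. 0))" and "w = snd ((T m ^^ n) (%_. 0, %_. 0))"
  have v: "lorentz_bound (1 - \<theta>r) (ennreal x) v" and w: "lorentz_bound (1 - \<theta>p) (ennreal y) w"
   and [measurable]: "v \<in> borel_measurable borel" "w \<in> borel_measurable borel" using Suc by (auto simp: v_def w_def)
  have P0: "0 <= P \<theta>r \<theta>r" "0 <= P \<theta>p \<theta>r" using r by (auto simp: P_def)
  have LV: "lorentz_bound (1 - (\<theta>r + \<theta>r)) (ennreal (P \<theta>r \<theta>r * (x * x))) (%s. v s * v s)"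
   unfolding P_def by (rule lorentz_bound_mult[OF _ _ r(1) r(1) r(3) xy(1) xy(1) v v]) measurable
  have LW: "lorentz_bound (1 - (\<theta>p + \<theta>r)) (ennreal (P \<theta>p \<theta>r * (y * x))) (%s. w s * v s)"
   unfolding P_def by (rule lorentz_bound_mult[OF _ _ r(5) r(1) r(4) xy(2) xy(1) w v]) measurable
  have e: "0 < 1 / \<alpha>" "0 < \<theta>r + \<theta>r" "1 < \<theta>r + \<theta>r + 1 / \<alpha>" "1 - \<theta>r = 2 - (\<theta>r + \<theta>r) - 1 / \<alpha>"
   "0 < \<theta>p + \<theta>r" "1 < \<theta>p + \<theta>r + 1 / \<alpha>" "1 - \<theta>p = 2 - (\<theta>p + \<theta>r) - 1 / \<alpha>"
   using a r \<theta>r by linarith+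
  have n: "0 <= P \<theta>r \<theta>r * (x * x)" "0 <= P \<theta>p \<theta>r * (y * x)" using P0 xy by auto
  have vv: "lorentz_bound (1 - \<theta>r) (ennreal (H (1 / \<alpha>) (\<theta>r + \<theta>r) * (P \<theta>r \<theta>r * (x * x)))) (riesz (1 / \<alpha>) (%s. v s * v s))"
   by (rule hls[OF e(1) a(2) e(2) r(3) e(3) n(1) _ LV e(4)]) measurable
  have wv: "lorentz_bound (1 - \<theta>p) (ennreal (H (1 / \<alpha>) (\<theta>p + \<theta>r) * (P \<theta>p \<theta>r * (y * x)))) (riesz (1 / \<alpha>) (%s. w s * v s))"
   by (rule hls[OF e(1) a(2) e(5) r(4) e(6) n(2) _ LW e(7)]) measurable
  have f: "1 < \<theta>p + \<gamma>1" "1 - \<theta>r = 2 - \<theta>p - \<gamma>1" "1 < \<theta>f + \<gamma>2" "1 - \<theta>r = 2 - \<theta>f - \<gamma>2"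
   using a \<theta>r \<gamma> by linarith+
  have w1: "lorentz_bound (1 - \<theta>r) (ennreal (H \<gamma>1 \<theta>p * y)) (riesz \<gamma>1 w)"
   by (rule hls[OF g(1,2) r(5,6) f(1) _ _ w f(2)]) (use xy in auto)
  have m1: "lorentz_bound (1 - \<theta>r) (ennreal (H \<gamma>2 \<theta>f * (K * \<epsilon>))) (riesz \<gamma>2 m)"
   by (rule hls[OF g(3,4) r(7) \<theta>f(2) f(3) _ _ mL f(4)]) (use K \<epsilon> in auto)
  have i1: "lorentz_bound (1 - \<theta>r) (ennreal (\<epsilon> / (1 - \<theta>r))) (%t. indicator {0<..} t * ennreal (\<epsilon> * t powr (- \<theta>r)))"
   and i2: "lorentz_bound (1 - \<theta>p) (ennreal (\<epsilon> / (1 - \<theta>p))) (%t. indicator {0<..} t * ennreal (\<epsilon> * t powr (- \<theta>p)))"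
   by (intro power_lorentz_bound; use r \<epsilon> in simp)+
  have Hs: "0 <= H (1 / \<alpha>) (\<theta>r + \<theta>r)" "0 <= H (1 / \<alpha>) (\<theta>p + \<theta>r)" "0 <= H \<gamma>1 \<theta>p" "0 <= H \<gamma>2 \<theta>f"
   by (rule H0[OF e(1) a(2) e(3)] H0[OF e(1) a(2) e(6)] H0[OF g(1,2) f(1)] H0[OF g(3,4) f(3)])+
  have sum1: "ennreal K * (ennreal (\<epsilon> / (1 - \<theta>r)) + ennreal (H (1 / \<alpha>) (\<theta>r + \<theta>r) * (P \<theta>r \<theta>r * (x * x))) + ennreal (H \<gamma>1 \<theta>p * y) + ennreal (H \<gamma>2 \<theta>f * (K * \<epsilon>))) <= ennreal x"
  proof -
   have "\<epsilon> / (1 - \<theta>r) + H (1 / \<alpha>) (\<theta>r + \<theta>r) * (P \<theta>r \<theta>r * (x * x)) + H \<gamma>1 \<theta>p * y + H \<gamma>2 \<theta>f * (K * \<epsilon>)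
    = (1 / (1 - \<theta>r) + H \<gamma>2 \<theta>f * K) * \<epsilon> + (H (1 / \<alpha>) (\<theta>r + \<theta>r) * P \<theta>r \<theta>r) * (x * x) + H \<gamma>1 \<theta>p * y"
    by (simp add: algebra_simps)
   also have "\<dots> <= D * \<epsilon> + D * (x * x) + D * y" using D xy \<epsilon> by (intro add_mono mult_right_mono) auto
   finally have "K * (\<epsilon> / (1 - \<theta>r) + H (1 / \<alpha>) (\<theta>r + \<theta>r) * (P \<theta>r \<theta>r * (x * x)) + H \<gamma>1 \<theta>p * y + H \<gamma>2 \<theta>f * (K * \<epsilon>)) <= x"
    using X K by (meson mult_left_mono less_imp_le order_trans)
   then show ?thesis using K Hs P0 xy \<epsilon> r
    by (simp add: ennreal_mult[symmetric] ennreal_plus[symmetric] ennreal_leI del: ennreal_plus)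
  qed
  have sum2: "ennreal K * (ennreal (\<epsilon> / (1 - \<theta>p)) + ennreal (H (1 / \<alpha>) (\<theta>p + \<theta>r) * (P \<theta>p \<theta>r * (y * x)))) <= ennreal y"
  proof -
   have "\<epsilon> / (1 - \<theta>p) + H (1 / \<alpha>) (\<theta>p + \<theta>r) * (P \<theta>p \<theta>r * (y * x))
    = (1 / (1 - \<theta>p)) * \<epsilon> + (H (1 / \<alpha>) (\<theta>p + \<theta>r) * P \<theta>p \<theta>r) * (y * x)"
    by (simp add: algebra_simps)
   also have "\<dots> <= D * \<epsilon> + D * (y * x)" using D xy \<epsilon> by (intro add_mono mult_right_mono) auto
   finally have "K * (\<epsilon> / (1 - \<theta>p) + H (1 / \<alpha>) (\<theta>p + \<theta>r) * (P \<theta>p \<theta>r * (y * x))) <= y"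
    using Y K by (meson mult_left_mono less_imp_le order_trans)
   then show ?thesis using K Hs P0 xy \<epsilon> r
    by (simp add: ennreal_mult[symmetric] ennreal_plus[symmetric] ennreal_leI del: ennreal_plus)
  qed
  have step: "(T m ^^ Suc n) (%_. 0, %_. 0) = T m (v, w)" by (simp add: v_def w_def)
  have "lorentz_bound (1 - \<theta>r) (ennreal x) (fst (T m (v, w)))"
   unfolding T_def time_step_def prod.case fst_conv
   by (rule lorentz_bound_mono[OF lorentz_bound_cmult[OF lorentz_bound_add[OF lorentz_bound_add[OF lorentz_bound_add[OF i1 vv] w1] m1]] sum1]) auto
  moreover have "lorentz_bound (1 - \<theta>p) (ennreal y) (snd (T m (v, w)))"
   unfolding T_def time_step_def prod.case snd_conv
   by (rule lorentz_bound_mono[OF lorentz_bound_cmult[OF lorentz_bound_add[OF i2 wv]] sum2]) auto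
  moreover have "fst (T m (v, w)) \<in> borel_measurable borel" "snd (T m (v, w)) \<in> borel_measurable borel"
   unfolding T_def time_step_def prod.case fst_conv snd_conv by measurable
  ultimately show ?case unfolding step by blast
 qed
 show ?thesis
 proof (rule exI[of _ \<epsilon>], rule conjI[OF \<epsilon>], rule exI[of _ "max x y"], intro conjI allI impI)
  fix m :: "real => ennreal" and n :: nat assume m: "m \<in> borel_measurable borel" "lorentz_bound (1 - \<theta>f) (ennreal (K * \<epsilon>)) m"
  have le: "ennreal x <= ennreal (max x y)" "ennreal y <= ennreal (max x y)" by (auto intro: ennreal_leI)
  note M = main[OF m, of n, unfolded T_def]
  show "lorentz_bound (1 - \<theta>r) (ennreal (max x y)) (fst ((time_step K \<epsilon> \<alpha> \<theta>r \<theta>p \<gamma>1 \<gamma>2 m ^^ n) (%_. 0, %_. 0)))"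
   using M by (intro lorentz_bound_mono[OF conjunct1[OF M] le(1)]) simp
  show "lorentz_bound (1 - \<theta>p) (ennreal (max x y)) (snd ((time_step K \<epsilon> \<alpha> \<theta>r \<theta>p \<gamma>1 \<gamma>2 m ^^ n) (%_. 0, %_. 0)))"
   using M by (intro lorentz_bound_mono[OF conjunct1[OF conjunct2[OF M]] le(2)]) simp
 qed (use \<epsilon> xy in auto)
qed

section \<open>Fourier symbols and bounds for the Duhamel terms\<close>

text \<open>The time interval is built in as an indicator, so Duhamel integrals run over the whole
  line and integrals can be exchanged without moving limits.\<close>

definition heat_kernel :: "real => real => real => real^'d => real" where
 "heat_kernel \<alpha> t s \<xi> = indicator {0<..<t} s * exp (- (t - s) * norm \<xi> powr \<alpha>)"

text \<open>The multiplier of the Leray projector. Since division by zero gives 0 it is the identity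
  matrix at the origin, a null point.\<close>

definition leray_symbol :: "'d => 'd => real^'d => complex" where
 "leray_symbol i l \<xi> = (if i = l then 1 else 0) - of_real (\<xi> $ i * \<xi> $ l / (norm \<xi>)\<^sup>2)"

text \<open>The component \<open>Some i\<close> stands for \<open>u\<^sub>i\<close> and \<open>None\<close> for \<open>\<theta>\<close>.\<close>

definition quad_symbol :: "'d option => 'd option => 'd option => real^'d => complex" where
 "quad_symbol c b b' \<xi> = (case (c, b, b') of
   (Some i, Some l, Some j) => - (leray_symbol i l \<xi> * (\<i> * of_real (\<xi> $ j))) / (2 * pi) ^ CARD('d)
  | (None, None, Some j) => - (\<i> * of_real (\<xi> $ j)) / (2 * pi) ^ CARD('d)
  | _ => 0)"

definition lin_symbol :: "'d::{finite,linorder} option => 'd option => (real, 'd) vec => complex" where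
 "lin_symbol c b \<xi> = (case (c, b) of (Some i, None) => leray_symbol i (Max UNIV) \<xi> | _ => 0)"

lemma leray_symbol_bound: "norm (leray_symbol i l \<xi>) <= 2"
proof -
 have "\<bar>\<xi> $ i * \<xi> $ l / (norm \<xi>)\<^sup>2\<bar> <= 1"
 proof (cases "\<xi> = 0")
  case False
  have "\<bar>\<xi> $ i\<bar> * \<bar>\<xi> $ l\<bar> <= norm \<xi> * norm \<xi>"
   by (intro mult_mono component_le_norm_cart) auto
  then show ?thesis using False by (simp add: abs_mult power2_eq_square divide_le_eq)
 qed simp
 then have "norm (complex_of_real (\<xi> $ i * \<xi> $ l / (norm \<xi>)\<^sup>2)) <= 1" by (simp only: norm_of_real)
 moreover have "norm ((if i = l then 1 else 0) :: complex) <= 1" by simp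
 ultimately show ?thesis unfolding leray_symbol_def
  by (intro order_trans[OF norm_triangle_ineq4]) linarith
qed

lemma quad_symbol_bound: "norm (quad_symbol c b b' \<xi>) <= 2 * norm \<xi>" for \<xi> :: "real^'d"
proof -
 have pi1: "1 <= (2 * pi) ^ CARD('d)" using pi_gt3 by (intro one_le_power) linarith
 have *: "norm (- z / (complex_of_real (2 * pi)) ^ CARD('d)) <= norm z" for z
 proof -
  have "norm z / (2 * pi) ^ CARD('d) <= norm z / 1" using pi1 by (intro divide_left_mono) auto
  then show ?thesis by (simp add: norm_divide norm_power norm_mult)
 qed
 have x: "norm (\<i> * of_real (\<xi> $ j)) <= norm \<xi>" for j using component_le_norm_cart[of \<xi> j] by (simp add: norm_mult)
 have y: "norm (leray_symbol i l \<xi> * (\<i> * of_real (\<xi> $ j))) <= 2 * norm \<xi>" for i l j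
  unfolding norm_mult[of "leray_symbol i l \<xi>"] by (intro mult_mono leray_symbol_bound x) auto
 have z: "norm (\<i> * of_real (\<xi> $ j)) <= 2 * norm \<xi>" for j using x[of j] norm_ge_zero[of \<xi>] by linarith
 show ?thesis unfolding quad_symbol_def
  using order_trans[OF *[of "leray_symbol i l \<xi> * (\<i> * of_real (\<xi> $ j))" for i l j] y] order_trans[OF *[of "\<i> * of_real (\<xi> $ j)" for j] z]
  by (cases c; cases b; cases b') auto
qed

lemma lin_symbol_bound: "norm (lin_symbol c b \<xi>) <= 2"
 unfolding lin_symbol_def using leray_symbol_bound by (auto split: option.splits)

lemma leray_symbol_measurable [measurable]: "leray_symbol i l \<in> borel_measurable borel"
 unfolding leray_symbol_def[abs_def] by measurable

lemma quad_symbol_measurable [measurable]: "quad_symbol c b b' \<in> borel_measurable borel"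
 unfolding quad_symbol_def[abs_def] by (cases c; cases b; cases b'; simp; measurable)

lemma lin_symbol_measurable [measurable]: "lin_symbol c b \<in> borel_measurable borel"
 unfolding lin_symbol_def[abs_def] by (cases c; cases b; simp; measurable)

lemma leray_symbol_uminus: "leray_symbol i l (- \<xi>) = cnj (leray_symbol i l \<xi>)"
 by (simp add: leray_symbol_def)

lemma quad_symbol_uminus: "quad_symbol c b b' (- \<xi>) = cnj (quad_symbol c b b' \<xi>)"
 by (cases c; cases b; cases b') (simp_all add: quad_symbol_def leray_symbol_uminus)

lemma lin_symbol_uminus: "lin_symbol c b (- \<xi>) = cnj (lin_symbol c b \<xi>)"
 by (cases c; cases b) (simp_all add: lin_symbol_def leray_symbol_uminus)

lemma heat_kernel_measurable [measurable (raw)]: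
 assumes [measurable]: "f \<in> borel_measurable M" "g \<in> borel_measurable M" "h \<in> borel_measurable M"
 shows "(%x. heat_kernel \<alpha> (f x) (g x) (h x :: real^'d)) \<in> borel_measurable M"
 unfolding heat_kernel_def by measurable

lemma heat_kernel_nonneg: "0 <= heat_kernel \<alpha> t s \<xi>"
 by (simp add: heat_kernel_def)

text \<open>With y = (t-s)^(1/\<alpha>) |\<xi>| the claim becomes y <= exp(y^\<alpha>), which for y
  > 1 uses \<alpha> >= 1. Uniformly in frequency, one derivative costs (t-s)^(-1/\<alpha>).\<close>

lemma heat_kernel_derivative_bound:
 assumes "1 <= \<alpha>"
 shows "heat_kernel \<alpha> t s \<xi> * norm \<xi> <= indicator {0<..<t} s * (t - s) powr (- (1 / \<alpha>))"
proof (cases "0 < s \<and> s < t")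
 case True
 define r where "r = (t - s) powr (1 / \<alpha>)"
 have r: "r > 0" using True by (simp add: r_def)
 define y where "y = r * norm \<xi>"
 have y0: "y \<ge> 0" using r by (simp add: y_def)
 have "y <= exp (y powr \<alpha>)"
 proof (cases "y <= 1")
  case True
  also have "1 <= exp (y powr \<alpha>)" by simp
  finally show ?thesis .
 next
  case False
  then have "y powr 1 <= y powr \<alpha>" using assms by (intro powr_mono) auto
  then have "y <= y powr \<alpha>" using y0 by simp
  then show ?thesis using exp_ge_add_one_self[of "y powr \<alpha>"] by linarith
 qed
 then have "exp (- (y powr \<alpha>)) * y <= exp (- (y powr \<alpha>)) * exp (y powr \<alpha>)" by (intro mult_left_mono) auto
 also have "\<dots> = 1" by (simp add: exp_add[symmetric])
 finally have le: "exp (- (y powr \<alpha>)) * y <= 1" .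
 have "y powr \<alpha> = (t - s) * norm \<xi> powr \<alpha>"
  using assms True by (simp add: y_def r_def powr_mult powr_powr)
 then have e: "- (t - s) * norm \<xi> powr \<alpha> = - (y powr \<alpha>)" by (simp only: mult_minus_left)
 have "exp (- (t - s) * norm \<xi> powr \<alpha>) * norm \<xi> * r <= 1" unfolding e using le by (simp add: y_def mult_ac)
 then have "exp (- (t - s) * norm \<xi> powr \<alpha>) * norm \<xi> <= 1 / r" using r by (simp add: pos_le_divide_eq)
 also have "1 / r = (t - s) powr (- (1 / \<alpha>))" by (simp add: r_def powr_minus_divide)
 finally show ?thesis using True by (simp add: heat_kernel_def)
qed (auto simp: heat_kernel_def)

text \<open>At fixed \<open>s\<close> the derivative bound removes the frequency from the kernel,
  the convolution inequality treats the product, and Minkowski's inequality collects the times. The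
  case \<kappa> = 0 serves the velocity, the other the temperature.\<close>

lemma quad_term_bound:
 fixes W W' :: "real \<times> (real^'d) => ennreal"
 assumes \<alpha>: "1 <= \<alpha>" and [measurable]: "W \<in> borel_measurable (borel \<Otimes>\<^sub>M borel)" "W' \<in> borel_measurable (borel \<Otimes>\<^sub>M borel)" "p \<in> borel_measurable borel" "p' \<in> borel_measurable borel"
  and W: "\<And>s. lorentz_bound \<kappa> (p s) (%\<xi>. W (s, \<xi>))" and W': "\<And>s. lorentz_bound 0 (p' s) (%\<xi>. W' (s, \<xi>))"
 shows "lorentz_bound \<kappa> (2 * riesz (1 / \<alpha>) (%s. p s * p' s) t)
  (%\<xi>. \<integral>\<^sup>+z. ennreal (norm (of_real (heat_kernel \<alpha> t (fst z) \<xi>) * quad_symbol c b b' \<xi>)) * (W (fst z, \<xi> - snd z) * W' z) \<partial>(lborel \<Otimes>\<^sub>M lborel))"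
proof -
 define H where "H s \<xi> = (\<integral>\<^sup>+\<eta>. ennreal (norm (of_real (heat_kernel \<alpha> t s \<xi>) * quad_symbol c b b' \<xi>)) * (W (s, \<xi> - \<eta>) * W' (s, \<eta>)) \<partial>lborel)" for s \<xi>
 have Hm: "(%(s, \<xi>). H s \<xi>) \<in> borel_measurable (borel \<Otimes>\<^sub>M borel)"
  unfolding H_def split_beta'
  by (rule sigma_finite_measure.borel_measurable_nn_integral[OF sigma_finite_lborel]) (simp add: split_beta', measurable)
 have eq: "(\<integral>\<^sup>+z. ennreal (norm (of_real (heat_kernel \<alpha> t (fst z) \<xi>) * quad_symbol c b b' \<xi>)) * (W (fst z, \<xi> - snd z) * W' z) \<partial>(lborel \<Otimes>\<^sub>M lborel)) = (\<integral>\<^sup>+s. H s \<xi> \<partial>lborel)" for \<xi>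
  unfolding H_def
  by (subst lborel.nn_integral_fst[symmetric]) auto
 have "lorentz_bound \<kappa> (\<integral>\<^sup>+s. 2 * (indicator {0<..<t} s * ennreal ((t - s) powr (- (1 / \<alpha>))) * (p s * p' s)) \<partial>lborel) (%\<xi>. \<integral>\<^sup>+s. H s \<xi> \<partial>lborel)"
 proof (rule lorentz_bound_nn_integral[OF Hm])
  fix s
  let ?c = "2 * (indicator {0<..<t} s * ennreal ((t - s) powr (- (1 / \<alpha>))))"
  have L: "lorentz_bound \<kappa> (?c * (p s * p' s)) (%\<xi>. ?c * (\<integral>\<^sup>+\<eta>. W (s, \<xi> - \<eta>) * W' (s, \<eta>) \<partial>lborel))"
   by (intro lorentz_bound_cmult lorentz_bound_convolution W W') measurable
  show "lorentz_bound \<kappa> (2 * (indicator {0<..<t} s * ennreal ((t - s) powr (- (1 / \<alpha>))) * (p s * p' s))) (H s)"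
  proof (rule lorentz_bound_mono[OF L])
   show "AE \<xi> in lborel. H s \<xi> <= ?c * (\<integral>\<^sup>+\<eta>. W (s, \<xi> - \<eta>) * W' (s, \<eta>) \<partial>lborel)"
   proof (rule AE_I2)
    fix \<xi> :: "(real^'d)"
    have "norm (of_real (heat_kernel \<alpha> t s \<xi>) * quad_symbol c b b' \<xi>) <= 2 * (indicator {0<..<t} s * (t - s) powr (- (1 / \<alpha>)))" for \<eta>
    proof -
     have "norm (of_real (heat_kernel \<alpha> t s \<xi>) * quad_symbol c b b' \<xi>) = heat_kernel \<alpha> t s \<xi> * norm (quad_symbol c b b' \<xi>)"
      by (simp add: norm_mult heat_kernel_nonneg)
     also have "\<dots> <= heat_kernel \<alpha> t s \<xi> * (2 * norm \<xi>)" by (intro mult_left_mono quad_symbol_bound heat_kernel_nonneg)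
     also have "\<dots> <= 2 * (indicator {0<..<t} s * (t - s) powr (- (1 / \<alpha>)))"
      using heat_kernel_derivative_bound[OF \<alpha>, of t s \<xi>] by simp
     finally show ?thesis .
    qed
    then have "ennreal (norm (of_real (heat_kernel \<alpha> t s \<xi>) * quad_symbol c b b' \<xi>)) <= ennreal (2 * (indicator {0<..<t} s * (t - s) powr (- (1 / \<alpha>))))" for \<eta>
     by (rule ennreal_leI)
    moreover have "ennreal (2 * (indicator {0<..<t} s * (t - s) powr (- (1 / \<alpha>)))) = ?c"
     by (auto simp: ennreal_mult split: split_indicator)
    ultimately have q: "ennreal (norm (of_real (heat_kernel \<alpha> t s \<xi>) * quad_symbol c b b' \<xi>)) <= ?c" for \<eta> by simp
    have "H s \<xi> <= (\<integral>\<^sup>+\<eta>. ?c * (W (s, \<xi> - \<eta>) * W' (s, \<eta>)) \<partial>lborel)"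
     unfolding H_def by (intro nn_integral_mono mult_right_mono q) auto
    also have "\<dots> = ?c * (\<integral>\<^sup>+\<eta>. W (s, \<xi> - \<eta>) * W' (s, \<eta>) \<partial>lborel)"
     by (rule nn_integral_cmult) measurable
    finally show "H s \<xi> <= ?c * (\<integral>\<^sup>+\<eta>. W (s, \<xi> - \<eta>) * W' (s, \<eta>) \<partial>lborel)" .
   qed
  qed (simp add: mult_ac)
 qed measurable
 moreover have "(\<integral>\<^sup>+s. 2 * (indicator {0<..<t} s * ennreal ((t - s) powr (- (1 / \<alpha>))) * (p s * p' s)) \<partial>lborel) = 2 * riesz (1 / \<alpha>) (%s. p s * p' s) t"
  unfolding riesz_def by (rule nn_integral_cmult) measurable
 ultimately show ?thesis unfolding eq by (simp only:)
qed

text \<open>Unlike in the quadratic term the exponential stays under the frequency integral: it is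
  what brings \<open>W\<close> from its own space into \<open>L^1\<close>.\<close>

lemma linear_term_bound:
 fixes W :: "real \<times> (real^'d) => ennreal" and g :: "(real^'d) => ennreal"
 assumes [measurable]: "W \<in> borel_measurable (borel \<Otimes>\<^sub>M borel)" "p \<in> borel_measurable borel" "g \<in> borel_measurable borel"
  and W: "\<And>s \<tau>. 0 < \<tau> ==> (\<integral>\<^sup>+\<xi>. ennreal (exp (- \<tau> * norm \<xi> powr \<alpha>)) * W (s, \<xi>) \<partial>lborel) <= C * p s * ennreal (\<tau> powr (- \<gamma>))"
  and g: "\<And>\<xi>. g \<xi> <= 2"
 shows "lorentz_bound 0 (2 * C * riesz \<gamma> p t)
  (%\<xi>. \<integral>\<^sup>+s. ennreal (heat_kernel \<alpha> t s \<xi>) * g \<xi> * W (s, \<xi>) \<partial>lborel)"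
proof -
 have "lorentz_bound 0 (\<integral>\<^sup>+s. (2 * C) * (indicator {0<..<t} s * ennreal ((t - s) powr (- \<gamma>)) * p s) \<partial>lborel)
   (%\<xi>. \<integral>\<^sup>+s. ennreal (heat_kernel \<alpha> t s \<xi>) * g \<xi> * W (s, \<xi>) \<partial>lborel)"
 proof (rule lorentz_bound_nn_integral)
  fix s
  show "lorentz_bound 0 ((2 * C) * (indicator {0<..<t} s * ennreal ((t - s) powr (- \<gamma>)) * p s)) (%\<xi>. ennreal (heat_kernel \<alpha> t s \<xi>) * g \<xi> * W (s, \<xi>))"
  proof (subst lorentz_bound_0_iff)
   show "(\<integral>\<^sup>+\<xi>. ennreal (heat_kernel \<alpha> t s \<xi>) * g \<xi> * W (s, \<xi>) \<partial>lborel) <= (2 * C) * (indicator {0<..<t} s * ennreal ((t - s) powr (- \<gamma>)) * p s)"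
   proof (cases "0 < s \<and> s < t")
    case True
    have "(\<integral>\<^sup>+\<xi>. ennreal (heat_kernel \<alpha> t s \<xi>) * g \<xi> * W (s, \<xi>) \<partial>lborel) <= (\<integral>\<^sup>+\<xi>. 2 * (ennreal (exp (- (t - s) * norm \<xi> powr \<alpha>)) * W (s, \<xi>)) \<partial>lborel)"
    proof (intro nn_integral_mono)
     fix \<xi> :: "(real^'d)"
     have "g \<xi> * (ennreal (exp (- (t - s) * norm \<xi> powr \<alpha>)) * W (s, \<xi>)) <= 2 * (ennreal (exp (- (t - s) * norm \<xi> powr \<alpha>)) * W (s, \<xi>))"
      by (intro mult_right_mono g) auto
     then show "ennreal (heat_kernel \<alpha> t s \<xi>) * g \<xi> * W (s, \<xi>) <= 2 * (ennreal (exp (- (t - s) * norm \<xi> powr \<alpha>)) * W (s, \<xi>))"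
      using True by (simp add: heat_kernel_def mult_ac)
    qed
    also have "\<dots> = 2 * (\<integral>\<^sup>+\<xi>. ennreal (exp (- (t - s) * norm \<xi> powr \<alpha>)) * W (s, \<xi>) \<partial>lborel)"
     by (rule nn_integral_cmult) measurable
    also have "\<dots> <= 2 * (C * p s * ennreal ((t - s) powr (- \<gamma>)))" using True by (intro mult_left_mono W) auto
    finally show ?thesis using True by (simp add: mult_ac)
   qed (auto simp: heat_kernel_def)
  qed measurable
 qed (simp_all add: split_beta')
 moreover have "(\<integral>\<^sup>+s. (2 * C) * (indicator {0<..<t} s * ennreal ((t - s) powr (- \<gamma>)) * p s) \<partial>lborel) = 2 * C * riesz \<gamma> p t"
  unfolding riesz_def by (rule nn_integral_cmult) measurable
 ultimately show ?thesis by (simp only:)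
qed

section \<open>The Boussinesq system as an instance of the scheme\<close>

text \<open>\<open>a0\<close>, \<open>b0\<close> and \<open>F\<close> are the transforms of initial
  velocity, initial temperature and force, as honest functions; those of the force depend on the
  pair of time and frequency.\<close>

locale boussinesq =
 fixes \<alpha> :: real and a0 :: "'d::{finite,linorder} => (real, 'd) vec => complex" and b0 :: "(real, 'd) vec => complex"
  and F :: "'d => real \<times> (real, 'd) vec => complex"
 assumes data_measurable [measurable]: "\<And>i. a0 i \<in> borel_measurable borel" "b0 \<in> borel_measurable borel"
   "\<And>i. F i \<in> borel_measurable (borel \<Otimes>\<^sub>M borel)"
  and \<alpha>1: "1 < \<alpha>"
begin

definition qker :: "'d option => 'd option => 'd option => real \<times> (real, 'd) vec => real \<times> (real, 'd) vec => complex" where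
 "qker c b b' x z = of_real (heat_kernel \<alpha> (fst x) (fst z) (snd x)) * quad_symbol c b b' (snd x)"

definition lker :: "'d option => 'd option => real \<times> (real, 'd) vec => real => complex" where
 "lker c b x s = of_real (heat_kernel \<alpha> (fst x) s (snd x)) * lin_symbol c b (snd x)"

definition force :: "'d => real \<times> (real, 'd) vec => complex" where
 "force i z = (\<Sum>l\<in>UNIV. leray_symbol i l (snd z) * F l z)"

text \<open>The Duhamel integral of the force counts as datum because it does not involve the
  unknowns. At nonpositive times everything is 0.\<close>

definition data :: "'d option => real \<times> (real, 'd) vec => complex" where
 "data c x = (case c of
   Some i => of_real (indicator {0<..} (fst x) * exp (- fst x * norm (snd x) powr \<alpha>)) * a0 i (snd x)
    + (LINT s|lborel. of_real (heat_kernel \<alpha> (fst x) s (snd x)) * force i (s, snd x))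
  | None => of_real (indicator {0<..} (fst x) * exp (- fst x * norm (snd x) powr \<alpha>)) * b0 (snd x))"

definition data_maj :: "'d option => real \<times> (real, 'd) vec => ennreal" where
 "data_maj c x = (case c of
   Some i => ennreal (indicator {0<..} (fst x) * exp (- fst x * norm (snd x) powr \<alpha>)) * ennreal (norm (a0 i (snd x)))
    + (\<integral>\<^sup>+s. ennreal (heat_kernel \<alpha> (fst x) s (snd x)) * ennreal (norm (force i (s, snd x))) \<partial>lborel)
  | None => ennreal (indicator {0<..} (fst x) * exp (- fst x * norm (snd x) powr \<alpha>)) * ennreal (norm (b0 (snd x))))"

lemma force_measurable [measurable]: "force i \<in> borel_measurable (borel \<Otimes>\<^sub>M borel)"
 unfolding force_def[abs_def] by measurable

lemma data_measurable' [measurable]: "data c \<in> borel_measurable (borel \<Otimes>\<^sub>M borel)"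
proof -
 have "(%x. LINT s|lborel. complex_of_real (heat_kernel \<alpha> (fst x) s (snd x)) * force i (s, snd x)) \<in> borel_measurable (borel \<Otimes>\<^sub>M borel)" for i
  by (rule sigma_finite_measure.borel_measurable_lebesgue_integral[OF sigma_finite_lborel]) (simp add: split_beta', measurable)
 then show ?thesis unfolding data_def[abs_def] by (cases c) simp_all
qed

lemma data_maj_measurable [measurable]: "data_maj c \<in> borel_measurable (borel \<Otimes>\<^sub>M borel)"
proof -
 have "(%x. \<integral>\<^sup>+s. ennreal (heat_kernel \<alpha> (fst x) s (snd x)) * ennreal (norm (force i (s, snd x))) \<partial>lborel) \<in> borel_measurable (borel \<Otimes>\<^sub>M borel)" for i
  by (rule sigma_finite_measure.borel_measurable_nn_integral[OF sigma_finite_lborel]) (simp add: split_beta', measurable)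
 then show ?thesis unfolding data_maj_def[abs_def] by (cases c) simp_all
qed

text \<open>Without integrability the left side is 0, by the convention for the Bochner
  integral.\<close>

lemma norm_integral_le: "ennreal (norm (LINT s|M. f s)) <= (\<integral>\<^sup>+s. ennreal (norm (f s)) \<partial>M)"
 for f :: "'x => complex"
 by (cases "integrable M f") (auto simp: not_integrable_integral_eq intro: integral_norm_bound_ennreal)

lemma data_le: "ennreal (norm (data c x)) <= data_maj c x"
proof (cases c)
 case None
 then show ?thesis by (simp add: data_def data_maj_def norm_mult ennreal_mult)
next
 case (Some i)
 let ?a = "complex_of_real (indicator {0<..} (fst x) * exp (- fst x * norm (snd x) powr \<alpha>)) * a0 i (snd x)"
 let ?b = "LINT s|lborel. of_real (heat_kernel \<alpha> (fst x) s (snd x)) * force i (s, snd x)"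
 have "ennreal (norm (?a + ?b)) <= ennreal (norm ?a) + ennreal (norm ?b)"
  by (simp add: ennreal_plus[symmetric] ennreal_leI norm_triangle_ineq del: ennreal_plus)
 also have "\<dots> <= ennreal (norm ?a) + (\<integral>\<^sup>+s. ennreal (norm (of_real (heat_kernel \<alpha> (fst x) s (snd x)) * force i (s, snd x))) \<partial>lborel)"
  by (intro add_left_mono norm_integral_le)
 also have "\<dots> = data_maj c x"
  by (simp add: Some data_maj_def norm_mult ennreal_mult heat_kernel_nonneg)
 finally show ?thesis by (simp add: Some data_def)
qed

text \<open>The bilinear term integrates over pairs (s, \<eta>), with its factors at (s, \<xi> -
  \<eta>) and (s, \<eta>); the linear term integrates over \<open>s\<close> at unchanged frequency.
  Causality sits in the kernels.\<close>

sublocale majorant "borel \<Otimes>\<^sub>M borel :: (real \<times> (real, 'd) vec) measure" "lborel \<Otimes>\<^sub>M lborel :: (real \<times> (real, 'd) vec) measure" "lborel :: real measure"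
 qker "%x z. (fst z, snd x - snd z)" "%x z. z" lker "%x s. (s, snd x)" data data_maj
proof
 have S: "sets ((borel \<Otimes>\<^sub>M borel) \<Otimes>\<^sub>M (lborel \<Otimes>\<^sub>M lborel) :: ((real \<times> (real, 'd) vec) \<times> (real \<times> (real, 'd) vec)) measure)
   = sets ((borel \<Otimes>\<^sub>M borel) \<Otimes>\<^sub>M (borel \<Otimes>\<^sub>M borel))"
  by (intro sets_pair_measure_cong sets_lborel refl)
 show "(%(x, z). qker c b b' x z) \<in> borel_measurable ((borel \<Otimes>\<^sub>M borel) \<Otimes>\<^sub>M (lborel \<Otimes>\<^sub>M lborel))" for c b b'
  unfolding qker_def split_beta' measurable_cong_sets[OF S refl] by measurable
 show "(%(x, z). (fst z, snd x - snd z)) \<in> (borel \<Otimes>\<^sub>M borel) \<Otimes>\<^sub>M (lborel \<Otimes>\<^sub>M lborel) \<rightarrow>\<^sub>M (borel \<Otimes>\<^sub>M borel :: (real \<times> (real, 'd) vec) measure)"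
  unfolding split_beta' measurable_cong_sets[OF S refl] by measurable
 show "(%(x, z). z) \<in> (borel \<Otimes>\<^sub>M borel) \<Otimes>\<^sub>M (lborel \<Otimes>\<^sub>M lborel) \<rightarrow>\<^sub>M (borel \<Otimes>\<^sub>M borel :: (real \<times> (real, 'd) vec) measure)"
  unfolding split_beta' measurable_cong_sets[OF S refl] by measurable
 show "(%(x, s). lker c b x s) \<in> borel_measurable ((borel \<Otimes>\<^sub>M borel) \<Otimes>\<^sub>M lborel)" for c b
  unfolding lker_def split_beta' by measurable
 show "(%(x, s). (s, snd x)) \<in> (borel \<Otimes>\<^sub>M borel) \<Otimes>\<^sub>M lborel \<rightarrow>\<^sub>M (borel \<Otimes>\<^sub>M borel :: (real \<times> (real, 'd) vec) measure)"
  unfolding split_beta' by measurable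
qed (auto simp: data_le space_pair_measure)

end

lemma time_step_mono:
 assumes "\<And>s. fst p s <= fst p' s" "\<And>s. snd p s <= snd p' s"
 shows "fst (time_step K \<epsilon> \<alpha> \<theta>r \<theta>p \<gamma>1 \<gamma>2 m p) s <= fst (time_step K \<epsilon> \<alpha> \<theta>r \<theta>p \<gamma>1 \<gamma>2 m p') s"
  "snd (time_step K \<epsilon> \<alpha> \<theta>r \<theta>p \<gamma>1 \<gamma>2 m p) s <= snd (time_step K \<epsilon> \<alpha> \<theta>r \<theta>p \<gamma>1 \<gamma>2 m p') s"
 using assms unfolding time_step_def split_beta fst_conv snd_conv
 by (intro mult_left_mono add_mono riesz_mono mult_mono order_refl; simp)+

lemma lorentz_bound_zero: "lorentz_bound \<kappa> A (%_. 0)"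
 by (simp add: lorentz_bound_def)

text \<open>Abstract constants separate the iteration from the function spaces. \<open>K1\<close>
  and \<open>K2\<close> concern the heat flow of the initial data, \<open>K3\<close> and
  \<open>K4\<close> the smoothing of temperature and force into \<open>L^1\<close>,
  \<open>K5\<close> and \<open>K6\<close> finiteness against a polynomial weight; \<open>T1\<close>
  and \<open>T2\<close> keep the scalar iterates bounded. The size of \<open>K\<close> pays for the
  number of index combinations in \<open>maj\<close>.\<close>

locale boussinesq_bounds = boussinesq \<alpha> a0 b0 F
 for \<alpha> :: real and a0 :: "'d::{finite,linorder} => (real, 'd) vec => complex" and b0 F +
 fixes \<kappa> \<theta>r \<theta>p \<theta>f \<gamma>1 \<gamma>2 c1 c2 K \<epsilon> R Rm :: real and m :: "real => ennreal"
 assumes m_measurable [measurable]: "m \<in> borel_measurable borel"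
  and K1: "\<And>i t. 0 < t ==> (\<integral>\<^sup>+\<xi>. ennreal (exp (- t * norm \<xi> powr \<alpha>)) * ennreal (norm (a0 i \<xi>)) \<partial>lborel) <= ennreal (c1 * (\<epsilon> * t powr (- \<theta>r)))"
  and K2: "\<And>t. 0 < t ==> lorentz_bound \<kappa> (ennreal (c1 * (\<epsilon> * t powr (- \<theta>p)))) (%\<xi>. ennreal (exp (- t * norm \<xi> powr \<alpha>)) * ennreal (norm (b0 \<xi>)))"
  and K3: "\<And>(h :: (real, 'd) vec => ennreal) A \<tau>. h \<in> borel_measurable borel ==> 0 < \<tau> ==> lorentz_bound \<kappa> A h ==>
    (\<integral>\<^sup>+\<xi>. ennreal (exp (- \<tau> * norm \<xi> powr \<alpha>)) * h \<xi> \<partial>lborel) <= ennreal c1 * A * ennreal (\<tau> powr (- \<gamma>1))"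
  and K4: "\<And>l s \<tau>. 0 < \<tau> ==> (\<integral>\<^sup>+\<xi>. ennreal (exp (- \<tau> * norm \<xi> powr \<alpha>)) * ennreal (norm (F l (s, \<xi>))) \<partial>lborel) <= ennreal c1 * m s * ennreal (\<tau> powr (- \<gamma>2))"
  and K5: "\<And>(h :: (real, 'd) vec => ennreal) A. h \<in> borel_measurable borel ==> lorentz_bound \<kappa> A h ==>
    (\<integral>\<^sup>+\<xi>. ennreal (1 / (1 + norm \<xi>) ^ (CARD('d) + 1)) * h \<xi> \<partial>lborel) <= ennreal c2 * A"
  and K6: "\<And>l s. (\<integral>\<^sup>+\<xi>. ennreal (1 / (1 + norm \<xi>) ^ (CARD('d) + 1)) * ennreal (norm (F l (s, \<xi>))) \<partial>lborel) <= ennreal c2 * m s"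
  and c: "0 < c1" "1 <= c2" "0 < \<epsilon>" "0 < R" and K: "2 * (real CARD('d) + real CARD('d option))\<^sup>2 * (c1 + 1) <= K"
  and T1: "\<And>n. lorentz_bound (1 - \<theta>r) (ennreal R) (fst ((time_step K \<epsilon> \<alpha> \<theta>r \<theta>p \<gamma>1 \<gamma>2 m ^^ n) (%_. 0, %_. 0)))"
  and T2: "\<And>n. lorentz_bound (1 - \<theta>p) (ennreal R) (snd ((time_step K \<epsilon> \<alpha> \<theta>r \<theta>p \<gamma>1 \<gamma>2 m ^^ n) (%_. 0, %_. 0)))"
  and T3: "lorentz_bound (1 - \<theta>f) (ennreal Rm) m"
  and \<theta>s: "0 < \<theta>r" "\<theta>r + \<theta>r < 1" "0 < \<theta>p" "\<theta>p + \<theta>r < 1"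
begin

definition tv :: "nat => real => ennreal" where "tv n = fst ((time_step K \<epsilon> \<alpha> \<theta>r \<theta>p \<gamma>1 \<gamma>2 m ^^ n) (%_. 0, %_. 0))"
definition tw :: "nat => real => ennreal" where "tw n = snd ((time_step K \<epsilon> \<alpha> \<theta>r \<theta>p \<gamma>1 \<gamma>2 m ^^ n) (%_. 0, %_. 0))"
definition tx :: "'d option => nat => real => ennreal" where "tx c n = (case c of Some _ => tv n | None => tw n)"
definition kap :: "'d option => real" where "kap c = (case c of Some _ => 0 | None => \<kappa>)"

lemma tv_Suc: "tv (Suc n) t = ennreal K * (indicator {0<..} t * ennreal (\<epsilon> * t powr (- \<theta>r)) + riesz (1 / \<alpha>) (%s. tv n s * tv n s) t + riesz \<gamma>1 (tw n) t + riesz \<gamma>2 m t)"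
 and tw_Suc: "tw (Suc n) t = ennreal K * (indicator {0<..} t * ennreal (\<epsilon> * t powr (- \<theta>p)) + riesz (1 / \<alpha>) (%s. tw n s * tv n s) t)"
 by (simp_all add: tv_def tw_def time_step_def split_beta)

lemma tvw_measurable: "tv n \<in> borel_measurable borel \<and> tw n \<in> borel_measurable borel"
proof (induction n)
 case 0
 then show ?case by (simp add: tv_def tw_def)
next
 case (Suc n)
 then have [measurable]: "tv n \<in> borel_measurable borel" "tw n \<in> borel_measurable borel" by auto
 show ?case unfolding tv_Suc[abs_def] tw_Suc[abs_def] by (intro conjI) measurable
qed

lemma tv_measurable [measurable]: "tv n \<in> borel_measurable borel"
 and tw_measurable [measurable]: "tw n \<in> borel_measurable borel"
 and tx_measurable [measurable]: "tx c n \<in> borel_measurable borel"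
 using tvw_measurable by (auto simp: tx_def split: option.splits)

lemma tx_mono: "tx c n s <= tx c (Suc n) s"
proof -
 have "tv n s <= tv (Suc n) s \<and> tw n s <= tw (Suc n) s" for s
 proof (induction n arbitrary: s)
  case 0
  then show ?case by (simp add: tv_def tw_def)
 next
  case (Suc n)
  then show ?case unfolding tv_def tw_def funpow.simps comp_def by (intro conjI time_step_mono) auto
 qed
 then show ?thesis by (auto simp: tx_def split: option.splits)
qed

text \<open>Links the two iterations by simultaneous induction over all components. It holds at each
  single time without averaging, so the scalar values on the right may be infinite at some
  times.\<close>

lemma majs_bound: "lorentz_bound (kap c) (tx c n t) (%\<xi>. majs n c (t, \<xi>))"
proof (induction n arbitrary: c t)
 case 0
 have "lorentz_bound (kap c) (tx c 0 t) (%\<xi>. 0)" by (rule lorentz_bound_zero)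
 then show ?case by (simp add: majs_0)
next
 case (Suc n)
 have sec [measurable]: "(%\<xi>. f (t, \<xi>)) \<in> borel_measurable borel" if "f \<in> borel_measurable (borel \<Otimes>\<^sub>M borel)" for f :: "real \<times> (real, 'd) vec => ennreal" and t
  using measurable_Pair2[OF that, of t] by simp
 let ?D0 = "real CARD('d)" and ?D1 = "real CARD('d option)"
 have D1: "?D1 \<ge> 1" by (simp add: Suc_leI)
 have D0: "?D0 \<ge> 1" by (simp add: Suc_leI)
 have sq: "?D0 <= (?D0 + ?D1)\<^sup>2" "?D1 <= (?D0 + ?D1)\<^sup>2" "?D1 * ?D1 <= (?D0 + ?D1)\<^sup>2" "1 <= (?D0 + ?D1)\<^sup>2"
 proof -
  have "?D0 * 1 <= ?D0 * ?D0" "?D1 * 1 <= ?D1 * ?D1" using D0 D1 by (intro mult_left_mono; simp)+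
  moreover have "0 <= ?D0 * ?D1" by simp
  moreover have "(?D0 + ?D1)\<^sup>2 = ?D0 * ?D0 + 2 * (?D0 * ?D1) + ?D1 * ?D1" by (simp add: power2_eq_square algebra_simps)
  ultimately show "?D0 <= (?D0 + ?D1)\<^sup>2" "?D1 <= (?D0 + ?D1)\<^sup>2" "?D1 * ?D1 <= (?D0 + ?D1)\<^sup>2" "1 <= (?D0 + ?D1)\<^sup>2"
   using D0 D1 by linarith+
 qed
 \<comment> \<open>These account for the initial data, the \<open>?D0\<close> force components, the
   \<open>?D1\<close> squared bilinear terms with constant 2, and the \<open>?D1\<close> linear
   terms.\<close>
 have Kb: "c1 <= K" "2 * (?D0 * c1) <= K" "?D1 * (?D1 * 2) <= K" "?D1 * (2 * c1) <= K"
 proof -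
  have e: "2 * (?D0 + ?D1)\<^sup>2 * (c1 + 1) = 2 * ((?D0 + ?D1)\<^sup>2 * c1) + 2 * (?D0 + ?D1)\<^sup>2" by (simp add: algebra_simps)
  have "?D0 * c1 <= (?D0 + ?D1)\<^sup>2 * c1" "?D1 * c1 <= (?D0 + ?D1)\<^sup>2 * c1" "1 * c1 <= (?D0 + ?D1)\<^sup>2 * c1"
   using sq c by (intro mult_right_mono; simp)+
  moreover have "0 <= (?D0 + ?D1)\<^sup>2" by simp
  moreover have "0 < c1" using c by simp
  ultimately show "c1 <= K" "2 * (?D0 * c1) <= K" "?D1 * (?D1 * 2) <= K" "?D1 * (2 * c1) <= K"
   using K sq unfolding e by linarith+
 qed
 have K0: "0 <= K" using Kb c by linarith
 \<comment> \<open>In every nonzero bilinear symbol the first factor is of the same kind as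
   \<open>c\<close> and the second is a velocity component, hence \<open>tx c\<close> and
   \<open>tv\<close>.\<close>
 define QB where "QB c = 2 * riesz (1 / \<alpha>) (%s. tx c n s * tv n s) t" for c
 define LB where "LB c = (case c of Some (_ :: 'd) => 2 * ennreal c1 * riesz \<gamma>1 (tw n) t | None => 0)" for c
 have IH: "lorentz_bound 0 (tv n s) (%\<xi>. majs n (Some j) (s, \<xi>))" "lorentz_bound \<kappa> (tw n s) (%\<xi>. majs n None (s, \<xi>))" for s j
  using Suc[of "Some j" s] Suc[of None s] by (simp_all add: kap_def tx_def)
 let ?Q = "%c b b' \<xi>. \<integral>\<^sup>+z. ennreal (norm (qker c b b' (t, \<xi>) z)) * (majs n b (fst z, snd (t, \<xi>) - snd z) * majs n b' z) \<partial>(lborel \<Otimes>\<^sub>M lborel)"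
 let ?L = "%c b \<xi>. \<integral>\<^sup>+s. ennreal (norm (lker c b (t, \<xi>) s)) * majs n b (s, snd (t, \<xi>)) \<partial>lborel"
 have Qz: "lorentz_bound (kap c) (QB c) (?Q c b b')" if "\<And>\<xi>. quad_symbol c b b' \<xi> = 0" for c b b'
  using that by (simp add: qker_def lorentz_bound_zero)
 have Q: "lorentz_bound (kap c) (QB c) (?Q c b b')" for c b b'
 proof (cases c)
  case None
  show ?thesis
  proof (cases "\<exists>j. b = None \<and> b' = Some j")
   case True
   then obtain j where "b = None" "b' = Some j" by auto
   then show ?thesis
    using quad_term_bound[of \<alpha> "majs n None" "majs n (Some j)" "tw n" "tv n" \<kappa> t None None "Some j"] \<alpha>1 IH None
    by (simp add: QB_def tx_def kap_def qker_def)
  next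
   case False
   then show ?thesis by (intro Qz) (cases b; cases b'; simp add: None quad_symbol_def)
  qed
 next
  case (Some i)
  show ?thesis
  proof (cases "\<exists>l j. b = Some l \<and> b' = Some j")
   case True
   then obtain l j where "b = Some l" "b' = Some j" by auto
   then show ?thesis
    using quad_term_bound[of \<alpha> "majs n (Some l)" "majs n (Some j)" "tv n" "tv n" 0 t "Some i" "Some l" "Some j"] \<alpha>1 IH Some
    by (simp add: QB_def tx_def kap_def qker_def)
  next
   case False
   then show ?thesis by (intro Qz) (cases b; cases b'; simp add: Some quad_symbol_def)
  qed
 qed
 have L: "lorentz_bound (kap c) (LB c) (?L c b)" for c b
 proof (cases "\<exists>i. c = Some i \<and> b = None")
  case True
  then obtain i where cb: "c = Some i" "b = None" by auto
  have "lorentz_bound 0 (2 * ennreal c1 * riesz \<gamma>1 (tw n) t)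
   (%\<xi>. \<integral>\<^sup>+s. ennreal (heat_kernel \<alpha> t s \<xi>) * ennreal (norm (lin_symbol (Some i) None \<xi>)) * majs n None (s, \<xi>) \<partial>lborel)"
  proof (rule linear_term_bound)
   show "(\<integral>\<^sup>+\<xi>. ennreal (exp (- \<tau> * norm \<xi> powr \<alpha>)) * majs n None (s, \<xi>) \<partial>lborel) <= ennreal c1 * tw n s * ennreal (\<tau> powr (- \<gamma>1))" if "0 < \<tau>" for s \<tau>
    by (rule K3) (use that IH in auto)
   show "ennreal (norm (lin_symbol (Some i) None \<xi>)) <= 2" for \<xi> :: "(real, 'd) vec"
    using ennreal_leI[OF lin_symbol_bound[of "Some i" None \<xi>]] by simp
  qed auto
  then show ?thesis by (simp add: cb LB_def kap_def lker_def norm_mult ennreal_mult heat_kernel_nonneg)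
 next
  case False
  then have "lin_symbol c b \<xi> = 0" for \<xi> by (cases c; cases b) (auto simp: lin_symbol_def)
  then show ?thesis by (simp add: lker_def lorentz_bound_zero)
 qed
 have dat: "lorentz_bound (kap c) (case c of Some (_ :: 'd) => ennreal c1 * (indicator {0<..} t * ennreal (\<epsilon> * t powr (- \<theta>r))) + 2 * (ennreal ?D0 * ennreal c1) * riesz \<gamma>2 m t
   | None => ennreal c1 * (indicator {0<..} t * ennreal (\<epsilon> * t powr (- \<theta>p)))) (%\<xi>. data_maj c (t, \<xi>))" for c
 proof (cases c)
  case None
  show ?thesis
  proof (cases "0 < t")
   case True
   then show ?thesis using K2[of t] c by (simp add: None kap_def data_maj_def ennreal_mult)
  qed (simp add: None kap_def data_maj_def lorentz_bound_zero)
 next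
  case (Some i)
  have 1: "lorentz_bound 0 (ennreal c1 * (indicator {0<..} t * ennreal (\<epsilon> * t powr (- \<theta>r)))) (%\<xi>. ennreal (indicator {0<..} t * exp (- t * norm \<xi> powr \<alpha>)) * ennreal (norm (a0 i \<xi>)))"
  proof (subst lorentz_bound_0_iff)
   show "(\<integral>\<^sup>+\<xi>. ennreal (indicator {0<..} t * exp (- t * norm \<xi> powr \<alpha>)) * ennreal (norm (a0 i \<xi>)) \<partial>lborel) <= ennreal c1 * (indicator {0<..} t * ennreal (\<epsilon> * t powr (- \<theta>r)))"
    using K1[of t i] c by (cases "0 < t") (auto simp: ennreal_mult)
  qed measurable
  let ?W = "%z. \<Sum>l\<in>UNIV. ennreal (norm (F l z))"
  have "lorentz_bound 0 (2 * (ennreal ?D0 * ennreal c1) * riesz \<gamma>2 m t) (%\<xi>. \<integral>\<^sup>+s. ennreal (heat_kernel \<alpha> t s \<xi>) * 2 * ?W (s, \<xi>) \<partial>lborel)"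
  proof (rule linear_term_bound)
   fix s \<tau> :: real assume \<tau>: "0 < \<tau>"
   have "(\<integral>\<^sup>+\<xi>. ennreal (exp (- \<tau> * norm \<xi> powr \<alpha>)) * ?W (s, \<xi>) \<partial>lborel) =
    (\<Sum>l\<in>UNIV. \<integral>\<^sup>+\<xi>. ennreal (exp (- \<tau> * norm \<xi> powr \<alpha>)) * ennreal (norm (F l (s, \<xi>))) \<partial>lborel)"
    unfolding sum_distrib_left by (rule nn_integral_sum) measurable
   also have "\<dots> <= (\<Sum>l\<in>(UNIV :: 'd set). ennreal c1 * m s * ennreal (\<tau> powr (- \<gamma>2)))" by (intro sum_mono K4 \<tau>)
   also have "\<dots> = ennreal ?D0 * ennreal c1 * m s * ennreal (\<tau> powr (- \<gamma>2))" by (simp add: mult.assoc ennreal_of_nat_eq_real_of_nat)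
   finally show "(\<integral>\<^sup>+\<xi>. ennreal (exp (- \<tau> * norm \<xi> powr \<alpha>)) * ?W (s, \<xi>) \<partial>lborel) <= ennreal ?D0 * ennreal c1 * m s * ennreal (\<tau> powr (- \<gamma>2))" .
  qed auto
  then have 2: "lorentz_bound 0 (2 * (ennreal ?D0 * ennreal c1) * riesz \<gamma>2 m t) (%\<xi>. \<integral>\<^sup>+s. ennreal (heat_kernel \<alpha> t s \<xi>) * ennreal (norm (force i (s, \<xi>))) \<partial>lborel)"
  proof (rule lorentz_bound_mono[OF _ order_refl])
   have f: "ennreal (norm (force i z)) <= 2 * ?W z" for z
   proof -
    have "norm (force i z) <= (\<Sum>l\<in>UNIV. norm (leray_symbol i l (snd z) * F l z))" unfolding force_def by (rule norm_sum)
    also have "\<dots> <= (\<Sum>l\<in>UNIV. 2 * norm (F l z))"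
     unfolding norm_mult by (intro sum_mono mult_right_mono leray_symbol_bound) auto
    finally have "ennreal (norm (force i z)) <= ennreal (2 * (\<Sum>l\<in>UNIV. norm (F l z)))" by (simp add: ennreal_leI sum_distrib_left)
    then show ?thesis by (simp add: ennreal_mult sum_nonneg sum_ennreal)
   qed
   show "AE \<xi> in lborel. (\<integral>\<^sup>+s. ennreal (heat_kernel \<alpha> t s \<xi>) * ennreal (norm (force i (s, \<xi>))) \<partial>lborel) <= (\<integral>\<^sup>+s. ennreal (heat_kernel \<alpha> t s \<xi>) * 2 * ?W (s, \<xi>) \<partial>lborel)"
    unfolding mult.assoc by (intro AE_I2 nn_integral_mono mult_left_mono f) auto
  qed
  have m2: "(%\<xi>. \<integral>\<^sup>+s. ennreal (heat_kernel \<alpha> t s \<xi>) * ennreal (norm (force i (s, \<xi>))) \<partial>lborel) \<in> borel_measurable borel" by measurable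
  show ?thesis using lorentz_bound_add[OF 1 2 _ m2] by (simp add: Some kap_def data_maj_def)
 qed
 have Qm': "(%\<xi>. \<integral>\<^sup>+z. ennreal (norm (qker c b b' (t, \<xi>) z)) * (f (fst z, \<xi> - snd z) * g z) \<partial>(lborel \<Otimes>\<^sub>M lborel)) \<in> borel_measurable borel"
  if [measurable]: "f \<in> borel_measurable (borel \<Otimes>\<^sub>M borel)" "g \<in> borel_measurable (lborel \<Otimes>\<^sub>M lborel)" for c b b' and f g :: "real \<times> (real, 'd) vec => ennreal"
  unfolding qker_def fst_conv snd_conv by measurable
 have s2: "sets (lborel \<Otimes>\<^sub>M lborel :: (real \<times> (real, 'd) vec) measure) = sets (borel \<Otimes>\<^sub>M borel)"
  by (intro sets_pair_measure_cong sets_lborel)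
 have Qm: "?Q c b b' \<in> borel_measurable borel" for c b b'
  using Qm'[of "majs n b" "majs n b'" c b b'] majs_measurable by (simp add: measurable_cong_sets[OF s2 refl])
 have Lm': "(%\<xi>. \<integral>\<^sup>+s. ennreal (norm (lker c b (t, \<xi>) s)) * f (s, \<xi>) \<partial>lborel) \<in> borel_measurable borel"
  if [measurable]: "f \<in> borel_measurable (borel \<Otimes>\<^sub>M borel)" for c b and f :: "real \<times> (real, 'd) vec => ennreal"
  unfolding lker_def fst_conv snd_conv by measurable
 have Lm: "?L c b \<in> borel_measurable borel" for c b
  using Lm'[of "majs n b" c b] majs_measurable by simp
 have dm: "(%\<xi>. data_maj c (t, \<xi>)) \<in> borel_measurable borel" by (rule sec) simp
 have T: "lorentz_bound (kap c) ((case c of Some (_ :: 'd) => ennreal c1 * (indicator {0<..} t * ennreal (\<epsilon> * t powr (- \<theta>r))) + 2 * (ennreal ?D0 * ennreal c1) * riesz \<gamma>2 m t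
   | None => ennreal c1 * (indicator {0<..} t * ennreal (\<epsilon> * t powr (- \<theta>p)))) + (\<Sum>b\<in>(UNIV :: 'd option set). \<Sum>b'\<in>(UNIV :: 'd option set). QB c) + (\<Sum>b\<in>(UNIV :: 'd option set). LB c))
   (%\<xi>. majs (Suc n) c (t, \<xi>))"
  unfolding majs_Suc maj_def
  by (intro lorentz_bound_add lorentz_bound_sum dat Q L borel_measurable_add borel_measurable_sum Qm Lm dm finite)
 have of: "of_nat CARD('d option) = ennreal ?D1" by (rule ennreal_of_nat_eq_real_of_nat)
 have two: "(2::ennreal) = ennreal 2" by simp
 show ?case
 proof (rule lorentz_bound_mono[OF T])
  show "(case c of Some (_ :: 'd) => ennreal c1 * (indicator {0<..} t * ennreal (\<epsilon> * t powr (- \<theta>r))) + 2 * (ennreal ?D0 * ennreal c1) * riesz \<gamma>2 m t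
   | None => ennreal c1 * (indicator {0<..} t * ennreal (\<epsilon> * t powr (- \<theta>p)))) + (\<Sum>b\<in>(UNIV :: 'd option set). \<Sum>b'\<in>(UNIV :: 'd option set). QB c) + (\<Sum>b\<in>(UNIV :: 'd option set). LB c)
   <= tx c (Suc n) t"
  proof -
   have k1: "ennreal c1 * x <= ennreal K * x" for x using Kb by (intro mult_right_mono ennreal_leI) auto
   have k2: "2 * (ennreal ?D0 * ennreal c1) * x <= ennreal K * x" for x
    unfolding two using Kb c by (intro mult_right_mono) (auto simp: ennreal_mult[symmetric] ennreal_leI simp del: ennreal_numeral)
   have k3: "(\<Sum>b\<in>(UNIV :: 'd option set). \<Sum>b'\<in>(UNIV :: 'd option set). 2 * x) <= ennreal K * x" for x
   proof -
    have "(\<Sum>b\<in>(UNIV :: 'd option set). \<Sum>b'\<in>(UNIV :: 'd option set). 2 * x) = (ennreal ?D1 * (ennreal ?D1 * ennreal 2)) * x"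
     by (simp only: sum_constant of two mult.assoc)
    also have "\<dots> <= ennreal K * x"
    proof (intro mult_right_mono)
     have "ennreal ?D1 * (ennreal ?D1 * ennreal 2) = ennreal (?D1 * (?D1 * 2))"
      by (simp only: ennreal_mult of_nat_0_le_iff mult_nonneg_nonneg zero_le_numeral)
     then show "ennreal ?D1 * (ennreal ?D1 * ennreal 2) <= ennreal K" using ennreal_leI[OF Kb(3)] by (simp only:)
    qed auto
    finally show ?thesis .
   qed
   have k4: "(\<Sum>b\<in>(UNIV :: 'd option set). 2 * ennreal c1 * x) <= ennreal K * x" for x
   proof -
    have "(\<Sum>b\<in>(UNIV :: 'd option set). 2 * ennreal c1 * x) = (ennreal ?D1 * (ennreal 2 * ennreal c1)) * x"
     by (simp only: sum_constant of two mult.assoc)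
    also have "\<dots> <= ennreal K * x"
    proof (intro mult_right_mono)
     have "ennreal ?D1 * (ennreal 2 * ennreal c1) = ennreal (?D1 * (2 * c1))"
      using c by (simp only: ennreal_mult of_nat_0_le_iff mult_nonneg_nonneg zero_le_numeral less_imp_le)
     then show "ennreal ?D1 * (ennreal 2 * ennreal c1) <= ennreal K" using ennreal_leI[OF Kb(4)] by (simp only:)
    qed auto
    finally show ?thesis .
   qed
   show ?thesis
   proof (cases c)
    case None
    have "ennreal c1 * (indicator {0<..} t * ennreal (\<epsilon> * t powr (- \<theta>p))) + (\<Sum>b\<in>(UNIV :: 'd option set). \<Sum>b'\<in>(UNIV :: 'd option set). 2 * riesz (1 / \<alpha>) (%s. tw n s * tv n s) t) <=
      ennreal K * (indicator {0<..} t * ennreal (\<epsilon> * t powr (- \<theta>p))) + ennreal K * riesz (1 / \<alpha>) (%s. tw n s * tv n s) t"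
     by (intro add_mono k1 k3)
    then show ?thesis by (simp only: None tx_def QB_def LB_def option.case tw_Suc distrib_left sum.neutral_const add_0_right)
   next
    case (Some i)
    have "ennreal c1 * (indicator {0<..} t * ennreal (\<epsilon> * t powr (- \<theta>r))) + 2 * (ennreal ?D0 * ennreal c1) * riesz \<gamma>2 m t
      + (\<Sum>b\<in>(UNIV :: 'd option set). \<Sum>b'\<in>(UNIV :: 'd option set). 2 * riesz (1 / \<alpha>) (%s. tv n s * tv n s) t) + (\<Sum>b\<in>(UNIV :: 'd option set). 2 * ennreal c1 * riesz \<gamma>1 (tw n) t) <=
      ennreal K * (indicator {0<..} t * ennreal (\<epsilon> * t powr (- \<theta>r))) + ennreal K * riesz \<gamma>2 m t
      + ennreal K * riesz (1 / \<alpha>) (%s. tv n s * tv n s) t + ennreal K * riesz \<gamma>1 (tw n) t"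
     by (intro add_mono k1 k2 k3 k4)
    then show ?thesis by (simp only: Some tx_def QB_def LB_def option.case tv_Suc distrib_left add_ac)
   qed
  qed
 qed simp
qed

definition ts :: "'d option => real => ennreal" where "ts c t = (SUP n. tx c n t)"
definition thc :: "'d option => real" where "thc c = (case c of Some _ => \<theta>r | None => \<theta>p)"

lemma ts_measurable [measurable]: "ts c \<in> borel_measurable borel"
 unfolding ts_def[abs_def] by measurable

lemma section_measurable' [measurable (raw)]: "f \<in> borel_measurable (borel \<Otimes>\<^sub>M borel) ==> (%\<xi>. f (t, \<xi>)) \<in> borel_measurable borel"
 for f :: "real \<times> (real, 'd) vec => ennreal" and t
 using measurable_Pair2[of f borel borel borel t] by simp

lemma maj_sol_bound: "lorentz_bound (kap c) (ts c t) (%\<xi>. maj_sol c (t, \<xi>))"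
 unfolding maj_sol_def
proof (rule lorentz_bound_SUP)
 show "lorentz_bound (kap c) (ts c t) (%\<xi>. majs n c (t, \<xi>))" for n
  by (rule lorentz_bound_mono[OF majs_bound]) (auto simp: ts_def intro: SUP_upper)
 show "incseq (%n \<xi>. majs n c (t, \<xi>))" by (intro incseq_SucI le_funI majs_mono)
qed (intro section_measurable' majs_measurable)

lemma ts_bound: "lorentz_bound (1 - thc c) (ennreal R) (ts c)"
 unfolding ts_def[abs_def]
proof (rule lorentz_bound_SUP)
 show "lorentz_bound (1 - thc c) (ennreal R) (%t. tx c n t)" for n
  using T1[of n] T2[of n] by (cases c) (simp_all add: thc_def tx_def tv_def tw_def)
 show "incseq (%n t. tx c n t)" by (intro incseq_SucI le_funI tx_mono)
qed measurable

end

section \<open>Finiteness of the majorant at every positive time\<close>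

lemma lorentz_bound_local_finite:
 fixes t :: real
 assumes [measurable]: "B \<in> borel_measurable borel" and L: "lorentz_bound \<kappa> (ennreal R) B"
 shows "(\<integral>\<^sup>+s. indicator {0<..<t} s * B s \<partial>lborel) < \<infinity>"
proof -
 have "(\<integral>\<^sup>+s. B s * indicator {0<..<t} s \<partial>lborel) <= ennreal R * ennreal (measure lborel {0<..<t} powr \<kappa>)"
  by (rule lorentz_boundD[OF L]) (cases "0 <= t"; simp)+
 also have "\<dots> < \<infinity>" by (simp add: ennreal_mult_less_top)
 finally show ?thesis by (simp add: mult.commute)
qed

lemma lorentz_bound_AE_finite:
 fixes B :: "'a::euclidean_space => ennreal"
 assumes [measurable]: "B \<in> borel_measurable borel" and L: "lorentz_bound \<kappa> (ennreal R) B"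
 shows "AE s in lborel. B s < \<infinity>"
proof -
 have "AE s in lborel. \<forall>n. B s * indicator (ball 0 (real n)) s \<noteq> \<infinity>"
  unfolding AE_all_countable
 proof
  fix n
  have "(\<integral>\<^sup>+s. B s * indicator (ball 0 (real n)) s \<partial>lborel) <= ennreal R * ennreal (measure lborel (ball (0::'a) (real n)) powr \<kappa>)"
   by (intro lorentz_boundD L emeasure_lborel_ball_finite) auto
  also have "\<dots> < \<infinity>" by (simp add: ennreal_mult_less_top)
  finally show "AE s in lborel. B s * indicator (ball 0 (real n)) s \<noteq> \<infinity>"
   by (intro nn_integral_PInf_AE) auto
 qed
 then show ?thesis
 proof eventually_elim
  case (elim s)
  obtain n where "norm s < real n" using reals_Archimedean2 by blast
  then show ?case using elim[rule_format, of n] by (simp add: less_top)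
 qed
qed

lemma weight_time_integral:
 fixes H :: "real \<times> 'a::euclidean_space => ennreal" and t :: real
 assumes [measurable]: "H \<in> borel_measurable (borel \<Otimes>\<^sub>M borel)" "w \<in> borel_measurable borel"
  and H: "\<And>s. (\<integral>\<^sup>+\<xi>. w \<xi> * H (s, \<xi>) \<partial>lborel) <= B s"
 shows "(\<integral>\<^sup>+\<xi>. w \<xi> * (\<integral>\<^sup>+s. indicator {0<..<t} s * H (s, \<xi>) \<partial>lborel) \<partial>lborel) <= (\<integral>\<^sup>+s. indicator {0<..<t} s * B s \<partial>lborel)"
proof -
 have "(\<integral>\<^sup>+\<xi>. w \<xi> * (\<integral>\<^sup>+s. indicator {0<..<t} s * H (s, \<xi>) \<partial>lborel) \<partial>lborel) =
  (\<integral>\<^sup>+\<xi>. (\<integral>\<^sup>+s. indicator {0<..<t} s * (w \<xi> * H (s, \<xi>)) \<partial>lborel) \<partial>lborel)"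
  by (intro nn_integral_cong, subst nn_integral_cmult[symmetric]) (auto simp: mult_ac)
 also have "\<dots> = (\<integral>\<^sup>+s. (\<integral>\<^sup>+\<xi>. indicator {0<..<t} s * (w \<xi> * H (s, \<xi>)) \<partial>lborel) \<partial>lborel)"
  by (rule lborel_pair.Fubini') measurable
 also have "\<dots> = (\<integral>\<^sup>+s. indicator {0<..<t} s * (\<integral>\<^sup>+\<xi>. w \<xi> * H (s, \<xi>) \<partial>lborel) \<partial>lborel)"
  by (intro nn_integral_cong nn_integral_cmult) measurable
 also have "\<dots> <= (\<integral>\<^sup>+s. indicator {0<..<t} s * B s \<partial>lborel)"
  by (intro nn_integral_mono mult_left_mono H) auto
 finally show ?thesis .
qed

definition weight :: "nat => 'a::real_normed_vector => ennreal" where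
 "weight N \<xi> = ennreal (1 / (1 + norm \<xi>) ^ N)"

lemma weight_measurable [measurable]: "(weight N :: 'a::euclidean_space => ennreal) \<in> borel_measurable borel"
 unfolding weight_def[abs_def] by measurable

lemma weight_Suc: "weight (Suc N) \<xi> <= weight N \<xi>" "weight (Suc N) \<xi> * ennreal (norm \<xi>) <= weight N \<xi>" "weight N \<xi> <= 1"
proof -
 have p: "1 + norm \<xi> > 0" by (simp add: add_pos_nonneg)
 have "(1 + norm \<xi>) ^ N <= (1 + norm \<xi>) ^ Suc N" by (intro power_increasing) auto
 then show "weight (Suc N) \<xi> <= weight N \<xi>" unfolding weight_def using p by (intro ennreal_leI divide_left_mono) auto
 have "1 <= (1 + norm \<xi>) ^ N" by (intro one_le_power) auto
 then show "weight N \<xi> <= 1" unfolding weight_def by (intro ennreal_le_1[THEN iffD2]) (simp add: divide_le_eq)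
 have "1 / (1 + norm \<xi>) ^ Suc N * norm \<xi> <= 1 / (1 + norm \<xi>) ^ Suc N * (1 + norm \<xi>)" by (intro mult_left_mono) auto
 also have "\<dots> = 1 / (1 + norm \<xi>) ^ N" using p by simp
 finally show "weight (Suc N) \<xi> * ennreal (norm \<xi>) <= weight N \<xi>"
  unfolding weight_def by (subst ennreal_mult[symmetric]) (auto intro: ennreal_leI)
qed

context boussinesq_bounds
begin

text \<open>\<open>w1\<close> makes the weak spaces integrable; \<open>w2\<close> has one power
  more, to absorb the factor |\<xi>| of the divergence.\<close>

abbreviation w1 :: "(real, 'd) vec => ennreal" where "w1 \<equiv> weight (CARD('d) + 1)"
abbreviation w2 :: "(real, 'd) vec => ennreal" where "w2 \<equiv> weight (Suc (CARD('d) + 1))"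

text \<open>The two kinds of component need different reasons: a weak bound consumes the decay of
  the weight, an \<open>L^1\<close> bound only uses that the weight is at most 1.\<close>

lemma w1_bound:
 assumes [measurable]: "h \<in> borel_measurable borel" and L: "lorentz_bound (kap c) A h"
 shows "(\<integral>\<^sup>+\<xi>. w1 \<xi> * h \<xi> \<partial>lborel) <= ennreal c2 * A"
proof (cases c)
 case None
 then show ?thesis using K5[OF assms(1), of A] L by (simp add: kap_def weight_def)
next
 case (Some i)
 have "(\<integral>\<^sup>+\<xi>. w1 \<xi> * h \<xi> \<partial>lborel) <= (\<integral>\<^sup>+\<xi>. 1 * h \<xi> \<partial>lborel)"
  by (intro nn_integral_mono mult_right_mono weight_Suc) auto
 also have "\<dots> <= 1 * A" using L by (simp add: Some kap_def lorentz_bound_0_iff)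
 also have "\<dots> <= ennreal c2 * A" using c by (intro mult_right_mono) auto
 finally show ?thesis .
qed

definition conv_maj :: "'d option => 'd option => real \<times> (real, 'd) vec => ennreal" where
 "conv_maj b b' z = (\<integral>\<^sup>+\<eta>. maj_sol b (fst z, snd z - \<eta>) * maj_sol b' (fst z, \<eta>) \<partial>lborel)"

lemma conv_maj_measurable [measurable]: "conv_maj b b' \<in> borel_measurable (borel \<Otimes>\<^sub>M borel)"
proof -
 have "(%z. \<integral>\<^sup>+\<eta>. f (fst z, snd z - \<eta>) * g (fst z, \<eta>) \<partial>lborel) \<in> borel_measurable (borel \<Otimes>\<^sub>M borel)"
  if [measurable]: "f \<in> borel_measurable (borel \<Otimes>\<^sub>M borel)" "g \<in> borel_measurable (borel \<Otimes>\<^sub>M borel)" for f g :: "real \<times> (real, 'd) vec => ennreal"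
  by measurable
 from this[OF maj_sol_measurable maj_sol_measurable] show ?thesis unfolding conv_maj_def[abs_def] .
qed

lemma conv_maj_bound: "(\<integral>\<^sup>+\<xi>. w1 \<xi> * conv_maj b (Some j) (s, \<xi>) \<partial>lborel) <= ennreal c2 * (ts b s * ts (Some j) s)"
proof (rule w1_bound)
 show "lorentz_bound (kap b) (ts b s * ts (Some j) s) (%\<xi>. conv_maj b (Some j) (s, \<xi>))"
  unfolding conv_maj_def fst_conv snd_conv
  by (rule lorentz_bound_convolution) (use maj_sol_bound[of b s] maj_sol_bound[of "Some j" s] in \<open>auto simp: kap_def intro!: section_measurable' maj_sol_measurable\<close>)
qed (intro section_measurable' conv_maj_measurable)

text \<open>The reciprocals of the two time exponents sum to less than 1, so the product lies in a
  weak space of exponent above 1 and is integrable down to time 0.\<close>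

lemma ts_product_finite: "(\<integral>\<^sup>+s. indicator {0<..<t} s * (ennreal c2 * (ts b s * ts (Some j) s)) \<partial>lborel) < \<infinity>"
proof -
 have "lorentz_bound (1 - (thc b + thc (Some j))) (ennreal (2 powr (thc b + thc (Some j)) / (1 - (thc b + thc (Some j))) * (R * R))) (%s. ts b s * ts (Some j) s)"
  by (rule lorentz_bound_mult[OF _ _ _ _ _ _ _ ts_bound ts_bound]) (use \<theta>s c in \<open>auto simp: thc_def split: option.splits\<close>)
 then have "(\<integral>\<^sup>+s. indicator {0<..<t} s * (ts b s * ts (Some j) s) \<partial>lborel) < \<infinity>"
  by (rule lorentz_bound_local_finite[rotated]) measurable
 then have "ennreal c2 * (\<integral>\<^sup>+s. indicator {0<..<t} s * (ts b s * ts (Some j) s) \<partial>lborel) < \<infinity>" by (simp add: ennreal_mult_less_top)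
 then show ?thesis by (subst (asm) nn_integral_cmult[symmetric]) (auto simp: mult_ac)
qed

lemma force_le: "ennreal (norm (force i z)) <= 2 * (\<Sum>l\<in>UNIV. ennreal (norm (F l z)))"
proof -
 have "norm (force i z) <= (\<Sum>l\<in>UNIV. norm (leray_symbol i l (snd z) * F l z))" unfolding force_def by (rule norm_sum)
 also have "\<dots> <= (\<Sum>l\<in>UNIV. 2 * norm (F l z))"
  unfolding norm_mult by (intro sum_mono mult_right_mono leray_symbol_bound) auto
 finally have "ennreal (norm (force i z)) <= ennreal (2 * (\<Sum>l\<in>UNIV. norm (F l z)))" by (simp add: ennreal_leI sum_distrib_left)
 then show ?thesis by (simp add: ennreal_mult sum_nonneg sum_ennreal)
qed

lemma force_weight: "(\<integral>\<^sup>+\<xi>. w1 \<xi> * ennreal (norm (force i (s, \<xi>))) \<partial>lborel) <= 2 * of_nat CARD('d) * ennreal c2 * m s"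
proof -
 have "(\<integral>\<^sup>+\<xi>. w1 \<xi> * ennreal (norm (force i (s, \<xi>))) \<partial>lborel) <= (\<integral>\<^sup>+\<xi>. 2 * (\<Sum>l\<in>UNIV. w1 \<xi> * ennreal (norm (F l (s, \<xi>)))) \<partial>lborel)"
 proof (intro nn_integral_mono)
  fix \<xi> :: "(real, 'd) vec"
  have "w1 \<xi> * ennreal (norm (force i (s, \<xi>))) <= w1 \<xi> * (2 * (\<Sum>l\<in>UNIV. ennreal (norm (F l (s, \<xi>)))))" by (intro mult_left_mono force_le) auto
  then show "w1 \<xi> * ennreal (norm (force i (s, \<xi>))) <= 2 * (\<Sum>l\<in>UNIV. w1 \<xi> * ennreal (norm (F l (s, \<xi>))))" by (simp add: sum_distrib_left mult_ac del: sum_ennreal)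
 qed
 also have "\<dots> = 2 * (\<Sum>l\<in>UNIV. \<integral>\<^sup>+\<xi>. w1 \<xi> * ennreal (norm (F l (s, \<xi>))) \<partial>lborel)"
  by (subst nn_integral_cmult, measurable, subst nn_integral_sum) auto
 also have "\<dots> <= 2 * (\<Sum>l\<in>(UNIV::'d set). ennreal c2 * m s)"
  unfolding weight_def by (intro mult_left_mono sum_mono K6) auto
 finally show ?thesis by (simp add: mult.assoc)
qed

lemma m_finite: "(\<integral>\<^sup>+s. indicator {0<..<t} s * (C * m s) \<partial>lborel) < \<infinity>" if "C < \<infinity>"
proof -
 have "C * (\<integral>\<^sup>+s. indicator {0<..<t} s * m s \<partial>lborel) < \<infinity>"
  using lorentz_bound_local_finite[OF m_measurable T3] that by (simp add: ennreal_mult_less_top)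
 then show ?thesis by (subst (asm) nn_integral_cmult[symmetric]) (auto simp: mult_ac)
qed

lemma ts_finite: "(\<integral>\<^sup>+s. indicator {0<..<t} s * (C * ts b s) \<partial>lborel) < \<infinity>" if "C < \<infinity>"
proof -
 have "C * (\<integral>\<^sup>+s. indicator {0<..<t} s * ts b s \<partial>lborel) < \<infinity>"
  using lorentz_bound_local_finite[OF ts_measurable ts_bound] that by (simp add: ennreal_mult_less_top)
 then show ?thesis by (subst (asm) nn_integral_cmult[symmetric]) (auto simp: mult_ac)
qed

lemma quad_majorant: "(\<integral>\<^sup>+z. ennreal (norm (qker c b b' (t, \<xi>) z)) * (maj_sol b (fst z, \<xi> - snd z) * maj_sol b' z) \<partial>(lborel \<Otimes>\<^sub>M lborel)) =
  (\<integral>\<^sup>+s. ennreal (heat_kernel \<alpha> t s \<xi>) * ennreal (norm (quad_symbol c b b' \<xi>)) * conv_maj b b' (s, \<xi>) \<partial>lborel)"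
proof -
 have "(\<integral>\<^sup>+z. ennreal (norm (qker c b b' (t, \<xi>) z)) * (f (fst z, \<xi> - snd z) * g z) \<partial>(lborel \<Otimes>\<^sub>M lborel)) =
  (\<integral>\<^sup>+s. ennreal (heat_kernel \<alpha> t s \<xi>) * ennreal (norm (quad_symbol c b b' \<xi>)) * (\<integral>\<^sup>+\<eta>. f (s, \<xi> - \<eta>) * g (s, \<eta>) \<partial>lborel) \<partial>lborel)"
  if [measurable]: "f \<in> borel_measurable (borel \<Otimes>\<^sub>M borel)" "g \<in> borel_measurable (borel \<Otimes>\<^sub>M borel)" for f g :: "real \<times> (real, 'd) vec => ennreal"
  by (subst lborel.nn_integral_fst[symmetric], simp add: qker_def, measurable)
   (intro nn_integral_cong, subst nn_integral_cmult[symmetric], auto simp: qker_def norm_mult ennreal_mult heat_kernel_nonneg)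
 from this[OF maj_sol_measurable maj_sol_measurable] show ?thesis by (simp add: conv_maj_def)
qed

text \<open>Although the time norms only control almost every time, the Duhamel formula makes the solution
 a tempered function at every positive time.\<close>

lemma maj_sol_weight:
 assumes t: "0 < t" shows "(\<integral>\<^sup>+\<xi>. w2 \<xi> * maj_sol c (t, \<xi>) \<partial>lborel) < \<infinity>"
proof -
 \<comment> \<open>At a fixed time the singular kernel (t-s)^(-1/\<alpha>) against weak norms may
   diverge. The heat kernel is therefore bounded by 1 only, and the frequency weight pays for the
   derivative.\<close>
 have hk: "ennreal (heat_kernel \<alpha> t s \<xi>) <= indicator {0<..<t} s" for s and \<xi> :: "(real, 'd) vec"
  by (auto simp: heat_kernel_def ennreal_le_1 intro!: mult_nonpos_nonneg split: split_indicator)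
 let ?Q = "%b b' \<xi>. \<integral>\<^sup>+z. ennreal (norm (qker c b b' (t, \<xi>) z)) * (maj_sol b (fst z, \<xi> - snd z) * maj_sol b' z) \<partial>(lborel \<Otimes>\<^sub>M lborel)"
 let ?L = "%b \<xi>. \<integral>\<^sup>+s. ennreal (norm (lker c b (t, \<xi>) s)) * maj_sol b (s, \<xi>) \<partial>lborel"
 have W2: "w2 \<xi> * x <= w1 \<xi> * x" for \<xi> x by (intro mult_right_mono weight_Suc) auto
 note Qeq = quad_majorant[of c _ _ t]
 have Q: "(\<integral>\<^sup>+\<xi>. w2 \<xi> * ?Q b b' \<xi> \<partial>lborel) < \<infinity>" for b b'
 proof (cases b')
  case None
  then have "quad_symbol c b b' \<xi> = 0" for \<xi> by (cases c; cases b) (auto simp: quad_symbol_def)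
  then show ?thesis unfolding Qeq by simp
 next
  case (Some j)
  have "(\<integral>\<^sup>+\<xi>. w2 \<xi> * ?Q b b' \<xi> \<partial>lborel) <= (\<integral>\<^sup>+\<xi>. 2 * (w1 \<xi> * (\<integral>\<^sup>+s. indicator {0<..<t} s * conv_maj b b' (s, \<xi>) \<partial>lborel)) \<partial>lborel)"
   unfolding Qeq
  proof (intro nn_integral_mono)
   fix \<xi> :: "(real, 'd) vec"
   have cm: "(%s. conv_maj b b' (s, \<xi>)) \<in> borel_measurable borel" using measurable_Pair1[OF conv_maj_measurable] by simp
   note [measurable] = cm
   have q: "ennreal (norm (quad_symbol c b b' \<xi>)) <= 2 * ennreal (norm \<xi>)"
    using ennreal_leI[OF quad_symbol_bound[of c b b' \<xi>]] by (simp add: ennreal_mult)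
   have "(\<integral>\<^sup>+s. ennreal (heat_kernel \<alpha> t s \<xi>) * ennreal (norm (quad_symbol c b b' \<xi>)) * conv_maj b b' (s, \<xi>) \<partial>lborel)
     <= (\<integral>\<^sup>+s. indicator {0<..<t} s * (2 * ennreal (norm \<xi>)) * conv_maj b b' (s, \<xi>) \<partial>lborel)"
    by (intro nn_integral_mono mult_mono hk q) auto
   also have "\<dots> = (\<integral>\<^sup>+s. (2 * ennreal (norm \<xi>)) * (indicator {0<..<t} s * conv_maj b b' (s, \<xi>)) \<partial>lborel)" by (simp add: mult_ac)
   also have "\<dots> = (2 * ennreal (norm \<xi>)) * (\<integral>\<^sup>+s. indicator {0<..<t} s * conv_maj b b' (s, \<xi>) \<partial>lborel)"
    by (rule nn_integral_cmult) measurable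
   finally have "w2 \<xi> * (\<integral>\<^sup>+s. ennreal (heat_kernel \<alpha> t s \<xi>) * ennreal (norm (quad_symbol c b b' \<xi>)) * conv_maj b b' (s, \<xi>) \<partial>lborel)
    <= w2 \<xi> * ((2 * ennreal (norm \<xi>)) * (\<integral>\<^sup>+s. indicator {0<..<t} s * conv_maj b b' (s, \<xi>) \<partial>lborel))" by (rule mult_left_mono) simp
   also have "\<dots> = 2 * ((w2 \<xi> * ennreal (norm \<xi>)) * (\<integral>\<^sup>+s. indicator {0<..<t} s * conv_maj b b' (s, \<xi>) \<partial>lborel))" by (simp add: mult_ac)
   also have "\<dots> <= 2 * (w1 \<xi> * (\<integral>\<^sup>+s. indicator {0<..<t} s * conv_maj b b' (s, \<xi>) \<partial>lborel))"
    by (intro mult_left_mono mult_right_mono weight_Suc) auto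
   finally show "w2 \<xi> * (\<integral>\<^sup>+s. ennreal (heat_kernel \<alpha> t s \<xi>) * ennreal (norm (quad_symbol c b b' \<xi>)) * conv_maj b b' (s, \<xi>) \<partial>lborel)
    <= 2 * (w1 \<xi> * (\<integral>\<^sup>+s. indicator {0<..<t} s * conv_maj b b' (s, \<xi>) \<partial>lborel))" .
  qed
  also have "\<dots> = 2 * (\<integral>\<^sup>+\<xi>. w1 \<xi> * (\<integral>\<^sup>+s. indicator {0<..<t} s * conv_maj b b' (s, \<xi>) \<partial>lborel) \<partial>lborel)"
   by (rule nn_integral_cmult) measurable
  also have "\<dots> <= 2 * (\<integral>\<^sup>+s. indicator {0<..<t} s * (ennreal c2 * (ts b s * ts (Some j) s)) \<partial>lborel)"
   unfolding Some by (intro mult_left_mono weight_time_integral conv_maj_bound) measurable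
  also have "\<dots> < \<infinity>" using ts_product_finite[of t b j] by (simp add: ennreal_mult_less_top)
  finally show ?thesis .
 qed
 have L: "(\<integral>\<^sup>+\<xi>. w2 \<xi> * ?L b \<xi> \<partial>lborel) < \<infinity>" for b
 proof -
  have "(\<integral>\<^sup>+\<xi>. w2 \<xi> * ?L b \<xi> \<partial>lborel) <= (\<integral>\<^sup>+\<xi>. w1 \<xi> * (\<integral>\<^sup>+s. indicator {0<..<t} s * (2 * maj_sol b (s, \<xi>)) \<partial>lborel) \<partial>lborel)"
  proof (intro nn_integral_mono order_trans[OF W2] mult_left_mono)
   fix s and \<xi> :: "(real, 'd) vec"
   have "ennreal (norm (lker c b (t, \<xi>) s)) <= indicator {0<..<t} s * 2"
    using mult_mono[OF hk[of s \<xi>] ennreal_leI[OF lin_symbol_bound[of c b \<xi>]]] by (simp add: lker_def norm_mult ennreal_mult heat_kernel_nonneg)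
   then show "ennreal (norm (lker c b (t, \<xi>) s)) * maj_sol b (s, \<xi>) <= indicator {0<..<t} s * (2 * maj_sol b (s, \<xi>))"
    unfolding mult.assoc[symmetric] by (rule mult_right_mono) simp
  qed auto
  also have "\<dots> <= (\<integral>\<^sup>+s. indicator {0<..<t} s * (2 * ennreal c2 * ts b s) \<partial>lborel)"
  proof (rule weight_time_integral)
   fix s
   have "(\<integral>\<^sup>+\<xi>. w1 \<xi> * (2 * maj_sol b (s, \<xi>)) \<partial>lborel) = 2 * (\<integral>\<^sup>+\<xi>. w1 \<xi> * maj_sol b (s, \<xi>) \<partial>lborel)"
    by (subst nn_integral_cmult[symmetric]) (auto simp: mult_ac intro!: borel_measurable_times section_measurable' maj_sol_measurable)
   also have "\<dots> <= 2 * (ennreal c2 * ts b s)"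
    by (intro mult_left_mono w1_bound[OF _ maj_sol_bound] section_measurable' maj_sol_measurable) auto
   finally show "(\<integral>\<^sup>+\<xi>. w1 \<xi> * (2 * maj_sol b (s, \<xi>)) \<partial>lborel) <= 2 * ennreal c2 * ts b s" by (simp add: mult.assoc)
  qed (use maj_sol_measurable in measurable)
  also have "\<dots> < \<infinity>" by (rule ts_finite) (simp add: ennreal_mult_less_top)
  finally show ?thesis .
 qed
 have D: "(\<integral>\<^sup>+\<xi>. w2 \<xi> * data_maj c (t, \<xi>) \<partial>lborel) < \<infinity>"
 proof (cases c)
  case None
  have "(\<integral>\<^sup>+\<xi>. w2 \<xi> * data_maj c (t, \<xi>) \<partial>lborel) <= (\<integral>\<^sup>+\<xi>. w1 \<xi> * (ennreal (exp (- t * norm \<xi> powr \<alpha>)) * ennreal (norm (b0 \<xi>))) \<partial>lborel)"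
   using t W2 by (intro nn_integral_mono) (simp add: None data_maj_def)
  also have "\<dots> <= ennreal c2 * ennreal (c1 * (\<epsilon> * t powr (- \<theta>p)))"
   using w1_bound[of _ None] K2[OF t] by (simp add: kap_def)
  also have "\<dots> < \<infinity>" by (simp add: ennreal_mult_less_top)
  finally show ?thesis .
 next
  case (Some i)
  have "(\<integral>\<^sup>+\<xi>. w2 \<xi> * data_maj c (t, \<xi>) \<partial>lborel) <= (\<integral>\<^sup>+\<xi>. ennreal (exp (- t * norm \<xi> powr \<alpha>)) * ennreal (norm (a0 i \<xi>))
     + w1 \<xi> * (\<integral>\<^sup>+s. indicator {0<..<t} s * ennreal (norm (force i (s, \<xi>))) \<partial>lborel) \<partial>lborel)"
  proof (intro nn_integral_mono)
   fix \<xi> :: "(real, 'd) vec"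
   have "w2 \<xi> * (ennreal (exp (- t * norm \<xi> powr \<alpha>)) * ennreal (norm (a0 i \<xi>))) <= 1 * (ennreal (exp (- t * norm \<xi> powr \<alpha>)) * ennreal (norm (a0 i \<xi>)))"
    by (intro mult_right_mono weight_Suc) auto
   moreover have "w2 \<xi> * (\<integral>\<^sup>+s. ennreal (heat_kernel \<alpha> t s \<xi>) * ennreal (norm (force i (s, \<xi>))) \<partial>lborel) <= w1 \<xi> * (\<integral>\<^sup>+s. indicator {0<..<t} s * ennreal (norm (force i (s, \<xi>))) \<partial>lborel)"
    by (intro order_trans[OF W2] mult_left_mono nn_integral_mono mult_right_mono hk) auto
   ultimately show "w2 \<xi> * data_maj c (t, \<xi>) <= ennreal (exp (- t * norm \<xi> powr \<alpha>)) * ennreal (norm (a0 i \<xi>)) + w1 \<xi> * (\<integral>\<^sup>+s. indicator {0<..<t} s * ennreal (norm (force i (s, \<xi>))) \<partial>lborel)"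
    using t by (simp add: Some data_maj_def distrib_left add_mono)
  qed
  also have "\<dots> = (\<integral>\<^sup>+\<xi>. ennreal (exp (- t * norm \<xi> powr \<alpha>)) * ennreal (norm (a0 i \<xi>)) \<partial>lborel)
     + (\<integral>\<^sup>+\<xi>. w1 \<xi> * (\<integral>\<^sup>+s. indicator {0<..<t} s * ennreal (norm (force i (s, \<xi>))) \<partial>lborel) \<partial>lborel)"
   by (rule nn_integral_add) measurable
  also have "\<dots> <= ennreal (c1 * (\<epsilon> * t powr (- \<theta>r))) + (\<integral>\<^sup>+s. indicator {0<..<t} s * (2 * of_nat CARD('d) * ennreal c2 * m s) \<partial>lborel)"
   by (intro add_mono K1 t weight_time_integral force_weight) measurable
  also have "\<dots> < \<infinity>"
   using m_finite[of "2 * of_nat CARD('d) * ennreal c2" t] by (simp add: ennreal_mult_less_top ennreal_of_nat_eq_real_of_nat)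
  finally show ?thesis .
 qed
 have dm: "(%\<xi>. data_maj c (t, \<xi>)) \<in> borel_measurable borel" by (intro section_measurable' data_maj_measurable)
 have Lm': "(%\<xi>. \<integral>\<^sup>+s. ennreal (norm (lker c b (t, \<xi>) s)) * f (s, \<xi>) \<partial>lborel) \<in> borel_measurable borel"
  if [measurable]: "f \<in> borel_measurable (borel \<Otimes>\<^sub>M borel)" for b and f :: "real \<times> (real, 'd) vec => ennreal"
  unfolding lker_def fst_conv snd_conv by measurable
 have Lm: "?L b \<in> borel_measurable borel" for b using Lm'[OF maj_sol_measurable] by simp
 have Qm': "(%\<xi>. \<integral>\<^sup>+s. ennreal (heat_kernel \<alpha> t s \<xi>) * ennreal (norm (quad_symbol c b b' \<xi>)) * f (s, \<xi>) \<partial>lborel) \<in> borel_measurable borel"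
  if [measurable]: "f \<in> borel_measurable (borel \<Otimes>\<^sub>M borel)" for b b' and f :: "real \<times> (real, 'd) vec => ennreal"
  by measurable
 have Qm: "?Q b b' \<in> borel_measurable borel" for b b' unfolding Qeq using Qm'[OF conv_maj_measurable] by simp
 note [measurable] = dm Lm Qm
 have "(\<integral>\<^sup>+\<xi>. w2 \<xi> * maj_sol c (t, \<xi>) \<partial>lborel) = (\<integral>\<^sup>+\<xi>. w2 \<xi> * data_maj c (t, \<xi>) + (\<Sum>b\<in>UNIV. \<Sum>b'\<in>UNIV. w2 \<xi> * ?Q b b' \<xi>) + (\<Sum>b\<in>UNIV. w2 \<xi> * ?L b \<xi>) \<partial>lborel)"
  by (subst maj_sol_eq) (simp add: maj_def distrib_left sum_distrib_left)
 also have "\<dots> = (\<integral>\<^sup>+\<xi>. w2 \<xi> * data_maj c (t, \<xi>) \<partial>lborel) + (\<Sum>b\<in>UNIV. \<Sum>b'\<in>UNIV. \<integral>\<^sup>+\<xi>. w2 \<xi> * ?Q b b' \<xi> \<partial>lborel) + (\<Sum>b\<in>UNIV. \<integral>\<^sup>+\<xi>. w2 \<xi> * ?L b \<xi> \<partial>lborel)"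
  by (simp add: nn_integral_add nn_integral_sum)
 also have "\<dots> < \<infinity>" using D Q L by (simp add: ennreal_sum_less_top)
 finally show ?thesis .
qed

end

section \<open>Transforms of the Duhamel terms and Hermitian symmetry\<close>

lemma tempered_fun_zero: "tempered_fun (%_. 0)"
 by (simp add: tempered_fun_def)

lemma tempered_fun_add:
 assumes f: "tempered_fun f" and g: "tempered_fun g"
 shows "tempered_fun (%\<xi>. f \<xi> + g \<xi>)"
proof -
 note [measurable] = tempered_fun_measurable[OF f] tempered_fun_measurable[OF g]
 obtain N where N: "(\<integral>\<^sup>+\<xi>. ennreal (1 / (1 + norm \<xi>) ^ N) * ennreal (norm (f \<xi>)) \<partial>lborel) < \<infinity>"
  using f by (auto simp: tempered_fun_def)
 obtain N' where N': "(\<integral>\<^sup>+\<xi>. ennreal (1 / (1 + norm \<xi>) ^ N') * ennreal (norm (g \<xi>)) \<partial>lborel) < \<infinity>"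
  using g by (auto simp: tempered_fun_def)
 have "(\<integral>\<^sup>+\<xi>. ennreal (1 / (1 + norm \<xi>) ^ (N + N')) * ennreal (norm (f \<xi> + g \<xi>)) \<partial>lborel) <=
  (\<integral>\<^sup>+\<xi>. ennreal (1 / (1 + norm \<xi>) ^ N) * ennreal (norm (f \<xi>)) + ennreal (1 / (1 + norm \<xi>) ^ N') * ennreal (norm (g \<xi>)) \<partial>lborel)"
 proof (intro nn_integral_mono)
  fix \<xi> :: "(real, 'a) vec"
  have w: "1 / (1 + norm \<xi>) ^ (N + N') <= 1 / (1 + norm \<xi>) ^ n" if "n <= N + N'" for n
   using that by (intro divide_left_mono power_increasing mult_pos_pos zero_less_power) (auto simp: add_pos_nonneg)
  have "1 / (1 + norm \<xi>) ^ (N + N') * norm (f \<xi> + g \<xi>) <= 1 / (1 + norm \<xi>) ^ (N + N') * (norm (f \<xi>) + norm (g \<xi>))"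
   by (intro mult_left_mono norm_triangle_ineq) auto
  also have "\<dots> <= 1 / (1 + norm \<xi>) ^ N * norm (f \<xi>) + 1 / (1 + norm \<xi>) ^ N' * norm (g \<xi>)"
   unfolding distrib_left by (intro add_mono mult_right_mono w) auto
  finally show "ennreal (1 / (1 + norm \<xi>) ^ (N + N')) * ennreal (norm (f \<xi> + g \<xi>)) <=
    ennreal (1 / (1 + norm \<xi>) ^ N) * ennreal (norm (f \<xi>)) + ennreal (1 / (1 + norm \<xi>) ^ N') * ennreal (norm (g \<xi>))"
   by (simp add: ennreal_mult[symmetric] ennreal_plus[symmetric] ennreal_leI del: ennreal_plus)
 qed
 also have "\<dots> < \<infinity>" using N N' by (simp add: nn_integral_add)
 finally show ?thesis unfolding tempered_fun_def by (intro conjI exI[of _ "N + N'"]) auto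
qed

lemma tempered_fun_sum: "finite I ==> (\<And>i. i \<in> I ==> tempered_fun (f i)) ==> tempered_fun (%\<xi>. \<Sum>i\<in>I. f i \<xi>)"
 by (induction I rule: finite_induct) (simp_all add: tempered_fun_zero tempered_fun_add)

lemma fourier_fun_leray:
 fixes \<psi> :: "'n::finite => 'n distr"
 assumes \<psi>: "\<And>l. fourier_fun (\<psi> l) (g l)" and g: "\<And>l. tempered_fun (g l)"
 shows "fourier_fun (leray \<psi> i) (%\<xi>. \<Sum>l\<in>UNIV. leray_symbol i l \<xi> * g l \<xi>)"
 unfolding leray_def
proof (rule fourier_fun_from_fourier)
 note [measurable] = tempered_fun_measurable[OF g] fhat_measurable[OF fourier_fun_imp_off0[OF \<psi>]]
 show "tempered_fun (%\<xi>. \<Sum>l\<in>UNIV. leray_symbol i l \<xi> * g l \<xi>)"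
 proof (intro tempered_fun_sum)
  fix l
  show "tempered_fun (%\<xi>. leray_symbol i l \<xi> * g l \<xi>)"
   by (rule tempered_fun_bound[OF g[of l], of _ 2 0])
    (measurable, auto simp: norm_mult intro!: mult_right_mono leray_symbol_bound)
 qed auto
 show "(%\<xi>. fhat (\<psi> i) \<xi> - of_real (\<xi> $ i) * (\<Sum>j\<in>UNIV. of_real (\<xi> $ j) * fhat (\<psi> j) \<xi>) / of_real ((norm \<xi>)\<^sup>2)) \<in> borel_measurable borel"
  by measurable
 have "AE \<xi> in lborel. \<forall>l\<in>UNIV. fhat (\<psi> l) \<xi> = g l \<xi>"
  by (intro AE_finite_allI fhat_AE \<psi>) auto
 then show "AE \<xi> in lborel. fhat (\<psi> i) \<xi> - of_real (\<xi> $ i) * (\<Sum>j\<in>UNIV. of_real (\<xi> $ j) * fhat (\<psi> j) \<xi>) / of_real ((norm \<xi>)\<^sup>2)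
   = (\<Sum>l\<in>UNIV. leray_symbol i l \<xi> * g l \<xi>)"
 proof eventually_elim
  case (elim \<xi>)
  have "(\<Sum>l\<in>UNIV. leray_symbol i l \<xi> * g l \<xi>) = (\<Sum>l\<in>UNIV. (if i = l then 1 else 0) * g l \<xi>) - (\<Sum>l\<in>UNIV. of_real (\<xi> $ i * \<xi> $ l / (norm \<xi>)\<^sup>2) * g l \<xi>)"
   by (simp add: leray_symbol_def left_diff_distrib sum_subtractf)
  also have "(\<Sum>l\<in>UNIV. (if i = l then 1 else 0) * g l \<xi>) = g i \<xi>" by (simp add: if_distrib[of "%x. x * _"] cong: if_cong)
  also have "(\<Sum>l\<in>UNIV. of_real (\<xi> $ i * \<xi> $ l / (norm \<xi>)\<^sup>2) * g l \<xi>) = of_real (\<xi> $ i) * (\<Sum>l\<in>UNIV. of_real (\<xi> $ l) * g l \<xi>) / of_real ((norm \<xi>)\<^sup>2)"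
   by (simp add: sum_distrib_left sum_divide_distrib mult_ac)
  finally show ?case using elim by simp
 qed
qed

text \<open>The time integrals are taken with respect to Lebesgue measure, of integrands known only
  almost everywhere; completeness of the measure supplies their measurability.\<close>

lemma lebesgue_measurable_AE:
 assumes g: "g \<in> borel_measurable lborel" and AE: "AE x in lborel. f x = g x"
 shows "f \<in> borel_measurable lebesgue"
proof (rule borel_measurableI)
 fix S :: "'b set" assume S: "open S"
 have "g -` S \<inter> space lborel \<in> sets lborel" using g S by (intro measurable_sets) auto
 then have G: "g -` S \<inter> space lborel \<in> sets lebesgue" by (rule sets_completionI_sets)
 have "AE x in lebesgue. f x = g x" by (rule AE_completion[OF AE])
 then have "AE x in lebesgue. x \<in> g -` S \<inter> space lborel \<longleftrightarrow> x \<in> f -` S \<inter> space lebesgue" by eventually_elim auto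
 then show "f -` S \<inter> space lebesgue \<in> sets lebesgue" by (rule completion.in_sets_AE[OF _ G]) auto
qed

lemma lebesgue_integral_AE:
 fixes f g :: "'a::euclidean_space => complex"
 assumes g: "integrable lborel g" and AE: "AE x in lborel. f x = g x"
 shows "integrable lebesgue f" "integral\<^sup>L lebesgue f = integral\<^sup>L lborel g"
proof -
 have gm: "g \<in> borel_measurable lborel" using g by auto
 have gc: "g \<in> borel_measurable lebesgue" using measurable_completion[OF gm] .
 note f = lebesgue_measurable_AE[OF gm AE]
 have AE': "AE x in lebesgue. f x = g x" by (rule AE_completion[OF AE])
 have I: "integrable lebesgue g" using g integrable_completion[OF gm] by simp
 show "integrable lebesgue f" using I integrable_cong_AE[OF f gc AE'] by simp
 show "integral\<^sup>L lebesgue f = integral\<^sup>L lborel g"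
  using integral_cong_AE[OF f gc AE'] integral_completion[OF gm] by simp
qed

text \<open>Paired with the rapidly decreasing \<open>fourier_inv \<phi>\<close>, the weighted bound
  makes the integrand absolutely integrable in (s, \<xi>), so Fubini exchanges the weak time
  integral with the frequency pairing. The transform of \<open>T s\<close> has to be known for
  almost every \<open>s\<close> only.\<close>

lemma duhamel_fourier:
 fixes H :: "real \<times> (real^'n) => complex" and T :: "real => 'n::finite distr"
 assumes H [measurable]: "H \<in> borel_measurable (borel \<Otimes>\<^sub>M borel)"
  and fin: "(\<integral>\<^sup>+\<xi>. weight N \<xi> * (\<integral>\<^sup>+s. ennreal (heat_kernel \<alpha> t s \<xi>) * ennreal (norm (H (s, \<xi>))) \<partial>lborel) \<partial>lborel) < \<infinity>"
  and T: "AE s in lborel. 0 < s \<and> s < t --> fourier_fun_off0 (T s) (%\<xi>. H (s, \<xi>))"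
  and \<phi>: "\<phi> \<in> schwartz"
 shows "set_integrable lebesgue {0<..<t} (%s. heat \<alpha> (t - s) (T s) \<phi>)"
  and "time_integral t (%s. heat \<alpha> (t - s) (T s)) \<phi> = (LINT \<xi>|lborel. (LINT s|lborel. of_real (heat_kernel \<alpha> t s \<xi>) * H (s, \<xi>)) * fourier_inv \<phi> \<xi>)"
  and "integrable lborel (%\<xi>. (LINT s|lborel. of_real (heat_kernel \<alpha> t s \<xi>) * H (s, \<xi>)) * fourier_inv \<phi> \<xi>)"
proof -
 note [measurable] = fourier_inv_measurable[OF \<phi>]
 define P where "P s \<xi> = of_real (heat_kernel \<alpha> t s \<xi>) * H (s, \<xi>) * fourier_inv \<phi> \<xi>" for s \<xi>
 have Pm [measurable]: "case_prod P \<in> borel_measurable (lborel \<Otimes>\<^sub>M lborel)"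
  unfolding P_def split_beta' by measurable
 obtain C where C: "\<And>\<xi>. norm (fourier_inv \<phi> \<xi>) <= C * (1 / (1 + norm \<xi>) ^ N)"
  using fourier_inv_weight_bound[OF \<phi>] by blast
 have C0: "0 <= C" using order_trans[OF norm_ge_zero C[of 0]] by simp
 let ?h = "%\<xi>. \<integral>\<^sup>+s. ennreal (heat_kernel \<alpha> t s \<xi>) * ennreal (norm (H (s, \<xi>))) \<partial>lborel"
 have le: "(\<integral>\<^sup>+s. ennreal (norm (P s \<xi>)) \<partial>lborel) <= ennreal C * (weight N \<xi> * ?h \<xi>)" for \<xi>
 proof -
  have "(\<integral>\<^sup>+s. ennreal (norm (P s \<xi>)) \<partial>lborel) = (\<integral>\<^sup>+s. ennreal (norm (fourier_inv \<phi> \<xi>)) * (ennreal (heat_kernel \<alpha> t s \<xi>) * ennreal (norm (H (s, \<xi>)))) \<partial>lborel)"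
   by (intro nn_integral_cong) (simp add: P_def norm_mult heat_kernel_nonneg ennreal_mult[symmetric] mult_ac)
  also have "\<dots> = ennreal (norm (fourier_inv \<phi> \<xi>)) * ?h \<xi>" by (rule nn_integral_cmult) measurable
  also have "\<dots> <= (ennreal C * weight N \<xi>) * ?h \<xi>"
  proof (intro mult_right_mono)
   show "ennreal (norm (fourier_inv \<phi> \<xi>)) <= ennreal C * weight N \<xi>"
    unfolding weight_def by (subst ennreal_mult[symmetric]) (use C0 C[of \<xi>] in \<open>auto intro: ennreal_leI\<close>)
  qed auto
  finally show ?thesis by (simp only: mult.assoc)
 qed
 have hm [measurable]: "?h \<in> borel_measurable borel" by measurable
 have int: "integrable (lborel \<Otimes>\<^sub>M lborel) (case_prod P)"
 proof (rule integrableI_bounded[OF Pm])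
  have "(\<integral>\<^sup>+z. ennreal (norm (case_prod P z)) \<partial>(lborel \<Otimes>\<^sub>M lborel)) = (\<integral>\<^sup>+\<xi>. \<integral>\<^sup>+s. ennreal (norm (P s \<xi>)) \<partial>lborel \<partial>lborel)"
   by (subst lborel_pair.nn_integral_snd[symmetric]) auto
  also have "\<dots> <= (\<integral>\<^sup>+\<xi>. ennreal C * (weight N \<xi> * ?h \<xi>) \<partial>lborel)" by (intro nn_integral_mono le)
  also have "\<dots> = ennreal C * (\<integral>\<^sup>+\<xi>. weight N \<xi> * ?h \<xi> \<partial>lborel)" by (rule nn_integral_cmult) measurable
  also have "\<dots> < \<infinity>" using fin by (simp add: ennreal_mult_less_top)
  finally show "(\<integral>\<^sup>+z. ennreal (norm (case_prod P z)) \<partial>(lborel \<Otimes>\<^sub>M lborel)) < \<infinity>" .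
 qed
 define B where "B s = (LINT \<xi>|lborel. P s \<xi>)" for s
 have B: "integrable lborel B" using lborel_pair.integrable_fst'[OF int] by (simp add: B_def[abs_def])
 have AE: "AE s in lborel. indicator {0<..<t} s *\<^sub>R heat \<alpha> (t - s) (T s) \<phi> = B s"
  using T
 proof eventually_elim
  case (elim s)
  show ?case
  proof (cases "0 < s \<and> s < t")
   case True
   then have "heat \<alpha> (t - s) (T s) \<phi> = (LINT \<xi>|lborel. of_real (exp (- (t - s) * norm \<xi> powr \<alpha>)) * H (s, \<xi>) * fourier_inv \<phi> \<xi>)"
    using elim heat_eq[OF _ \<phi>] by blast
   then show ?thesis using True by (simp add: B_def P_def heat_kernel_def)
  next
   case False
   then have "P s \<xi> = 0" for \<xi> by (auto simp: P_def heat_kernel_def)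
   then show ?thesis using False by (auto simp: B_def)
  qed
 qed
 show "set_integrable lebesgue {0<..<t} (%s. heat \<alpha> (t - s) (T s) \<phi>)"
  unfolding set_integrable_def by (rule lebesgue_integral_AE(1)[OF B AE])
 have eq: "(LINT s|lborel. P s \<xi>) = (LINT s|lborel. of_real (heat_kernel \<alpha> t s \<xi>) * H (s, \<xi>)) * fourier_inv \<phi> \<xi>" for \<xi>
  unfolding P_def by simp
 show "integrable lborel (%\<xi>. (LINT s|lborel. of_real (heat_kernel \<alpha> t s \<xi>) * H (s, \<xi>)) * fourier_inv \<phi> \<xi>)"
  using lborel_pair.integrable_snd[OF int] unfolding eq .
 have "time_integral t (%s. heat \<alpha> (t - s) (T s)) \<phi> = integral\<^sup>L lborel B"
  unfolding time_integral_def set_lebesgue_integral_def by (rule lebesgue_integral_AE(2)[OF B AE])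
 also have "\<dots> = integral\<^sup>L (lborel \<Otimes>\<^sub>M lborel) (case_prod P)" unfolding B_def[abs_def] using lborel_pair.integral_fst'[OF int] by simp
 also have "\<dots> = (LINT \<xi>|lborel. LINT s|lborel. P s \<xi>)" using lborel_pair.integral_snd[OF int] by simp
 finally show "time_integral t (%s. heat \<alpha> (t - s) (T s)) \<phi> = (LINT \<xi>|lborel. (LINT s|lborel. of_real (heat_kernel \<alpha> t s \<xi>) * H (s, \<xi>)) * fourier_inv \<phi> \<xi>)"
  unfolding eq .
qed

lemma lborel_distr_reflect: "distr lborel borel (%x. a - x) = (lborel :: 'a::euclidean_space measure)"
 using lborel_affine[of "- 1" a] by (simp add: density_1 one_ennreal_def[symmetric])

lemma lborel_pair_integral_reflect_snd:
 fixes f :: "'a::euclidean_space \<times> 'b::euclidean_space => complex"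
 assumes [measurable]: "f \<in> borel_measurable (borel \<Otimes>\<^sub>M borel)"
 shows "(LINT z|(lborel \<Otimes>\<^sub>M lborel). f (fst z, - snd z)) = integral\<^sup>L (lborel \<Otimes>\<^sub>M lborel) f"
proof -
 have u: "distr lborel borel (uminus :: 'b => 'b) = lborel" using lborel_distr_reflect[of "0 :: 'b"] by (simp add: fun_eq_iff)
 have "distr lborel borel (%x::'a. x) \<Otimes>\<^sub>M distr lborel borel (uminus :: 'b => 'b) = distr (lborel \<Otimes>\<^sub>M lborel) (borel \<Otimes>\<^sub>M borel) (%(x, y). (x, - y))"
  by (rule pair_measure_distr) (auto simp: u sigma_finite_lborel)
 moreover have "distr lborel borel (%x::'a. x) = lborel" by (rule distr_id2) simp
 ultimately have "(lborel :: 'a measure) \<Otimes>\<^sub>M (lborel :: 'b measure) = distr (lborel \<Otimes>\<^sub>M lborel) (borel \<Otimes>\<^sub>M borel) (%(x, y). (x, - y))"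
  by (simp only: u)
 then have "integral\<^sup>L (lborel \<Otimes>\<^sub>M lborel) f = integral\<^sup>L (distr (lborel \<Otimes>\<^sub>M lborel) (borel \<Otimes>\<^sub>M borel) (%(x, y). (x, - y))) f" by simp
 also have "\<dots> = (LINT z|(lborel \<Otimes>\<^sub>M lborel). f (case z of (x, y) => (x, - y)))" by (rule integral_distr) measurable
 finally show ?thesis by (simp add: split_beta')
qed

context boussinesq
begin

context
 assumes hermitian: "\<And>i \<xi>. a0 i (- \<xi>) = cnj (a0 i \<xi>)" "\<And>\<xi>. b0 (- \<xi>) = cnj (b0 \<xi>)" "\<And>l s \<xi>. F l (s, - \<xi>) = cnj (F l (s, \<xi>))"
begin

text \<open>The symbols are Hermitian, and the substitution of -\<eta> for \<eta> carries the
  convolution at -\<xi> to the conjugate of the one at \<xi>; so every iterate inherits the symmetry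
  of the data.\<close>

lemma pics_cnj: "pics n c (t, - \<xi>) = cnj (pics n c (t, \<xi>))"
proof (induction n arbitrary: c t \<xi>)
 case 0
 show ?case by (simp add: pics_0)
next
 case (Suc n)
 have hk: "heat_kernel \<alpha> t s (- \<xi>) = heat_kernel \<alpha> t s \<xi>" for s by (simp add: heat_kernel_def)
 have "force i (s, - \<xi>) = cnj (force i (s, \<xi>))" for i s
  by (simp add: force_def leray_symbol_uminus hermitian)
 then have D: "data c (t, - \<xi>) = cnj (data c (t, \<xi>))"
  by (simp add: data_def hk hermitian lebesgue_integral_cnj[symmetric] split: option.split)
 have Q: "(LINT z|(lborel \<Otimes>\<^sub>M lborel). qker c b b' (t, - \<xi>) z * (pics n b (fst z, snd (t, - \<xi>) - snd z) * pics n b' z))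
   = cnj (LINT z|(lborel \<Otimes>\<^sub>M lborel). qker c b b' (t, \<xi>) z * (pics n b (fst z, snd (t, \<xi>) - snd z) * pics n b' z))" for b b'
 proof -
  define G where "G z = qker c b b' (t, - \<xi>) z * (pics n b (fst z, - \<xi> - snd z) * pics n b' z)" for z
  have "(%z. qker c b b' (t, - \<xi>) z * (f (fst z, - \<xi> - snd z) * g z)) \<in> borel_measurable (borel \<Otimes>\<^sub>M borel)"
   if [measurable]: "f \<in> borel_measurable (borel \<Otimes>\<^sub>M borel)" "g \<in> borel_measurable (borel \<Otimes>\<^sub>M borel)" for f g
   unfolding qker_def fst_conv snd_conv by measurable
  from this[OF pics_measurable pics_measurable] have "G \<in> borel_measurable (borel \<Otimes>\<^sub>M borel)" unfolding G_def[abs_def] .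
  then have "integral\<^sup>L (lborel \<Otimes>\<^sub>M lborel) G = (LINT z|(lborel \<Otimes>\<^sub>M lborel). G (fst z, - snd z))"
   by (rule lborel_pair_integral_reflect_snd[symmetric])
  also have "\<dots> = (LINT z|(lborel \<Otimes>\<^sub>M lborel). cnj (qker c b b' (t, \<xi>) z * (pics n b (fst z, \<xi> - snd z) * pics n b' z)))"
  proof (intro Bochner_Integration.integral_cong refl)
   fix z :: "real \<times> (real, 'd) vec"
   have q: "qker c b b' (t, - \<xi>) (fst z, - snd z) = cnj (qker c b b' (t, \<xi>) z)"
    by (simp add: qker_def hk quad_symbol_uminus)
   have e: "- \<xi> - - snd z = - (\<xi> - snd z)" by simp
   have p: "pics n b' (fst z, - snd z) = cnj (pics n b' z)" using Suc[of b' "fst z" "snd z"] by (simp only: prod.collapse)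
   show "G (fst z, - snd z) = cnj (qker c b b' (t, \<xi>) z * (pics n b (fst z, \<xi> - snd z) * pics n b' z))"
    unfolding G_def fst_conv snd_conv q e p Suc[of b "fst z" "\<xi> - snd z"] complex_cnj_mult ..
  qed
  finally show ?thesis unfolding G_def snd_conv lebesgue_integral_cnj .
 qed
 have lk: "lker c b (t, - \<xi>) s = cnj (lker c b (t, \<xi>) s)" for b s
  by (simp add: lker_def hk lin_symbol_uminus)
 have L: "(LINT s|lborel. lker c b (t, - \<xi>) s * pics n b (s, snd (t, - \<xi>))) = cnj (LINT s|lborel. lker c b (t, \<xi>) s * pics n b (s, snd (t, \<xi>)))" for b
  unfolding lebesgue_integral_cnj[symmetric] snd_conv lk Suc complex_cnj_mult ..
 show ?case unfolding pics_Suc pic_def Q L D by (simp only: complex_cnj_add cnj_sum)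
qed

text \<open>Finiteness is asked at both points because the default value 0 at just one of them could
  break the symmetry.\<close>

lemma sol_cnj: "maj_sol c (t, \<xi>) < \<infinity> ==> maj_sol c (t, - \<xi>) < \<infinity> ==> sol c (t, - \<xi>) = cnj (sol c (t, \<xi>))"
 using LIMSEQ_unique[OF pics_tendsto[of c "(t, - \<xi>)"] tendsto_cnj[OF pics_tendsto[of c "(t, \<xi>)"], folded pics_cnj]] by blast

end

end

lemma lborel_AE_reflect: "AE x in lborel. P x ==> AE x in lborel. P (a - x)"
 for a :: "'a::euclidean_space"
proof -
 assume "AE x in lborel. P x"
 then have "AE x in distr lborel borel (%x. a - x). P x" unfolding lborel_distr_reflect .
 then show ?thesis by (rule AE_distrD[rotated]) measurable
qed

lemma sum_UNIV_option: "(\<Sum>b\<in>(UNIV :: 'a::finite option set). g b) = g None + (\<Sum>i\<in>UNIV. g (Some i))"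
 by (simp add: UNIV_option_conv sum.reindex)

section \<open>The solution on the side of distributions\<close>

text \<open>The symmetry is demanded at every frequency, since the iterates are compared point by
  point; the link to the force is demanded at almost every time, since there \<open>s\<close> is
  only integrated over.\<close>

locale boussinesq_solution = boussinesq_bounds \<alpha> a0 b0 F \<kappa> \<theta>r \<theta>p \<theta>f \<gamma>1 \<gamma>2 c1 c2 K \<epsilon> R Rm m
 for \<alpha> and a0 :: "'d::{finite,linorder} => (real, 'd) vec => complex" and b0 F \<kappa> \<theta>r \<theta>p \<theta>f \<gamma>1 \<gamma>2 c1 c2 K \<epsilon> R Rm m +
 fixes u0 :: "'d => 'd distr" and \<theta>0 :: "'d distr" and f :: "real => 'd => 'd distr"
 assumes hermitian: "\<And>i \<xi>. a0 i (- \<xi>) = cnj (a0 i \<xi>)" "\<And>\<xi>. b0 (- \<xi>) = cnj (b0 \<xi>)" "\<And>l s \<xi>. F l (s, - \<xi>) = cnj (F l (s, \<xi>))"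
  and transforms: "\<And>i. fourier_fun_off0 (u0 i) (a0 i)" "fourier_fun_off0 \<theta>0 b0"
   "AE s in lborel. 0 < s --> (\<forall>l. fourier_fun (f s l) (%\<xi>. F l (s, \<xi>)))"
begin

definition component :: "'d option => real => 'd distr" where
 "component c t = from_fourier (%\<xi>. sol c (t, \<xi>))"

lemma sol_section [measurable]: "(%\<xi>. sol c (t, \<xi>)) \<in> borel_measurable borel"
 using measurable_Pair2[OF sol_measurable[of c], of t] by simp

lemma dominated_tempered:
 assumes t: "0 < t" and [measurable]: "h \<in> borel_measurable borel" and le: "\<And>\<xi>. ennreal (norm (h \<xi>)) <= maj_sol c (t, \<xi>)"
 shows "tempered_fun h"
proof -
 have "(\<integral>\<^sup>+\<xi>. w2 \<xi> * ennreal (norm (h \<xi>)) \<partial>lborel) <= (\<integral>\<^sup>+\<xi>. w2 \<xi> * maj_sol c (t, \<xi>) \<partial>lborel)"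
  by (intro nn_integral_mono mult_left_mono le) auto
 also have "\<dots> < \<infinity>" by (rule maj_sol_weight[OF t])
 finally show ?thesis unfolding tempered_fun_def weight_def using assms(2) by blast
qed

text \<open>A finite integral against a strictly positive weight. It is available at every positive
  time, so at each of them the points where \<open>sol\<close> takes its default value form a null
  set.\<close>

lemma maj_sol_AE_finite:
 assumes t: "0 < t" shows "AE \<xi> in lborel. maj_sol c (t, \<xi>) < \<infinity>"
proof -
 have "AE \<xi> in lborel. w2 \<xi> * maj_sol c (t, \<xi>) \<noteq> \<infinity>"
  using maj_sol_weight[OF t, of c]
  by (intro nn_integral_PInf_AE) (auto intro!: borel_measurable_times section_measurable' maj_sol_measurable)
 then show ?thesis
 proof eventually_elim
  case (elim \<xi>)
  have "0 < 1 / (1 + norm \<xi>) ^ Suc (CARD('d) + 1)" by (intro divide_pos_pos zero_less_power add_pos_nonneg) auto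
  then have "w2 \<xi> \<noteq> 0" unfolding weight_def by (simp only: ennreal_eq_0_iff not_le)
  then show ?case using elim by (auto simp: less_top ennreal_mult_eq_top_iff)
 qed
qed

lemma sol_tempered: "0 < t ==> tempered_fun (%\<xi>. sol c (t, \<xi>))"
 by (rule dominated_tempered[OF _ sol_section sol_le])

lemma component_fourier: "0 < t ==> fourier_fun (component c t) (%\<xi>. sol c (t, \<xi>))"
 unfolding component_def by (rule fourier_fun_from_fourier[OF sol_tempered]) auto

lemma component_tempered: "0 < t ==> tempered (component c t)"
 unfolding component_def by (rule tempered_from_fourier[OF sol_tempered])

lemma component_real_valued:
 assumes t: "0 < t" shows "real_valued (component c t)"
 unfolding component_def
proof (rule real_valued_from_fourier)
 show "AE \<xi> in lborel. sol c (t, - \<xi>) = cnj (sol c (t, \<xi>))"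
  using maj_sol_AE_finite[OF t, of c] lborel_AE_reflect[OF maj_sol_AE_finite[OF t, of c], of 0]
  by eventually_elim (use sol_cnj hermitian in \<open>auto simp del: infinity_ennreal_def\<close>)
qed measurable

definition conv :: "'d option => 'd option => real \<times> (real, 'd) vec => complex" where
 "conv b b' z = (LINT \<eta>|lborel. sol b (fst z, snd z - \<eta>) * sol b' (fst z, \<eta>))"

lemma conv_measurable [measurable]: "conv b b' \<in> borel_measurable (borel \<Otimes>\<^sub>M borel)"
proof -
 have "(%z. LINT \<eta>|lborel. f (fst z, snd z - \<eta>) * g (fst z, \<eta>)) \<in> borel_measurable (borel \<Otimes>\<^sub>M borel)"
  if [measurable]: "f \<in> borel_measurable (borel \<Otimes>\<^sub>M borel)" "g \<in> borel_measurable (borel \<Otimes>\<^sub>M borel)" for f g :: "real \<times> (real, 'd) vec => complex"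
  by (rule sigma_finite_measure.borel_measurable_lebesgue_integral[OF sigma_finite_lborel]) (simp add: split_beta', measurable)
 from this[OF sol_measurable sol_measurable] show ?thesis unfolding conv_def[abs_def] .
qed

lemma section_measurable_complex [measurable (raw)]: "h \<in> borel_measurable (borel \<Otimes>\<^sub>M borel) ==> (%\<xi>. h (t, \<xi>)) \<in> borel_measurable borel"
 for h :: "real \<times> (real, 'd) vec => complex" and t
 using measurable_Pair2[of h borel borel borel t] by simp

lemma conv_le: "ennreal (norm (conv b b' z)) <= conv_maj b b' z"
 unfolding conv_def conv_maj_def
 by (rule order_trans[OF norm_integral_le]) (auto simp: norm_mult ennreal_mult intro!: nn_integral_mono mult_mono sol_le)

text \<open>The transforms inside \<open>dprod\<close> are choices equal to \<open>sol\<close>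
  almost everywhere. Reflection and translation preserve null sets, so the convolution integrals
  agree at every frequency.\<close>

lemma dprod_component:
 assumes s: "0 < s"
 shows "dprod (component b s) (component b' s) = from_fourier (%\<xi>. conv b b' (s, \<xi>) / (2 * pi) ^ CARD('d))"
proof -
 have m [measurable]: "fhat (component c s) \<in> borel_measurable borel" for c
  by (rule fhat_measurable[OF fourier_fun_imp_off0[OF component_fourier[OF s]]])
 have "(LINT \<eta>|lborel. fhat (component b s) (\<xi> - \<eta>) * fhat (component b' s) \<eta>) = conv b b' (s, \<xi>)" for \<xi>
  unfolding conv_def fst_conv snd_conv
 proof (rule integral_cong_AE)
  have [measurable]: "(%\<eta>. sol b (s, \<xi> - \<eta>)) \<in> borel_measurable borel"
   using measurable_compose[OF _ sol_section, of "%\<eta>. \<xi> - \<eta>" borel] by simp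
  show "(%\<eta>. sol b (s, \<xi> - \<eta>) * sol b' (s, \<eta>)) \<in> borel_measurable lborel" by measurable
  show "AE \<eta> in lborel. fhat (component b s) (\<xi> - \<eta>) * fhat (component b' s) \<eta> = sol b (s, \<xi> - \<eta>) * sol b' (s, \<eta>)"
   using lborel_AE_reflect[OF fhat_AE[OF component_fourier[OF s, of b]], of \<xi>] fhat_AE[OF component_fourier[OF s, of b']]
   by eventually_elim simp
 qed measurable
 then show ?thesis unfolding dprod_def by simp
qed

text \<open>Times at which all scalar bounds are finite and the force has its transform. Almost
  every positive time is good, which suffices because \<open>s\<close> is an integration variable in
  each Duhamel term.\<close>

definition good :: "real => bool" where
 "good s \<longleftrightarrow> 0 < s \<and> (\<forall>c. ts c s < \<infinity>) \<and> m s < \<infinity> \<and> (\<forall>l. fourier_fun (f s l) (%\<xi>. F l (s, \<xi>)))"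

lemma AE_good: "AE s in lborel. 0 < s --> good s"
proof -
 have "AE s in lborel. \<forall>c\<in>UNIV. ts c s < \<infinity>"
  by (intro AE_finite_allI lorentz_bound_AE_finite[OF ts_measurable ts_bound]) auto
 then show ?thesis
  using lorentz_bound_AE_finite[OF m_measurable T3] transforms(3) by eventually_elim (auto simp: good_def)
qed

lemma conv_tempered:
 assumes g: "good s" shows "tempered_fun (%\<xi>. conv b (Some j) (s, \<xi>))"
proof -
 have "(\<integral>\<^sup>+\<xi>. w1 \<xi> * ennreal (norm (conv b (Some j) (s, \<xi>))) \<partial>lborel) <= (\<integral>\<^sup>+\<xi>. w1 \<xi> * conv_maj b (Some j) (s, \<xi>) \<partial>lborel)"
  by (intro nn_integral_mono mult_left_mono conv_le) auto
 also have "\<dots> <= ennreal c2 * (ts b s * ts (Some j) s)" by (rule conv_maj_bound)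
 also have "\<dots> < \<infinity>" using g by (simp add: good_def ennreal_mult_less_top)
 finally show ?thesis unfolding tempered_fun_def weight_def using section_measurable_complex[OF conv_measurable] by blast
qed

lemma F_tempered:
 assumes g: "good s" shows "tempered_fun (%\<xi>. F l (s, \<xi>))"
proof -
 have "ennreal c2 * m s < \<infinity>" using g by (simp add: good_def ennreal_mult_less_top)
 then show ?thesis unfolding tempered_fun_def
  using le_less_trans[OF K6] section_measurable_complex[OF data_measurable(3)] by blast
qed

lemma dprod_fourier:
 assumes g: "good s"
 shows "tempered_fun (%\<xi>. conv b (Some j) (s, \<xi>) / (2 * pi) ^ CARD('d))"
  and "fourier_fun (dprod (component b s) (component (Some j) s)) (%\<xi>. conv b (Some j) (s, \<xi>) / (2 * pi) ^ CARD('d))"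
proof -
 have [measurable]: "(%\<xi>. conv b (Some j) (s, \<xi>)) \<in> borel_measurable borel" by (rule section_measurable_complex[OF conv_measurable])
 show T: "tempered_fun (%\<xi>. conv b (Some j) (s, \<xi>) / (2 * pi) ^ CARD('d))"
  by (rule tempered_fun_bound[OF conv_tempered[OF g, of b j], of _ "1 / (2 * pi) ^ CARD('d)" 0])
   (auto simp: norm_divide norm_mult norm_power)
 have s: "0 < s" using g by (simp add: good_def)
 show "fourier_fun (dprod (component b s) (component (Some j) s)) (%\<xi>. conv b (Some j) (s, \<xi>) / (2 * pi) ^ CARD('d))"
  unfolding dprod_component[OF s] by (rule fourier_fun_from_fourier[OF T]) auto
qed

definition quad :: "'d option => real \<times> (real, 'd) vec => complex" where
 "quad c z = (\<Sum>b\<in>UNIV. \<Sum>b'\<in>UNIV. quad_symbol c b b' (snd z) * conv b b' z)"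

definition lin :: "'d option => real \<times> (real, 'd) vec => complex" where
 "lin c z = (\<Sum>b\<in>UNIV. lin_symbol c b (snd z) * sol b z)"

lemma quad_measurable [measurable]: "quad c \<in> borel_measurable (borel \<Otimes>\<^sub>M borel)"
proof -
 have "(%z. \<Sum>b\<in>UNIV. \<Sum>b'\<in>UNIV. quad_symbol c b b' (snd z) * h b b' z) \<in> borel_measurable (borel \<Otimes>\<^sub>M borel)"
  if [measurable]: "\<And>b b'. h b b' \<in> borel_measurable (borel \<Otimes>\<^sub>M borel)" for h :: "'d option => 'd option => real \<times> (real, 'd) vec => complex"
  by measurable
 from this[OF conv_measurable] show ?thesis unfolding quad_def[abs_def] .
qed

lemma lin_measurable [measurable]: "lin c \<in> borel_measurable (borel \<Otimes>\<^sub>M borel)"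
proof -
 have "(%z. \<Sum>b\<in>UNIV. lin_symbol c b (snd z) * h b z) \<in> borel_measurable (borel \<Otimes>\<^sub>M borel)"
  if [measurable]: "\<And>b. h b \<in> borel_measurable (borel \<Otimes>\<^sub>M borel)" for h :: "'d option => real \<times> (real, 'd) vec => complex"
  by measurable
 from this[OF sol_measurable] show ?thesis unfolding lin_def[abs_def] .
qed

lemma fourier_div:
 assumes g: "good s"
 shows "tempered_fun (%\<xi>. \<Sum>j\<in>UNIV. \<i> * of_real (\<xi> $ j) * (conv b (Some j) (s, \<xi>) / (2 * pi) ^ CARD('d)))"
  and "fourier_fun (ddiv (%j. dprod (component b s) (component (Some j) s))) (%\<xi>. \<Sum>j\<in>UNIV. \<i> * of_real (\<xi> $ j) * (conv b (Some j) (s, \<xi>) / (2 * pi) ^ CARD('d)))"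
proof -
 have [measurable]: "(%\<xi>. conv b (Some j) (s, \<xi>)) \<in> borel_measurable borel" for j by (rule section_measurable_complex[OF conv_measurable])
 have N: "norm (\<i> * of_real (\<xi> $ j) * z) <= 1 * (1 + norm \<xi>) ^ 1 * norm z" for \<xi> :: "(real, 'd) vec" and j z
  unfolding norm_mult using component_le_norm_cart[of \<xi> j] by (intro mult_right_mono) auto
 have "tempered_fun (%\<xi>. \<i> * of_real (\<xi> $ j) * (conv b (Some j) (s, \<xi>) / (2 * pi) ^ CARD('d)))" for j
 proof (rule tempered_fun_bound[OF dprod_fourier(1)[OF g, of b j], where c = 1 and k = 1])
  show "AE \<xi> in lborel. norm (\<i> * of_real (\<xi> $ j) * (conv b (Some j) (s, \<xi>) / (2 * pi) ^ CARD('d))) <= 1 * (1 + norm \<xi>) ^ 1 * norm (conv b (Some j) (s, \<xi>) / (2 * pi) ^ CARD('d))"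
   by (rule AE_I2, rule N)
  show "(%\<xi>. \<i> * of_real (\<xi> $ j) * (conv b (Some j) (s, \<xi>) / (2 * pi) ^ CARD('d))) \<in> borel_measurable borel" by measurable
  show "(0 :: real) <= 1" by simp
 qed
 then show "tempered_fun (%\<xi>. \<Sum>j\<in>UNIV. \<i> * of_real (\<xi> $ j) * (conv b (Some j) (s, \<xi>) / (2 * pi) ^ CARD('d)))"
  by (intro tempered_fun_sum) auto
 show "fourier_fun (ddiv (%j. dprod (component b s) (component (Some j) s))) (%\<xi>. \<Sum>j\<in>UNIV. \<i> * of_real (\<xi> $ j) * (conv b (Some j) (s, \<xi>) / (2 * pi) ^ CARD('d)))"
  by (rule fourier_fun_ddiv[OF dprod_fourier(2)[OF g]])
qed

text \<open>The sign of the nonlinearity and the normalisation of \<open>dprod\<close> are built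
  into \<open>quad_symbol\<close>, hence the minus sign.\<close>

lemma fourier_quad_None:
 assumes g: "good s"
 shows "fourier_fun_off0 (ddiv (%j. dprod (component None s) (component (Some j) s))) (%\<xi>. - quad None (s, \<xi>))"
proof -
 have "(%\<xi>. \<Sum>j\<in>UNIV. \<i> * of_real (\<xi> $ j) * (conv None (Some j) (s, \<xi>) / (2 * pi) ^ CARD('d))) = (%\<xi>. - quad None (s, \<xi>))"
  by (simp add: quad_def sum_UNIV_option quad_symbol_def sum_negf fun_eq_iff)
 then show ?thesis using fourier_fun_imp_off0[OF fourier_div(2)[OF g, of None]] by simp
qed

lemma fourier_quad_Some:
 assumes g: "good s"
 shows "fourier_fun_off0 (leray (div_tensor (%i. component (Some i) s) (%i. component (Some i) s)) i) (%\<xi>. - quad (Some i) (s, \<xi>))"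
proof -
 have 1: "fourier_fun (leray (div_tensor (%i. component (Some i) s) (%i. component (Some i) s)) i)
   (%\<xi>. \<Sum>l\<in>UNIV. leray_symbol i l \<xi> * (\<Sum>j\<in>UNIV. \<i> * of_real (\<xi> $ j) * (conv (Some l) (Some j) (s, \<xi>) / (2 * pi) ^ CARD('d))))"
  unfolding div_tensor_def by (rule fourier_fun_leray[OF fourier_div(2)[OF g] fourier_div(1)[OF g]])
 have 2: "(\<Sum>l\<in>UNIV. leray_symbol i l \<xi> * (\<Sum>j\<in>UNIV. \<i> * of_real (\<xi> $ j) * (h l j / (2 * pi) ^ CARD('d)))) =
   (\<Sum>l\<in>UNIV. \<Sum>j\<in>UNIV. - (quad_symbol (Some i) (Some l) (Some j) \<xi> * h l j))" for h :: "'d => 'd => complex" and \<xi> :: "(real, 'd) vec"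
  unfolding sum_distrib_left by (intro sum.cong refl) (simp add: quad_symbol_def mult_ac)
 have z: "quad_symbol (Some i) None b \<xi> = 0" "quad_symbol (Some i) (Some l) None \<xi> = 0" for b l and \<xi> :: "(real, 'd) vec"
  by (simp_all add: quad_symbol_def)
 have 3: "(\<Sum>l\<in>UNIV. \<Sum>j\<in>UNIV. - (quad_symbol (Some i) (Some l) (Some j) \<xi> * conv (Some l) (Some j) (s, \<xi>))) = - quad (Some i) (s, \<xi>)" for \<xi>
  by (simp only: quad_def sum_UNIV_option z snd_conv mult_zero_left sum.neutral_const add_0_left sum_negf)
 show ?thesis using fourier_fun_imp_off0[OF 1] unfolding 2 3 .
qed

lemma fourier_lin:
 assumes g: "good s"
 shows "fourier_fun_off0 (leray (times_ed (component None s)) i) (%\<xi>. lin (Some i) (s, \<xi>))"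
proof -
 have s: "0 < s" using g by (simp add: good_def)
 define h where "h l \<xi> = (if l = Max UNIV then sol None (s, \<xi>) else 0)" for l :: 'd and \<xi>
 have "fourier_fun (times_ed (component None s) l) (h l)" for l
  using component_fourier[OF s, of None] by (cases "l = Max UNIV") (simp_all add: times_ed_def h_def[abs_def] fourier_fun_def)
 moreover have "tempered_fun (h l)" for l
  using sol_tempered[OF s, of None] by (cases "l = Max UNIV") (simp_all add: h_def[abs_def] tempered_fun_zero)
 ultimately have "fourier_fun (leray (times_ed (component None s)) i) (%\<xi>. \<Sum>l\<in>UNIV. leray_symbol i l \<xi> * h l \<xi>)"
  by (rule fourier_fun_leray)
 moreover have "(%\<xi>. \<Sum>l\<in>UNIV. leray_symbol i l \<xi> * h l \<xi>) = (%\<xi>. lin (Some i) (s, \<xi>))"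
  by (simp add: lin_def sum_UNIV_option lin_symbol_def h_def fun_eq_iff if_distrib[of "(*) _"] cong: if_cong)
 ultimately show ?thesis using fourier_fun_imp_off0 by metis
qed

lemma fourier_force:
 assumes g: "good s"
 shows "fourier_fun_off0 (leray (f s) i) (%\<xi>. force i (s, \<xi>))"
 unfolding force_def snd_conv
 by (rule fourier_fun_imp_off0, rule fourier_fun_leray[OF _ F_tempered[OF g]]) (use g in \<open>simp add: good_def\<close>)

lemma maj_sol_expand: "maj_sol c (t, \<xi>) = data_maj c (t, \<xi>)
  + (\<Sum>b\<in>UNIV. \<Sum>b'\<in>UNIV. \<integral>\<^sup>+s. ennreal (heat_kernel \<alpha> t s \<xi>) * ennreal (norm (quad_symbol c b b' \<xi>)) * conv_maj b b' (s, \<xi>) \<partial>lborel)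
  + (\<Sum>b\<in>UNIV. \<integral>\<^sup>+s. ennreal (norm (lker c b (t, \<xi>) s)) * maj_sol b (s, \<xi>) \<partial>lborel)"
 unfolding quad_majorant[symmetric] by (subst maj_sol_eq) (simp only: maj_def fst_conv snd_conv)

lemma quad_le: "ennreal (norm (quad c (s, \<xi>))) <= (\<Sum>b\<in>UNIV. \<Sum>b'\<in>UNIV. ennreal (norm (quad_symbol c b b' \<xi>)) * conv_maj b b' (s, \<xi>))"
proof -
 have "norm (quad c (s, \<xi>)) <= (\<Sum>b\<in>UNIV. \<Sum>b'\<in>UNIV. norm (quad_symbol c b b' \<xi>) * norm (conv b b' (s, \<xi>)))"
  unfolding quad_def snd_conv norm_mult[symmetric] by (rule sum_norm_le) (rule norm_sum)
 then have 1: "ennreal (norm (quad c (s, \<xi>))) <= ennreal (\<Sum>b\<in>UNIV. \<Sum>b'\<in>UNIV. norm (quad_symbol c b b' \<xi>) * norm (conv b b' (s, \<xi>)))"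
  by (rule ennreal_leI)
 have 2: "ennreal (\<Sum>b\<in>UNIV. \<Sum>b'\<in>UNIV. norm (quad_symbol c b b' \<xi>) * norm (conv b b' (s, \<xi>))) = (\<Sum>b\<in>UNIV. \<Sum>b'\<in>UNIV. ennreal (norm (quad_symbol c b b' \<xi>)) * ennreal (norm (conv b b' (s, \<xi>))))"
  by (simp only: sum_ennreal[symmetric] sum_nonneg mult_nonneg_nonneg norm_ge_zero ennreal_mult)
 have 3: "(\<Sum>b\<in>UNIV. \<Sum>b'\<in>UNIV. ennreal (norm (quad_symbol c b b' \<xi>)) * ennreal (norm (conv b b' (s, \<xi>)))) <= (\<Sum>b\<in>UNIV. \<Sum>b'\<in>UNIV. ennreal (norm (quad_symbol c b b' \<xi>)) * conv_maj b b' (s, \<xi>))"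
  by (intro sum_mono mult_left_mono conv_le) simp
 show ?thesis using 1 3 unfolding 2 by (rule order_trans)
qed

lemma lin_le: "ennreal (norm (lin c (s, \<xi>))) <= (\<Sum>b\<in>UNIV. ennreal (norm (lin_symbol c b \<xi>)) * maj_sol b (s, \<xi>))"
proof -
 have "norm (lin c (s, \<xi>)) <= (\<Sum>b\<in>UNIV. norm (lin_symbol c b \<xi>) * norm (sol b (s, \<xi>)))"
  unfolding lin_def snd_conv norm_mult[symmetric] by (rule norm_sum)
 then have 1: "ennreal (norm (lin c (s, \<xi>))) <= ennreal (\<Sum>b\<in>UNIV. norm (lin_symbol c b \<xi>) * norm (sol b (s, \<xi>)))"
  by (rule ennreal_leI)
 have 2: "ennreal (\<Sum>b\<in>UNIV. norm (lin_symbol c b \<xi>) * norm (sol b (s, \<xi>))) = (\<Sum>b\<in>UNIV. ennreal (norm (lin_symbol c b \<xi>)) * ennreal (norm (sol b (s, \<xi>))))"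
  by (simp only: sum_ennreal[symmetric] mult_nonneg_nonneg norm_ge_zero ennreal_mult)
 have 3: "(\<Sum>b\<in>UNIV. ennreal (norm (lin_symbol c b \<xi>)) * ennreal (norm (sol b (s, \<xi>)))) <= (\<Sum>b\<in>UNIV. ennreal (norm (lin_symbol c b \<xi>)) * maj_sol b (s, \<xi>))"
  by (intro sum_mono mult_left_mono sol_le) simp
 show ?thesis using 1 3 unfolding 2 by (rule order_trans)
qed

text \<open>\<open>maj_sol\<close> is a sum of nonnegative terms and so dominates each part of the
  Duhamel formula separately, with absolute values inside the time integral. This one domination
  later provides temperedness and Fubini for all parts.\<close>

lemma maj_sol_parts:
 "data_maj c (t, \<xi>) <= maj_sol c (t, \<xi>)"
 "(\<integral>\<^sup>+s. ennreal (heat_kernel \<alpha> t s \<xi>) * ennreal (norm (quad c (s, \<xi>))) \<partial>lborel) <= maj_sol c (t, \<xi>)"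
 "(\<integral>\<^sup>+s. ennreal (heat_kernel \<alpha> t s \<xi>) * ennreal (norm (lin c (s, \<xi>))) \<partial>lborel) <= maj_sol c (t, \<xi>)"
proof -
 have le: "x <= x + y + z" "y <= x + y + z" "z <= x + y + z" for x y z :: ennreal
  by (simp_all add: add_increasing add_increasing2)
 show "data_maj c (t, \<xi>) <= maj_sol c (t, \<xi>)" unfolding maj_sol_expand[of c t \<xi>] by (rule le(1))
 have cm: "(%s. conv_maj b b' (s, \<xi>)) \<in> borel_measurable borel" for b b' using measurable_Pair1[OF conv_maj_measurable] by simp
 have sm: "(%s. maj_sol b (s, \<xi>)) \<in> borel_measurable borel" for b using measurable_Pair1[OF maj_sol_measurable] by simp
 have lk: "ennreal (norm (lker c b (t, \<xi>) s)) = ennreal (heat_kernel \<alpha> t s \<xi>) * ennreal (norm (lin_symbol c b \<xi>))" for b s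
  by (simp add: lker_def norm_mult ennreal_mult heat_kernel_nonneg)
 have Q: "(\<integral>\<^sup>+s. (\<Sum>b\<in>(UNIV :: 'd option set). \<Sum>b'\<in>(UNIV :: 'd option set). ennreal (heat_kernel \<alpha> t s \<xi>) * ennreal (norm (quad_symbol c b b' \<xi>)) * g b b' s) \<partial>lborel)
   = (\<Sum>b\<in>UNIV. \<Sum>b'\<in>UNIV. \<integral>\<^sup>+s. ennreal (heat_kernel \<alpha> t s \<xi>) * ennreal (norm (quad_symbol c b b' \<xi>)) * g b b' s \<partial>lborel)"
  if [measurable]: "\<And>b b'. g b b' \<in> borel_measurable borel" for g :: "'d option => 'd option => real => ennreal"
  by (subst nn_integral_sum, measurable, intro sum.cong refl nn_integral_sum, measurable)
 have L: "(\<integral>\<^sup>+s. (\<Sum>b\<in>(UNIV :: 'd option set). ennreal (heat_kernel \<alpha> t s \<xi>) * ennreal (norm (lin_symbol c b \<xi>)) * g b s) \<partial>lborel)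
   = (\<Sum>b\<in>UNIV. \<integral>\<^sup>+s. ennreal (heat_kernel \<alpha> t s \<xi>) * ennreal (norm (lin_symbol c b \<xi>)) * g b s \<partial>lborel)"
  if [measurable]: "\<And>b. g b \<in> borel_measurable borel" for g :: "'d option => real => ennreal"
  by (rule nn_integral_sum) measurable
 have 1: "(\<integral>\<^sup>+s. ennreal (heat_kernel \<alpha> t s \<xi>) * ennreal (norm (quad c (s, \<xi>))) \<partial>lborel) <=
   (\<integral>\<^sup>+s. (\<Sum>b\<in>UNIV. \<Sum>b'\<in>UNIV. ennreal (heat_kernel \<alpha> t s \<xi>) * ennreal (norm (quad_symbol c b b' \<xi>)) * conv_maj b b' (s, \<xi>)) \<partial>lborel)"
 proof (rule nn_integral_mono)
  fix s
  have "ennreal (heat_kernel \<alpha> t s \<xi>) * ennreal (norm (quad c (s, \<xi>))) <= ennreal (heat_kernel \<alpha> t s \<xi>) * (\<Sum>b\<in>UNIV. \<Sum>b'\<in>UNIV. ennreal (norm (quad_symbol c b b' \<xi>)) * conv_maj b b' (s, \<xi>))"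
   by (rule mult_left_mono[OF quad_le]) simp
  then show "ennreal (heat_kernel \<alpha> t s \<xi>) * ennreal (norm (quad c (s, \<xi>))) <= (\<Sum>b\<in>UNIV. \<Sum>b'\<in>UNIV. ennreal (heat_kernel \<alpha> t s \<xi>) * ennreal (norm (quad_symbol c b b' \<xi>)) * conv_maj b b' (s, \<xi>))"
   by (simp only: sum_distrib_left mult.assoc)
 qed
 show "(\<integral>\<^sup>+s. ennreal (heat_kernel \<alpha> t s \<xi>) * ennreal (norm (quad c (s, \<xi>))) \<partial>lborel) <= maj_sol c (t, \<xi>)"
  unfolding maj_sol_expand[of c t \<xi>] using 1 le(2) unfolding Q[OF cm] by (rule order_trans)
 have 2: "(\<integral>\<^sup>+s. ennreal (heat_kernel \<alpha> t s \<xi>) * ennreal (norm (lin c (s, \<xi>))) \<partial>lborel) <=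
   (\<integral>\<^sup>+s. (\<Sum>b\<in>UNIV. ennreal (heat_kernel \<alpha> t s \<xi>) * ennreal (norm (lin_symbol c b \<xi>)) * maj_sol b (s, \<xi>)) \<partial>lborel)"
 proof (rule nn_integral_mono)
  fix s
  have "ennreal (heat_kernel \<alpha> t s \<xi>) * ennreal (norm (lin c (s, \<xi>))) <= ennreal (heat_kernel \<alpha> t s \<xi>) * (\<Sum>b\<in>UNIV. ennreal (norm (lin_symbol c b \<xi>)) * maj_sol b (s, \<xi>))"
   by (rule mult_left_mono[OF lin_le]) simp
  then show "ennreal (heat_kernel \<alpha> t s \<xi>) * ennreal (norm (lin c (s, \<xi>))) <= (\<Sum>b\<in>UNIV. ennreal (heat_kernel \<alpha> t s \<xi>) * ennreal (norm (lin_symbol c b \<xi>)) * maj_sol b (s, \<xi>))"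
   by (simp only: sum_distrib_left mult.assoc)
 qed
 show "(\<integral>\<^sup>+s. ennreal (heat_kernel \<alpha> t s \<xi>) * ennreal (norm (lin c (s, \<xi>))) \<partial>lborel) <= maj_sol c (t, \<xi>)"
  unfolding maj_sol_expand[of c t \<xi>] lk using 2 le(3) unfolding L[OF sm] by (rule order_trans)
qed

text \<open>Finiteness of the majorant makes the integral over (s, \<eta>) absolutely convergent, so
  it splits into a convolution in frequency followed by an integral in time.\<close>

lemma sol_duhamel:
 assumes fin: "maj_sol c (t, \<xi>) < \<infinity>"
 shows "sol c (t, \<xi>) = data c (t, \<xi>) + (LINT s|lborel. of_real (heat_kernel \<alpha> t s \<xi>) * quad c (s, \<xi>)) + (LINT s|lborel. of_real (heat_kernel \<alpha> t s \<xi>) * lin c (s, \<xi>))"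
proof -
 have fin': "maj maj_sol c (t, \<xi>) < \<infinity>" using fin maj_sol_eq[of c "(t, \<xi>)"] by simp
 note I = integrable_terms[of sol maj_sol c "(t, \<xi>)", OF sol_measurable sol_le fin']
 have inner: "(LINT \<eta>|lborel. qker c b b' (t, \<xi>) (s, \<eta>) * (g (s, \<xi> - \<eta>) * h (s, \<eta>))) =
   of_real (heat_kernel \<alpha> t s \<xi>) * (quad_symbol c b b' \<xi> * (LINT \<eta>|lborel. g (s, \<xi> - \<eta>) * h (s, \<eta>)))" for b b' s g h
  by (simp add: qker_def mult.assoc)
 have q: "(LINT z|(lborel \<Otimes>\<^sub>M lborel). qker c b b' (t, \<xi>) z * (sol b (fst z, \<xi> - snd z) * sol b' z)) =
   (LINT s|lborel. of_real (heat_kernel \<alpha> t s \<xi>) * (quad_symbol c b b' \<xi> * conv b b' (s, \<xi>)))" for b b'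
  using lborel_pair.integral_fst'[OF I(1)[of b b'], symmetric] unfolding fst_conv snd_conv inner conv_def .
 have qi: "integrable lborel (%s. of_real (heat_kernel \<alpha> t s \<xi>) * (quad_symbol c b b' \<xi> * conv b b' (s, \<xi>)))" for b b'
  using lborel_pair.integrable_fst'[OF I(1)[of b b']] unfolding fst_conv snd_conv inner conv_def .
 have lk: "lker c b (t, \<xi>) s * x = of_real (heat_kernel \<alpha> t s \<xi>) * (lin_symbol c b \<xi> * x)" for b s x
  by (simp add: lker_def mult.assoc)
 note li = I(2)[unfolded lk snd_conv]
 have Q: "(\<Sum>b\<in>UNIV. \<Sum>b'\<in>UNIV. LINT s|lborel. of_real (heat_kernel \<alpha> t s \<xi>) * (quad_symbol c b b' \<xi> * conv b b' (s, \<xi>)))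
   = (LINT s|lborel. of_real (heat_kernel \<alpha> t s \<xi>) * quad c (s, \<xi>))"
  unfolding quad_def snd_conv sum_distrib_left using qi
  by (subst Bochner_Integration.integral_sum, simp, intro sum.cong refl Bochner_Integration.integral_sum[symmetric]) simp
 have L: "(\<Sum>b\<in>UNIV. LINT s|lborel. of_real (heat_kernel \<alpha> t s \<xi>) * (lin_symbol c b \<xi> * sol b (s, \<xi>)))
   = (LINT s|lborel. of_real (heat_kernel \<alpha> t s \<xi>) * lin c (s, \<xi>))"
  unfolding lin_def snd_conv sum_distrib_left using li by (intro Bochner_Integration.integral_sum[symmetric]) simp
 show ?thesis unfolding sol_eq[OF fin] pic_def snd_conv q lk Q L ..
qed

end

section \<open>The mild equations and membership in the solution spaces\<close>

lemma AE_lebesgue_on_nonneg_iff: "(AE t in lebesgue_on {0..}. P t) \<longleftrightarrow> (AE t in lborel. 0 <= t --> P t)"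
 for P :: "real => bool"
proof -
 have "(AE t in lebesgue_on {0..}. P t) \<longleftrightarrow> (AE t in lebesgue. t \<in> {0..} --> P t)"
  by (rule AE_restrict_space_iff) auto
 then show ?thesis by (simp add: AE_completion_iff)
qed

lemma AE_lebesgue_on_positive: "(\<And>t. 0 < t ==> P t) ==> AE t in lebesgue_on {0..}. P t"
 for P :: "real => bool"
 unfolding AE_lebesgue_on_nonneg_iff using AE_lborel_singleton[of "0 :: real"] by eventually_elim auto

text \<open>The norm in question lives on Lebesgue measure of the half-line, where \<open>h\<close>
  is merely dominated at positive times; comparison with the Borel function \<open>B\<close> on the
  whole line brings it into the calculus of set bounds.\<close>

lemma weak_norm_time_finite:
 fixes h B :: "real => ennreal"
 assumes [measurable]: "B \<in> borel_measurable borel" and p: "0 < p" and L: "lorentz_bound (1 - 1 / p) A B" and A: "A < \<infinity>"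
  and h: "\<And>t. 0 < t ==> h t <= B t"
 shows "weak_norm (lebesgue_on {0..}) p h < \<infinity>"
proof -
 have w: "weak_norm lborel p B <= ennreal (enn2real A)"
  using weak_norm_le_lorentz_bound[OF assms(1) p L] A by simp
 have "weak_norm (lebesgue_on {0..}) p h <= ennreal (enn2real A)"
 proof (rule weak_norm_leI[OF p enn2real_nonneg])
  fix l :: real assume l: "0 < l"
  let ?N = "{t. B t > ennreal l}" and ?S = "{x \<in> space (lebesgue_on {0..}). ennreal l < h x}"
  have N: "?N \<in> sets lborel" by measurable
  have AE: "AE t in lebesgue. t \<in> ?S --> t \<in> ?N"
   using AE_completion[OF AE_lborel_singleton[of "0 :: real"]]
  proof eventually_elim
   case (elim t)
   show ?case
   proof
    assume "t \<in> ?S"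
    then have t: "0 <= t" "ennreal l < h t" by (auto simp: space_restrict_space)
    then have "h t <= B t" using elim by (intro h) simp
    then show "t \<in> ?N" using t by simp
   qed
  qed
  have "emeasure (lebesgue_on {0..}) ?S = emeasure lebesgue ?S"
   by (rule emeasure_restrict_space) (auto simp: space_restrict_space)
  \<comment> \<open>Monotonicity needs measurability of the larger set only; \<open>h\<close> is not
    known to be measurable.\<close>
  also have "\<dots> <= emeasure lebesgue ?N" by (rule emeasure_mono_AE[OF AE sets_completionI_sets[OF N]])
  also have "\<dots> = emeasure lborel {t \<in> space lborel. B t > ennreal l}" using sets_completionI_sets[OF N] N by simp
  also have "\<dots> <= ennreal ((enn2real A / l) powr p)" by (rule weak_norm_level_set[OF p enn2real_nonneg w l])
  finally show "emeasure (lebesgue_on {0..}) ?S <= ennreal ((enn2real A / l) powr p)" .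
 qed
 then show ?thesis by (rule le_less_trans) simp
qed

lemma norm_vec_le_sum: "norm x <= (\<Sum>i\<in>UNIV. norm (x $ i))"
 for x :: "('a::real_normed_vector)^'n"
 unfolding norm_vec_def by (rule L2_set_le_sum) auto

context boussinesq_solution
begin

lemma duhamel_integral_measurable:
 assumes [measurable]: "H \<in> borel_measurable (borel \<Otimes>\<^sub>M borel)"
 shows "(%\<xi>::(real, 'd) vec. LINT s|lborel. complex_of_real (heat_kernel \<alpha> t s \<xi>) * H (s, \<xi>)) \<in> borel_measurable borel"
 by (rule sigma_finite_measure.borel_measurable_lebesgue_integral[OF sigma_finite_lborel]) (simp add: split_beta', measurable)

lemma duhamel_dominated:
 assumes t: "0 < t" and H: "H \<in> borel_measurable (borel \<Otimes>\<^sub>M borel)"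
  and le: "\<And>\<xi>. (\<integral>\<^sup>+s. ennreal (heat_kernel \<alpha> t s \<xi>) * ennreal (norm (H (s, \<xi>))) \<partial>lborel) <= maj_sol c (t, \<xi>)"
 shows "tempered_fun (%\<xi>. LINT s|lborel. of_real (heat_kernel \<alpha> t s \<xi>) * H (s, \<xi>))"
  and "(\<integral>\<^sup>+\<xi>. w2 \<xi> * (\<integral>\<^sup>+s. ennreal (heat_kernel \<alpha> t s \<xi>) * ennreal (norm (H (s, \<xi>))) \<partial>lborel) \<partial>lborel) < \<infinity>"
proof -
 show "tempered_fun (%\<xi>. LINT s|lborel. of_real (heat_kernel \<alpha> t s \<xi>) * H (s, \<xi>))"
 proof (rule dominated_tempered[OF t duhamel_integral_measurable[OF H]])
  fix \<xi> :: "(real, 'd) vec"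
  have "ennreal (norm (LINT s|lborel. of_real (heat_kernel \<alpha> t s \<xi>) * H (s, \<xi>))) <= (\<integral>\<^sup>+s. ennreal (norm (of_real (heat_kernel \<alpha> t s \<xi>) * H (s, \<xi>))) \<partial>lborel)"
   by (rule norm_integral_le)
  also have "\<dots> = (\<integral>\<^sup>+s. ennreal (heat_kernel \<alpha> t s \<xi>) * ennreal (norm (H (s, \<xi>))) \<partial>lborel)"
   by (simp add: norm_mult ennreal_mult heat_kernel_nonneg)
  also note le
  finally show "ennreal (norm (LINT s|lborel. of_real (heat_kernel \<alpha> t s \<xi>) * H (s, \<xi>))) <= maj_sol c (t, \<xi>)" .
 qed
 show "(\<integral>\<^sup>+\<xi>. w2 \<xi> * (\<integral>\<^sup>+s. ennreal (heat_kernel \<alpha> t s \<xi>) * ennreal (norm (H (s, \<xi>))) \<partial>lborel) \<partial>lborel) < \<infinity>"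
  by (rule le_less_trans[OF nn_integral_mono[OF mult_left_mono[OF le]] maj_sol_weight[OF t]]) simp
qed

lemma duhamel_parts:
 assumes t: "0 < t" and H: "H \<in> borel_measurable (borel \<Otimes>\<^sub>M borel)"
  and le: "\<And>\<xi>. (\<integral>\<^sup>+s. ennreal (heat_kernel \<alpha> t s \<xi>) * ennreal (norm (H (s, \<xi>))) \<partial>lborel) <= maj_sol c (t, \<xi>)"
  and T: "\<And>s. good s ==> fourier_fun_off0 (T s) (%\<xi>. H (s, \<xi>))"
 shows "time_integrable t (%s. heat \<alpha> (t - s) (T s))"
  and "\<phi> \<in> schwartz ==> time_integral t (%s. heat \<alpha> (t - s) (T s)) \<phi> = (LINT \<xi>|lborel. (LINT s|lborel. of_real (heat_kernel \<alpha> t s \<xi>) * H (s, \<xi>)) * fourier_inv \<phi> \<xi>)"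
proof -
 have "AE s in lborel. 0 < s \<and> s < t --> fourier_fun_off0 (T s) (%\<xi>. H (s, \<xi>))"
  using AE_good by eventually_elim (use T in auto)
 note D = duhamel_fourier[OF H duhamel_dominated(2)[OF t H le] this]
 show "time_integrable t (%s. heat \<alpha> (t - s) (T s))" unfolding time_integrable_def using D(1) by blast
 show "\<phi> \<in> schwartz ==> time_integral t (%s. heat \<alpha> (t - s) (T s)) \<phi> = (LINT \<xi>|lborel. (LINT s|lborel. of_real (heat_kernel \<alpha> t s \<xi>) * H (s, \<xi>)) * fourier_inv \<phi> \<xi>)"
  by (rule D(2))
qed

text \<open>At each positive time the pointwise Duhamel formula holds off a null set of frequencies.
  Its three parts are tempered one by one, so the pairing with a test function may be split.\<close>

lemma component_equation:
 assumes t: "0 < t" and \<phi>: "\<phi> \<in> schwartz"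
 shows "component c t \<phi> = (LINT \<xi>|lborel. data c (t, \<xi>) * fourier_inv \<phi> \<xi>)
  + (LINT \<xi>|lborel. (LINT s|lborel. of_real (heat_kernel \<alpha> t s \<xi>) * quad c (s, \<xi>)) * fourier_inv \<phi> \<xi>)
  + (LINT \<xi>|lborel. (LINT s|lborel. of_real (heat_kernel \<alpha> t s \<xi>) * lin c (s, \<xi>)) * fourier_inv \<phi> \<xi>)"
proof -
 let ?Q = "%\<xi>. LINT s|lborel. of_real (heat_kernel \<alpha> t s \<xi>) * quad c (s, \<xi>)"
 let ?L = "%\<xi>. LINT s|lborel. of_real (heat_kernel \<alpha> t s \<xi>) * lin c (s, \<xi>)"
 have TD: "tempered_fun (%\<xi>. data c (t, \<xi>))"
  by (rule dominated_tempered[OF t section_measurable_complex[OF data_measurable'] order_trans[OF data_le maj_sol_parts(1)]])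
 have TQ: "tempered_fun ?Q" by (rule duhamel_dominated(1)[OF t quad_measurable maj_sol_parts(2)])
 have TL: "tempered_fun ?L" by (rule duhamel_dominated(1)[OF t lin_measurable maj_sol_parts(3)])
 note I = TD[THEN tempered_fun_integrable_schwartz(2), OF \<phi>] TQ[THEN tempered_fun_integrable_schwartz(2), OF \<phi>] TL[THEN tempered_fun_integrable_schwartz(2), OF \<phi>]
 note [measurable] = tempered_fun_measurable[OF TD] tempered_fun_measurable[OF TQ] tempered_fun_measurable[OF TL]
 have "component c t \<phi> = from_fourier (%\<xi>. data c (t, \<xi>) + ?Q \<xi> + ?L \<xi>) \<phi>"
  unfolding component_def
 proof (rule from_fourier_eq_AE[OF \<phi>])
  show "AE \<xi> in lborel. sol c (t, \<xi>) = data c (t, \<xi>) + ?Q \<xi> + ?L \<xi>"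
   using maj_sol_AE_finite[OF t, of c] by eventually_elim (rule sol_duhamel)
 qed measurable
 also have "\<dots> = (LINT \<xi>|lborel. data c (t, \<xi>) * fourier_inv \<phi> \<xi> + ?Q \<xi> * fourier_inv \<phi> \<xi> + ?L \<xi> * fourier_inv \<phi> \<xi>)"
  unfolding from_fourier_def by (simp only: distrib_right)
 also have "\<dots> = (LINT \<xi>|lborel. data c (t, \<xi>) * fourier_inv \<phi> \<xi>) + (LINT \<xi>|lborel. ?Q \<xi> * fourier_inv \<phi> \<xi>) + (LINT \<xi>|lborel. ?L \<xi> * fourier_inv \<phi> \<xi>)"
  using I by (simp only: Bochner_Integration.integral_add Bochner_Integration.integrable_add)
 finally show ?thesis .
qed

lemma minus_quad:
 "(%z. - quad c z) \<in> borel_measurable (borel \<Otimes>\<^sub>M borel)"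
 "(\<integral>\<^sup>+s. ennreal (heat_kernel \<alpha> t s \<xi>) * ennreal (norm (- quad c (s, \<xi>))) \<partial>lborel) <= maj_sol c (t, \<xi>)"
 using borel_measurable_uminus[OF quad_measurable[of c]] maj_sol_parts(2)[of t \<xi> c] by simp_all

lemma force_maj_sol: "(\<integral>\<^sup>+s. ennreal (heat_kernel \<alpha> t s \<xi>) * ennreal (norm (force i (s, \<xi>))) \<partial>lborel) <= maj_sol (Some i) (t, \<xi>)"
 by (rule order_trans[OF _ maj_sol_parts(1)]) (simp add: data_maj_def)

lemma mild_integrable:
 assumes t: "0 < t"
 shows "time_integrable t (%s. heat \<alpha> (t - s) (leray (div_tensor (%i. component (Some i) s) (%i. component (Some i) s)) i))"
  and "time_integrable t (%s. heat \<alpha> (t - s) (leray (times_ed (component None s)) i))"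
  and "time_integrable t (%s. heat \<alpha> (t - s) (leray (f s) i))"
  and "time_integrable t (%s. heat \<alpha> (t - s) (ddiv (%j. dprod (component None s) (component (Some j) s))))"
 by (rule duhamel_parts(1)[OF t minus_quad fourier_quad_Some] duhamel_parts(1)[OF t lin_measurable maj_sol_parts(3) fourier_lin]
   duhamel_parts(1)[OF t force_measurable force_maj_sol fourier_force] duhamel_parts(1)[OF t minus_quad fourier_quad_None], assumption)+

lemma velocity_equation:
 assumes t: "0 < t" and \<phi>: "\<phi> \<in> schwartz"
 shows "component (Some i) t \<phi> = heat \<alpha> t (u0 i) \<phi>
   - time_integral t (%s. heat \<alpha> (t - s) (leray (div_tensor (%i. component (Some i) s) (%i. component (Some i) s)) i)) \<phi>
   + time_integral t (%s. heat \<alpha> (t - s) (leray (times_ed (component None s)) i)) \<phi>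
   + time_integral t (%s. heat \<alpha> (t - s) (leray (f s) i)) \<phi>"
proof -
 let ?E = "%\<xi>. complex_of_real (exp (- t * norm \<xi> powr \<alpha>)) * a0 i \<xi>"
 let ?G = "%\<xi>. LINT s|lborel. of_real (heat_kernel \<alpha> t s \<xi>) * force i (s, \<xi>)"
 have D: "data (Some i) (t, \<xi>) = ?E \<xi> + ?G \<xi>" for \<xi> using t by (simp add: data_def)
 have TE: "tempered_fun ?E"
 proof (rule dominated_tempered[OF t, of _ "Some i"])
  fix \<xi>
  have "ennreal (norm (?E \<xi>)) = ennreal (exp (- t * norm \<xi> powr \<alpha>)) * ennreal (norm (a0 i \<xi>))" by (simp add: norm_mult ennreal_mult)
  also have "\<dots> <= data_maj (Some i) (t, \<xi>)" using t by (simp add: data_maj_def add_increasing2)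
  also have "\<dots> <= maj_sol (Some i) (t, \<xi>)" by (rule maj_sol_parts(1))
  finally show "ennreal (norm (?E \<xi>)) <= maj_sol (Some i) (t, \<xi>)" .
 qed measurable
 have TG: "tempered_fun ?G" by (rule duhamel_dominated(1)[OF t force_measurable force_maj_sol])
 note I = TE[THEN tempered_fun_integrable_schwartz(2), OF \<phi>] TG[THEN tempered_fun_integrable_schwartz(2), OF \<phi>]
 have e: "time_integral t (%s. heat \<alpha> (t - s) (leray (f s) i)) \<phi> = (LINT \<xi>|lborel. (LINT s|lborel. of_real (heat_kernel \<alpha> t s \<xi>) * force i (s, \<xi>)) * fourier_inv \<phi> \<xi>)"
  by (rule duhamel_parts(2)[OF t force_measurable force_maj_sol fourier_force \<phi>])
 have h: "(LINT \<xi>|lborel. data (Some i) (t, \<xi>) * fourier_inv \<phi> \<xi>) = heat \<alpha> t (u0 i) \<phi> + time_integral t (%s. heat \<alpha> (t - s) (leray (f s) i)) \<phi>"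
  unfolding D distrib_right heat_eq[OF transforms(1) \<phi>] e by (rule Bochner_Integration.integral_add[OF I])
 have "time_integral t (%s. heat \<alpha> (t - s) (leray (div_tensor (%i. component (Some i) s) (%i. component (Some i) s)) i)) \<phi> = (LINT \<xi>|lborel. (LINT s|lborel. of_real (heat_kernel \<alpha> t s \<xi>) * (- quad (Some i) (s, \<xi>))) * fourier_inv \<phi> \<xi>)"
  by (rule duhamel_parts(2)[OF t minus_quad fourier_quad_Some \<phi>])
 then have q: "time_integral t (%s. heat \<alpha> (t - s) (leray (div_tensor (%i. component (Some i) s) (%i. component (Some i) s)) i)) \<phi> = - (LINT \<xi>|lborel. (LINT s|lborel. of_real (heat_kernel \<alpha> t s \<xi>) * quad (Some i) (s, \<xi>)) * fourier_inv \<phi> \<xi>)" by simp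
 have l: "time_integral t (%s. heat \<alpha> (t - s) (leray (times_ed (component None s)) i)) \<phi> = (LINT \<xi>|lborel. (LINT s|lborel. of_real (heat_kernel \<alpha> t s \<xi>) * lin (Some i) (s, \<xi>)) * fourier_inv \<phi> \<xi>)"
  by (rule duhamel_parts(2)[OF t lin_measurable maj_sol_parts(3) fourier_lin \<phi>])
 show ?thesis unfolding component_equation[OF t \<phi>] h q l by simp
qed

lemma temperature_equation:
 assumes t: "0 < t" and \<phi>: "\<phi> \<in> schwartz"
 shows "component None t \<phi> = heat \<alpha> t \<theta>0 \<phi>
   - time_integral t (%s. heat \<alpha> (t - s) (ddiv (%j. dprod (component None s) (component (Some j) s)))) \<phi>"
proof -
 have D: "data None (t, \<xi>) = of_real (exp (- t * norm \<xi> powr \<alpha>)) * b0 \<xi>" for \<xi> using t by (simp add: data_def)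
 have L: "lin None z = 0" for z by (simp add: lin_def lin_symbol_def)
 have "time_integral t (%s. heat \<alpha> (t - s) (ddiv (%j. dprod (component None s) (component (Some j) s)))) \<phi> = (LINT \<xi>|lborel. (LINT s|lborel. of_real (heat_kernel \<alpha> t s \<xi>) * (- quad None (s, \<xi>))) * fourier_inv \<phi> \<xi>)"
  by (rule duhamel_parts(2)[OF t minus_quad fourier_quad_None \<phi>])
 then have q: "time_integral t (%s. heat \<alpha> (t - s) (ddiv (%j. dprod (component None s) (component (Some j) s)))) \<phi> = - (LINT \<xi>|lborel. (LINT s|lborel. of_real (heat_kernel \<alpha> t s \<xi>) * quad None (s, \<xi>)) * fourier_inv \<phi> \<xi>)" by simp
 show ?thesis unfolding component_equation[OF t \<phi>] q heat_eq[OF transforms(2) \<phi>] D L by simp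
qed

lemma mild: "mild_solution \<alpha> u0 \<theta>0 f (%t i. component (Some i) t) (component None)"
 unfolding mild_solution_def
 by (intro allI impI conjI ballI component_tempered component_real_valued mild_integrable velocity_equation temperature_equation)

lemma component_time_fourier: "time_fourier_measurable (component c)"
 unfolding time_fourier_measurable_def
proof (intro exI conjI)
 show "sol c \<in> borel_measurable borel" using sol_measurable[of c] by (simp add: borel_prod)
 show "AE t in lebesgue_on {0..}. tempered (component c t) \<and> fourier_fun (component c t) (%\<xi>. sol c (t, \<xi>))"
  by (rule AE_lebesgue_on_positive) (simp add: component_tempered component_fourier)
qed

lemma fhat_component_le:
 assumes t: "0 < t" shows "AE \<xi> in lborel. ennreal (norm (fhat (component c t) \<xi>)) <= maj_sol c (t, \<xi>)"
 using fhat_AE[OF component_fourier[OF t, of c]] by eventually_elim (use sol_le in simp)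

lemma velocity_membership:
 assumes \<alpha>2: "\<alpha> < 2" and r: "\<theta>r = 1 - 1 / \<alpha>"
 shows "(%t i. component (Some i) t) \<in> time_L1_vec (\<alpha> / (\<alpha> - 1))"
proof -
 let ?p = "\<alpha> / (\<alpha> - 1)"
 have p: "0 < ?p" "1 / ?p = \<theta>r" using \<alpha>1 r by (auto simp: field_simps)
 have "lorentz_bound (1 - \<theta>r) (\<Sum>i\<in>(UNIV :: 'd set). ennreal R) (%t. \<Sum>i\<in>UNIV. ts (Some i) t)"
  using ts_bound[of "Some i" for i] by (intro lorentz_bound_sum) (auto simp: thc_def)
 then have L: "lorentz_bound (1 - 1 / ?p) (\<Sum>i\<in>(UNIV :: 'd set). ennreal R) (%t. \<Sum>i\<in>UNIV. ts (Some i) t)" unfolding p(2) .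
 have "weak_norm (lebesgue_on {0..}) ?p (%t. \<integral>\<^sup>+\<xi>. ennreal (norm (vhat (%i. component (Some i) t) \<xi>)) \<partial>lborel) < \<infinity>"
 proof (rule weak_norm_time_finite[OF _ p(1) L])
  fix t :: real assume t: "0 < t"
  have m: "(%\<xi>. maj_sol (Some i) (t, \<xi>)) \<in> borel_measurable borel" for i by (intro section_measurable' maj_sol_measurable)
  have "(\<integral>\<^sup>+\<xi>. ennreal (norm (vhat (%i. component (Some i) t) \<xi>)) \<partial>lborel) <= (\<integral>\<^sup>+\<xi>. (\<Sum>i\<in>UNIV. maj_sol (Some i) (t, \<xi>)) \<partial>lborel)"
  proof (rule nn_integral_mono_AE)
   have "AE \<xi> in lborel. \<forall>i\<in>UNIV. ennreal (norm (fhat (component (Some i) t) \<xi>)) <= maj_sol (Some i) (t, \<xi>)"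
    by (intro AE_finite_allI fhat_component_le t) auto
   then show "AE \<xi> in lborel. ennreal (norm (vhat (%i. component (Some i) t) \<xi>)) <= (\<Sum>i\<in>UNIV. maj_sol (Some i) (t, \<xi>))"
   proof eventually_elim
    case (elim \<xi>)
    have "ennreal (norm (vhat (%i. component (Some i) t) \<xi>)) <= ennreal (\<Sum>i\<in>UNIV. norm (fhat (component (Some i) t) \<xi>))"
     using norm_vec_le_sum[of "vhat (%i. component (Some i) t) \<xi>"] by (intro ennreal_leI) (simp add: vhat_def)
    also have "\<dots> = (\<Sum>i\<in>UNIV. ennreal (norm (fhat (component (Some i) t) \<xi>)))" by (subst sum_ennreal) auto
    also have "\<dots> <= (\<Sum>i\<in>UNIV. maj_sol (Some i) (t, \<xi>))" using elim by (intro sum_mono) auto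
    finally show ?case .
   qed
  qed
  also have "\<dots> = (\<Sum>i\<in>UNIV. \<integral>\<^sup>+\<xi>. maj_sol (Some i) (t, \<xi>) \<partial>lborel)" using m by (intro nn_integral_sum) auto
  also have "\<dots> <= (\<Sum>i\<in>UNIV. ts (Some i) t)"
   using maj_sol_bound[of "Some i" t for i] m by (intro sum_mono) (auto simp: kap_def lorentz_bound_0_iff)
  finally show "(\<integral>\<^sup>+\<xi>. ennreal (norm (vhat (%i. component (Some i) t) \<xi>)) \<partial>lborel) <= (\<Sum>i\<in>UNIV. ts (Some i) t)" .
 qed (simp_all add: ennreal_mult_less_top ennreal_of_nat_eq_real_of_nat)
 then show ?thesis unfolding time_L1_vec_def time_L1_norm_def using component_time_fourier by simp
qed

lemma temperature_membership:
 assumes p: "0 < p" "\<theta>p = 1 / p" and q: "0 < q" "\<kappa> = 1 - 1 / q"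
 shows "component None \<in> time_weak p 0 q"
proof -
 have "thc None = \<theta>p" by (simp add: thc_def)
 then have ep: "1 - 1 / p = 1 - thc None" using p(2) by linarith
 have L: "lorentz_bound (1 - 1 / p) (ennreal R) (ts None)" unfolding ep by (rule ts_bound)
 have "kap None = \<kappa>" by (simp add: kap_def)
 then have eq: "1 - 1 / q = kap None" using q(2) by linarith
 have "weak_norm (lebesgue_on {0..}) p (%t. weak_norm lborel q (%\<xi>. ennreal (norm \<xi> powr 0 * norm (fhat (component None t) \<xi>)))) < \<infinity>"
 proof (rule weak_norm_time_finite[OF ts_measurable p(1) L])
  fix t :: real assume t: "0 < t"
  have [measurable]: "fhat (component None t) \<in> borel_measurable borel"
   by (rule fhat_measurable[OF fourier_fun_imp_off0[OF component_fourier[OF t]]])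
  show "weak_norm lborel q (%\<xi>. ennreal (norm \<xi> powr 0 * norm (fhat (component None t) \<xi>))) <= ts None t"
  proof (rule weak_norm_le_lorentz_bound[OF _ q(1)])
   have "lorentz_bound (1 - 1 / q) (ts None t) (%\<xi>. maj_sol None (t, \<xi>))"
    unfolding eq by (rule maj_sol_bound)
   then show "lorentz_bound (1 - 1 / q) (ts None t) (%\<xi>. ennreal (norm \<xi> powr 0 * norm (fhat (component None t) \<xi>)))"
   proof (rule lorentz_bound_mono)
    show "AE \<xi> in lborel. ennreal (norm \<xi> powr 0 * norm (fhat (component None t) \<xi>)) <= maj_sol None (t, \<xi>)"
     using fhat_component_le[OF t, of None] by eventually_elim (simp add: powr_def)
   qed simp
  qed measurable
 qed simp
 then show ?thesis unfolding time_weak_def time_weak_norm_def using component_time_fourier by simp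
qed

end

section \<open>From the norms of the data to the quantitative hypotheses\<close>

lemma dyadic_weight_le:
 assumes "ennreal (2 powr (of_int j * (- \<beta>))) * W <= N"
 shows "W <= N * ennreal (2 powr (of_int j * \<beta>))"
proof -
 have e: "ennreal (2 powr (of_int j * \<beta>)) * ennreal (2 powr (of_int j * (- \<beta>))) = 1"
  by (simp add: ennreal_mult[symmetric] powr_add[symmetric])
 have "W = ennreal (2 powr (of_int j * \<beta>)) * (ennreal (2 powr (of_int j * (- \<beta>))) * W)"
  unfolding mult.assoc[symmetric] e by simp
 also have "\<dots> <= ennreal (2 powr (of_int j * \<beta>)) * N" by (intro mult_left_mono assms) auto
 finally show ?thesis by (simp only: mult.commute)
qed

text \<open>The heat-flow estimate for Besov data of negative regularity -\<beta>: positive \<beta>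
  makes the low annuli summable, and the exponential disposes of the high ones.\<close>

lemma besov_L1_heat:
 assumes \<beta>: "0 < \<beta>" and \<alpha>: "0 < \<alpha>"
 shows "\<exists>C>0. \<forall>(h :: real^'n => ennreal) N t. h \<in> borel_measurable borel --> 0 < t -->
  (\<forall>j. ennreal (2 powr (of_int j * (- \<beta>))) * (\<integral>\<^sup>+\<xi>. indicator (annulus j) \<xi> * h \<xi> \<partial>lborel) <= N) -->
  (\<integral>\<^sup>+\<xi>. ennreal (exp (- t * norm \<xi> powr \<alpha>)) * h \<xi> \<partial>lborel) <= ennreal C * N * ennreal (t powr (- (\<beta> / \<alpha>)))"
proof -
 obtain C where C: "C > 0" and H: "\<And>(h :: real^'n => ennreal) A \<tau>. h \<in> borel_measurable borel ==> 0 < \<tau> ==>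
  (\<forall>j. (\<integral>\<^sup>+\<xi>. h \<xi> * indicator (annulus j) \<xi> \<partial>lborel) <= A * ennreal (2 powr (of_int j * \<beta>))) ==>
  (\<integral>\<^sup>+\<xi>. ennreal (exp (- \<tau> * norm \<xi> powr \<alpha>)) * h \<xi> \<partial>lborel) <= ennreal C * A * ennreal (\<tau> powr (- (\<beta> / \<alpha>)))"
  using heat_integral_bound[OF \<beta> \<alpha>, where 'n = 'n] by blast
 show ?thesis
 proof (intro exI[of _ C] conjI C allI impI)
  fix h :: "real^'n => ennreal" and N and t :: real
  assume h: "h \<in> borel_measurable borel" and t: "0 < t"
   and N: "\<forall>j. ennreal (2 powr (of_int j * (- \<beta>))) * (\<integral>\<^sup>+\<xi>. indicator (annulus j) \<xi> * h \<xi> \<partial>lborel) <= N"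
  show "(\<integral>\<^sup>+\<xi>. ennreal (exp (- t * norm \<xi> powr \<alpha>)) * h \<xi> \<partial>lborel) <= ennreal C * N * ennreal (t powr (- (\<beta> / \<alpha>)))"
  proof (rule H[OF h t], rule allI)
   fix j
   show "(\<integral>\<^sup>+\<xi>. h \<xi> * indicator (annulus j) \<xi> \<partial>lborel) <= N * ennreal (2 powr (of_int j * \<beta>))"
    using dyadic_weight_le[OF N[rule_format, of j]] by (simp add: mult.commute)
  qed
 qed
qed

text \<open>Instead of adding weak quasi-norms over annuli, the \<open>L^1\<close> estimate is
  applied to \<open>h\<close> restricted to a test set: on each annulus its mass is at most a
  multiple of the weak norm times the measure of the set to the power 1 - 1/q.\<close>

lemma besov_weak_heat:
 assumes \<beta>: "0 < \<beta>" and \<alpha>: "0 < \<alpha>" and q: "1 < q"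
 shows "\<exists>C>0. \<forall>(h :: real^'n => ennreal) N t. h \<in> borel_measurable borel --> 0 < t -->
  (\<forall>j. ennreal (2 powr (of_int j * (- \<beta>))) * weak_norm lborel q (%\<xi>. indicator (annulus j) \<xi> * h \<xi>) <= N) -->
  lorentz_bound (1 - 1 / q) (ennreal C * N * ennreal (t powr (- (\<beta> / \<alpha>)))) (%\<xi>. ennreal (exp (- t * norm \<xi> powr \<alpha>)) * h \<xi>)"
proof -
 obtain C where C: "C > 0" and H: "\<And>(h :: real^'n => ennreal) A \<tau>. h \<in> borel_measurable borel ==> 0 < \<tau> ==>
  (\<forall>j. (\<integral>\<^sup>+\<xi>. h \<xi> * indicator (annulus j) \<xi> \<partial>lborel) <= A * ennreal (2 powr (of_int j * \<beta>))) ==>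
  (\<integral>\<^sup>+\<xi>. ennreal (exp (- \<tau> * norm \<xi> powr \<alpha>)) * h \<xi> \<partial>lborel) <= ennreal C * A * ennreal (\<tau> powr (- (\<beta> / \<alpha>)))"
  using heat_integral_bound[OF \<beta> \<alpha>, where 'n = 'n] by blast
 define c where "c = 1 / (1 - 1 / q)"
 have c: "0 < c" using q by (simp add: c_def)
 show ?thesis
 proof (intro exI[of _ "C * c"] conjI allI impI)
  show "0 < C * c" using C c by simp
  fix h :: "real^'n => ennreal" and N and t :: real
  assume h [measurable]: "h \<in> borel_measurable borel" and t: "0 < t"
   and N: "\<forall>j. ennreal (2 powr (of_int j * (- \<beta>))) * weak_norm lborel q (%\<xi>. indicator (annulus j) \<xi> * h \<xi>) <= N"
  show "lorentz_bound (1 - 1 / q) (ennreal (C * c) * N * ennreal (t powr (- (\<beta> / \<alpha>)))) (%\<xi>. ennreal (exp (- t * norm \<xi> powr \<alpha>)) * h \<xi>)"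
  proof (rule lorentz_boundI)
   fix E :: "(real^'n) set" assume E [measurable]: "E \<in> sets borel" and fin: "emeasure lborel E < \<infinity>"
   let ?m = "ennreal (measure lborel E powr (1 - 1 / q))"
   have "(\<integral>\<^sup>+\<xi>. ennreal (exp (- t * norm \<xi> powr \<alpha>)) * (h \<xi> * indicator E \<xi>) \<partial>lborel) <= ennreal C * (ennreal c * N * ?m) * ennreal (t powr (- (\<beta> / \<alpha>)))"
   proof (rule H[OF _ t], measurable, rule allI)
    fix j
    note [measurable] = annulus_measurable[of j]
    have "(\<integral>\<^sup>+\<xi>. h \<xi> * indicator E \<xi> * indicator (annulus j) \<xi> \<partial>lborel) = (\<integral>\<^sup>+\<xi>. indicator (annulus j) \<xi> * h \<xi> * indicator E \<xi> \<partial>lborel)"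
     by (simp add: mult_ac)
    also have "\<dots> <= ennreal c * weak_norm lborel q (%\<xi>. indicator (annulus j) \<xi> * h \<xi>) * ?m"
     unfolding c_def by (rule lorentz_boundD[OF lorentz_bound_weak_norm[OF _ q] E fin]) measurable
    also have "\<dots> <= ennreal c * (N * ennreal (2 powr (of_int j * \<beta>))) * ?m"
     by (intro mult_right_mono mult_left_mono dyadic_weight_le N[rule_format]) auto
    finally show "(\<integral>\<^sup>+\<xi>. h \<xi> * indicator E \<xi> * indicator (annulus j) \<xi> \<partial>lborel) <= ennreal c * N * ?m * ennreal (2 powr (of_int j * \<beta>))"
     by (simp only: mult_ac)
   qed
   then show "(\<integral>\<^sup>+\<xi>. ennreal (exp (- t * norm \<xi> powr \<alpha>)) * h \<xi> * indicator E \<xi> \<partial>lborel) <= ennreal (C * c) * N * ennreal (t powr (- (\<beta> / \<alpha>))) * ?m"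
    using C c by (simp add: ennreal_mult mult_ac)
  qed
 qed
qed

lemma fourier_fun_cong_AE:
 assumes f: "fourier_fun T g" and [measurable]: "h \<in> borel_measurable borel" and AE: "AE \<xi> in lborel. h \<xi> = g \<xi>"
 shows "fourier_fun T h"
 unfolding fourier_fun_def
proof (intro conjI ballI)
 fix \<phi> :: "(real, 'a) vec => complex" assume S: "\<phi> \<in> schwartz"
 have [measurable]: "g \<in> borel_measurable borel" "\<phi> \<in> borel_measurable borel" using f schwartz_measurable[OF S] by (auto simp: fourier_fun_def)
 have e: "AE \<xi> in lborel. g \<xi> * \<phi> \<xi> = h \<xi> * \<phi> \<xi>" using AE by eventually_elim simp
 have i: "integrable lborel (%\<xi>. g \<xi> * \<phi> \<xi>)" "T (fourier \<phi>) = (LINT \<xi>|lborel. g \<xi> * \<phi> \<xi>)" using f S by (auto simp: fourier_fun_def)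
 show "integrable lborel (%\<xi>. h \<xi> * \<phi> \<xi>)" by (rule integrable_cong_AE_imp[OF i(1) _ e]) measurable
 show "T (fourier \<phi>) = (LINT \<xi>|lborel. h \<xi> * \<phi> \<xi>)" unfolding i(2) by (rule integral_cong_AE[OF _ _ e]) measurable
qed measurable

lemma fourier_fun_off0_cong_AE:
 assumes f: "fourier_fun_off0 T g" and [measurable]: "h \<in> borel_measurable borel" and AE: "AE \<xi> in lborel. h \<xi> = g \<xi>"
 shows "fourier_fun_off0 T h"
 unfolding fourier_fun_off0_def
proof (intro conjI ballI impI)
 fix \<phi> :: "(real, 'a) vec => complex" assume S: "\<phi> \<in> schwartz" and K: "\<exists>K. compact K \<and> 0 \<notin> K \<and> (\<forall>\<xi>. \<xi> \<notin> K --> \<phi> \<xi> = 0)"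
 have [measurable]: "g \<in> borel_measurable borel" "\<phi> \<in> borel_measurable borel" using f schwartz_measurable[OF S] by (auto simp: fourier_fun_off0_def)
 have e: "AE \<xi> in lborel. g \<xi> * \<phi> \<xi> = h \<xi> * \<phi> \<xi>" using AE by eventually_elim simp
 have i: "integrable lborel (%\<xi>. g \<xi> * \<phi> \<xi>)" "T (fourier \<phi>) = (LINT \<xi>|lborel. g \<xi> * \<phi> \<xi>)" using f S K unfolding fourier_fun_off0_def by blast+
 show "integrable lborel (%\<xi>. h \<xi> * \<phi> \<xi>)" by (rule integrable_cong_AE_imp[OF i(1) _ e]) measurable
 show "T (fourier \<phi>) = (LINT \<xi>|lborel. h \<xi> * \<phi> \<xi>)" unfolding i(2) by (rule integral_cong_AE[OF _ _ e]) measurable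
qed measurable

text \<open>Transforms of real distributions are Hermitian only almost everywhere. Symmetrising
  yields a representative with the symmetry at every point, as the pointwise iteration
  requires.\<close>

definition hermitian_part :: "(real^'n => complex) => real^'n => complex" where
 "hermitian_part g \<xi> = (g \<xi> + cnj (g (- \<xi>))) / 2"

lemma hermitian_part_uminus: "hermitian_part g (- \<xi>) = cnj (hermitian_part g \<xi>)"
 by (simp add: hermitian_part_def add.commute)

lemma hermitian_part_measurable [measurable]:
 assumes [measurable]: "g \<in> borel_measurable borel"
 shows "hermitian_part g \<in> borel_measurable borel"
 unfolding hermitian_part_def[abs_def] by measurable

lemma hermitian_part_AE:
 assumes "real_valued T" "fourier_fun_off0 T g"
 shows "AE \<xi> in lborel. hermitian_part g \<xi> = g \<xi>"
 using hermitian_of_real_valued[OF assms] by eventually_elim (simp add: hermitian_part_def)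

lemma weak_norm_cong_AE:
 assumes [measurable]: "f \<in> borel_measurable M" "g \<in> borel_measurable M" and "AE x in M. f x = g x"
 shows "weak_norm M q f = weak_norm M q g"
proof -
 have "emeasure M {x \<in> space M. f x > ennreal l} = emeasure M {x \<in> space M. g x > ennreal l}" for l
 proof (rule emeasure_eq_AE)
  show "AE x in M. x \<in> {x \<in> space M. f x > ennreal l} \<longleftrightarrow> x \<in> {x \<in> space M. g x > ennreal l}"
   using assms(3) by eventually_elim simp
 qed measurable
 then show ?thesis unfolding weak_norm_def by (simp only:)
qed

text \<open>Replaces the half-line norm of \<open>h\<close>, about which only almost everywhere
  information exists, by the whole-line norm of a Borel function; completeness makes the level sets
  of \<open>h\<close> measurable.\<close>

lemma weak_norm_lebesgue_on_nonneg:
 fixes \<nu> h :: "real => ennreal"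
 assumes [measurable]: "\<nu> \<in> borel_measurable borel" and zero: "\<And>t. t <= 0 ==> \<nu> t = 0" and AE: "AE t in lborel. 0 < t --> \<nu> t = h t"
 shows "weak_norm (lebesgue_on {0..}) p h = weak_norm lborel p \<nu>"
proof -
 have "emeasure (lebesgue_on {0..}) {t \<in> space (lebesgue_on {0..}). h t > ennreal l} = emeasure lborel {t \<in> space lborel. \<nu> t > ennreal l}" if l: "0 < l" for l
 proof -
  let ?N = "{t. \<nu> t > ennreal l}" and ?H = "{t. 0 <= t \<and> h t > ennreal l}"
  have N: "?N \<in> sets lborel" by measurable
  note Nc = sets_completionI_sets[OF N]
  have "AE t in lborel. t \<in> ?N \<longleftrightarrow> t \<in> ?H"
   using AE AE_lborel_singleton[of "0 :: real"]
  proof eventually_elim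
   case (elim t)
   show ?case
   proof (cases "0 < t")
    case False
    then show ?thesis using elim zero[of t] by simp
   qed (use elim in simp)
  qed
  then have A: "AE t in lebesgue. t \<in> ?N \<longleftrightarrow> t \<in> ?H" by (rule AE_completion)
  have H: "?H \<in> sets lebesgue" by (rule completion.in_sets_AE[OF A Nc]) simp
  have "emeasure (lebesgue_on {0..}) {t \<in> space (lebesgue_on {0..}). h t > ennreal l} = emeasure (lebesgue_on {0..}) ?H"
   by (rule arg_cong[where f = "emeasure _"]) (auto simp: space_restrict_space)
  also have "\<dots> = emeasure lebesgue ?H" by (rule emeasure_restrict_space) auto
  also have "\<dots> = emeasure lebesgue ?N"
  proof (rule emeasure_eq_AE[OF _ H Nc])
   show "AE t in lebesgue. t \<in> ?H \<longleftrightarrow> t \<in> ?N" using A by eventually_elim (rule sym)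
  qed
  also have "\<dots> = emeasure lborel ?N" using Nc N by simp
  finally show ?thesis by simp
 qed
 then show ?thesis unfolding weak_norm_def by (intro SUP_cong) auto
qed

text \<open>Produces one jointly Borel, exactly Hermitian representative \<open>F\<close>, and a
  Borel function \<open>m\<close> bounding its weighted weak norm at every time. The two fractions
  in the constant are the costs of passing from weak quasi-norms to set bounds, once in frequency
  and once in time.\<close>

lemma force_representation:
 fixes f :: "real => 'n => 'n::finite distr"
 assumes f: "f \<in> time_weak_vec p \<sigma> q" and real: "AE t in lebesgue_on {0..}. \<forall>i. real_valued (f t i)"
  and p: "1 < p" and q: "1 < q" and small: "time_weak_norm p \<sigma> q (%t. vhat (f t)) <= ennreal \<epsilon>" and \<epsilon>: "0 <= \<epsilon>"
 shows "\<exists>F m. (\<forall>l. F l \<in> borel_measurable (borel \<Otimes>\<^sub>M borel)) \<and> (\<forall>l s \<xi>. F l (s, - \<xi>) = cnj (F l (s, \<xi>))) \<and>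
  (AE s in lborel. 0 < s --> (\<forall>l. fourier_fun (f s l) (%\<xi>. F l (s, \<xi>)))) \<and> m \<in> borel_measurable borel \<and>
  (\<forall>l s. lorentz_bound (1 - 1 / q) (m s) (%\<xi>. ennreal (norm \<xi> powr \<sigma>) * ennreal (norm (F l (s, \<xi>))))) \<and>
  lorentz_bound (1 - 1 / p) (ennreal (1 / (1 - 1 / q) * (1 / (1 - 1 / p)) * \<epsilon>)) m"
proof -
 have "\<forall>i. \<exists>G :: real \<times> (real^'n) => complex. G \<in> borel_measurable borel \<and> (AE t in lebesgue_on {0..}. tempered (f t i) \<and> fourier_fun (f t i) (%\<xi>. G (t, \<xi>)))"
  using f unfolding time_weak_vec_def time_fourier_measurable_def by blast
 from choice[OF this] obtain G :: "'n => real \<times> (real^'n) => complex"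
  where G': "\<forall>i. G i \<in> borel_measurable borel \<and> (AE t in lebesgue_on {0..}. tempered (f t i) \<and> fourier_fun (f t i) (%\<xi>. G i (t, \<xi>)))" by blast
 have G: "G i \<in> borel_measurable borel" "AE t in lebesgue_on {0..}. tempered (f t i) \<and> fourier_fun (f t i) (%\<xi>. G i (t, \<xi>))" for i
  using G' by blast+
 have Gm [measurable]: "G i \<in> borel_measurable (borel \<Otimes>\<^sub>M borel)" for i using G(1)[of i] by (simp add: borel_prod)
 \<comment> \<open>The cutoff at nonpositive times makes whole-line and half-line norms agree; the
   symmetrisation changes nothing almost everywhere because the force is real-valued.\<close>
 define F where "F l z = (if 0 < fst z then hermitian_part (%\<xi>. G l (fst z, \<xi>)) (snd z) else 0)" for l z
 have Fm [measurable]: "F l \<in> borel_measurable (borel \<Otimes>\<^sub>M borel)" for l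
  unfolding F_def[abs_def] hermitian_part_def by measurable
 have Fs [measurable]: "(%\<xi>. F l (s, \<xi>)) \<in> borel_measurable borel" for l s using measurable_Pair2[OF Fm[of l], of s] by simp
 have Fh: "F l (s, - \<xi>) = cnj (F l (s, \<xi>))" for l s \<xi> by (simp add: F_def hermitian_part_uminus)
 have "AE t in lebesgue_on {0..}. \<forall>i\<in>UNIV. tempered (f t i) \<and> fourier_fun (f t i) (%\<xi>. G i (t, \<xi>))"
  by (intro AE_finite_allI G(2)) auto
 then have "AE s in lborel. 0 <= s --> (\<forall>i\<in>UNIV. tempered (f s i) \<and> fourier_fun (f s i) (%\<xi>. G i (s, \<xi>)))"
  unfolding AE_lebesgue_on_nonneg_iff .
 moreover have "AE s in lborel. 0 <= s --> (\<forall>i. real_valued (f s i))" using real unfolding AE_lebesgue_on_nonneg_iff .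
 ultimately have FF: "AE s in lborel. 0 < s --> (\<forall>l. fourier_fun (f s l) (%\<xi>. F l (s, \<xi>)))"
 proof eventually_elim
  case (elim s)
  show ?case
  proof (intro impI allI)
   fix l assume s: "0 < s"
   have g: "fourier_fun (f s l) (%\<xi>. G l (s, \<xi>))" and r: "real_valued (f s l)" using elim s by auto
   show "fourier_fun (f s l) (%\<xi>. F l (s, \<xi>))"
    by (rule fourier_fun_cong_AE[OF g Fs])
     (use hermitian_part_AE[OF r fourier_fun_imp_off0[OF g]] s in \<open>simp add: F_def\<close>)
  qed
 qed
 define h where "h s \<xi> = ennreal (norm \<xi> powr \<sigma> * norm (\<chi> l. F l (s, \<xi>)))" for s \<xi>
 have hm: "(%(s, \<xi>). h s \<xi>) \<in> borel_measurable (borel \<Otimes>\<^sub>M lborel)"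
 proof -
  have [measurable]: "(%z. norm (\<chi> l. F l z)) \<in> borel_measurable (borel \<Otimes>\<^sub>M borel)"
   unfolding norm_vec_def L2_set_def vec_lambda_beta by measurable
  have "(%z. ennreal (norm (snd z) powr \<sigma> * norm (\<chi> l. F l z))) \<in> borel_measurable (borel \<Otimes>\<^sub>M borel)" by measurable
  then show ?thesis
   by (simp add: h_def split_beta' measurable_cong_sets[OF sets_pair_measure_cong[OF refl sets_lborel] refl])
 qed
 have hs [measurable]: "h s \<in> borel_measurable borel" for s using measurable_Pair2[OF hm, of s] by simp
 define \<nu> where "\<nu> s = weak_norm lborel q (h s)" for s
 have \<nu>m [measurable]: "\<nu> \<in> borel_measurable borel"
  unfolding \<nu>_def[abs_def] using q by (intro weak_norm_measurable hm) auto
 have \<nu>0: "\<nu> t = 0" if "t <= 0" for t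
 proof -
  have "(\<chi> l. F l (t, \<xi>)) = 0" for \<xi> using that by (simp add: vec_eq_iff F_def)
  then have "h t = (%_. 0)" by (simp add: h_def fun_eq_iff)
  moreover have "weak_norm lborel q (%_ :: real^'n. 0) <= 0"
   by (rule weak_norm_le_lorentz_bound[OF _ _ lorentz_bound_zero]) (use q in auto)
  ultimately show ?thesis by (simp add: \<nu>_def)
 qed
 have AE\<nu>: "AE t in lborel. 0 < t --> \<nu> t = weak_norm lborel q (%\<xi>. ennreal (norm \<xi> powr \<sigma> * norm (vhat (f t) \<xi>)))"
  using FF
 proof eventually_elim
  case (elim t)
  show ?case
  proof
   assume "0 < t"
   then have ft: "fourier_fun (f t l) (%\<xi>. F l (t, \<xi>))" for l using elim by blast
   have [measurable]: "fhat (f t l) \<in> borel_measurable borel" for l by (rule fhat_measurable[OF fourier_fun_imp_off0[OF ft]])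
   show "\<nu> t = weak_norm lborel q (%\<xi>. ennreal (norm \<xi> powr \<sigma> * norm (vhat (f t) \<xi>)))"
    unfolding \<nu>_def
   proof (rule weak_norm_cong_AE)
    show "(%\<xi>. ennreal (norm \<xi> powr \<sigma> * norm (vhat (f t) \<xi>))) \<in> borel_measurable lborel"
    proof -
     have [measurable]: "(%\<xi>. norm (vhat (f t) \<xi>)) \<in> borel_measurable borel"
      unfolding vhat_def norm_vec_def L2_set_def vec_lambda_beta by measurable
     show ?thesis by measurable
    qed
    have "AE \<xi> in lborel. \<forall>l\<in>UNIV. fhat (f t l) \<xi> = F l (t, \<xi>)" by (intro AE_finite_allI fhat_AE[OF ft]) auto
    then show "AE \<xi> in lborel. h t \<xi> = ennreal (norm \<xi> powr \<sigma> * norm (vhat (f t) \<xi>))"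
     by eventually_elim (simp add: h_def vhat_def)
   qed measurable
  qed
 qed
 have "weak_norm (lebesgue_on {0..}) p (%t. weak_norm lborel q (%\<xi>. ennreal (norm \<xi> powr \<sigma> * norm (vhat (f t) \<xi>)))) = weak_norm lborel p \<nu>"
  by (rule weak_norm_lebesgue_on_nonneg[OF \<nu>m _ AE\<nu>]) (rule \<nu>0)
 then have wn: "weak_norm lborel p \<nu> <= ennreal \<epsilon>" using small unfolding time_weak_norm_def by (simp only:)
 have P: "ennreal a * (ennreal b * ennreal c) = ennreal (a * b * c)" if "0 <= a" "0 <= b" "0 <= c" for a b c
  using that by (simp add: ennreal_mult mult.assoc)
 have "ennreal (1 / (1 - 1 / q)) * (ennreal (1 / (1 - 1 / p)) * ennreal \<epsilon>) = ennreal (1 / (1 - 1 / q) * (1 / (1 - 1 / p)) * \<epsilon>)"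
  by (rule P) (use p q \<epsilon> in auto)
 moreover have "ennreal (1 / (1 - 1 / q)) * (ennreal (1 / (1 - 1 / p)) * weak_norm lborel p \<nu>) <= ennreal (1 / (1 - 1 / q)) * (ennreal (1 / (1 - 1 / p)) * ennreal \<epsilon>)"
  by (intro mult_left_mono wn) auto
 ultimately have le: "ennreal (1 / (1 - 1 / q)) * (ennreal (1 / (1 - 1 / p)) * weak_norm lborel p \<nu>) <= ennreal (1 / (1 - 1 / q) * (1 / (1 - 1 / p)) * \<epsilon>)"
  by (simp only:)
 define m where "m s = ennreal (1 / (1 - 1 / q)) * \<nu> s" for s
 have mb: "lorentz_bound (1 - 1 / p) (ennreal (1 / (1 - 1 / q) * (1 / (1 - 1 / p)) * \<epsilon>)) m"
  unfolding m_def[abs_def] by (rule lorentz_bound_mono[OF lorentz_bound_cmult[OF lorentz_bound_weak_norm[OF \<nu>m p] \<nu>m] le]) simp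
 have ml: "lorentz_bound (1 - 1 / q) (m s) (%\<xi>. ennreal (norm \<xi> powr \<sigma>) * ennreal (norm (F l (s, \<xi>))))" for l s
 proof (rule lorentz_bound_mono[OF lorentz_bound_weak_norm[OF hs q]])
  show "AE \<xi> in lborel. ennreal (norm \<xi> powr \<sigma>) * ennreal (norm (F l (s, \<xi>))) <= h s \<xi>"
  proof (rule AE_I2)
   fix \<xi> :: "real^'n"
   have "norm (F l (s, \<xi>)) <= norm (\<chi> l. F l (s, \<xi>))" using Finite_Cartesian_Product.norm_nth_le[where x = "\<chi> l. F l (s, \<xi>)" and i = l] by simp
   then show "ennreal (norm \<xi> powr \<sigma>) * ennreal (norm (F l (s, \<xi>))) <= h s \<xi>"
    unfolding h_def by (simp add: ennreal_mult[symmetric] ennreal_leI mult_left_mono)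
  qed
 qed (simp add: m_def \<nu>_def)
 have mm: "m \<in> borel_measurable borel" unfolding m_def[abs_def] by measurable
 show ?thesis by (intro exI[of _ F] exI[of _ m] conjI allI Fm Fh FF mm ml mb)
qed

lemma lorentz_bound_powr_0: "lorentz_bound \<kappa> A h ==> lorentz_bound \<kappa> A (%\<xi>. ennreal (norm \<xi> powr 0) * h \<xi>)"
 by (erule lorentz_bound_mono) (auto simp: powr_def)

text \<open>The symmetrised transform differs from \<open>fhat\<close> on a null set only, and each
  component is bounded by the vector norm; so the dyadic norm of the datum controls the pointwise
  Hermitian representative.\<close>

lemma besov_L1_component:
 assumes u: "\<psi> \<in> besov_L1_vec \<sigma>" and r: "real_valued (\<psi> i)"
 shows "fourier_fun_off0 (\<psi> i) (hermitian_part (fhat (\<psi> i)))"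
  and "ennreal (2 powr (of_int j * \<sigma>)) * (\<integral>\<^sup>+\<xi>. indicator (annulus j) \<xi> * ennreal (norm (hermitian_part (fhat (\<psi> i)) \<xi>)) \<partial>lborel) <= besov_L1_norm \<sigma> (vhat \<psi>)"
proof -
 obtain g where "fourier_fun_off0 (\<psi> i) g" using u unfolding besov_L1_vec_def by blast
 then have f: "fourier_fun_off0 (\<psi> i) (fhat (\<psi> i))" by (rule fhat_off0)
 have m: "fhat (\<psi> i) \<in> borel_measurable borel" using f by (rule fhat_measurable)
 have AE: "AE \<xi> in lborel. hermitian_part (fhat (\<psi> i)) \<xi> = fhat (\<psi> i) \<xi>" by (rule hermitian_part_AE[OF r f])
 show "fourier_fun_off0 (\<psi> i) (hermitian_part (fhat (\<psi> i)))"
  by (rule fourier_fun_off0_cong_AE[OF f hermitian_part_measurable[OF m] AE])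
 have 1: "(\<integral>\<^sup>+\<xi>. indicator (annulus j) \<xi> * ennreal (norm (hermitian_part (fhat (\<psi> i)) \<xi>)) \<partial>lborel) <= (\<integral>\<^sup>+\<xi>. indicator (annulus j) \<xi> * ennreal (norm (vhat \<psi> \<xi>)) \<partial>lborel)"
 proof (rule nn_integral_mono_AE)
  show "AE \<xi> in lborel. indicator (annulus j) \<xi> * ennreal (norm (hermitian_part (fhat (\<psi> i)) \<xi>)) <= indicator (annulus j) \<xi> * ennreal (norm (vhat \<psi> \<xi>))"
   using AE
  proof eventually_elim
   case (elim \<xi>)
   have "norm (fhat (\<psi> i) \<xi>) <= norm (vhat \<psi> \<xi>)" using Finite_Cartesian_Product.norm_nth_le[where x = "vhat \<psi> \<xi>" and i = i] by (simp add: vhat_def)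
   then show ?case unfolding elim by (intro mult_left_mono ennreal_leI) auto
  qed
 qed
 have 2: "ennreal (2 powr (of_int j * \<sigma>)) * (\<integral>\<^sup>+\<xi>. indicator (annulus j) \<xi> * ennreal (norm (vhat \<psi> \<xi>)) \<partial>lborel) <= besov_L1_norm \<sigma> (vhat \<psi>)"
  unfolding besov_L1_norm_def by (rule SUP_upper) simp
 show "ennreal (2 powr (of_int j * \<sigma>)) * (\<integral>\<^sup>+\<xi>. indicator (annulus j) \<xi> * ennreal (norm (hermitian_part (fhat (\<psi> i)) \<xi>)) \<partial>lborel) <= besov_L1_norm \<sigma> (vhat \<psi>)"
  by (rule order_trans[OF mult_left_mono[OF 1] 2]) simp
qed

lemma besov_weak_hermitian:
 assumes u: "T \<in> besov_weak \<sigma> q" and r: "real_valued T"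
 shows "fourier_fun_off0 T (hermitian_part (fhat T))"
  and "ennreal (2 powr (of_int j * \<sigma>)) * weak_norm lborel q (%\<xi>. indicator (annulus j) \<xi> * ennreal (norm (hermitian_part (fhat T) \<xi>))) <= besov_weak_norm \<sigma> q (fhat T)"
proof -
 obtain g where "fourier_fun_off0 T g" using u unfolding besov_weak_def by blast
 then have f: "fourier_fun_off0 T (fhat T)" by (rule fhat_off0)
 note m [measurable] = fhat_measurable[OF f] annulus_measurable[of j]
 have AE: "AE \<xi> in lborel. hermitian_part (fhat T) \<xi> = fhat T \<xi>" by (rule hermitian_part_AE[OF r f])
 show "fourier_fun_off0 T (hermitian_part (fhat T))"
  by (rule fourier_fun_off0_cong_AE[OF f hermitian_part_measurable[OF m(1)] AE])
 have e: "weak_norm lborel q (%\<xi>. indicator (annulus j) \<xi> * ennreal (norm (hermitian_part (fhat T) \<xi>))) = weak_norm lborel q (%\<xi>. indicator (annulus j) \<xi> * ennreal (norm (fhat T \<xi>)))"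
 proof (rule weak_norm_cong_AE)
  show "AE \<xi> in lborel. indicator (annulus j) \<xi> * ennreal (norm (hermitian_part (fhat T) \<xi>)) = indicator (annulus j) \<xi> * ennreal (norm (fhat T \<xi>))"
   using AE by eventually_elim (simp only:)
 qed measurable
 show "ennreal (2 powr (of_int j * \<sigma>)) * weak_norm lborel q (%\<xi>. indicator (annulus j) \<xi> * ennreal (norm (hermitian_part (fhat T) \<xi>))) <= besov_weak_norm \<sigma> q (fhat T)"
  unfolding e besov_weak_norm_def by (rule SUP_upper) simp
qed

text \<open>The indices enter through exponents only: scaling identifies the smoothing rates with
  \<gamma>1 and \<gamma>2, and the admissible ranges place the time system within reach of
  Hardy-Littlewood-Sobolev. The threshold \<epsilon> comes from that time system, hence is fixed
  before any data are given.\<close>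

theorem theorem2:
  fixes \<alpha> p\<^sub>\<theta> q\<^sub>\<theta> p\<^sub>f q\<^sub>f s\<^sub>f :: real
  assumes "CARD('d::{finite,linorder}) \<ge> 2"
    and "1 < \<alpha>" "\<alpha> < 2"
    and "\<alpha> / p\<^sub>\<theta> + CARD('d) / conj_exponent q\<^sub>\<theta> = 2 * \<alpha> - 1"
    and "\<alpha> < p\<^sub>\<theta>" "p\<^sub>\<theta> < \<alpha> / (\<alpha> - 1)" "1 < q\<^sub>\<theta>"
    and "\<alpha> / p\<^sub>f + CARD('d) / conj_exponent q\<^sub>f - s\<^sub>f = 2 * \<alpha> - 1"
    and "1 < p\<^sub>f" "p\<^sub>f < \<alpha> / (\<alpha> - 1)" "1 < q\<^sub>f"
    and "0 \<le> s\<^sub>f" "s\<^sub>f < CARD('d) / conj_exponent q\<^sub>f"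
  shows "\<exists>\<epsilon>>0. \<forall>(u0 :: 'd \<Rightarrow> 'd distr) (\<theta>0 :: 'd distr) (f :: real \<Rightarrow> 'd \<Rightarrow> 'd distr).
    u0 \<in> besov_L1_vec (- (\<alpha> - 1)) \<longrightarrow>
    (\<forall>i. real_valued (u0 i)) \<longrightarrow>
    zero_mod_polynomials (ddiv u0) \<longrightarrow>
    \<theta>0 \<in> besov_weak (- (\<alpha> / p\<^sub>\<theta>)) q\<^sub>\<theta> \<longrightarrow>
    real_valued \<theta>0 \<longrightarrow>
    f \<in> time_weak_vec p\<^sub>f s\<^sub>f q\<^sub>f \<longrightarrow>
    (AE t in lebesgue_on {0..}. \<forall>i. real_valued (f t i)) \<longrightarrow>
    besov_L1_norm (- (\<alpha> - 1)) (vhat u0) + besov_weak_norm (- (\<alpha> / p\<^sub>\<theta>)) q\<^sub>\<theta> (fhat \<theta>0)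
      + time_weak_norm p\<^sub>f s\<^sub>f q\<^sub>f (\<lambda>t. vhat (f t)) < ennreal \<epsilon> \<longrightarrow>
    (\<exists>(u :: real \<Rightarrow> 'd \<Rightarrow> 'd distr) (\<theta> :: real \<Rightarrow> 'd distr).
      mild_solution \<alpha> u0 \<theta>0 f u \<theta> \<and>
      u \<in> time_L1_vec (\<alpha> / (\<alpha> - 1)) \<and>
      \<theta> \<in> time_weak p\<^sub>\<theta> 0 q\<^sub>\<theta>)"
proof -
 let ?d = "real CARD('d)"
 \<comment> \<open>\<theta>r, \<theta>p and \<theta>f are the reciprocals of the time exponents of
   velocity, temperature and force; \<kappa> and \<kappa>f below are the reciprocals of the
   conjugate frequency exponents.\<close>
 define \<theta>r where "\<theta>r = 1 - 1 / \<alpha>"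
 define \<theta>p where "\<theta>p = 1 / p\<^sub>\<theta>"
 define \<theta>f where "\<theta>f = 1 / p\<^sub>f"
 define \<kappa> where "\<kappa> = 1 - 1 / q\<^sub>\<theta>"
 define \<kappa>f where "\<kappa>f = 1 - 1 / q\<^sub>f"
 define \<gamma>1 where "\<gamma>1 = 2 - 1 / \<alpha> - \<theta>p"
 define \<gamma>2 where "\<gamma>2 = 2 - 1 / \<alpha> - \<theta>f"
 have \<alpha>: "0 < \<alpha>" "1 < \<alpha>" "\<alpha> < 2" using assms(2,3) by auto
 have q0: "0 < q\<^sub>\<theta>" using assms(7) by simp
 have pq: "0 < p\<^sub>\<theta>" "1 < p\<^sub>\<theta>" "0 < p\<^sub>f" using assms \<alpha> by linarith+
 have \<kappa>: "0 < \<kappa>" "\<kappa> < 1" "0 < \<kappa>f" "\<kappa>f < 1" using assms(7,11) by (simp_all add: \<kappa>_def \<kappa>f_def)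
 have conj: "?d / conj_exponent q = ?d * (1 - 1 / q)" if "1 < q" for q
  using that by (simp add: conj_exponent_def field_simps)
 have dk: "?d * \<kappa> = 2 * \<alpha> - 1 - \<alpha> / p\<^sub>\<theta>" "?d * \<kappa>f - s\<^sub>f = 2 * \<alpha> - 1 - \<alpha> / p\<^sub>f" "s\<^sub>f < ?d * \<kappa>f"
  using assms(4,8,13) conj[OF assms(7)] conj[OF assms(11)] unfolding \<kappa>_def \<kappa>f_def by linarith+
 \<comment> \<open>The scaling relations at work: heat smoothing from the two weak spaces into
   \<open>L^1\<close> costs exactly the powers \<gamma>1 and \<gamma>2 that the time system
   tolerates.\<close>
 have g: "(?d * \<kappa> - 0) / \<alpha> = \<gamma>1" "(?d * \<kappa>f - s\<^sub>f) / \<alpha> = \<gamma>2"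
  unfolding dk \<gamma>1_def \<gamma>2_def \<theta>p_def \<theta>f_def using \<alpha> dk(1) by (simp_all add: field_simps)
 \<comment> \<open>Since \<kappa> and \<kappa>f are below 1, a weight of order d + 1 beats the
   dyadic growth of functions in both weak spaces.\<close>
 have d1: "?d * \<kappa> - 0 < real (CARD('d) + 1)" "?d * \<kappa>f - s\<^sub>f < real (CARD('d) + 1)" "0 < ?d * \<kappa>"
 proof -
  have "?d * \<kappa> <= ?d * 1" "?d * \<kappa>f <= ?d * 1" using \<kappa> by (intro mult_left_mono; simp)+
  moreover have B: "real (CARD('d) + 1) = ?d + 1" by simp
  ultimately show "?d * \<kappa> - 0 < real (CARD('d) + 1)" "?d * \<kappa>f - s\<^sub>f < real (CARD('d) + 1)"
   unfolding B using assms(12) by linarith+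
  show "0 < ?d * \<kappa>" using \<kappa> by (intro mult_pos_pos) (auto simp: card_gt_0_iff)
 qed
 \<comment> \<open>The upper limits on \<open>p\<^sub>\<theta>\<close> and \<open>p\<^sub>f\<close>
   give the lower ones here and keep \<gamma>1 and \<gamma>2 below 1; \<alpha> <
   \<open>p\<^sub>\<theta>\<close> gives \<theta>p + \<theta>r < 1, so that temperature times
   velocity stays in a weak space of exponent above 1.\<close>
 have t\<theta>: "1 - 1 / \<alpha> < \<theta>p" "\<theta>p < 1 / \<alpha>" "1 - 1 / \<alpha> < \<theta>f" "\<theta>f < 1"
  using assms(5,6,9,10) \<alpha> pq by (simp_all add: \<theta>p_def \<theta>f_def field_simps)
 have half: "1 / 2 < 1 / \<alpha>" "1 / \<alpha> < 1" using \<alpha> by (auto simp: field_simps)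
 have \<beta>: "0 < \<alpha> - 1" "0 < \<alpha> / p\<^sub>\<theta>" using \<alpha> pq by auto
 have \<beta>': "(\<alpha> - 1) / \<alpha> = \<theta>r" "\<alpha> / p\<^sub>\<theta> / \<alpha> = \<theta>p" using \<alpha> pq by (simp_all add: \<theta>r_def \<theta>p_def field_simps)
 obtain C1 where C1: "0 < C1" and K1: "\<And>(h :: (real, 'd) vec => ennreal) N t. h \<in> borel_measurable borel ==> 0 < t ==>
  \<forall>j. ennreal (2 powr (of_int j * (- (\<alpha> - 1)))) * (\<integral>\<^sup>+\<xi>. indicator (annulus j) \<xi> * h \<xi> \<partial>lborel) <= N ==>
  (\<integral>\<^sup>+\<xi>. ennreal (exp (- t * norm \<xi> powr \<alpha>)) * h \<xi> \<partial>lborel) <= ennreal C1 * N * ennreal (t powr (- \<theta>r))"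
  using besov_L1_heat[OF \<beta>(1) \<alpha>(1), where 'n = 'd] unfolding \<beta>' by blast
 obtain C2 where C2: "0 < C2" and K2: "\<And>(h :: (real, 'd) vec => ennreal) N t. h \<in> borel_measurable borel ==> 0 < t ==>
  \<forall>j. ennreal (2 powr (of_int j * (- (\<alpha> / p\<^sub>\<theta>)))) * weak_norm lborel q\<^sub>\<theta> (%\<xi>. indicator (annulus j) \<xi> * h \<xi>) <= N ==>
  lorentz_bound \<kappa> (ennreal C2 * N * ennreal (t powr (- \<theta>p))) (%\<xi>. ennreal (exp (- t * norm \<xi> powr \<alpha>)) * h \<xi>)"
  using besov_weak_heat[OF \<beta>(2) \<alpha>(1) assms(7), where 'n = 'd] unfolding \<beta>' \<kappa>_def[symmetric] by blast
 obtain C3 where C3: "0 < C3" and K3: "\<And>(h :: (real, 'd) vec => ennreal) A \<tau>. h \<in> borel_measurable borel ==> 0 < \<tau> ==>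
  lorentz_bound \<kappa> A (%\<xi>. ennreal (norm \<xi> powr 0) * h \<xi>) ==>
  (\<integral>\<^sup>+\<xi>. ennreal (exp (- \<tau> * norm \<xi> powr \<alpha>)) * h \<xi> \<partial>lborel) <= ennreal C3 * A * ennreal (\<tau> powr (- \<gamma>1))"
  using heat_smoothing[OF order_refl less_imp_le[OF \<kappa>(1)] d1(3) \<alpha>(1)] unfolding g by blast
 obtain C4 where C4: "0 < C4" and K4: "\<And>(h :: (real, 'd) vec => ennreal) A \<tau>. h \<in> borel_measurable borel ==> 0 < \<tau> ==>
  lorentz_bound \<kappa>f A (%\<xi>. ennreal (norm \<xi> powr s\<^sub>f) * h \<xi>) ==>
  (\<integral>\<^sup>+\<xi>. ennreal (exp (- \<tau> * norm \<xi> powr \<alpha>)) * h \<xi> \<partial>lborel) <= ennreal C4 * A * ennreal (\<tau> powr (- \<gamma>2))"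
  using heat_smoothing[OF assms(12) less_imp_le[OF \<kappa>(3)] dk(3) \<alpha>(1)] unfolding g by blast
 obtain C5 where C5: "0 < C5" and K5: "\<And>(h :: (real, 'd) vec => ennreal) A. h \<in> borel_measurable borel ==>
  lorentz_bound \<kappa> A (%\<xi>. ennreal (norm \<xi> powr 0) * h \<xi>) ==>
  (\<integral>\<^sup>+\<xi>. ennreal (1 / (1 + norm \<xi>) ^ (CARD('d) + 1)) * h \<xi> \<partial>lborel) <= ennreal C5 * A"
  using weight_smoothing[OF order_refl less_imp_le[OF \<kappa>(1)] d1(3) d1(1)] by blast
 obtain C6 where C6: "0 < C6" and K6: "\<And>(h :: (real, 'd) vec => ennreal) A. h \<in> borel_measurable borel ==>
  lorentz_bound \<kappa>f A (%\<xi>. ennreal (norm \<xi> powr s\<^sub>f) * h \<xi>) ==>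
  (\<integral>\<^sup>+\<xi>. ennreal (1 / (1 + norm \<xi>) ^ (CARD('d) + 1)) * h \<xi> \<partial>lborel) <= ennreal C6 * A"
  using weight_smoothing[OF assms(12) less_imp_le[OF \<kappa>(3)] dk(3) d1(2)] by blast
 define c1 where "c1 = C1 + C2 + C3 + C4"
 define c2 where "c2 = 1 + C5 + C6"
 define Kf where "Kf = 1 / (1 - 1 / q\<^sub>f) * (1 / (1 - 1 / p\<^sub>f))"
 \<comment> \<open>The summand \<open>Kf\<close> is the conversion constant of the force norm; with
   it the bound \<open>Kf * \<epsilon>\<close> on \<open>m\<close> is also the bound
   \<open>K * \<epsilon>\<close> that the time system expects.\<close>
 define K where "K = 2 * (real CARD('d) + real CARD('d option))\<^sup>2 * (c1 + 1) + Kf"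
 have c: "0 < c1" "C1 <= c1" "C2 <= c1" "C3 <= c1" "C4 <= c1" "1 <= c2" "C5 <= c2" "C6 <= c2"
  using C1 C2 C3 C4 C5 C6 by (simp_all add: c1_def c2_def)
 have Kf0: "0 < Kf" using assms(9,11) by (simp add: Kf_def)
 have "0 <= 2 * (real CARD('d) + real CARD('d option))\<^sup>2 * (c1 + 1)" using c(1) by (intro mult_nonneg_nonneg) auto
 then have KK: "2 * (real CARD('d) + real CARD('d option))\<^sup>2 * (c1 + 1) <= K" "Kf <= K" "0 < K" using Kf0 unfolding K_def by linarith+
 obtain \<epsilon> R where \<epsilon>: "0 < \<epsilon>" and R: "0 < R" and TS: "\<And>m n. m \<in> borel_measurable borel ==> lorentz_bound (1 - \<theta>f) (ennreal (K * \<epsilon>)) m ==>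
   lorentz_bound (1 - \<theta>r) (ennreal R) (fst ((time_step K \<epsilon> \<alpha> \<theta>r \<theta>p \<gamma>1 \<gamma>2 m ^^ n) (%_. 0, %_. 0))) \<and>
   lorentz_bound (1 - \<theta>p) (ennreal R) (snd ((time_step K \<epsilon> \<alpha> \<theta>r \<theta>p \<gamma>1 \<gamma>2 m ^^ n) (%_. 0, %_. 0)))"
  using time_system[OF \<alpha>(2,3) \<theta>r_def t\<theta> \<gamma>1_def \<gamma>2_def KK(3)] by blast
 have bump: "ennreal C * A * B <= ennreal c1 * A * B" if "C <= c1" for C A B
  by (intro mult_right_mono ennreal_leI that) auto
 have bump2: "ennreal C * A <= ennreal c2 * A" if "C <= c2" for C A
  by (intro mult_right_mono ennreal_leI that) auto
 have eps: "ennreal c1 * ennreal \<epsilon> * ennreal x = ennreal (c1 * (\<epsilon> * x))" if "0 <= x" for x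
  using c(1) \<epsilon> that by (simp add: ennreal_mult mult.assoc)
 show ?thesis
 proof (intro exI[of _ \<epsilon>] conjI allI impI)
  show "\<epsilon> > 0" by (rule \<epsilon>)
  fix u0 :: "'d => 'd distr" and \<theta>0 :: "'d distr" and f :: "real => 'd => 'd distr"
  assume u0: "u0 \<in> besov_L1_vec (- (\<alpha> - 1))" and u0r: "\<forall>i. real_valued (u0 i)" and "zero_mod_polynomials (ddiv u0)"
   and \<theta>0: "\<theta>0 \<in> besov_weak (- (\<alpha> / p\<^sub>\<theta>)) q\<^sub>\<theta>" and \<theta>0r: "real_valued \<theta>0"
   and f: "f \<in> time_weak_vec p\<^sub>f s\<^sub>f q\<^sub>f" and fr: "AE t in lebesgue_on {0..}. \<forall>i. real_valued (f t i)"
   and small: "besov_L1_norm (- (\<alpha> - 1)) (vhat u0) + besov_weak_norm (- (\<alpha> / p\<^sub>\<theta>)) q\<^sub>\<theta> (fhat \<theta>0)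
    + time_weak_norm p\<^sub>f s\<^sub>f q\<^sub>f (%t. vhat (f t)) < ennreal \<epsilon>"
  have le3: "x <= x + y + z" "y <= x + y + z" "z <= x + y + z" for x y z :: ennreal
   by (simp_all add: add_increasing add_increasing2)
  note s1 = order_trans[OF le3(1) less_imp_le[OF small]]
  note s2 = order_trans[OF le3(2) less_imp_le[OF small]]
  note s3 = order_trans[OF le3(3) less_imp_le[OF small]]
  obtain F m where F: "\<And>l. F l \<in> borel_measurable (borel \<Otimes>\<^sub>M borel)" "\<And>l s \<xi>. F l (s, - \<xi>) = cnj (F l (s, \<xi>))"
    "AE s in lborel. 0 < s --> (\<forall>l. fourier_fun (f s l) (%\<xi>. F l (s, \<xi>)))" and m: "m \<in> borel_measurable borel"
    and Fb: "\<And>l s. lorentz_bound \<kappa>f (m s) (%\<xi>. ennreal (norm \<xi> powr s\<^sub>f) * ennreal (norm (F l (s, \<xi>))))"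
    and mb: "lorentz_bound (1 - \<theta>f) (ennreal (Kf * \<epsilon>)) m"
   using force_representation[OF f fr assms(9,11) s3 less_imp_le[OF \<epsilon>]] unfolding \<kappa>f_def \<theta>f_def Kf_def by blast
  have Fs: "(%\<xi>. ennreal (norm (F l (s, \<xi>)))) \<in> borel_measurable borel" for l s
   using measurable_Pair2[OF F(1)[of l], of s] by simp
  have T3: "lorentz_bound (1 - \<theta>f) (ennreal (K * \<epsilon>)) m"
   by (rule lorentz_bound_mono[OF mb]) (use KK \<epsilon> in \<open>auto intro!: ennreal_leI mult_right_mono\<close>)
  define a0 where "a0 i = hermitian_part (fhat (u0 i))" for i
  define b0 where "b0 = hermitian_part (fhat \<theta>0)"
  have a: "fourier_fun_off0 (u0 i) (a0 i)" for i unfolding a0_def by (rule besov_L1_component(1)[OF u0]) (use u0r in blast)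
  have b: "fourier_fun_off0 \<theta>0 b0" unfolding b0_def by (rule besov_weak_hermitian(1)[OF \<theta>0 \<theta>0r])
  have am: "a0 i \<in> borel_measurable borel" for i using a[of i] by (simp add: fourier_fun_off0_def)
  have bm: "b0 \<in> borel_measurable borel" using b by (simp add: fourier_fun_off0_def)
  have L1: "(\<integral>\<^sup>+\<xi>. ennreal (exp (- t * norm \<xi> powr \<alpha>)) * ennreal (norm (a0 i \<xi>)) \<partial>lborel) <= ennreal (c1 * (\<epsilon> * t powr (- \<theta>r)))" if t: "0 < t" for i t
  proof -
   have "(\<integral>\<^sup>+\<xi>. ennreal (exp (- t * norm \<xi> powr \<alpha>)) * ennreal (norm (a0 i \<xi>)) \<partial>lborel) <= ennreal C1 * ennreal \<epsilon> * ennreal (t powr (- \<theta>r))"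
   proof (rule K1[OF _ t], use am in measurable, rule allI)
    show "ennreal (2 powr (of_int j * (- (\<alpha> - 1)))) * (\<integral>\<^sup>+\<xi>. indicator (annulus j) \<xi> * ennreal (norm (a0 i \<xi>)) \<partial>lborel) <= ennreal \<epsilon>" for j
     unfolding a0_def by (rule order_trans[OF besov_L1_component(2)[OF u0] s1]) (use u0r in blast)
   qed
   then show ?thesis using bump[OF c(2)] unfolding eps[OF powr_ge_zero, symmetric] by (rule order_trans)
  qed
  have L2: "lorentz_bound \<kappa> (ennreal (c1 * (\<epsilon> * t powr (- \<theta>p)))) (%\<xi>. ennreal (exp (- t * norm \<xi> powr \<alpha>)) * ennreal (norm (b0 \<xi>)))" if t: "0 < t" for t
  proof -
   have "lorentz_bound \<kappa> (ennreal C2 * ennreal \<epsilon> * ennreal (t powr (- \<theta>p))) (%\<xi>. ennreal (exp (- t * norm \<xi> powr \<alpha>)) * ennreal (norm (b0 \<xi>)))"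
   proof (rule K2[OF _ t], use bm in measurable, rule allI)
    show "ennreal (2 powr (of_int j * (- (\<alpha> / p\<^sub>\<theta>)))) * weak_norm lborel q\<^sub>\<theta> (%\<xi>. indicator (annulus j) \<xi> * ennreal (norm (b0 \<xi>))) <= ennreal \<epsilon>" for j
     unfolding b0_def by (rule order_trans[OF besov_weak_hermitian(2)[OF \<theta>0 \<theta>0r] s2])
   qed
   then show ?thesis unfolding eps[OF powr_ge_zero, symmetric] by (rule lorentz_bound_mono[OF _ bump[OF c(3)]]) simp
  qed
  have L3: "(\<integral>\<^sup>+\<xi>. ennreal (exp (- \<tau> * norm \<xi> powr \<alpha>)) * h \<xi> \<partial>lborel) <= ennreal c1 * A * ennreal (\<tau> powr (- \<gamma>1))"
   if "h \<in> borel_measurable borel" "0 < \<tau>" "lorentz_bound \<kappa> A h" for h :: "(real, 'd) vec => ennreal" and A \<tau>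
   by (rule order_trans[OF K3[OF that(1,2) lorentz_bound_powr_0[OF that(3)]] bump[OF c(4)]])
  have L4: "(\<integral>\<^sup>+\<xi>. ennreal (exp (- \<tau> * norm \<xi> powr \<alpha>)) * ennreal (norm (F l (s, \<xi>))) \<partial>lborel) <= ennreal c1 * m s * ennreal (\<tau> powr (- \<gamma>2))"
   if "0 < \<tau>" for l s \<tau>
   by (rule order_trans[OF K4[OF Fs that Fb] bump[OF c(5)]])
  have L5: "(\<integral>\<^sup>+\<xi>. ennreal (1 / (1 + norm \<xi>) ^ (CARD('d) + 1)) * h \<xi> \<partial>lborel) <= ennreal c2 * A"
   if "h \<in> borel_measurable borel" "lorentz_bound \<kappa> A h" for h :: "(real, 'd) vec => ennreal" and A
   by (rule order_trans[OF K5[OF that(1) lorentz_bound_powr_0[OF that(2)]] bump2[OF c(7)]])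
  have L6: "(\<integral>\<^sup>+\<xi>. ennreal (1 / (1 + norm \<xi>) ^ (CARD('d) + 1)) * ennreal (norm (F l (s, \<xi>))) \<partial>lborel) <= ennreal c2 * m s" for l s
   by (rule order_trans[OF K6[OF Fs Fb] bump2[OF c(8)]])
  have T12: "lorentz_bound (1 - \<theta>r) (ennreal R) (fst ((time_step K \<epsilon> \<alpha> \<theta>r \<theta>p \<gamma>1 \<gamma>2 m ^^ n) (%_. 0, %_. 0)))"
   "lorentz_bound (1 - \<theta>p) (ennreal R) (snd ((time_step K \<epsilon> \<alpha> \<theta>r \<theta>p \<gamma>1 \<gamma>2 m ^^ n) (%_. 0, %_. 0)))" for n
   using TS[OF m T3, of n] by blast+
  have \<theta>s: "0 < \<theta>r" "\<theta>r + \<theta>r < 1" "0 < \<theta>p" "\<theta>p + \<theta>r < 1"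
   using t\<theta> half unfolding \<theta>r_def by linarith+
  have h: "a0 i (- \<xi>) = cnj (a0 i \<xi>)" "b0 (- \<xi>) = cnj (b0 \<xi>)" for i \<xi>
   by (simp_all add: a0_def b0_def hermitian_part_uminus)
  interpret S: boussinesq_solution \<alpha> a0 b0 F \<kappa> \<theta>r \<theta>p \<theta>f \<gamma>1 \<gamma>2 c1 c2 K \<epsilon> R "K * \<epsilon>" m u0 \<theta>0 f
   by unfold_locales (fact am bm F \<alpha>(2) m L1 L2 L3 L4 L5 L6 c \<epsilon> R KK(1) T12 T3 \<theta>s h a b)+
  show "\<exists>u \<theta>. mild_solution \<alpha> u0 \<theta>0 f u \<theta> \<and> u \<in> time_L1_vec (\<alpha> / (\<alpha> - 1)) \<and> \<theta> \<in> time_weak p\<^sub>\<theta> 0 q\<^sub>\<theta>"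
   by (rule exI[where x = "%t i. S.component (Some i) t"], rule exI[where x = "S.component None"], intro conjI S.mild S.velocity_membership[OF \<alpha>(3) \<theta>r_def] S.temperature_membership[OF pq(1) \<theta>p_def q0 \<kappa>_def])
 qed
qed

end
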